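(* Let $A$ be an $F$-nilpotent $H$-algebra. Then $A$ is $kk$-equivalent to zero, i.e. $A\cong 0$ in $kk$.
   Context: **$F$-nilpotent.** An $H$-algebra $A$ is nilpotent if $A^m=0$ for some positive integer $m$, and $F$-nilpotent if it is nilpotent and, in addition, all quotient maps $A^{2^n}\to A^{2^n}/A^{2^{n+1}}$ are $F$-split surjections (i.e. have a section in $\mathfrak U$). **Algebras.** $H$ is a fixed unital, not necessarily commutative ring. An $H$-algebra is a monoid, possibly without unit, in $H$-bimodules with $\otimes_H$; $\mathrm{Alg}_H$ is a fixed choice of either the category of all $H$-algebras or, if $H$ is commutative, that of central ones ($ha=ah$). $\mathfrak U$ is a fixed underlying category: sets, abelian groups, or $H$-bimodules (central ones in the central case); $F:\mathrm{Alg}_H\to\mathfrak U$ is the forgetful functor, $\tilde T$ its left adjoint, $T=\tilde T\circ F$. For a ring $L$, $LA=AL=L\otimes_{\mathbb Z}A$. An extension is a sequence $A\xrightarrow{f}B\xrightarrow{g}C$ in which $f$ is a kernel of $g$ and $g$ a cokernel of $f$; it is $F$-split if $F(g)$ has a section in $\mathfrak U$. **Homotopy.** Functors on algebras are extended levelwise to ind-algebras (directed diagrams of algebras, with $\mathrm{Hom}((X_i),(Y_j))=\lim_i\mathrm{colim}_j\mathrm{Hom}(X_i,Y_j)$), and ind-ind-algebras are collapsed to ind-algebras. $A^\Delta$ is the simplicial algebra $[n]\mapsto A\otimes_{\mathbb Z}\mathbb Z[t_0,\dots,t_n]/\langle 1-\sum t_i\rangle$. For a simplicial set $K$, $A^K=\mathrm{map}(K,A^\Delta)$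 (simplicial maps); for a pointed one, $A^{(K,\star)}=\ker(A^K\to A)$ (evaluation at $\star$). Thus $A^{\Delta^1}=A[t]$. Put $S^1=\Delta^1/\partial\Delta^1$, $\Omega A=A^{(S^1,\star)}=\{p\in A[t]:p(0)=p(1)=0\}$, $PA=A^{(\Delta^1,\star)}=\{p\in A[t]:p(0)=0\}$, $\mathrm{ev}_1:PA\to A$ evaluation at $1$. Homomorphisms $f,g:A\to B$ are elementary homotopic if there is $h:A\to B[t]$ with $\mathrm{ev}_0h=f$, $\mathrm{ev}_1h=g$; homotopic if joined by a chain of elementary homotopies; $[A,B]$ is the set of homotopy classes, and for ind-algebras $[(A_i),(B_j)]=\lim_i\mathrm{colim}_j[A_i,B_j]$. With $\mathrm{sd}$ the simplicial subdivision and last vertex maps $\mathrm{sd}K\to K$, let $A^{\mathcal S^1}$ be the ind-algebra $\{A^{(\mathrm{sd}^pS^1,\star)}\}_{p\ge0}$, $A^{\mathcal S^0}=A$, $A^{\mathcal S^{n+1}}=(A^{\mathcal S^n})^{\mathcal S^1}$. $M_\infty=\bigcup_nM_n(\mathbb Z)$, $M_\bullet$ is the ind-ring $(M_n(\mathbb Z))_n$ (upper left corner inclusions), $\mathcal M_\infty=M_\bullet\otimes M_\infty$, and $\{A,B\}=[A,\mathcal M_\infty B]$. **Definition of $kk$.** $J(A)=\ker(T(A)\to A)$ (counit). For an $F$-split extension $A\to B\xrightarrow{g} C$, a section of $F(g)$ induces $T(C)\to B$, restricting to the classifying map $J(C)\to A$, unique up to elementary homotopy. $\rho_A:J(A)\to\Omega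 A$ is the classifying map of $\Omega A\to PA\xrightarrow{\mathrm{ev}_1}A$ (section $a\mapsto ta$); its composite with $\Omega A\to A^{\mathcal S^1}$ is also denoted $\rho_A$. For $L$ a ring that is free as an abelian group, the classifying map of $LJ(A)\to LT(A)\to LA$ is a map $J(LA)\to LJ(A)$; applied levelwise this gives $\gamma:J(A^{\mathcal S^1})\to J(A)^{\mathcal S^1}$ and $J(\mathcal M_\infty A)\to\mathcal M_\infty J(A)$, so that $J$ induces maps $\{A,B\}\to\{J(A),J(B)\}$. For $H$-algebras $A,B$, $$kk(A,B)=\mathrm{colim}_n\{J^n(A),B^{\mathcal S^n}\},$$ with transition maps $f\mapsto\rho_{B^{\mathcal S^n}}\circ J(f)$; it is an abelian group (concatenation of loops, equivalently block sum of matrices). The product of the classes of $\alpha:J^n(B)\to C^{\mathcal S^n}$ and $\beta:J^m(A)\to B^{\mathcal S^m}$ is $(-1)^{mn}$ times the class of $J^{n+m}(A)\xrightarrow{J^n(\beta)}J^n(B^{\mathcal S^m})\xrightarrow{\gamma}J^n(B)^{\mathcal S^m}\xrightarrow{\alpha^{\mathcal S^m}}C^{\mathcal S^{n+m}}$, matrix factors being combined by tensor product of matrices $\mathcal M_\infty\otimes\mathcal M_\infty\to\mathcal M_\infty$. $kk$ is the resulting category with the objects of $\mathrm{Alg}_H$. Two algebras are $kk$-equivalent if they are isomorphic in $kk$. *)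

theory Defs
  imports "HOL-Algebra.Ring" "HOL-Algebra.Generated_Groups" "HOL-Library.Poly_Mapping"
    "HOL-Library.Nat_Bijection"
begin

section \<open>Nonunital algebras, homomorphisms, quotients\<close>

text \<open>Algebras are monoids without unit in bimodules. The record extends the library's
  ring record, whose field \<open>one\<close> is never used.\<close>

record ('h, 'x) algebra = "'x ring" +
  lact :: "'h \<Rightarrow> 'x \<Rightarrow> 'x"
  ract :: "'x \<Rightarrow> 'h \<Rightarrow> 'x"

text \<open>A quotient has chosen class representatives as its elements, so that it lives on the
  same type as the structure it is a quotient of.\<close>

definition rep :: "('x \<Rightarrow> 'x \<Rightarrow> bool) \<Rightarrow> 'x \<Rightarrow> 'x" where
  "rep R x = (SOME y. R x y)"

definition quot_alg :: "('h, 'x) algebra \<Rightarrow> ('x \<Rightarrow> 'x \<Rightarrow> bool) \<Rightarrow> ('h, 'x) algebra" where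
  "quot_alg A R =
    \<lparr>carrier = rep R ` carrier A,
     mult = (\<lambda>x y. rep R (x \<otimes>\<^bsub>A\<^esub> y)), one = undefined,
     zero = rep R \<zero>\<^bsub>A\<^esub>, add = (\<lambda>x y. rep R (x \<oplus>\<^bsub>A\<^esub> y)),
     lact = (\<lambda>h x. rep R (lact A h x)), ract = (\<lambda>x h. rep R (ract A x h))\<rparr>"

definition mod_rel :: "('h, 'x) algebra \<Rightarrow> 'x set \<Rightarrow> 'x \<Rightarrow> 'x \<Rightarrow> bool" where
  "mod_rel A I x y \<longleftrightarrow> x \<in> carrier A \<and> y \<in> carrier A \<and> x \<ominus>\<^bsub>A\<^esub> y \<in> I"

text \<open>\<open>alg_pow A m\<close> is the additive span of all products of \<open>m\<close> elements, for \<open>m \<ge> 1\<close>.\<close>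

primrec alg_pow :: "('h, 'x) algebra \<Rightarrow> nat \<Rightarrow> 'x set" where
  "alg_pow A 0 = carrier A"
| "alg_pow A (Suc m) =
    (if m = 0 then carrier A
     else generate (add_monoid A) {x \<otimes>\<^bsub>A\<^esub> y | x y. x \<in> carrier A \<and> y \<in> alg_pow A m})"

definition sub_pow :: "('h, 'x) algebra \<Rightarrow> nat \<Rightarrow> ('h, 'x) algebra" where
  "sub_pow A m = A\<lparr>carrier := alg_pow A m\<rparr>"

definition nilpotent_alg :: "('h, 'x) algebra \<Rightarrow> bool" where
  "nilpotent_alg A \<longleftrightarrow> (\<exists>m\<ge>1. alg_pow A m = {\<zero>\<^bsub>A\<^esub>})"


section \<open>A type closed under the constructions\<close>

text \<open>Simplices of the iterated subdivisions of the simplicial circle.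
  \<open>Flag n x c\<close> stands for the simplex \<open>c\<close> of \<open>sd \<Delta>\<^sup>n\<close> placed along an \<open>n\<close>-simplex \<open>x\<close>.\<close>

datatype cell = Smplx (verts: "nat list") | Flag nat cell "nat set list"

text \<open>Formal expressions in generators \<open>'x\<close> in the language of algebras.\<close>

datatype (scalars: 'h, gens: 'x) tm =
    Gen 'x
  | Zero
  | Add "('h, 'x) tm" "('h, 'x) tm"
  | Neg "('h, 'x) tm"
  | Mul "('h, 'x) tm" "('h, 'x) tm"
  | LAct 'h "('h, 'x) tm"
  | RAct "('h, 'x) tm" 'h

text \<open>The iterates \<open>J\<^sup>n(A)\<close> and \<open>B\<close> with \<open>n\<close> loop coordinates must have elements in one type.
  \<open>univ\<close> has all atoms \<open>'a\<close> and is closed under polynomials in commuting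
  variables \<open>t\<^sub>0, t\<^sub>1, \<dots>\<close> (functions of exponents), families indexed by simplices,
  matrices and formal expressions. Since \<open>'a\<close> is arbitrary, algebras on
  \<open>('h, 'a) univ\<close> comprise, up to isomorphism, all algebras on \<open>'a\<close>.\<close>

datatype ('h, 'a) univ =
    Atom 'a
  | Poly (coef: "(nat \<Rightarrow>\<^sub>0 nat) \<Rightarrow> ('h, 'a) univ")
  | SMap (sval: "nat \<times> cell \<Rightarrow> ('h, 'a) univ")
  | Mtx (entry: "nat \<times> nat \<Rightarrow> nat \<times> nat \<Rightarrow> ('h, 'a) univ")
  | Expr (expr: "('h, ('h, 'a) univ) tm")

type_synonym ('h, 'a) ualg = "('h, ('h, 'a) univ) algebra"

definition zero_alg :: "('h, 'a) ualg" where
  "zero_alg = (let z = Atom undefined in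
    \<lparr>carrier = {z}, mult = (\<lambda>_ _. z), one = undefined, zero = z, add = (\<lambda>_ _. z),
     lact = (\<lambda>_ _. z), ract = (\<lambda>_ _. z)\<rparr>)"


section \<open>Polynomials with coefficients in an algebra\<close>

text \<open>\<open>poly_alg V A\<close> is \<open>A \<otimes> \<int>[t\<^sub>v | v \<in> V]\<close>, written on the basis of monomials.\<close>

definition psupp :: "('h, 'a) ualg \<Rightarrow> ('h, 'a) univ \<Rightarrow> (nat \<Rightarrow>\<^sub>0 nat) set" where
  "psupp A x = {e. coef x e \<noteq> \<zero>\<^bsub>A\<^esub>}"

definition poly_alg :: "nat set \<Rightarrow> ('h, 'a) ualg \<Rightarrow> ('h, 'a) ualg" where
  "poly_alg V A =
    \<lparr>carrier = {Poly p | p. range p \<subseteq> carrier A \<and> finite (psupp A (Poly p)) \<and>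
                (\<forall>e\<in>psupp A (Poly p). Poly_Mapping.keys e \<subseteq> V)},
     mult = (\<lambda>x y. Poly (\<lambda>e. \<Oplus>\<^bsub>A\<^esub>z\<in>{(f, g). f + g = e}. coef x (fst z) \<otimes>\<^bsub>A\<^esub> coef y (snd z))),
     one = undefined,
     zero = Poly (\<lambda>_. \<zero>\<^bsub>A\<^esub>),
     add = (\<lambda>x y. Poly (\<lambda>e. coef x e \<oplus>\<^bsub>A\<^esub> coef y e)),
     lact = (\<lambda>h x. Poly (\<lambda>e. lact A h (coef x e))),
     ract = (\<lambda>x h. Poly (\<lambda>e. ract A (coef x e) h))\<rparr>"

text \<open>\<open>A[t]\<close>, and evaluation of \<open>t\<close> at an integer.\<close>

definition poly1 :: "('h, 'a) ualg \<Rightarrow> ('h, 'a) ualg" where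
  "poly1 A = poly_alg {0} A"

definition ev :: "('h, 'a) ualg \<Rightarrow> int \<Rightarrow> ('h, 'a) univ \<Rightarrow> ('h, 'a) univ" where
  "ev A c x = (\<Oplus>\<^bsub>A\<^esub>e\<in>psupp A x. [(c ^ Poly_Mapping.lookup e 0)] \<cdot>\<^bsub>A\<^esub> coef x e)"

type_synonym zpoly = "(nat \<Rightarrow>\<^sub>0 nat) \<Rightarrow>\<^sub>0 int"

definition zvar :: "nat \<Rightarrow> zpoly" where
  "zvar i = Poly_Mapping.single (Poly_Mapping.single i 1) 1"

text \<open>The map \<open>A \<otimes> \<phi>\<close>, for the additive map \<open>\<phi>\<close> of integral polynomials with the given
  values on monomials.\<close>

definition tensor_map ::
    "('h, 'a) ualg \<Rightarrow> ((nat \<Rightarrow>\<^sub>0 nat) \<Rightarrow> zpoly) \<Rightarrow> ('h, 'a) univ \<Rightarrow> ('h, 'a) univ" where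
  "tensor_map A \<phi> x =
    Poly (\<lambda>f. \<Oplus>\<^bsub>A\<^esub>e\<in>psupp A x. [Poly_Mapping.lookup (\<phi> e) f] \<cdot>\<^bsub>A\<^esub> coef x e)"

text \<open>\<open>A\<^sup>\<Delta>\<close>: in degree \<open>n\<close>, \<open>A \<otimes> \<int>[t\<^sub>0, \<dots>, t\<^sub>n]\<close> modulo \<open>1 - \<Sum> t\<^sub>i\<close>. A monotone map
  \<open>\<theta> : [m] \<rightarrow> [n]\<close> is the list of its values; it acts by \<open>t\<^sub>i \<mapsto> \<Sum>\<^bsub>\<theta>(j) = i\<^esub> t\<^sub>j\<close>.\<close>

definition opers :: "nat \<Rightarrow> nat \<Rightarrow> nat list set" where
  "opers m n = {\<theta>. length \<theta> = Suc m \<and> sorted \<theta> \<and> set \<theta> \<subseteq> {..n}}"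

definition simplex_rel :: "('h, 'a) ualg \<Rightarrow> nat \<Rightarrow> ('h, 'a) univ \<Rightarrow> ('h, 'a) univ \<Rightarrow> bool" where
  "simplex_rel A n x y \<longleftrightarrow>
    x \<in> carrier (poly_alg {..n} A) \<and> y \<in> carrier (poly_alg {..n} A) \<and>
    (\<exists>r\<in>carrier (poly_alg {..n} A).
      x = y \<oplus>\<^bsub>poly_alg {..n} A\<^esub>
          tensor_map A (\<lambda>e. Poly_Mapping.single e 1 * (1 - (\<Sum>i\<le>n. zvar i))) r)"

definition simplex_alg :: "('h, 'a) ualg \<Rightarrow> nat \<Rightarrow> ('h, 'a) ualg" where
  "simplex_alg A n = quot_alg (poly_alg {..n} A) (simplex_rel A n)"

definition simplex_act :: "('h, 'a) ualg \<Rightarrow> nat list \<Rightarrow> ('h, 'a) univ \<Rightarrow> ('h, 'a) univ" where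
  "simplex_act A \<theta> x = rep (simplex_rel A (length \<theta> - 1))
    (tensor_map A
      (\<lambda>e. \<Prod>i\<in>Poly_Mapping.keys e. (\<Sum>j\<in>{j. j < length \<theta> \<and> \<theta> ! j = i}. zvar j) ^ Poly_Mapping.lookup e i) x)"

definition simplex_map ::
    "nat \<Rightarrow> ('h, 'a) ualg \<Rightarrow> (('h, 'a) univ \<Rightarrow> ('h, 'a) univ) \<Rightarrow> ('h, 'a) univ \<Rightarrow> ('h, 'a) univ" where
  "simplex_map n B \<phi> x = rep (simplex_rel B n) (Poly (\<lambda>e. \<phi> (coef x e)))"


section \<open>Simplicial sets and subdivision\<close>

text \<open>Pointed simplicial sets; \<open>sact K \<theta>\<close> is the action of a monotone map \<open>\<theta>\<close>.\<close>

record sset =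
  simp :: "nat \<Rightarrow> cell set"
  sact :: "nat list \<Rightarrow> cell \<Rightarrow> cell"
  spt :: cell

text \<open>\<open>\<Delta>\<^sup>1\<close> pointed at the vertex \<open>0\<close>. In \<open>S\<^sup>1 = \<Delta>\<^sup>1/\<partial>\<Delta>\<^sup>1\<close> the simplices of the boundary,
  that is the constant maps to \<open>[1]\<close>, are identified in each degree.\<close>

definition interval :: sset where
  "interval = \<lparr>simp = (\<lambda>m. Smplx ` opers m 1),
     sact = (\<lambda>\<theta> x. Smplx (map (\<lambda>i. verts x ! i) \<theta>)), spt = Smplx [0]\<rparr>"

definition collapse :: "cell \<Rightarrow> cell" where
  "collapse x = (if set (verts x) = {0, 1} then x else Smplx (replicate (length (verts x)) 0))"

definition circle :: sset where
  "circle = \<lparr>simp = (\<lambda>m. collapse ` simp interval m),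
     sact = (\<lambda>\<theta> x. collapse (sact interval \<theta> x)), spt = collapse (spt interval)\<rparr>"

text \<open>\<open>sd \<Delta>\<^sup>n\<close> is the nerve of the poset of nonempty subsets of \<open>{0, \<dots>, n}\<close>, and \<open>sd K\<close> is the
  colimit of \<open>sd \<Delta>\<^sup>n\<close> over all simplices \<open>\<Delta>\<^sup>n \<rightarrow> K\<close>.\<close>

definition flags :: "nat \<Rightarrow> nat \<Rightarrow> nat set list set" where
  "flags n m = {c. length c = Suc m \<and> sorted_wrt (\<subseteq>) c \<and> (\<forall>S\<in>set c. S \<noteq> {} \<and> S \<subseteq> {..n})}"

inductive sd_gen :: "sset \<Rightarrow> cell \<Rightarrow> cell \<Rightarrow> bool" for K where
  "x \<in> simp K n \<Longrightarrow> \<theta> \<in> opers k n \<Longrightarrow> c \<in> flags k m \<Longrightarrow>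
    sd_gen K (Flag k (sact K \<theta> x) c) (Flag n x (map (image (\<lambda>i. \<theta> ! i)) c))"

definition sd_rep :: "sset \<Rightarrow> cell \<Rightarrow> cell" where
  "sd_rep K = rep (equivclp (sd_gen K))"

definition sd :: "sset \<Rightarrow> sset" where
  "sd K = \<lparr>simp = (\<lambda>m. sd_rep K ` {Flag n x c | n x c. x \<in> simp K n \<and> c \<in> flags n m}),
     sact = (\<lambda>\<theta> y. case y of Flag n x c \<Rightarrow> sd_rep K (Flag n x (map (\<lambda>i. c ! i) \<theta>))),
     spt = sd_rep K (Flag 0 (spt K) [{0}])\<rparr>"

definition last_vertex :: "sset \<Rightarrow> cell \<Rightarrow> cell" where
  "last_vertex K y = (case y of Flag n x c \<Rightarrow> sact K (map Max c) x)"

definition sd_circle :: "nat \<Rightarrow> sset" where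
  "sd_circle p = (sd ^^ p) circle"

text \<open>The composite of last vertex maps from the \<open>(p+d)\<close>-fold to the \<open>p\<close>-fold subdivision.\<close>

primrec last_vertices :: "nat \<Rightarrow> nat \<Rightarrow> cell \<Rightarrow> cell" where
  "last_vertices p 0 = id"
| "last_vertices p (Suc d) = last_vertices p d \<circ> last_vertex (sd_circle (p + d))"


section \<open>Mapping algebras\<close>

text \<open>\<open>map_alg K A\<close> is \<open>A\<^sup>K\<close>, the simplicial maps from \<open>K\<close> to \<open>A\<^sup>\<Delta>\<close>, and \<open>pmap_alg K A\<close> is \<open>A\<^sup>(\<^sup>K\<^sup>,\<^sup>\<star>\<^sup>)\<close>.\<close>

definition cells :: "sset \<Rightarrow> (nat \<times> cell) set" where
  "cells K = (SIGMA n:UNIV. simp K n)"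

definition map_alg :: "sset \<Rightarrow> ('h, 'a) ualg \<Rightarrow> ('h, 'a) ualg" where
  "map_alg K A =
    \<lparr>carrier = {SMap f | f. f \<in> (\<Pi>\<^sub>E z\<in>cells K. carrier (simplex_alg A (fst z))) \<and>
        (\<forall>m n \<theta> x. \<theta> \<in> opers m n \<and> x \<in> simp K n \<longrightarrow>
           f (m, sact K \<theta> x) = simplex_act A \<theta> (f (n, x)))},
     mult = (\<lambda>x y. SMap (\<lambda>z\<in>cells K. sval x z \<otimes>\<^bsub>simplex_alg A (fst z)\<^esub> sval y z)),
     one = undefined,
     zero = SMap (\<lambda>z\<in>cells K. \<zero>\<^bsub>simplex_alg A (fst z)\<^esub>),
     add = (\<lambda>x y. SMap (\<lambda>z\<in>cells K. sval x z \<oplus>\<^bsub>simplex_alg A (fst z)\<^esub> sval y z)),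
     lact = (\<lambda>h x. SMap (\<lambda>z\<in>cells K. lact (simplex_alg A (fst z)) h (sval x z))),
     ract = (\<lambda>x h. SMap (\<lambda>z\<in>cells K. ract (simplex_alg A (fst z)) (sval x z) h))\<rparr>"

definition pmap_alg :: "sset \<Rightarrow> ('h, 'a) ualg \<Rightarrow> ('h, 'a) ualg" where
  "pmap_alg K A = (map_alg K A)
    \<lparr>carrier := {x \<in> carrier (map_alg K A). sval x (0, spt K) = \<zero>\<^bsub>simplex_alg A 0\<^esub>}\<rparr>"

text \<open>Functoriality in the algebra (\<open>B\<close> is the target of \<open>\<phi>\<close>, which need only be additive)
  and in the simplicial set (\<open>K\<close> is the source of \<open>u\<close>).\<close>

definition push ::
    "sset \<Rightarrow> ('h, 'a) ualg \<Rightarrow> (('h, 'a) univ \<Rightarrow> ('h, 'a) univ) \<Rightarrow> ('h, 'a) univ \<Rightarrow> ('h, 'a) univ" where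
  "push K B \<phi> x = SMap (\<lambda>z\<in>cells K. simplex_map (fst z) B \<phi> (sval x z))"

definition pull :: "sset \<Rightarrow> (cell \<Rightarrow> cell) \<Rightarrow> ('h, 'a) univ \<Rightarrow> ('h, 'a) univ" where
  "pull K u x = SMap (\<lambda>z\<in>cells K. sval x (fst z, u (snd z)))"

text \<open>Level \<open>p\<close> of the ind-algebra of loops, its functoriality, and its transition maps.\<close>

definition loops :: "nat \<Rightarrow> ('h, 'a) ualg \<Rightarrow> ('h, 'a) ualg" where
  "loops p A = pmap_alg (sd_circle p) A"

definition loops_map ::
    "nat \<Rightarrow> ('h, 'a) ualg \<Rightarrow> (('h, 'a) univ \<Rightarrow> ('h, 'a) univ) \<Rightarrow> ('h, 'a) univ \<Rightarrow> ('h, 'a) univ" where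
  "loops_map p = push (sd_circle p)"

definition loops_trans :: "nat \<Rightarrow> nat \<Rightarrow> ('h, 'a) univ \<Rightarrow> ('h, 'a) univ" where
  "loops_trans p q = pull (sd_circle q) (last_vertices p (q - p))"

text \<open>The same for \<open>n\<close>-fold loops: the levels are the lists of length \<open>n\<close>, ordered
  componentwise; the head belongs to the outermost loop coordinate.\<close>

primrec iloops :: "nat list \<Rightarrow> ('h, 'a) ualg \<Rightarrow> ('h, 'a) ualg" where
  "iloops [] A = A"
| "iloops (p # ps) A = loops p (iloops ps A)"

primrec iloops_map ::
    "nat list \<Rightarrow> ('h, 'a) ualg \<Rightarrow> (('h, 'a) univ \<Rightarrow> ('h, 'a) univ) \<Rightarrow> ('h, 'a) univ \<Rightarrow> ('h, 'a) univ" where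
  "iloops_map [] B \<phi> = \<phi>"
| "iloops_map (p # ps) B \<phi> = loops_map p (iloops ps B) (iloops_map ps B \<phi>)"

fun iloops_trans :: "('h, 'a) ualg \<Rightarrow> nat list \<Rightarrow> nat list \<Rightarrow> ('h, 'a) univ \<Rightarrow> ('h, 'a) univ" where
  "iloops_trans A (p # ps) (q # qs) =
     loops_trans p q \<circ> loops_map p (iloops qs A) (iloops_trans A ps qs)"
| "iloops_trans A _ _ = id"

text \<open>\<open>P A\<close>, its subalgebra \<open>\<Omega> A\<close> (level 0 of the loops), and the section \<open>a \<mapsto> t a\<close> of
  evaluation at the vertex 1, where \<open>t = t\<^sub>1\<close>. A simplicial map on \<open>\<Delta>\<^sup>1\<close> is determined by
  its value at the identity of \<open>[1]\<close>.\<close>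

definition path_alg :: "('h, 'a) ualg \<Rightarrow> ('h, 'a) ualg" where
  "path_alg A = pmap_alg interval A"

definition loop_to_path :: "('h, 'a) univ \<Rightarrow> ('h, 'a) univ" where
  "loop_to_path = pull interval collapse"

definition linear_path :: "('h, 'a) ualg \<Rightarrow> ('h, 'a) univ \<Rightarrow> ('h, 'a) univ" where
  "linear_path A a = SMap (\<lambda>z\<in>cells interval. simplex_act A (verts (snd z))
     (rep (simplex_rel A 1) (Poly (\<lambda>e. if e = Poly_Mapping.single 1 1 then a else \<zero>\<^bsub>A\<^esub>))))"


section \<open>Matrices\<close>

text \<open>Level \<open>k\<close> of the ind-algebra \<open>M\<^sub>\<bullet> \<otimes> M\<^sub>\<infinity> \<otimes> A\<close>: finitely supported matrices with rows and
  columns indexed by \<open>{..<k} \<times> \<nat>\<close>. As functions on all of \<open>\<nat> \<times> \<nat>\<close> they vanish elsewhere, so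
  the transition maps (upper left corner inclusions) are identities on elements.\<close>

definition mat_alg :: "nat \<Rightarrow> ('h, 'a) ualg \<Rightarrow> ('h, 'a) ualg" where
  "mat_alg k A =
    \<lparr>carrier = {Mtx f | f. (\<forall>i j. f i j \<in> carrier A) \<and> finite {(i, j). f i j \<noteq> \<zero>\<^bsub>A\<^esub>} \<and>
        (\<forall>i j. f i j \<noteq> \<zero>\<^bsub>A\<^esub> \<longrightarrow> fst i < k \<and> fst j < k)},
     mult = (\<lambda>x y. Mtx (\<lambda>i j.
        \<Oplus>\<^bsub>A\<^esub>l\<in>{l. entry x i l \<noteq> \<zero>\<^bsub>A\<^esub>}. entry x i l \<otimes>\<^bsub>A\<^esub> entry y l j)),
     one = undefined,
     zero = Mtx (\<lambda>_ _. \<zero>\<^bsub>A\<^esub>),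
     add = (\<lambda>x y. Mtx (\<lambda>i j. entry x i j \<oplus>\<^bsub>A\<^esub> entry y i j)),
     lact = (\<lambda>h x. Mtx (\<lambda>i j. lact A h (entry x i j))),
     ract = (\<lambda>x h. Mtx (\<lambda>i j. ract A (entry x i j) h))\<rparr>"

definition mat_map :: "(('h, 'a) univ \<Rightarrow> ('h, 'a) univ) \<Rightarrow> ('h, 'a) univ \<Rightarrow> ('h, 'a) univ" where
  "mat_map \<phi> x = Mtx (\<lambda>i j. \<phi> (entry x i j))"

definition corner :: "('h, 'a) ualg \<Rightarrow> ('h, 'a) univ \<Rightarrow> ('h, 'a) univ" where
  "corner A a = Mtx (\<lambda>i j. if i = (0, 0) \<and> j = (0, 0) then a else \<zero>\<^bsub>A\<^esub>)"

definition block_sum ::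
    "('h, 'a) ualg \<Rightarrow> nat \<Rightarrow> ('h, 'a) univ \<Rightarrow> ('h, 'a) univ \<Rightarrow> ('h, 'a) univ" where
  "block_sum A k x y = Mtx (\<lambda>(i, a) (j, b).
     if i < k \<and> j < k then entry x (i, a) (j, b)
     else if k \<le> i \<and> k \<le> j then entry y (i - k, a) (j - k, b)
     else \<zero>\<^bsub>A\<^esub>)"

text \<open>Loops in matrices over \<open>A\<close> are matrices of loops in \<open>A\<close>.\<close>

definition loops_mat :: "nat list \<Rightarrow> ('h, 'a) ualg \<Rightarrow> ('h, 'a) univ \<Rightarrow> ('h, 'a) univ" where
  "loops_mat ps A x = Mtx (\<lambda>i j. iloops_map ps A (\<lambda>y. entry y i j) x)"

text \<open>Matrices of level \<open>k\<close> of matrices of level \<open>l\<close> become matrices of level \<open>k * l\<close> by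
  \<open>(i, j) \<mapsto> i * l + j\<close> on finite indices and \<open>prod_encode\<close> on those of \<open>M\<^sub>\<infinity>\<close>.\<close>

definition mat_tensor :: "nat \<Rightarrow> ('h, 'a) univ \<Rightarrow> ('h, 'a) univ" where
  "mat_tensor l x = Mtx (\<lambda>(i, a) (j, b).
     entry
       (entry x (i div l, fst (prod_decode a)) (j div l, fst (prod_decode b)))
       (i mod l, snd (prod_decode a)) (j mod l, snd (prod_decode b)))"


section \<open>The category kk\<close>

datatype underlying = Sets | AbGroups | Bimodules

text \<open>The locale parameters are the ground ring, the choice between central and all algebras,
  and the underlying category.\<close>

locale kk_setting = ring H for H :: "'h ring" +
  fixes central :: bool and und :: underlying
  assumes central_comm: "central \<Longrightarrow> cring H"
begin

definition is_algebra :: "('h, 'x) algebra \<Rightarrow> bool" where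
  "is_algebra A \<longleftrightarrow>
    abelian_group A \<and>
    (\<forall>x\<in>carrier A. \<forall>y\<in>carrier A. x \<otimes>\<^bsub>A\<^esub> y \<in> carrier A) \<and>
    (\<forall>x\<in>carrier A. \<forall>y\<in>carrier A. \<forall>z\<in>carrier A.
       (x \<otimes>\<^bsub>A\<^esub> y) \<otimes>\<^bsub>A\<^esub> z = x \<otimes>\<^bsub>A\<^esub> (y \<otimes>\<^bsub>A\<^esub> z) \<and>
       (x \<oplus>\<^bsub>A\<^esub> y) \<otimes>\<^bsub>A\<^esub> z = x \<otimes>\<^bsub>A\<^esub> z \<oplus>\<^bsub>A\<^esub> y \<otimes>\<^bsub>A\<^esub> z \<and>
       z \<otimes>\<^bsub>A\<^esub> (x \<oplus>\<^bsub>A\<^esub> y) = z \<otimes>\<^bsub>A\<^esub> x \<oplus>\<^bsub>A\<^esub> z \<otimes>\<^bsub>A\<^esub> y) \<and>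
    (\<forall>h\<in>carrier H. \<forall>x\<in>carrier A. lact A h x \<in> carrier A \<and> ract A x h \<in> carrier A) \<and>
    (\<forall>x\<in>carrier A. lact A \<one>\<^bsub>H\<^esub> x = x \<and> ract A x \<one>\<^bsub>H\<^esub> = x) \<and>
    (\<forall>h\<in>carrier H. \<forall>k\<in>carrier H. \<forall>x\<in>carrier A.
       lact A (h \<oplus>\<^bsub>H\<^esub> k) x = lact A h x \<oplus>\<^bsub>A\<^esub> lact A k x \<and>
       ract A x (h \<oplus>\<^bsub>H\<^esub> k) = ract A x h \<oplus>\<^bsub>A\<^esub> ract A x k \<and>
       lact A (h \<otimes>\<^bsub>H\<^esub> k) x = lact A h (lact A k x) \<and>
       ract A x (h \<otimes>\<^bsub>H\<^esub> k) = ract A (ract A x h) k \<and>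
       ract A (lact A h x) k = lact A h (ract A x k)) \<and>
    (\<forall>h\<in>carrier H. \<forall>x\<in>carrier A. \<forall>y\<in>carrier A.
       lact A h (x \<oplus>\<^bsub>A\<^esub> y) = lact A h x \<oplus>\<^bsub>A\<^esub> lact A h y \<and>
       ract A (x \<oplus>\<^bsub>A\<^esub> y) h = ract A x h \<oplus>\<^bsub>A\<^esub> ract A y h \<and>
       lact A h (x \<otimes>\<^bsub>A\<^esub> y) = lact A h x \<otimes>\<^bsub>A\<^esub> y \<and>
       ract A (x \<otimes>\<^bsub>A\<^esub> y) h = x \<otimes>\<^bsub>A\<^esub> ract A y h \<and>
       ract A x h \<otimes>\<^bsub>A\<^esub> y = x \<otimes>\<^bsub>A\<^esub> lact A h y) \<and>
    (central \<longrightarrow> (\<forall>h\<in>carrier H. \<forall>x\<in>carrier A. lact A h x = ract A x h))"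

definition alg_hom :: "('h, 'x) algebra \<Rightarrow> ('h, 'y) algebra \<Rightarrow> ('x \<Rightarrow> 'y) set" where
  "alg_hom A B = {f \<in> carrier A \<rightarrow> carrier B.
    (\<forall>x\<in>carrier A. \<forall>y\<in>carrier A.
       f (x \<oplus>\<^bsub>A\<^esub> y) = f x \<oplus>\<^bsub>B\<^esub> f y \<and> f (x \<otimes>\<^bsub>A\<^esub> y) = f x \<otimes>\<^bsub>B\<^esub> f y) \<and>
    (\<forall>h\<in>carrier H. \<forall>x\<in>carrier A.
       f (lact A h x) = lact B h (f x) \<and> f (ract A x h) = ract B (f x) h)}"

text \<open>Morphisms of the underlying category between the underlying objects of algebras.\<close>

definition und_hom :: "('h, 'x) algebra \<Rightarrow> ('h, 'y) algebra \<Rightarrow> ('x \<Rightarrow> 'y) set" where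
  "und_hom A B = {f \<in> carrier A \<rightarrow> carrier B.
    (und \<noteq> Sets \<longrightarrow> (\<forall>x\<in>carrier A. \<forall>y\<in>carrier A. f (x \<oplus>\<^bsub>A\<^esub> y) = f x \<oplus>\<^bsub>B\<^esub> f y)) \<and>
    (und = Bimodules \<longrightarrow> (\<forall>h\<in>carrier H. \<forall>x\<in>carrier A.
       f (lact A h x) = lact B h (f x) \<and> f (ract A x h) = ract B (f x) h))}"

definition sections :: "('h, 'x) algebra \<Rightarrow> ('h, 'y) algebra \<Rightarrow> ('x \<Rightarrow> 'y) \<Rightarrow> ('y \<Rightarrow> 'x) set" where
  "sections B C g = {s \<in> und_hom C B. \<forall>c\<in>carrier C. g (s c) = c}"

definition F_nilpotent :: "('h, 'x) algebra \<Rightarrow> bool" where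
  "F_nilpotent A \<longleftrightarrow> nilpotent_alg A \<and>
    (\<forall>n. let B = sub_pow A (2 ^ n); R = mod_rel B (alg_pow A (2 ^ Suc n))
         in sections B (quot_alg B R) (rep R) \<noteq> {})"

text \<open>\<open>T(A)\<close> is the free algebra on the underlying object of \<open>A\<close>: formal expressions in the
  elements of \<open>A\<close> modulo the axioms of algebras and the relations which make the insertion of
  generators a morphism of the underlying category.\<close>

definition terms :: "('h, 'x) algebra \<Rightarrow> ('h, 'x) tm set" where
  "terms A = {t. scalars t \<subseteq> carrier H \<and> gens t \<subseteq> carrier A}"

inductive tm_eq :: "('h, 'x) algebra \<Rightarrow> ('h, 'x) tm \<Rightarrow> ('h, 'x) tm \<Rightarrow> bool" for A where
  refl: "t \<in> terms A \<Longrightarrow> tm_eq A t t"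
| sym: "tm_eq A s t \<Longrightarrow> tm_eq A t s"
| trans: "tm_eq A s t \<Longrightarrow> tm_eq A t u \<Longrightarrow> tm_eq A s u"
| cong_Add: "tm_eq A s s' \<Longrightarrow> tm_eq A t t' \<Longrightarrow> tm_eq A (Add s t) (Add s' t')"
| cong_Neg: "tm_eq A s s' \<Longrightarrow> tm_eq A (Neg s) (Neg s')"
| cong_Mul: "tm_eq A s s' \<Longrightarrow> tm_eq A t t' \<Longrightarrow> tm_eq A (Mul s t) (Mul s' t')"
| cong_LAct: "h \<in> carrier H \<Longrightarrow> tm_eq A s s' \<Longrightarrow> tm_eq A (LAct h s) (LAct h s')"
| cong_RAct: "h \<in> carrier H \<Longrightarrow> tm_eq A s s' \<Longrightarrow> tm_eq A (RAct s h) (RAct s' h)"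
| add_assoc: "{s, t, u} \<subseteq> terms A \<Longrightarrow> tm_eq A (Add (Add s t) u) (Add s (Add t u))"
| add_comm: "{s, t} \<subseteq> terms A \<Longrightarrow> tm_eq A (Add s t) (Add t s)"
| add_zero: "s \<in> terms A \<Longrightarrow> tm_eq A (Add s Zero) s"
| add_neg: "s \<in> terms A \<Longrightarrow> tm_eq A (Add s (Neg s)) Zero"
| mul_assoc: "{s, t, u} \<subseteq> terms A \<Longrightarrow> tm_eq A (Mul (Mul s t) u) (Mul s (Mul t u))"
| distrib_r: "{s, t, u} \<subseteq> terms A \<Longrightarrow> tm_eq A (Mul (Add s t) u) (Add (Mul s u) (Mul t u))"
| distrib_l: "{s, t, u} \<subseteq> terms A \<Longrightarrow> tm_eq A (Mul u (Add s t)) (Add (Mul u s) (Mul u t))"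
| lact_one: "s \<in> terms A \<Longrightarrow> tm_eq A (LAct \<one>\<^bsub>H\<^esub> s) s"
| ract_one: "s \<in> terms A \<Longrightarrow> tm_eq A (RAct s \<one>\<^bsub>H\<^esub>) s"
| lact_mult: "s \<in> terms A \<Longrightarrow> {h, k} \<subseteq> carrier H \<Longrightarrow>
    tm_eq A (LAct (h \<otimes>\<^bsub>H\<^esub> k) s) (LAct h (LAct k s))"
| ract_mult: "s \<in> terms A \<Longrightarrow> {h, k} \<subseteq> carrier H \<Longrightarrow>
    tm_eq A (RAct s (h \<otimes>\<^bsub>H\<^esub> k)) (RAct (RAct s h) k)"
| lact_add: "s \<in> terms A \<Longrightarrow> {h, k} \<subseteq> carrier H \<Longrightarrow>
    tm_eq A (LAct (h \<oplus>\<^bsub>H\<^esub> k) s) (Add (LAct h s) (LAct k s))"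
| ract_add: "s \<in> terms A \<Longrightarrow> {h, k} \<subseteq> carrier H \<Longrightarrow>
    tm_eq A (RAct s (h \<oplus>\<^bsub>H\<^esub> k)) (Add (RAct s h) (RAct s k))"
| add_lact: "{s, t} \<subseteq> terms A \<Longrightarrow> h \<in> carrier H \<Longrightarrow>
    tm_eq A (LAct h (Add s t)) (Add (LAct h s) (LAct h t))"
| add_ract: "{s, t} \<subseteq> terms A \<Longrightarrow> h \<in> carrier H \<Longrightarrow>
    tm_eq A (RAct (Add s t) h) (Add (RAct s h) (RAct t h))"
| lact_ract: "s \<in> terms A \<Longrightarrow> {h, k} \<subseteq> carrier H \<Longrightarrow>
    tm_eq A (RAct (LAct h s) k) (LAct h (RAct s k))"
| lact_mul: "{s, t} \<subseteq> terms A \<Longrightarrow> h \<in> carrier H \<Longrightarrow>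
    tm_eq A (LAct h (Mul s t)) (Mul (LAct h s) t)"
| ract_mul: "{s, t} \<subseteq> terms A \<Longrightarrow> h \<in> carrier H \<Longrightarrow>
    tm_eq A (RAct (Mul s t) h) (Mul s (RAct t h))"
| mul_balanced: "{s, t} \<subseteq> terms A \<Longrightarrow> h \<in> carrier H \<Longrightarrow>
    tm_eq A (Mul (RAct s h) t) (Mul s (LAct h t))"
| central: "central \<Longrightarrow> s \<in> terms A \<Longrightarrow> h \<in> carrier H \<Longrightarrow>
    tm_eq A (LAct h s) (RAct s h)"
| gen_add: "und \<noteq> Sets \<Longrightarrow> {x, y} \<subseteq> carrier A \<Longrightarrow>
    tm_eq A (Gen (x \<oplus>\<^bsub>A\<^esub> y)) (Add (Gen x) (Gen y))"
| gen_lact: "und = Bimodules \<Longrightarrow> x \<in> carrier A \<Longrightarrow> h \<in> carrier H \<Longrightarrow>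
    tm_eq A (Gen (lact A h x)) (LAct h (Gen x))"
| gen_ract: "und = Bimodules \<Longrightarrow> x \<in> carrier A \<Longrightarrow> h \<in> carrier H \<Longrightarrow>
    tm_eq A (Gen (ract A x h)) (RAct (Gen x) h)"

definition expr_alg :: "('h, 'a) ualg \<Rightarrow> ('h, 'a) ualg" where
  "expr_alg A =
    \<lparr>carrier = Expr ` terms A,
     mult = (\<lambda>x y. Expr (Mul (expr x) (expr y))), one = undefined,
     zero = Expr Zero, add = (\<lambda>x y. Expr (Add (expr x) (expr y))),
     lact = (\<lambda>h x. Expr (LAct h (expr x))), ract = (\<lambda>x h. Expr (RAct (expr x) h))\<rparr>"

definition T_rel :: "('h, 'a) ualg \<Rightarrow> ('h, 'a) univ \<Rightarrow> ('h, 'a) univ \<Rightarrow> bool" where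
  "T_rel A x y \<longleftrightarrow> (\<exists>s t. x = Expr s \<and> y = Expr t \<and> tm_eq A s t)"

definition T :: "('h, 'a) ualg \<Rightarrow> ('h, 'a) ualg" where
  "T A = quot_alg (expr_alg A) (T_rel A)"

definition T_unit :: "('h, 'a) ualg \<Rightarrow> ('h, 'a) univ \<Rightarrow> ('h, 'a) univ" where
  "T_unit A a = rep (T_rel A) (Expr (Gen a))"

primrec eval_tm :: "('h, 'y) algebra \<Rightarrow> ('x \<Rightarrow> 'y) \<Rightarrow> ('h, 'x) tm \<Rightarrow> 'y" where
  "eval_tm B s (Gen x) = s x"
| "eval_tm B s Zero = \<zero>\<^bsub>B\<^esub>"
| "eval_tm B s (Add t u) = eval_tm B s t \<oplus>\<^bsub>B\<^esub> eval_tm B s u"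
| "eval_tm B s (Neg t) = \<ominus>\<^bsub>B\<^esub> eval_tm B s t"
| "eval_tm B s (Mul t u) = eval_tm B s t \<otimes>\<^bsub>B\<^esub> eval_tm B s u"
| "eval_tm B s (LAct h t) = lact B h (eval_tm B s t)"
| "eval_tm B s (RAct t h) = ract B (eval_tm B s t) h"

text \<open>The homomorphism \<open>T(A) \<rightarrow> B\<close> adjoint to a morphism \<open>s\<close> of underlying objects.\<close>

definition T_lift :: "('h, 'a) ualg \<Rightarrow> (('h, 'a) univ \<Rightarrow> ('h, 'a) univ) \<Rightarrow> ('h, 'a) univ \<Rightarrow> ('h, 'a) univ" where
  "T_lift B s x = eval_tm B s (expr x)"

definition counit :: "('h, 'a) ualg \<Rightarrow> ('h, 'a) univ \<Rightarrow> ('h, 'a) univ" where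
  "counit A = T_lift A id"

definition J :: "('h, 'a) ualg \<Rightarrow> ('h, 'a) ualg" where
  "J A = (T A)\<lparr>carrier := {x \<in> carrier (T A). counit A x = \<zero>\<^bsub>A\<^esub>}\<rparr>"

text \<open>\<open>J(f)\<close> is the restriction of \<open>T(f)\<close>; \<open>B\<close> is the target of \<open>f\<close>.\<close>

definition J_map :: "('h, 'a) ualg \<Rightarrow> (('h, 'a) univ \<Rightarrow> ('h, 'a) univ) \<Rightarrow> ('h, 'a) univ \<Rightarrow> ('h, 'a) univ" where
  "J_map B f = T_lift (T B) (T_unit B \<circ> f)"

text \<open>For an extension \<open>A \<rightarrow> B \<rightarrow> C\<close> with maps \<open>f\<close>, \<open>g\<close>: the classifying map \<open>J(C) \<rightarrow> A\<close> for the
  section \<open>s\<close>, and the set of classifying maps for all sections.\<close>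

definition classifying_map ::
    "('h, 'a) ualg \<Rightarrow> (('h, 'a) univ \<Rightarrow> ('h, 'a) univ) \<Rightarrow> ('h, 'a) ualg \<Rightarrow>
     (('h, 'a) univ \<Rightarrow> ('h, 'a) univ) \<Rightarrow> ('h, 'a) univ \<Rightarrow> ('h, 'a) univ" where
  "classifying_map A f B s x = inv_into (carrier A) f (T_lift B s x)"

definition classifying_maps ::
    "('h, 'a) ualg \<Rightarrow> (('h, 'a) univ \<Rightarrow> ('h, 'a) univ) \<Rightarrow> ('h, 'a) ualg \<Rightarrow>
     (('h, 'a) univ \<Rightarrow> ('h, 'a) univ) \<Rightarrow> ('h, 'a) ualg \<Rightarrow> (('h, 'a) univ \<Rightarrow> ('h, 'a) univ) set" where
  "classifying_maps A f B g C = classifying_map A f B ` sections B C g"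

definition rho :: "('h, 'a) ualg \<Rightarrow> ('h, 'a) univ \<Rightarrow> ('h, 'a) univ" where
  "rho A = classifying_map (loops 0 A) loop_to_path (path_alg A) (linear_path A)"

text \<open>The classifying maps \<open>J(LA) \<rightarrow> L J(A)\<close> of \<open>L J(A) \<rightarrow> L T(A) \<rightarrow> LA\<close> when \<open>L\<close> is a level of the
  ind-ring of loops or of matrices. They depend on a section, so each is a set of maps.\<close>

definition gamma1 :: "nat \<Rightarrow> ('h, 'a) ualg \<Rightarrow> (('h, 'a) univ \<Rightarrow> ('h, 'a) univ) set" where
  "gamma1 p A = classifying_maps
     (loops p (J A)) (loops_map p (T A) id) (loops p (T A)) (loops_map p A (counit A)) (loops p A)"

definition mat_J :: "nat \<Rightarrow> ('h, 'a) ualg \<Rightarrow> (('h, 'a) univ \<Rightarrow> ('h, 'a) univ) set" where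
  "mat_J k A = classifying_maps
     (mat_alg k (J A)) id (mat_alg k (T A)) (mat_map (counit A)) (mat_alg k A)"

text \<open>The iterates \<open>J(A\<^sup>\<S>\<^sup>m) \<rightarrow> J(A)\<^sup>\<S>\<^sup>m\<close> and \<open>J\<^sup>n(A\<^sup>\<S>\<^sup>m) \<rightarrow> J\<^sup>n(A)\<^sup>\<S>\<^sup>m\<close>, at level \<open>ps\<close>.\<close>

primrec gamma :: "nat list \<Rightarrow> ('h, 'a) ualg \<Rightarrow> (('h, 'a) univ \<Rightarrow> ('h, 'a) univ) set" where
  "gamma [] A = {id}"
| "gamma (p # ps) A =
    {loops_map p (iloops ps (J A)) g \<circ> g1 | g g1. g \<in> gamma ps A \<and> g1 \<in> gamma1 p (iloops ps A)}"

primrec gamma_pow :: "nat \<Rightarrow> nat list \<Rightarrow> ('h, 'a) ualg \<Rightarrow> (('h, 'a) univ \<Rightarrow> ('h, 'a) univ) set" where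
  "gamma_pow 0 ps A = {id}"
| "gamma_pow (Suc n) ps A =
    {g1 \<circ> J_map (iloops ps ((J ^^ n) A)) g | g g1.
       g \<in> gamma_pow n ps A \<and> g1 \<in> gamma ps ((J ^^ n) A)}"

text \<open>The maps \<open>J\<^sup>n(X) \<rightarrow> M J\<^sup>n(Y)\<close> induced by \<open>f : X \<rightarrow> M Y\<close>, for \<open>M\<close> the matrices of level \<open>k\<close>.\<close>

primrec J_pow :: "nat \<Rightarrow> nat \<Rightarrow> ('h, 'a) ualg \<Rightarrow> (('h, 'a) univ \<Rightarrow> ('h, 'a) univ) \<Rightarrow>
    (('h, 'a) univ \<Rightarrow> ('h, 'a) univ) set" where
  "J_pow 0 k Y f = {f}"
| "J_pow (Suc n) k Y f =
    {\<mu> \<circ> J_map (mat_alg k ((J ^^ n) Y)) g | g \<mu>. g \<in> J_pow n k Y f \<and> \<mu> \<in> mat_J k ((J ^^ n) Y)}"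

definition elem_homotopic ::
    "('h, 'a) ualg \<Rightarrow> ('h, 'a) ualg \<Rightarrow> (('h, 'a) univ \<Rightarrow> ('h, 'a) univ) \<Rightarrow>
     (('h, 'a) univ \<Rightarrow> ('h, 'a) univ) \<Rightarrow> bool" where
  "elem_homotopic A B f g \<longleftrightarrow>
    (\<exists>h\<in>alg_hom A (poly1 B). \<forall>a\<in>carrier A. ev B 0 (h a) = f a \<and> ev B 1 (h a) = g a)"

text \<open>A representative \<open>(ps, k, f)\<close> of an element of \<open>kk(A, B)\<close> is a homomorphism \<open>f\<close> from \<open>J\<^sup>n(A)\<close>,
  with \<open>n\<close> the length of \<open>ps\<close>, to the level given by \<open>ps\<close> and \<open>k\<close> of the ind-algebra of matrices over
  \<open>B\<close> with \<open>n\<close> loop coordinates. Since \<open>J\<^sup>n(A)\<close> is an algebra, homotopy classes of maps into the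
  ind-algebra are a colimit over its levels. The equivalence relation generated by \<open>kk_step\<close> computes this
  colimit and the one over \<open>n\<close>.\<close>

type_synonym ('k, 'a) kk_rep_type =
  "nat list \<times> nat \<times> (('k, 'a) univ \<Rightarrow> ('k, 'a) univ)"

definition kk_reps :: "('h, 'a) ualg \<Rightarrow> ('h, 'a) ualg \<Rightarrow> ('h, 'a) kk_rep_type set" where
  "kk_reps A B = {(ps, k, f). 0 < k \<and> f \<in> alg_hom ((J ^^ length ps) A) (mat_alg k (iloops ps B))}"

inductive kk_step :: "('h, 'a) ualg \<Rightarrow> ('h, 'a) ualg \<Rightarrow>
    ('h, 'a) kk_rep_type \<Rightarrow> ('h, 'a) kk_rep_type \<Rightarrow> bool" for A B where
  homotopy: "(ps, k, f) \<in> kk_reps A B \<Longrightarrow> (ps, k, g) \<in> kk_reps A B \<Longrightarrow>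
    elem_homotopic ((J ^^ length ps) A) (mat_alg k (iloops ps B)) f g \<Longrightarrow>
    kk_step A B (ps, k, f) (ps, k, g)"
| level: "(ps, k, f) \<in> kk_reps A B \<Longrightarrow> list_all2 (\<le>) ps qs \<Longrightarrow> k \<le> l \<Longrightarrow>
    kk_step A B (ps, k, f) (qs, l, mat_map (iloops_trans B ps qs) \<circ> f)"
| suspension: "(ps, k, f) \<in> kk_reps A B \<Longrightarrow> g \<in> J_pow 1 k (iloops ps B) f \<Longrightarrow>
    kk_step A B (ps, k, f) (0 # ps, k, mat_map (rho (iloops ps B)) \<circ> g)"

definition kk_class :: "('h, 'a) ualg \<Rightarrow> ('h, 'a) ualg \<Rightarrow>
    ('h, 'a) kk_rep_type \<Rightarrow> ('h, 'a) kk_rep_type set" where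
  "kk_class A B x = {y. equivclp (kk_step A B) x y}"

definition kk :: "('h, 'a) ualg \<Rightarrow> ('h, 'a) ualg \<Rightarrow> ('h, 'a) kk_rep_type set set" where
  "kk A B = kk_class A B ` kk_reps A B"

text \<open>The abelian group structure, given by block sum. Operations on classes are defined as unions over
  all choices of representatives.\<close>

definition kk_zero :: "('h, 'a) ualg \<Rightarrow> ('h, 'a) ualg \<Rightarrow> ('h, 'a) kk_rep_type set" where
  "kk_zero A B = kk_class A B ([], 1, \<lambda>_. \<zero>\<^bsub>mat_alg 1 B\<^esub>)"

definition kk_add :: "('h, 'a) ualg \<Rightarrow> ('h, 'a) ualg \<Rightarrow> ('h, 'a) kk_rep_type set \<Rightarrow>
    ('h, 'a) kk_rep_type set \<Rightarrow> ('h, 'a) kk_rep_type set" where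
  "kk_add A B \<alpha> \<beta> =
    \<Union>{kk_class A B (ps, k + l, \<lambda>x. block_sum (iloops ps B) k (f x) (g x)) | ps k l f g.
        (ps, k, f) \<in> \<alpha> \<and> (ps, l, g) \<in> \<beta>}"

definition kk_neg :: "('h, 'a) ualg \<Rightarrow> ('h, 'a) ualg \<Rightarrow> ('h, 'a) kk_rep_type set \<Rightarrow>
    ('h, 'a) kk_rep_type set" where
  "kk_neg A B \<alpha> = (THE \<beta>. \<beta> \<in> kk A B \<and> kk_add A B \<alpha> \<beta> = kk_zero A B)"

text \<open>\<open>kk_prod A B C a b\<close>, for representatives \<open>a\<close> of an element of \<open>kk(B, C)\<close> and \<open>b\<close> of an element of \<open>kk(A, B)\<close>,
  consists of the representatives of their product before the sign, one for each choice of sections.\<close>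

definition kk_prod :: "('h, 'a) ualg \<Rightarrow> ('h, 'a) ualg \<Rightarrow> ('h, 'a) ualg \<Rightarrow>
    ('h, 'a) kk_rep_type \<Rightarrow> ('h, 'a) kk_rep_type \<Rightarrow> ('h, 'a) kk_rep_type set" where
  "kk_prod A B C = (\<lambda>(qs, l, a) (ps, k, b).
    {(ps @ qs, k * l,
      mat_tensor l \<circ> mat_map (loops_mat ps (iloops qs C)) \<circ>
      mat_map (iloops_map ps (mat_alg l (iloops qs C)) a) \<circ> mat_map g \<circ> b') | b' g.
     b' \<in> J_pow (length qs) k (iloops ps B) b \<and> g \<in> gamma_pow (length qs) ps B})"

definition kk_comp :: "('h, 'a) ualg \<Rightarrow> ('h, 'a) ualg \<Rightarrow> ('h, 'a) ualg \<Rightarrow>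
    ('h, 'a) kk_rep_type set \<Rightarrow> ('h, 'a) kk_rep_type set \<Rightarrow> ('h, 'a) kk_rep_type set" where
  "kk_comp A B C \<alpha> \<beta> =
    \<Union>{(if odd (length (fst b) * length (fst a)) then kk_neg A C else id) (kk_class A C c) | a b c.
        a \<in> \<alpha> \<and> b \<in> \<beta> \<and> c \<in> kk_prod A B C a b}"

definition kk_id :: "('h, 'a) ualg \<Rightarrow> ('h, 'a) kk_rep_type set" where
  "kk_id A = kk_class A A ([], 1, corner A)"

definition kk_equivalent :: "('h, 'a) ualg \<Rightarrow> ('h, 'a) ualg \<Rightarrow> bool" where
  "kk_equivalent A B \<longleftrightarrow>
    (\<exists>\<alpha>\<in>kk A B. \<exists>\<beta>\<in>kk B A. kk_comp A B A \<beta> \<alpha> = kk_id A \<and> kk_comp B A B \<alpha> \<beta> = kk_id B)"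

end

end

theory Submission
  imports Defs
begin

text \<open>
  Let \<open>A\<close> be nilpotent. Then every representative of an element of \<open>kk(A, B)\<close>, that is, every homomorphism from
  \<open>J\<^sup>n(A)\<close> to matrices of \<open>n\<close>-fold loops in \<open>B\<close>, is equivalent to zero (\<open>kk_class_zero\<close>). So \<open>kk(A, A)\<close> and
  \<open>kk(0, 0)\<close> consist of the zero class, which is thus the identity, and the zero classes between \<open>A\<close> and \<open>0\<close> are mutually
  inverse (\<open>dnil_kk_equivalent\<close>).

  The reason is that suspension gains a factor. Let \<open>I\<close> be an ideal of \<open>A\<close> that contains all products. The suspension map
  from \<open>J(A)\<close> to \<open>\<Omega> A\<close> is induced by \<open>a \<mapsto> t a\<close>. Modulo \<open>I[t]\<close> this assignment is multiplicative, as all products vanish,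
  so the suspension map takes values in \<open>\<Omega> I\<close> (\<open>rho'_factor\<close>). Suspension commutes with \<open>J\<close> up to homotopy and
  reversal of loops (\<open>rho'_J_homotopic\<close>). Therefore the suspension map of \<open>J\<^sup>n(A)\<close> factors, up to homotopy,
  through \<open>J\<^sup>n(\<Omega> I)\<close> (\<open>rho'_J_pow_factor\<close>). The algebra \<open>\<Omega> I\<close> is in the same position with respect to the loops in an
  ideal of \<open>I\<close> that contains the products of \<open>I\<close>. Descending along \<open>A\<close>, \<open>A\<^sup>2\<close>, \<open>A\<^sup>4\<close> and so on, finitely many suspensions
  and homotopies turn a map out of \<open>J\<^sup>n(A)\<close> into one that factors through the contractible algebra obtained from \<open>0\<close> in
  place of \<open>A\<close>, hence into zero (\<open>dnil_null\<close>).

  All homotopies are constructed with one principle: a map out of \<open>J(X)\<close> is prescribed on the generators \<open>X\<close>, and its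
  composite with \<open>\<phi>\<close> vanishes if \<open>\<phi>\<close> makes the prescription multiplicative (\<open>T_lift_kernel\<close>).

  This argument uses polynomial loops and knows nothing of matrices. It applies to representatives because the suspension of
  a matrix-valued map is its polynomial suspension over the matrix algebra, followed by the comparison of polynomial with
  simplicial loops and the exchange of loops and matrices (\<open>mat_rho_gamma\<close>, \<open>null_equiv_zero\<close>). That suspensions,
  products and block sums of representatives are again representatives rests on the functoriality of the mapping
  algebras; the exchange of loops and matrices needs that the subdivided circles have finitely many generating simplices, so
  that matrices stay finite (\<open>kmat_closed\<close>).
\<close>

section \<open>Algebras and homomorphisms\<close>

context kk_setting
begin

lemma algebra_abelian_group: "is_algebra A \<Longrightarrow> abelian_group A"
  by (simp add: is_algebra_def)

lemma algebra_abelian_monoid: "is_algebra A \<Longrightarrow> abelian_monoid A"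
  by (rule abelian_group.axioms(1)[OF algebra_abelian_group])

lemma algebra_closed [simp]:
  assumes "is_algebra A"
  shows "\<zero>\<^bsub>A\<^esub> \<in> carrier A"
    and "x \<in> carrier A \<Longrightarrow> y \<in> carrier A \<Longrightarrow> x \<oplus>\<^bsub>A\<^esub> y \<in> carrier A"
    and "x \<in> carrier A \<Longrightarrow> y \<in> carrier A \<Longrightarrow> x \<otimes>\<^bsub>A\<^esub> y \<in> carrier A"
    and "x \<in> carrier A \<Longrightarrow> \<ominus>\<^bsub>A\<^esub> x \<in> carrier A"
    and "x \<in> carrier A \<Longrightarrow> y \<in> carrier A \<Longrightarrow> x \<ominus>\<^bsub>A\<^esub> y \<in> carrier A"
    and "h \<in> carrier H \<Longrightarrow> x \<in> carrier A \<Longrightarrow> lact A h x \<in> carrier A"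
    and "h \<in> carrier H \<Longrightarrow> x \<in> carrier A \<Longrightarrow> ract A x h \<in> carrier A"
  using assms abelian_monoid.zero_closed[OF algebra_abelian_monoid[OF assms]] abelian_monoid.a_closed[OF algebra_abelian_monoid[OF assms]]
    abelian_group.a_inv_closed[OF algebra_abelian_group[OF assms]] abelian_group.minus_closed[OF algebra_abelian_group[OF assms]]
  by (simp_all add: is_algebra_def)

lemmas algebra_zero_add [simp] = abelian_monoid.l_zero[OF algebra_abelian_monoid]
  and algebra_add_zero [simp] = abelian_monoid.r_zero[OF algebra_abelian_monoid]
  and algebra_neg_add [simp] = abelian_group.l_neg[OF algebra_abelian_group]
  and algebra_add_neg [simp] = abelian_group.r_neg[OF algebra_abelian_group]
  and algebra_neg_neg [simp] = abelian_group.minus_minus[OF algebra_abelian_group]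
  and algebra_add_comm = abelian_monoid.a_comm[OF algebra_abelian_monoid]
  and algebra_add_assoc = abelian_monoid.a_assoc[OF algebra_abelian_monoid]
  and algebra_add_left_comm = abelian_monoid.a_lcomm[OF algebra_abelian_monoid]
  and algebra_neg_distrib = abelian_group.minus_add[OF algebra_abelian_group]

lemmas algebra_ac = algebra_add_assoc algebra_add_comm algebra_add_left_comm

lemma algebra_neg_zero [simp]: "is_algebra A \<Longrightarrow> \<ominus>\<^bsub>A\<^esub> \<zero>\<^bsub>A\<^esub> = \<zero>\<^bsub>A\<^esub>"
  by (metis algebra_add_zero algebra_closed(1,4) algebra_neg_add)

lemma algebra_diff: "x \<ominus>\<^bsub>A\<^esub> y = x \<oplus>\<^bsub>A\<^esub> \<ominus>\<^bsub>A\<^esub> y"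
  by (simp add: a_minus_def)

lemma
  assumes "is_algebra A" "x \<in> carrier A"
  shows algebra_diff_self [simp]: "x \<ominus>\<^bsub>A\<^esub> x = \<zero>\<^bsub>A\<^esub>"
    and algebra_diff_zero [simp]: "x \<ominus>\<^bsub>A\<^esub> \<zero>\<^bsub>A\<^esub> = x"
    and algebra_add_diff_cancel: "y \<in> carrier A \<Longrightarrow> x \<oplus>\<^bsub>A\<^esub> (y \<ominus>\<^bsub>A\<^esub> x) = y"
  using assms algebra_add_left_comm[OF assms(1), of x y]
  by (simp_all add: algebra_diff algebra_add_assoc)

lemma algebra_neg_unique:
  assumes "is_algebra A" "x \<in> carrier A" "y \<in> carrier A" "x \<oplus>\<^bsub>A\<^esub> y = \<zero>\<^bsub>A\<^esub>"
  shows "y = \<ominus>\<^bsub>A\<^esub> x"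
proof -
  interpret abelian_group A using assms(1) by (rule algebra_abelian_group)
  show ?thesis using assms(2-) by (metis a_comm minus_equality)
qed

lemma algebra_add_self_zero:
  assumes "is_algebra A" "x \<in> carrier A" "x \<oplus>\<^bsub>A\<^esub> x = x"
  shows "x = \<zero>\<^bsub>A\<^esub>"
  using assms by (metis algebra_add_assoc algebra_add_neg algebra_add_zero algebra_closed(4))

lemma
  assumes "is_algebra A" "x \<in> carrier A" "y \<in> carrier A"
  shows algebra_distrib_r: "z \<in> carrier A \<Longrightarrow> (x \<oplus>\<^bsub>A\<^esub> y) \<otimes>\<^bsub>A\<^esub> z = x \<otimes>\<^bsub>A\<^esub> z \<oplus>\<^bsub>A\<^esub> y \<otimes>\<^bsub>A\<^esub> z"
    and algebra_distrib_l: "z \<in> carrier A \<Longrightarrow> z \<otimes>\<^bsub>A\<^esub> (x \<oplus>\<^bsub>A\<^esub> y) = z \<otimes>\<^bsub>A\<^esub> x \<oplus>\<^bsub>A\<^esub> z \<otimes>\<^bsub>A\<^esub> y"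
    and algebra_mult_assoc: "z \<in> carrier A \<Longrightarrow> (x \<otimes>\<^bsub>A\<^esub> y) \<otimes>\<^bsub>A\<^esub> z = x \<otimes>\<^bsub>A\<^esub> (y \<otimes>\<^bsub>A\<^esub> z)"
    and algebra_lact_add: "h \<in> carrier H \<Longrightarrow> lact A h (x \<oplus>\<^bsub>A\<^esub> y) = lact A h x \<oplus>\<^bsub>A\<^esub> lact A h y"
    and algebra_ract_add: "h \<in> carrier H \<Longrightarrow> ract A (x \<oplus>\<^bsub>A\<^esub> y) h = ract A x h \<oplus>\<^bsub>A\<^esub> ract A y h"
    and algebra_lact_mult: "h \<in> carrier H \<Longrightarrow> lact A h (x \<otimes>\<^bsub>A\<^esub> y) = lact A h x \<otimes>\<^bsub>A\<^esub> y"
    and algebra_ract_mult: "h \<in> carrier H \<Longrightarrow> ract A (x \<otimes>\<^bsub>A\<^esub> y) h = x \<otimes>\<^bsub>A\<^esub> ract A y h"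
    and algebra_balanced: "h \<in> carrier H \<Longrightarrow> ract A x h \<otimes>\<^bsub>A\<^esub> y = x \<otimes>\<^bsub>A\<^esub> lact A h y"
  using conjunct1[OF conjunct2[OF conjunct2[OF assms(1)[unfolded is_algebra_def]]]] assms(2,3)
    conjunct1[OF conjunct2[OF conjunct2[OF conjunct2[OF conjunct2[OF conjunct2[OF conjunct2[OF assms(1)[unfolded is_algebra_def]]]]]]]]
  by blast+

lemma
  assumes "is_algebra A" "x \<in> carrier A"
  shows algebra_lact_one: "lact A \<one>\<^bsub>H\<^esub> x = x"
    and algebra_ract_one: "ract A x \<one>\<^bsub>H\<^esub> = x"
    and algebra_act_add: "h \<in> carrier H \<Longrightarrow> k \<in> carrier H \<Longrightarrow> lact A (h \<oplus>\<^bsub>H\<^esub> k) x = lact A h x \<oplus>\<^bsub>A\<^esub> lact A k x"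
      "h \<in> carrier H \<Longrightarrow> k \<in> carrier H \<Longrightarrow> ract A x (h \<oplus>\<^bsub>H\<^esub> k) = ract A x h \<oplus>\<^bsub>A\<^esub> ract A x k"
    and algebra_act_mult: "h \<in> carrier H \<Longrightarrow> k \<in> carrier H \<Longrightarrow> lact A (h \<otimes>\<^bsub>H\<^esub> k) x = lact A h (lact A k x)"
      "h \<in> carrier H \<Longrightarrow> k \<in> carrier H \<Longrightarrow> ract A x (h \<otimes>\<^bsub>H\<^esub> k) = ract A (ract A x h) k"
    and algebra_lact_ract: "h \<in> carrier H \<Longrightarrow> k \<in> carrier H \<Longrightarrow> ract A (lact A h x) k = lact A h (ract A x k)"
    and algebra_central: "central \<Longrightarrow> h \<in> carrier H \<Longrightarrow> lact A h x = ract A x h"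
  using assms unfolding is_algebra_def by blast+

lemma algebra_zero_mult [simp]:
  assumes "is_algebra A" "x \<in> carrier A"
  shows "\<zero>\<^bsub>A\<^esub> \<otimes>\<^bsub>A\<^esub> x = \<zero>\<^bsub>A\<^esub>" "x \<otimes>\<^bsub>A\<^esub> \<zero>\<^bsub>A\<^esub> = \<zero>\<^bsub>A\<^esub>"
  using algebra_distrib_r[OF assms(1), of "\<zero>\<^bsub>A\<^esub>" "\<zero>\<^bsub>A\<^esub>" x] algebra_distrib_l[OF assms(1), of "\<zero>\<^bsub>A\<^esub>" "\<zero>\<^bsub>A\<^esub>" x]
    assms by (auto intro!: algebra_add_self_zero)

lemma algebra_act_zero [simp]:
  assumes "is_algebra A" "h \<in> carrier H"
  shows "lact A h \<zero>\<^bsub>A\<^esub> = \<zero>\<^bsub>A\<^esub>" "ract A \<zero>\<^bsub>A\<^esub> h = \<zero>\<^bsub>A\<^esub>"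
  using algebra_lact_add[OF assms(1), of "\<zero>\<^bsub>A\<^esub>" "\<zero>\<^bsub>A\<^esub>" h] algebra_ract_add[OF assms(1), of "\<zero>\<^bsub>A\<^esub>" "\<zero>\<^bsub>A\<^esub>" h]
    assms by (auto intro!: algebra_add_self_zero)

text \<open>Entries of matrices and coefficients of polynomials are additive maps without being homomorphisms
  of algebras.\<close>

definition add_hom :: "('h, 'x) algebra \<Rightarrow> ('h, 'y) algebra \<Rightarrow> ('x \<Rightarrow> 'y) set" where
  "add_hom A B = {f \<in> carrier A \<rightarrow> carrier B.
     \<forall>x\<in>carrier A. \<forall>y\<in>carrier A. f (x \<oplus>\<^bsub>A\<^esub> y) = f x \<oplus>\<^bsub>B\<^esub> f y}"

definition bimod_hom :: "('h, 'x) algebra \<Rightarrow> ('h, 'y) algebra \<Rightarrow> ('x \<Rightarrow> 'y) set" where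
  "bimod_hom A B = {f \<in> add_hom A B. \<forall>h\<in>carrier H. \<forall>x\<in>carrier A.
       f (lact A h x) = lact B h (f x) \<and> f (ract A x h) = ract B (f x) h}"

lemma bimod_hom_add_hom: "f \<in> bimod_hom A B \<Longrightarrow> f \<in> add_hom A B"
  by (simp add: bimod_hom_def)

lemma alg_hom_bimod_hom: "f \<in> alg_hom A B \<Longrightarrow> f \<in> bimod_hom A B"
  by (auto simp: alg_hom_def bimod_hom_def add_hom_def)

lemma alg_hom_add_hom: "f \<in> alg_hom A B \<Longrightarrow> f \<in> add_hom A B"
  by (simp add: alg_hom_bimod_hom bimod_hom_add_hom)

lemma alg_hom_iff:
  "f \<in> alg_hom A B \<longleftrightarrow> f \<in> bimod_hom A B \<and>
    (\<forall>x\<in>carrier A. \<forall>y\<in>carrier A. f (x \<otimes>\<^bsub>A\<^esub> y) = f x \<otimes>\<^bsub>B\<^esub> f y)"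
  by (auto simp: alg_hom_def bimod_hom_def add_hom_def)

lemma bimod_hom_und_hom: "f \<in> bimod_hom A B \<Longrightarrow> f \<in> und_hom A B"
  by (auto simp: und_hom_def bimod_hom_def add_hom_def)

lemma alg_hom_und_hom: "f \<in> alg_hom A B \<Longrightarrow> f \<in> und_hom A B"
  by (simp add: alg_hom_bimod_hom bimod_hom_und_hom)

lemma add_hom_closed: "f \<in> add_hom A B \<Longrightarrow> x \<in> carrier A \<Longrightarrow> f x \<in> carrier B"
  by (auto simp: add_hom_def)

lemma add_hom_add: "f \<in> add_hom A B \<Longrightarrow> x \<in> carrier A \<Longrightarrow> y \<in> carrier A \<Longrightarrow> f (x \<oplus>\<^bsub>A\<^esub> y) = f x \<oplus>\<^bsub>B\<^esub> f y"
  by (auto simp: add_hom_def)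

lemma alg_hom_closed: "f \<in> alg_hom A B \<Longrightarrow> x \<in> carrier A \<Longrightarrow> f x \<in> carrier B"
  by (auto simp: alg_hom_def)

lemma alg_homD:
  assumes "f \<in> alg_hom A B" "x \<in> carrier A"
  shows "y \<in> carrier A \<Longrightarrow> f (x \<oplus>\<^bsub>A\<^esub> y) = f x \<oplus>\<^bsub>B\<^esub> f y"
    and "y \<in> carrier A \<Longrightarrow> f (x \<otimes>\<^bsub>A\<^esub> y) = f x \<otimes>\<^bsub>B\<^esub> f y"
    and "h \<in> carrier H \<Longrightarrow> f (lact A h x) = lact B h (f x)"
    and "h \<in> carrier H \<Longrightarrow> f (ract A x h) = ract B (f x) h"
  using assms by (auto simp: alg_hom_def)

lemma bimod_homD:
  assumes "f \<in> bimod_hom A B" "x \<in> carrier A"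
  shows "f x \<in> carrier B"
    and "y \<in> carrier A \<Longrightarrow> f (x \<oplus>\<^bsub>A\<^esub> y) = f x \<oplus>\<^bsub>B\<^esub> f y"
    and "h \<in> carrier H \<Longrightarrow> f (lact A h x) = lact B h (f x)"
    and "h \<in> carrier H \<Longrightarrow> f (ract A x h) = ract B (f x) h"
  using assms by (auto simp: bimod_hom_def add_hom_def)

lemma und_hom_closed: "f \<in> und_hom A B \<Longrightarrow> x \<in> carrier A \<Longrightarrow> f x \<in> carrier B"
  by (auto simp: und_hom_def)

lemma add_hom_zero:
  assumes "f \<in> add_hom A B" "is_algebra A" "is_algebra B"
  shows "f \<zero>\<^bsub>A\<^esub> = \<zero>\<^bsub>B\<^esub>"
  using add_hom_add[OF assms(1), of "\<zero>\<^bsub>A\<^esub>" "\<zero>\<^bsub>A\<^esub>"] add_hom_closed[OF assms(1)] assms(2-)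
  by (auto intro!: algebra_add_self_zero)

lemma add_hom_neg:
  assumes "f \<in> add_hom A B" "is_algebra A" "is_algebra B" "x \<in> carrier A"
  shows "f (\<ominus>\<^bsub>A\<^esub> x) = \<ominus>\<^bsub>B\<^esub> f x"
  using add_hom_add[OF assms(1), of x "\<ominus>\<^bsub>A\<^esub> x"] add_hom_closed[OF assms(1)] assms(2-)
  by (auto intro!: algebra_neg_unique simp: add_hom_zero[OF assms(1-3)])

lemma add_hom_diff:
  assumes "f \<in> add_hom A B" "is_algebra A" "is_algebra B" "x \<in> carrier A" "y \<in> carrier A"
  shows "f (x \<ominus>\<^bsub>A\<^esub> y) = f x \<ominus>\<^bsub>B\<^esub> f y"
  using assms by (simp add: algebra_diff add_hom_add add_hom_neg)

lemma add_hom_finsum: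
  assumes "f \<in> add_hom A B" "is_algebra A" "is_algebra B" "g \<in> I \<rightarrow> carrier A"
  shows "f (\<Oplus>\<^bsub>A\<^esub>i\<in>I. g i) = (\<Oplus>\<^bsub>B\<^esub>i\<in>I. f (g i))"
proof -
  interpret A: abelian_group A using assms(2) by (rule algebra_abelian_group)
  interpret B: abelian_group B using assms(3) by (rule algebra_abelian_group)
  show ?thesis using assms(4)
  proof (induction I rule: infinite_finite_induct)
    case (insert i I)
    then have "finsum A g I \<in> carrier A" by auto
    with insert show ?case
      using add_hom_closed[OF assms(1)] add_hom_add[OF assms(1)]
      by (subst A.finsum_insert; simp add: Pi_iff) 
  qed (simp_all add: add_hom_zero[OF assms(1-3)])
qed

lemma add_hom_comp: "f \<in> add_hom A B \<Longrightarrow> g \<in> add_hom B C \<Longrightarrow> g \<circ> f \<in> add_hom A C"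
  by (auto simp: add_hom_def Pi_iff)

lemma bimod_hom_comp: "f \<in> bimod_hom A B \<Longrightarrow> g \<in> bimod_hom B C \<Longrightarrow> g \<circ> f \<in> bimod_hom A C"
  by (auto simp: bimod_hom_def add_hom_def Pi_iff)

lemma alg_hom_comp: "f \<in> alg_hom A B \<Longrightarrow> g \<in> alg_hom B C \<Longrightarrow> g \<circ> f \<in> alg_hom A C"
  by (auto simp: alg_hom_def Pi_iff)

lemma und_hom_comp: "f \<in> und_hom A B \<Longrightarrow> g \<in> und_hom B C \<Longrightarrow> g \<circ> f \<in> und_hom A C"
  by (auto simp: und_hom_def Pi_iff)

lemma alg_hom_cong:
  assumes "f \<in> alg_hom A B" "\<And>x. x \<in> carrier A \<Longrightarrow> f x = g x" "is_algebra A"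
  shows "g \<in> alg_hom A B"
proof -
  have "g x \<in> carrier B" if "x \<in> carrier A" for x
    using assms(1,2) that alg_hom_closed by fastforce
  then show ?thesis using assms(1,3) by (simp add: alg_hom_def Pi_iff flip: assms(2))
qed

lemma alg_hom_corestrict:
  assumes X: "is_algebra X" and S: "is_algebra S" and f: "f \<in> alg_hom X E" and i: "\<iota> \<in> alg_hom S E" "inj_on \<iota> (carrier S)"
    and im: "\<And>x. x \<in> carrier X \<Longrightarrow> f x \<in> \<iota> ` carrier S"
  shows "(\<lambda>x. inv_into (carrier S) \<iota> (f x)) \<in> alg_hom X S"
proof -
  define g where "g = (\<lambda>x. inv_into (carrier S) \<iota> (f x))"
  have eq: "\<iota> (g x) = f x" if "x \<in> carrier X" for x unfolding g_def by (rule f_inv_into_f[OF im[OF that]])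
  have cl: "g x \<in> carrier S" if "x \<in> carrier X" for x unfolding g_def by (rule inv_into_into[OF im[OF that]])
  show ?thesis
    unfolding g_def[symmetric] alg_hom_def mem_Collect_eq
    by (intro conjI ballI funcsetI cl; (rule inj_onD[OF i(2)])?)
      (simp_all only: eq cl algebra_closed[OF X] algebra_closed[OF S] alg_homD[OF f] alg_homD[OF i(1)])
qed

lemma alg_hom_id: "id \<in> alg_hom A A" by (auto simp: alg_hom_def)

lemma zero_bimod_hom: "is_algebra B \<Longrightarrow> (\<lambda>_. \<zero>\<^bsub>B\<^esub>) \<in> bimod_hom A B"
  by (auto simp: bimod_hom_def add_hom_def)

lemma zero_alg_hom: "is_algebra B \<Longrightarrow> (\<lambda>_. \<zero>\<^bsub>B\<^esub>) \<in> alg_hom A B"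
  by (auto simp: alg_hom_def)

lemma und_hom_add:
  assumes "is_algebra B" "is_algebra A" "f \<in> und_hom A B" "g \<in> und_hom A B"
  shows "(\<lambda>x. f x \<oplus>\<^bsub>B\<^esub> g x) \<in> und_hom A B"
  using assms und_hom_closed[OF assms(3)] und_hom_closed[OF assms(4)]
  by (auto simp: und_hom_def Pi_iff algebra_ac algebra_lact_add algebra_ract_add)

lemma algebra_act_neg:
  assumes "is_algebra A" "h \<in> carrier H" "x \<in> carrier A"
  shows "lact A h (\<ominus>\<^bsub>A\<^esub> x) = \<ominus>\<^bsub>A\<^esub> lact A h x" "ract A (\<ominus>\<^bsub>A\<^esub> x) h = \<ominus>\<^bsub>A\<^esub> ract A x h"
  using assms by (auto intro!: algebra_neg_unique simp flip: algebra_lact_add algebra_ract_add)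

lemma neg_bimod_hom: "is_algebra A \<Longrightarrow> a_inv A \<in> bimod_hom A A"
  by (auto simp: bimod_hom_def add_hom_def algebra_neg_distrib algebra_act_neg)

lemma und_hom_diff:
  assumes "is_algebra B" "is_algebra A" "f \<in> und_hom A B" "g \<in> und_hom A B"
  shows "(\<lambda>x. f x \<ominus>\<^bsub>B\<^esub> g x) \<in> und_hom A B"
  unfolding algebra_diff
  using und_hom_comp[OF assms(4) bimod_hom_und_hom[OF neg_bimod_hom[OF assms(1)]]]
  by (intro und_hom_add assms) (simp add: comp_def)

text \<open>The axioms of algebras can be checked after applying a jointly injective family of maps to
  algebras that preserve the operations.\<close>

lemma is_algebra_jointly_injective:
  fixes B :: "('h, 'y) algebra" and C :: "'i \<Rightarrow> ('h, 'z) algebra"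
  assumes C: "\<And>i. i \<in> I \<Longrightarrow> is_algebra (C i)"
    and closed: "\<And>i x. i \<in> I \<Longrightarrow> x \<in> carrier B \<Longrightarrow> \<phi> i x \<in> carrier (C i)"
    and inj: "\<And>x y. x \<in> carrier B \<Longrightarrow> y \<in> carrier B \<Longrightarrow> (\<And>i. i \<in> I \<Longrightarrow> \<phi> i x = \<phi> i y) \<Longrightarrow> x = y"
    and B0: "\<zero>\<^bsub>B\<^esub> \<in> carrier B"
    and Ba: "\<And>x y. x \<in> carrier B \<Longrightarrow> y \<in> carrier B \<Longrightarrow> x \<oplus>\<^bsub>B\<^esub> y \<in> carrier B"
    and Bm: "\<And>x y. x \<in> carrier B \<Longrightarrow> y \<in> carrier B \<Longrightarrow> x \<otimes>\<^bsub>B\<^esub> y \<in> carrier B"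
    and Bl: "\<And>h x. h \<in> carrier H \<Longrightarrow> x \<in> carrier B \<Longrightarrow> lact B h x \<in> carrier B"
    and Br: "\<And>h x. h \<in> carrier H \<Longrightarrow> x \<in> carrier B \<Longrightarrow> ract B x h \<in> carrier B"
    and Bn: "\<And>x. x \<in> carrier B \<Longrightarrow> \<exists>y\<in>carrier B. \<forall>i\<in>I. \<phi> i y = \<ominus>\<^bsub>C i\<^esub> \<phi> i x"
    and p0: "\<And>i. i \<in> I \<Longrightarrow> \<phi> i \<zero>\<^bsub>B\<^esub> = \<zero>\<^bsub>C i\<^esub>"
    and pa: "\<And>i x y. i \<in> I \<Longrightarrow> x \<in> carrier B \<Longrightarrow> y \<in> carrier B \<Longrightarrow> \<phi> i (x \<oplus>\<^bsub>B\<^esub> y) = \<phi> i x \<oplus>\<^bsub>C i\<^esub> \<phi> i y"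
    and pm: "\<And>i x y. i \<in> I \<Longrightarrow> x \<in> carrier B \<Longrightarrow> y \<in> carrier B \<Longrightarrow> \<phi> i (x \<otimes>\<^bsub>B\<^esub> y) = \<phi> i x \<otimes>\<^bsub>C i\<^esub> \<phi> i y"
    and pl: "\<And>i h x. i \<in> I \<Longrightarrow> h \<in> carrier H \<Longrightarrow> x \<in> carrier B \<Longrightarrow> \<phi> i (lact B h x) = lact (C i) h (\<phi> i x)"
    and pr: "\<And>i h x. i \<in> I \<Longrightarrow> h \<in> carrier H \<Longrightarrow> x \<in> carrier B \<Longrightarrow> \<phi> i (ract B x h) = ract (C i) (\<phi> i x) h"
  shows "is_algebra B" and "\<And>i. i \<in> I \<Longrightarrow> \<phi> i \<in> alg_hom B (C i)"
proof -
  note [simp] = B0 Ba Bm Bl Br p0 pa pm pl pr C closed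
  have neg: "\<exists>y\<in>carrier B. y \<oplus>\<^bsub>B\<^esub> x = \<zero>\<^bsub>B\<^esub>" if x: "x \<in> carrier B" for x
  proof -
    obtain y where "y \<in> carrier B" "\<forall>i\<in>I. \<phi> i y = \<ominus>\<^bsub>C i\<^esub> \<phi> i x" using Bn x by blast
    with x show ?thesis by (intro bexI[of _ y] inj) auto
  qed
  have comm: "x \<oplus>\<^bsub>B\<^esub> y = y \<oplus>\<^bsub>B\<^esub> x" if "x \<in> carrier B" "y \<in> carrier B" for x y
    using that by (auto intro!: inj simp: algebra_add_comm[OF C closed closed])
  have cent: "lact B h x = ract B x h" if "central" "h \<in> carrier H" "x \<in> carrier B" for h x
    using that by (auto intro!: inj simp: algebra_central[OF C closed])
  show "is_algebra B"
    unfolding is_algebra_def by (intro conjI impI ballI abelian_groupI comm cent neg) (auto intro!: inj simp: algebra_add_assoc algebra_distrib_l algebra_distrib_r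
        algebra_mult_assoc algebra_lact_add algebra_ract_add algebra_lact_mult algebra_ract_mult
        algebra_balanced algebra_lact_one algebra_ract_one algebra_act_add algebra_act_mult
        algebra_lact_ract)
  show "\<phi> i \<in> alg_hom B (C i)" if "i \<in> I" for i
    using that by (auto simp: alg_hom_def)
qed

lemma sub_algebra:
  assumes "is_algebra A" "S \<subseteq> carrier A" "\<zero>\<^bsub>A\<^esub> \<in> S"
    "\<And>x y. x \<in> S \<Longrightarrow> y \<in> S \<Longrightarrow> x \<oplus>\<^bsub>A\<^esub> y \<in> S" "\<And>x. x \<in> S \<Longrightarrow> \<ominus>\<^bsub>A\<^esub> x \<in> S"
    "\<And>x y. x \<in> S \<Longrightarrow> y \<in> S \<Longrightarrow> x \<otimes>\<^bsub>A\<^esub> y \<in> S"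
    "\<And>h x. h \<in> carrier H \<Longrightarrow> x \<in> S \<Longrightarrow> lact A h x \<in> S"
    "\<And>h x. h \<in> carrier H \<Longrightarrow> x \<in> S \<Longrightarrow> ract A x h \<in> S"
  shows "is_algebra (A\<lparr>carrier := S\<rparr>)" and "id \<in> alg_hom (A\<lparr>carrier := S\<rparr>) A"
proof -
  have *: "is_algebra (A\<lparr>carrier := S\<rparr>) \<and> (\<forall>i\<in>{()}. id \<in> alg_hom (A\<lparr>carrier := S\<rparr>) A)"
    using is_algebra_jointly_injective[of "{()}" "\<lambda>_. A" "A\<lparr>carrier := S\<rparr>" "\<lambda>_. id"] assms
    by (fastforce dest: subsetD)
  show "is_algebra (A\<lparr>carrier := S\<rparr>)" and "id \<in> alg_hom (A\<lparr>carrier := S\<rparr>) A" using * by auto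
qed

lemma kernel_algebra:
  assumes "is_algebra A" "is_algebra C" "f \<in> alg_hom A C"
  defines "K \<equiv> A\<lparr>carrier := {x \<in> carrier A. f x = \<zero>\<^bsub>C\<^esub>}\<rparr>"
  shows "is_algebra K" and "id \<in> alg_hom K A"
  unfolding K_def
  by (rule sub_algebra; use assms add_hom_zero[OF alg_hom_add_hom] in
      \<open>auto simp: alg_homD add_hom_neg[OF alg_hom_add_hom]\<close>)+

text \<open>Operations are compared on the carrier of \<open>S\<close> only, since subalgebras such as polynomials with
  coefficients in \<open>J X\<close> are not carrier restrictions of the surrounding algebra.\<close>

definition subalg :: "('h, 'x) algebra \<Rightarrow> ('h, 'x) algebra \<Rightarrow> bool" where
  "subalg S E \<longleftrightarrow> is_algebra S \<and> is_algebra E \<and> id \<in> alg_hom S E"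

lemma subalg_carrier: "subalg S E \<Longrightarrow> x \<in> carrier S \<Longrightarrow> x \<in> carrier E"
  by (auto simp: subalg_def alg_hom_def)

lemma subalg_ops:
  assumes "subalg S E" "x \<in> carrier S"
  shows "y \<in> carrier S \<Longrightarrow> x \<oplus>\<^bsub>S\<^esub> y = x \<oplus>\<^bsub>E\<^esub> y"
    and "y \<in> carrier S \<Longrightarrow> x \<otimes>\<^bsub>S\<^esub> y = x \<otimes>\<^bsub>E\<^esub> y"
    and "h \<in> carrier H \<Longrightarrow> lact S h x = lact E h x"
    and "h \<in> carrier H \<Longrightarrow> ract S x h = ract E x h"
  using assms by (auto simp: subalg_def alg_hom_def)

lemma subalg_zero: "subalg S E \<Longrightarrow> \<zero>\<^bsub>S\<^esub> = \<zero>\<^bsub>E\<^esub>"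
  using add_hom_zero[OF alg_hom_add_hom, of id S E] by (auto simp: subalg_def)

lemma alg_hom_into_subalg:
  assumes "subalg S E" "f \<in> alg_hom X E" "\<And>x. x \<in> carrier X \<Longrightarrow> f x \<in> carrier S"
  shows "f \<in> alg_hom X S"
  using assms by (auto simp: alg_hom_def subalg_ops[OF assms(1)])

lemma und_hom_into_subalg:
  assumes "subalg S E" "f \<in> und_hom X E" "\<And>x. x \<in> carrier X \<Longrightarrow> f x \<in> carrier S"
  shows "f \<in> und_hom X S"
  using assms by (auto simp: und_hom_def subalg_ops[OF assms(1)])

lemma subalg_alg_hom: "subalg S E \<Longrightarrow> f \<in> alg_hom X S \<Longrightarrow> f \<in> alg_hom X E"
  using alg_hom_comp[of f X S id E] by (simp add: subalg_def)

lemma alg_hom_restrict: "subalg S E \<Longrightarrow> f \<in> alg_hom E X \<Longrightarrow> f \<in> alg_hom S X"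
  using alg_hom_comp[of id S E f X] by (simp add: subalg_def)

lemma subalg_trans: "subalg A B \<Longrightarrow> subalg B C \<Longrightarrow> subalg A C"
  using alg_hom_comp[of id A B id C] by (simp add: subalg_def)

lemma kernel_subalg:
  assumes "is_algebra A" "is_algebra C" "f \<in> alg_hom A C"
  shows "subalg (A\<lparr>carrier := {x \<in> carrier A. f x = \<zero>\<^bsub>C\<^esub>}\<rparr>) A"
  using kernel_algebra[OF assms] assms(1) by (simp add: subalg_def)

abbreviation zmul :: "('h, 'x) algebra \<Rightarrow> int \<Rightarrow> 'x \<Rightarrow> 'x" where
  "zmul A n x \<equiv> add_pow A n x"

lemma zmul_simps [simp]:
  assumes "is_algebra A" "x \<in> carrier A"
  shows "zmul A n x \<in> carrier A" "zmul A 0 x = \<zero>\<^bsub>A\<^esub>" "zmul A 1 x = x" "zmul A n \<zero>\<^bsub>A\<^esub> = \<zero>\<^bsub>A\<^esub>"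
proof -
  interpret abelian_group A using assms(1) by (rule algebra_abelian_group)
  show "zmul A n x \<in> carrier A" "zmul A 0 x = \<zero>\<^bsub>A\<^esub>" "zmul A 1 x = x"
    using assms(2) add.int_pow_1 add.int_pow_closed by (auto simp: add_pow_def)
  show "zmul A n \<zero>\<^bsub>A\<^esub> = \<zero>\<^bsub>A\<^esub>" by simp
qed

lemma zmul_zero [simp]: "is_algebra A \<Longrightarrow> zmul A n \<zero>\<^bsub>A\<^esub> = \<zero>\<^bsub>A\<^esub>"
  by (rule zmul_simps(4)[OF _ algebra_closed(1)])

lemma zmul_add:
  assumes "is_algebra A" "x \<in> carrier A"
  shows "zmul A (m + n) x = zmul A m x \<oplus>\<^bsub>A\<^esub> zmul A n x"
proof -
  interpret abelian_group A using assms(1) by (rule algebra_abelian_group)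
  show ?thesis using assms(2) by (rule add.int_pow_mult)
qed

lemma zmul_neg:
  assumes "is_algebra A" "x \<in> carrier A"
  shows "zmul A (- n) x = \<ominus>\<^bsub>A\<^esub> zmul A n x"
proof -
  interpret abelian_group A using assms(1) by (rule algebra_abelian_group)
  show ?thesis using assms(2) by (rule add.int_pow_neg)
qed

lemma add_hom_zmul:
  assumes "f \<in> add_hom A B" "is_algebra A" "is_algebra B" "x \<in> carrier A"
  shows "f (zmul A n x) = zmul B n (f x)"
proof (induction n rule: int_induct[where k = 0])
  case base
  show ?case using assms add_hom_zero[OF assms(1-3)] add_hom_closed[OF assms(1,4)] by simp
next
  case (step1 i)
  then show ?case using assms add_hom_closed[OF assms(1,4)] by (simp add: zmul_add add_hom_add)
next
  case (step2 i)
  have "f (zmul A (i + - 1) x) = zmul B (i + - 1) (f x)"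
    using assms add_hom_closed[OF assms(1,4)] step2
    by (simp only: zmul_add zmul_neg add_hom_add[OF assms(1)] add_hom_neg[OF assms(1)] zmul_simps algebra_closed)
  then show ?case by simp
qed

lemma zmul_add_right:
  assumes "is_algebra A" "x \<in> carrier A" "y \<in> carrier A"
  shows "zmul A n (x \<oplus>\<^bsub>A\<^esub> y) = zmul A n x \<oplus>\<^bsub>A\<^esub> zmul A n y"
proof -
  interpret abelian_group A using assms(1) by (rule algebra_abelian_group)
  show ?thesis using assms(2,3) by (rule add.int_pow_distrib)
qed

lemma zmul_add_hom: "is_algebra A \<Longrightarrow> zmul A n \<in> add_hom A A"
  by (auto simp: add_hom_def zmul_add_right)

lemma zmul_mult:
  assumes "is_algebra A" "x \<in> carrier A"
  shows "zmul A (m * n) x = zmul A m (zmul A n x)"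
proof -
  interpret abelian_group A using assms(1) by (rule algebra_abelian_group)
  show ?thesis using assms(2) by (metis add.int_pow_pow mult.commute)
qed

lemma zmul_bimod_hom:
  assumes "is_algebra A" shows "zmul A n \<in> bimod_hom A A"
proof -
  have "lact A h \<in> add_hom A A" "(\<lambda>x. ract A x h) \<in> add_hom A A" if "h \<in> carrier H" for h
    using assms that by (auto simp: add_hom_def algebra_lact_add algebra_ract_add)
  then show ?thesis using assms zmul_add_hom[OF assms] add_hom_zmul[OF _ assms assms] unfolding bimod_hom_def
    by fastforce
qed

lemma zmul_tensor:
  assumes "is_algebra A" "x \<in> carrier A" "y \<in> carrier A"
  shows "zmul A n x \<otimes>\<^bsub>A\<^esub> y = zmul A n (x \<otimes>\<^bsub>A\<^esub> y)" "x \<otimes>\<^bsub>A\<^esub> zmul A n y = zmul A n (x \<otimes>\<^bsub>A\<^esub> y)"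
proof -
  have "(\<lambda>x. x \<otimes>\<^bsub>A\<^esub> y) \<in> add_hom A A" "(\<lambda>y. x \<otimes>\<^bsub>A\<^esub> y) \<in> add_hom A A"
    using assms by (auto simp: add_hom_def algebra_distrib_l algebra_distrib_r)
  then show "zmul A n x \<otimes>\<^bsub>A\<^esub> y = zmul A n (x \<otimes>\<^bsub>A\<^esub> y)" "x \<otimes>\<^bsub>A\<^esub> zmul A n y = zmul A n (x \<otimes>\<^bsub>A\<^esub> y)"
    using add_hom_zmul assms by fastforce+
qed

end

section \<open>Free algebras and classifying maps\<close>

lemma rep_rel: "R x x \<Longrightarrow> R x (rep R x)"
  unfolding rep_def by (rule someI)

lemma rep_eq:
  assumes "\<And>x y. R x y \<Longrightarrow> R y x" "\<And>x y z. R x y \<Longrightarrow> R y z \<Longrightarrow> R x z" "R x y"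
  shows "rep R x = rep R y"
proof -
  have "R x = R y" using assms by blast
  then show ?thesis by (simp add: rep_def)
qed

context kk_setting
begin

lemma und_hom_act:
  assumes "f \<in> und_hom A B" "und = Bimodules" "x \<in> carrier A" "h \<in> carrier H"
  shows "f (lact A h x) = lact B h (f x)" "f (ract A x h) = ract B (f x) h"
  using assms unfolding und_hom_def by blast+

lemma terms_simps [simp]:
  "Gen x \<in> terms A \<longleftrightarrow> x \<in> carrier A" "Zero \<in> terms A"
  "Add s t \<in> terms A \<longleftrightarrow> s \<in> terms A \<and> t \<in> terms A" "Neg s \<in> terms A \<longleftrightarrow> s \<in> terms A"
  "Mul s t \<in> terms A \<longleftrightarrow> s \<in> terms A \<and> t \<in> terms A"
  "LAct h s \<in> terms A \<longleftrightarrow> h \<in> carrier H \<and> s \<in> terms A"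
  "RAct s h \<in> terms A \<longleftrightarrow> h \<in> carrier H \<and> s \<in> terms A"
  by (auto simp: terms_def)

lemma terms_induct [consumes 1, case_names Gen Zero Add Neg Mul LAct RAct]:
  assumes "t \<in> terms A" "\<And>x. x \<in> carrier A \<Longrightarrow> P (Gen x)" "P Zero"
    "\<And>s t. s \<in> terms A \<Longrightarrow> t \<in> terms A \<Longrightarrow> P s \<Longrightarrow> P t \<Longrightarrow> P (Add s t)"
    "\<And>s. s \<in> terms A \<Longrightarrow> P s \<Longrightarrow> P (Neg s)"
    "\<And>s t. s \<in> terms A \<Longrightarrow> t \<in> terms A \<Longrightarrow> P s \<Longrightarrow> P t \<Longrightarrow> P (Mul s t)"
    "\<And>h s. h \<in> carrier H \<Longrightarrow> s \<in> terms A \<Longrightarrow> P s \<Longrightarrow> P (LAct h s)"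
    "\<And>h s. h \<in> carrier H \<Longrightarrow> s \<in> terms A \<Longrightarrow> P s \<Longrightarrow> P (RAct s h)"
  shows "P t"
  using assms(1) by (induction t) (use assms(2-) in auto)

definition cls :: "('h, 'a) ualg \<Rightarrow> ('h, ('h, 'a) univ) tm \<Rightarrow> ('h, 'a) univ" where
  "cls A t = rep (T_rel A) (Expr t)"

lemma cls_expr:
  assumes "t \<in> terms A" shows "\<exists>t'. cls A t = Expr t' \<and> tm_eq A t t'"
proof -
  have "T_rel A (Expr t) (Expr t)" using assms tm_eq.refl by (auto simp: T_rel_def)
  from rep_rel[of "T_rel A", OF this] show ?thesis by (auto simp: T_rel_def cls_def)
qed

lemma cls_eqI: "tm_eq A s t \<Longrightarrow> cls A s = cls A t"
  unfolding cls_def by (rule rep_eq) (auto simp: T_rel_def intro: tm_eq.sym tm_eq.trans)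

lemma T_carrier: "carrier (T A) = cls A ` terms A"
  by (auto simp: T_def quot_alg_def expr_alg_def cls_def)

lemma T_carrierE:
  assumes "x \<in> carrier (T A)" obtains t where "t \<in> terms A" "x = cls A t"
  using assms by (auto simp: T_carrier)

lemma T_ops:
  shows "\<zero>\<^bsub>T A\<^esub> = cls A Zero"
    and "s \<in> terms A \<Longrightarrow> t \<in> terms A \<Longrightarrow> cls A s \<oplus>\<^bsub>T A\<^esub> cls A t = cls A (Add s t)"
    and "s \<in> terms A \<Longrightarrow> t \<in> terms A \<Longrightarrow> cls A s \<otimes>\<^bsub>T A\<^esub> cls A t = cls A (Mul s t)"
    and "h \<in> carrier H \<Longrightarrow> s \<in> terms A \<Longrightarrow> lact (T A) h (cls A s) = cls A (LAct h s)"
    and "h \<in> carrier H \<Longrightarrow> s \<in> terms A \<Longrightarrow> ract (T A) (cls A s) h = cls A (RAct s h)"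
proof -
  show "\<zero>\<^bsub>T A\<^esub> = cls A Zero" by (simp add: T_def quot_alg_def expr_alg_def cls_def)
  { assume s: "s \<in> terms A"
    then obtain s' where s': "cls A s = Expr s'" "tm_eq A s s'" using cls_expr by blast
    show "lact (T A) h (cls A s) = cls A (LAct h s)" "ract (T A) (cls A s) h = cls A (RAct s h)"
      if "h \<in> carrier H"
      using s' that by (auto simp: T_def quot_alg_def expr_alg_def simp flip: cls_def
          intro: cls_eqI tm_eq.intros)
    assume t: "t \<in> terms A"
    then obtain t' where t': "cls A t = Expr t'" "tm_eq A t t'" using cls_expr by blast
    show "cls A s \<oplus>\<^bsub>T A\<^esub> cls A t = cls A (Add s t)" "cls A s \<otimes>\<^bsub>T A\<^esub> cls A t = cls A (Mul s t)"
      using s' t' by (auto simp: T_def quot_alg_def expr_alg_def simp flip: cls_def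
          intro: cls_eqI tm_eq.cong_Add tm_eq.cong_Mul tm_eq.sym) }
qed

lemma cls_closed [simp]: "t \<in> terms A \<Longrightarrow> cls A t \<in> carrier (T A)"
  by (simp add: T_carrier)

lemma T_algebra: "is_algebra (T A)"
proof -
  have neg: "\<exists>y\<in>carrier (T A). y \<oplus>\<^bsub>T A\<^esub> x = \<zero>\<^bsub>T A\<^esub>" if x: "x \<in> carrier (T A)" for x
  proof -
    obtain t where t: "t \<in> terms A" "x = cls A t" using x by (rule T_carrierE)
    then show ?thesis by (intro bexI[of _ "cls A (Neg t)"])
        (auto simp: T_carrier T_ops intro!: cls_eqI intro: tm_eq.trans[OF tm_eq.add_comm tm_eq.add_neg])
  qed
  have zero_add: "tm_eq A (Add Zero s) s" if "s \<in> terms A" for s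
    by (rule tm_eq.trans[OF tm_eq.add_comm tm_eq.add_zero]) (use that in auto)
  have cent: "lact (T A) h x = ract (T A) x h" if c: "central" and h: "h \<in> carrier H" and x: "x \<in> carrier (T A)" for h x
  proof -
    obtain t where t: "t \<in> terms A" "x = cls A t" using x by (rule T_carrierE)
    show ?thesis unfolding t(2) T_ops(4)[OF h t(1)] T_ops(5)[OF h t(1)]
      by (rule cls_eqI, rule tm_eq.central[OF c t(1) h])
  qed
  show ?thesis
  unfolding is_algebra_def by (intro conjI impI ballI abelian_groupI neg cent)
    (auto simp: T_carrier T_ops intro!: cls_eqI
      intro: tm_eq.add_assoc tm_eq.add_comm tm_eq.mul_assoc tm_eq.distrib_l tm_eq.distrib_r
        tm_eq.lact_one tm_eq.ract_one tm_eq.lact_mult tm_eq.ract_mult tm_eq.lact_add tm_eq.ract_add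
        tm_eq.add_lact tm_eq.add_ract tm_eq.lact_ract tm_eq.lact_mul tm_eq.ract_mul tm_eq.mul_balanced
        zero_add)
qed

lemma eval_closed:
  assumes "is_algebra B" "s \<in> carrier A \<rightarrow> carrier B" "t \<in> terms A"
  shows "eval_tm B s t \<in> carrier B"
  using assms(3) by (induction rule: terms_induct) (use assms in auto)

lemma eval_tm_eq:
  assumes B: "is_algebra B" and s: "s \<in> und_hom A B" and eq: "tm_eq A t u"
    and A: "is_algebra A"
  shows "eval_tm B s t = eval_tm B s u"
proof -
  have E: "eval_tm B s v \<in> carrier B" if "v \<in> terms A" for v
    using eval_closed[OF B _ that] s by (auto simp: und_hom_def)
  have sc: "x \<in> carrier A \<Longrightarrow> s x \<in> carrier B" for x using s by (rule und_hom_closed)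
  note [simp] = E B sc
  show ?thesis using eq
  proof induction
    case (add_comm s t) then show ?case by (simp add: algebra_add_comm)
  next
    case (central s h) then show ?case by (simp only: eval_tm.simps) (intro algebra_central B E)
  next
    case (add_assoc s t u) then show ?case by (simp add: algebra_add_assoc)
  next
    case (gen_add x y) then show ?case using s by (simp add: und_hom_def)
  next
    case (gen_lact x h) then show ?case by (simp only: eval_tm.simps und_hom_act(1)[OF s])
  next
    case (gen_ract x h) then show ?case by (simp only: eval_tm.simps und_hom_act(2)[OF s])
  qed (simp_all add: algebra_mult_assoc algebra_distrib_l
        algebra_distrib_r algebra_lact_one algebra_ract_one algebra_act_add algebra_act_mult
        algebra_lact_add algebra_ract_add algebra_lact_ract algebra_lact_mult algebra_ract_mult
        algebra_balanced)
qed

lemma T_lift_cls: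
  assumes "is_algebra B" "s \<in> und_hom A B" "is_algebra A" "t \<in> terms A"
  shows "T_lift B s (cls A t) = eval_tm B s t"
proof -
  obtain t' where t': "cls A t = Expr t'" "tm_eq A t t'" using cls_expr assms(4) by blast
  show ?thesis using eval_tm_eq[OF assms(1,2) t'(2) assms(3)] t'(1) by (simp add: T_lift_def)
qed

lemma T_lift_hom:
  assumes "is_algebra B" "s \<in> und_hom A B" "is_algebra A"
  shows "T_lift B s \<in> alg_hom (T A) B"
proof -
  have "eval_tm B s t \<in> carrier B" if "t \<in> terms A" for t
    using eval_closed[OF assms(1) _ that] assms(2) by (auto simp: und_hom_def)
  then show ?thesis
    by (auto simp: alg_hom_def T_carrier T_ops T_lift_cls[OF assms])
qed

lemma T_unit_cls: "T_unit A a = cls A (Gen a)"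
  by (simp add: T_unit_def cls_def)

lemma T_unit_und_hom: "T_unit A \<in> und_hom A (T A)"
proof -
  have "T_unit A (lact A h a) = lact (T A) h (T_unit A a) \<and> T_unit A (ract A a h) = ract (T A) (T_unit A a) h"
    if "und = Bimodules" "a \<in> carrier A" "h \<in> carrier H" for a h
  proof -
    have g: "Gen a \<in> terms A" using that by simp
    show ?thesis
      unfolding T_unit_cls T_ops(4)[OF that(3) g] T_ops(5)[OF that(3) g]
      using cls_eqI[OF tm_eq.gen_lact[OF that]] cls_eqI[OF tm_eq.gen_ract[OF that]] by blast
  qed
  moreover have "T_unit A (a \<oplus>\<^bsub>A\<^esub> b) = T_unit A a \<oplus>\<^bsub>T A\<^esub> T_unit A b"
    if "und \<noteq> Sets" "a \<in> carrier A" "b \<in> carrier A" for a b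
    using that by (auto simp: T_unit_cls T_ops intro!: cls_eqI intro: tm_eq.gen_add)
  ultimately show ?thesis unfolding und_hom_def by (simp add: T_unit_cls)
qed

lemma T_unit_closed [simp]: "a \<in> carrier A \<Longrightarrow> T_unit A a \<in> carrier (T A)"
  by (rule und_hom_closed[OF T_unit_und_hom])

lemma T_lift_unit:
  "is_algebra B \<Longrightarrow> s \<in> und_hom A B \<Longrightarrow> is_algebra A \<Longrightarrow> a \<in> carrier A \<Longrightarrow> T_lift B s (T_unit A a) = s a"
  by (simp add: T_unit_cls T_lift_cls)

lemma T_induct [consumes 1, case_names unit zero add neg mult lact ract]:
  assumes "x \<in> carrier (T A)" "\<And>a. a \<in> carrier A \<Longrightarrow> P (T_unit A a)" "P \<zero>\<^bsub>T A\<^esub>"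
    "\<And>x y. x \<in> carrier (T A) \<Longrightarrow> y \<in> carrier (T A) \<Longrightarrow> P x \<Longrightarrow> P y \<Longrightarrow> P (x \<oplus>\<^bsub>T A\<^esub> y)"
    "\<And>x. x \<in> carrier (T A) \<Longrightarrow> P x \<Longrightarrow> P (\<ominus>\<^bsub>T A\<^esub> x)"
    "\<And>x y. x \<in> carrier (T A) \<Longrightarrow> y \<in> carrier (T A) \<Longrightarrow> P x \<Longrightarrow> P y \<Longrightarrow> P (x \<otimes>\<^bsub>T A\<^esub> y)"
    "\<And>h x. h \<in> carrier H \<Longrightarrow> x \<in> carrier (T A) \<Longrightarrow> P x \<Longrightarrow> P (lact (T A) h x)"
    "\<And>h x. h \<in> carrier H \<Longrightarrow> x \<in> carrier (T A) \<Longrightarrow> P x \<Longrightarrow> P (ract (T A) x h)"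
  shows "P x"
proof -
  have "P (cls A t)" if "t \<in> terms A" for t
    using that
  proof (induction rule: terms_induct)
    case (Neg t)
    have "cls A (Neg t) = \<ominus>\<^bsub>T A\<^esub> cls A t"
      by (rule algebra_neg_unique[OF T_algebra])
        (use Neg in \<open>auto simp: T_carrier T_ops intro!: cls_eqI tm_eq.add_neg\<close>)
    then show ?case using Neg assms(5)[of "cls A t"] by (simp add: T_carrier)
  qed (use assms(2-4,6-8) in \<open>simp_all add: T_carrier T_unit_cls T_ops flip: T_ops(2-5)\<close>)
  then show ?thesis using assms(1) by (auto simp: T_carrier)
qed

lemma T_hom_eqI:
  assumes "is_algebra B" "f \<in> alg_hom (T A) B" "g \<in> alg_hom (T A) B"
    "\<And>a. a \<in> carrier A \<Longrightarrow> f (T_unit A a) = g (T_unit A a)" "x \<in> carrier (T A)"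
  shows "f x = g x"
proof -
  have z: "f \<zero>\<^bsub>T A\<^esub> = \<zero>\<^bsub>B\<^esub>" "g \<zero>\<^bsub>T A\<^esub> = \<zero>\<^bsub>B\<^esub>"
    using assms(2,3) by (auto intro!: add_hom_zero alg_hom_add_hom T_algebra assms(1))
  have n: "f (\<ominus>\<^bsub>T A\<^esub> x) = \<ominus>\<^bsub>B\<^esub> f x" "g (\<ominus>\<^bsub>T A\<^esub> x) = \<ominus>\<^bsub>B\<^esub> g x" if "x \<in> carrier (T A)" for x
    using assms(2,3) that by (auto intro!: add_hom_neg alg_hom_add_hom T_algebra assms(1))
  show ?thesis using assms(5)
    by (induction rule: T_induct)
      (simp_all add: assms(4) z n alg_homD[OF assms(2)] alg_homD[OF assms(3)])
qed

lemma T_lift_natural: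
  fixes E F :: "('h, 'a) ualg"
  assumes "is_algebra A" "is_algebra E" "is_algebra F" "y \<in> und_hom A E" "\<psi> \<in> alg_hom E F" "x \<in> carrier (T A)"
  shows "\<psi> (T_lift E y x) = T_lift F (\<psi> \<circ> y) x"
proof -
  have c: "\<psi> \<circ> y \<in> und_hom A F" using assms(4) alg_hom_und_hom[OF assms(5)] by (rule und_hom_comp)
  have "(\<psi> \<circ> T_lift E y) x = T_lift F (\<psi> \<circ> y) x"
    using assms(3) alg_hom_comp[OF T_lift_hom[OF assms(2,4,1)] assms(5)] T_lift_hom[OF assms(3) c assms(1)] _ assms(6)
    by (rule T_hom_eqI) (simp add: T_lift_unit assms c)
  then show ?thesis by simp
qed

lemma T_lift_eqI:
  assumes "is_algebra A" "is_algebra E" "y \<in> und_hom A E" "f \<in> alg_hom (T A) E"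
    "\<And>a. a \<in> carrier A \<Longrightarrow> f (T_unit A a) = y a" "x \<in> carrier (T A)"
  shows "f x = T_lift E y x"
  by (rule T_hom_eqI[OF assms(2,4) T_lift_hom[OF assms(2,3,1)] _ assms(6)])
    (simp add: assms T_lift_unit)

lemma T_lift_cong:
  assumes "is_algebra A" "is_algebra E" "y \<in> und_hom A E" "z \<in> und_hom A E"
    "\<And>a. a \<in> carrier A \<Longrightarrow> z a = y a" "x \<in> carrier (T A)"
  shows "T_lift E z x = T_lift E y x"
  using assms by (intro T_lift_eqI T_lift_hom) (auto simp: T_lift_unit)

lemma counit_hom: "is_algebra A \<Longrightarrow> counit A \<in> alg_hom (T A) A"
  unfolding counit_def by (intro T_lift_hom alg_hom_und_hom alg_hom_id)

lemma counit_unit: "is_algebra A \<Longrightarrow> a \<in> carrier A \<Longrightarrow> counit A (T_unit A a) = a"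
  unfolding counit_def by (simp add: T_lift_unit alg_hom_und_hom alg_hom_id)

lemma T_lift_of_hom:
  assumes "is_algebra A" "is_algebra B" "y \<in> alg_hom A B" "x \<in> carrier (T A)"
  shows "T_lift B y x = y (counit A x)"
  using T_lift_eqI[OF assms(1,2) alg_hom_und_hom[OF assms(3)] alg_hom_comp[OF counit_hom assms(3)] _ assms(4)] assms(1)
  by (simp add: counit_unit)

lemma J_subalg: "is_algebra A \<Longrightarrow> subalg (J A) (T A)"
  unfolding J_def by (intro kernel_subalg T_algebra counit_hom)

lemma J_algebra: "is_algebra A \<Longrightarrow> is_algebra (J A)"
  using J_subalg unfolding subalg_def by blast

lemma J_pow_algebra: "is_algebra A \<Longrightarrow> is_algebra ((J ^^ n) A)"
  by (induction n) (auto intro: J_algebra)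

lemma J_carrier: "x \<in> carrier (J A) \<longleftrightarrow> x \<in> carrier (T A) \<and> counit A x = \<zero>\<^bsub>A\<^esub>"
  by (simp add: J_def)

text \<open>Where the composite of \<open>y\<close> with \<open>\<phi>\<close> is multiplicative, the induced map on \<open>J\<close> vanishes. All
  homotopies below are built from this observation: a map out of \<open>J\<close> is prescribed on generators,
  and a boundary condition holds as soon as the prescription becomes a homomorphism there.\<close>

lemma T_lift_kernel:
  fixes E F :: "('h, 'a) ualg"
  assumes "is_algebra X" "is_algebra E" "is_algebra F" "y \<in> und_hom X E" "\<phi> \<in> alg_hom E F"
    "g \<in> alg_hom X F" "\<And>a. a \<in> carrier X \<Longrightarrow> \<phi> (y a) = g a" "x \<in> carrier (J X)"
  shows "\<phi> (T_lift E y x) = \<zero>\<^bsub>F\<^esub>"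
proof -
  have x: "x \<in> carrier (T X)" "counit X x = \<zero>\<^bsub>X\<^esub>" using assms(8) by (auto simp: J_carrier)
  have "\<phi> (T_lift E y x) = T_lift F (\<phi> \<circ> y) x"
    using assms x by (intro T_lift_natural)
  also have "\<dots> = T_lift F g x"
    by (rule T_lift_cong[OF assms(1,3) alg_hom_und_hom[OF assms(6)]
        und_hom_comp[OF assms(4) alg_hom_und_hom[OF assms(5)]] _ x(1)]) (simp add: assms(7))
  also have "\<dots> = g (counit X x)"
    using assms x by (intro T_lift_of_hom)
  also have "\<dots> = \<zero>\<^bsub>F\<^esub>"
    using x add_hom_zero[OF alg_hom_add_hom[OF assms(6)] assms(1,3)] by simp
  finally show ?thesis .
qed

lemma J_map_T_hom:
  assumes "is_algebra A" "f \<in> und_hom A B" shows "J_map B f \<in> alg_hom (T A) (T B)"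
  unfolding J_map_def using assms by (intro T_lift_hom T_algebra und_hom_comp[OF _ T_unit_und_hom])

lemma J_map_unit:
  assumes "is_algebra A" "f \<in> und_hom A B" "a \<in> carrier A" shows "J_map B f (T_unit A a) = T_unit B (f a)"
  unfolding J_map_def using assms by (subst T_lift_unit) (auto intro: T_algebra und_hom_comp T_unit_und_hom)

lemma T_lift_J_map:
  assumes "is_algebra A" "is_algebra B" "is_algebra C" "f \<in> und_hom A B" "s \<in> und_hom B C" "x \<in> carrier (T A)"
  shows "T_lift C s (J_map B f x) = T_lift C (s \<circ> f) x"
proof -
  have "(T_lift C s \<circ> J_map B f) x = T_lift C (s \<circ> f) x"
    using assms by (intro T_lift_eqI und_hom_comp[OF assms(4,5)] alg_hom_comp[OF J_map_T_hom T_lift_hom])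
      (auto simp: J_map_unit T_lift_unit und_hom_closed intro: und_hom_comp[OF assms(4,5), unfolded comp_def])
  then show ?thesis by simp
qed

lemma counit_J_map:
  assumes "is_algebra A" "is_algebra B" "f \<in> alg_hom A B" "x \<in> carrier (T A)"
  shows "counit B (J_map B f x) = f (counit A x)"
  using T_lift_J_map[OF assms(1,2,2) alg_hom_und_hom[OF assms(3)] alg_hom_und_hom[OF alg_hom_id] assms(4)]
    T_lift_of_hom[OF assms] by (simp add: counit_def)

lemma J_map_hom:
  assumes "is_algebra A" "is_algebra B" "f \<in> alg_hom A B"
  shows "J_map B f \<in> alg_hom (J A) (J B)"
proof (rule alg_hom_into_subalg[OF J_subalg[OF assms(2)]])
  show h: "J_map B f \<in> alg_hom (J A) (T B)"
    using alg_hom_restrict[OF J_subalg J_map_T_hom] assms alg_hom_und_hom by blast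
  show "J_map B f x \<in> carrier (J B)" if "x \<in> carrier (J A)" for x
    using that alg_hom_closed[OF h that] counit_J_map[OF assms] add_hom_zero[OF alg_hom_add_hom[OF assms(3)] assms(1,2)]
    by (simp add: J_carrier)
qed

lemma J_map_comp:
  assumes "is_algebra A" "is_algebra B" "is_algebra C" "f \<in> und_hom A B" "g \<in> und_hom B C" "x \<in> carrier (T A)"
  shows "J_map C g (J_map B f x) = J_map C (g \<circ> f) x"
proof -
  have u: "T_unit C \<circ> g \<in> und_hom B (T C)" using assms(5) T_unit_und_hom by (rule und_hom_comp)
  show ?thesis
    using T_lift_J_map[OF assms(1,2) T_algebra[of C] assms(4) u assms(6)]
    by (simp add: J_map_def[of C] comp_assoc)
qed

text \<open>After \<open>g\<close>, the section becomes the identity, a homomorphism; so \<open>T_lift_kernel\<close> sends \<open>J C\<close> into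
  the kernel of \<open>g\<close>.\<close>

lemma classifying_map:
  assumes A: "is_algebra A" and B: "is_algebra B" and C: "is_algebra C"
    and f: "f \<in> alg_hom A B" "inj_on f (carrier A)" and g: "g \<in> alg_hom B C"
    and ker: "\<And>b. b \<in> carrier B \<Longrightarrow> g b = \<zero>\<^bsub>C\<^esub> \<Longrightarrow> b \<in> f ` carrier A"
    and s: "s \<in> sections B C g"
  shows "x \<in> carrier (J C) \<Longrightarrow> f (classifying_map A f B s x) = T_lift B s x"
    and "classifying_map A f B s \<in> alg_hom (J C) A"
proof -
  have su: "s \<in> und_hom C B" and gs: "\<And>c. c \<in> carrier C \<Longrightarrow> g (s c) = c"
    using s by (auto simp: sections_def)
  have h: "T_lift B s \<in> alg_hom (J C) B"
    by (rule alg_hom_restrict[OF J_subalg[OF C] T_lift_hom[OF B su C]])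
  have im: "T_lift B s x \<in> f ` carrier A" if "x \<in> carrier (J C)" for x
    using T_lift_kernel[OF C B C su g alg_hom_id _ that] gs alg_hom_closed[OF h that] by (auto intro: ker)
  show "x \<in> carrier (J C) \<Longrightarrow> f (classifying_map A f B s x) = T_lift B s x"
    unfolding classifying_map_def by (rule f_inv_into_f[OF im])
  show "classifying_map A f B s \<in> alg_hom (J C) A"
    using alg_hom_corestrict[OF J_algebra[OF C] A h f im] unfolding classifying_map_def[abs_def] .
qed

end

section \<open>Finitely supported functions with a partial convolution product\<close>

context kk_setting
begin

text \<open>Polynomials over \<open>A\<close> and finite matrices over \<open>A\<close> are both algebras of finitely supported
  functions on a set of indices with a partially defined associative operation (addition of
  exponents, composition of matrix units). Their axioms are verified here at once.\<close>

definition fsa :: "('i \<Rightarrow> 'i \<Rightarrow> 'i option) \<Rightarrow> ('h, 'x) algebra \<Rightarrow> ('h, 'i \<Rightarrow> 'x) algebra" where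
  "fsa opr A =
    \<lparr>carrier = {x. range x \<subseteq> carrier A \<and> finite {i. x i \<noteq> \<zero>\<^bsub>A\<^esub>}},
     mult = (\<lambda>x y e. \<Oplus>\<^bsub>A\<^esub>p\<in>{p \<in> {i. x i \<noteq> \<zero>\<^bsub>A\<^esub>} \<times> {i. y i \<noteq> \<zero>\<^bsub>A\<^esub>}. opr (fst p) (snd p) = Some e}.
       x (fst p) \<otimes>\<^bsub>A\<^esub> y (snd p)),
     one = undefined, zero = (\<lambda>_. \<zero>\<^bsub>A\<^esub>), add = (\<lambda>x y i. x i \<oplus>\<^bsub>A\<^esub> y i),
     lact = (\<lambda>h x i. lact A h (x i)), ract = (\<lambda>x h i. ract A (x i) h)\<rparr>"

definition fmono :: "('h, 'x) algebra \<Rightarrow> 'i \<Rightarrow> 'x \<Rightarrow> 'i \<Rightarrow> 'x" where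
  "fmono A i a = (\<lambda>j. if j = i then a else \<zero>\<^bsub>A\<^esub>)"

definition opr_assoc :: "('i \<Rightarrow> 'i \<Rightarrow> 'i option) \<Rightarrow> bool" where
  "opr_assoc opr \<longleftrightarrow> (\<forall>i j k. (case opr i j of None \<Rightarrow> None | Some e \<Rightarrow> opr e k) =
     (case opr j k of None \<Rightarrow> None | Some e \<Rightarrow> opr i e))"

lemma fsa_simps:
  "\<zero>\<^bsub>fsa opr A\<^esub> = (\<lambda>_. \<zero>\<^bsub>A\<^esub>)" "x \<oplus>\<^bsub>fsa opr A\<^esub> y = (\<lambda>i. x i \<oplus>\<^bsub>A\<^esub> y i)"
  "lact (fsa opr A) h x = (\<lambda>i. lact A h (x i))" "ract (fsa opr A) x h = (\<lambda>i. ract A (x i) h)"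
  "x \<in> carrier (fsa opr A) \<longleftrightarrow> (\<forall>i. x i \<in> carrier A) \<and> finite {i. x i \<noteq> \<zero>\<^bsub>A\<^esub>}"
  by (auto simp: fsa_def)

lemma fsa_add_closed:
  assumes "is_algebra A" "x \<in> carrier (fsa opr A)" "y \<in> carrier (fsa opr A)"
  shows "x \<oplus>\<^bsub>fsa opr A\<^esub> y \<in> carrier (fsa opr A)"
proof -
  have "{i. x i \<oplus>\<^bsub>A\<^esub> y i \<noteq> \<zero>\<^bsub>A\<^esub>} \<subseteq> {i. x i \<noteq> \<zero>\<^bsub>A\<^esub>} \<union> {i. y i \<noteq> \<zero>\<^bsub>A\<^esub>}" using assms by auto
  then have "finite {i. x i \<oplus>\<^bsub>A\<^esub> y i \<noteq> \<zero>\<^bsub>A\<^esub>}" by (rule finite_subset) (use assms in \<open>auto simp: fsa_simps\<close>)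
  then show ?thesis using assms by (auto simp: fsa_simps)
qed

lemma fmono_closed: "is_algebra A \<Longrightarrow> a \<in> carrier A \<Longrightarrow> fmono A i a \<in> carrier (fsa opr A)"
  by (auto simp: fsa_simps fmono_def intro!: finite_subset[of _ "{i}"])

text \<open>The freedom in the index sets allows elements with different supports to be compared.\<close>

lemma fsa_mult:
  assumes A: "is_algebra A" and x: "x \<in> carrier (fsa opr A)" and y: "y \<in> carrier (fsa opr A)"
    and F: "finite F" "{i. x i \<noteq> \<zero>\<^bsub>A\<^esub>} \<subseteq> F" and G: "finite G" "{i. y i \<noteq> \<zero>\<^bsub>A\<^esub>} \<subseteq> G"
  shows "(x \<otimes>\<^bsub>fsa opr A\<^esub> y) e =
    (\<Oplus>\<^bsub>A\<^esub>p\<in>F \<times> G. if opr (fst p) (snd p) = Some e then x (fst p) \<otimes>\<^bsub>A\<^esub> y (snd p) else \<zero>\<^bsub>A\<^esub>)"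
proof -
  interpret abelian_group A using A by (rule algebra_abelian_group)
  have c: "x i \<in> carrier A" "y i \<in> carrier A" for i using x y by (auto simp: fsa_simps)
  have z: "x (fst p) \<otimes>\<^bsub>A\<^esub> y (snd p) = \<zero>\<^bsub>A\<^esub>"
    if "x (fst p) = \<zero>\<^bsub>A\<^esub> \<or> y (snd p) = \<zero>\<^bsub>A\<^esub>" for p
    using that A c by (metis algebra_zero_mult)
  show ?thesis unfolding fsa_def monoid.simps
    by (rule add.finprod_mono_neutral_cong_left) (use F G in \<open>auto simp: c A Pi_iff z\<close>)
qed

lemma fsa_mult_closed:
  assumes A: "is_algebra A" and x: "x \<in> carrier (fsa opr A)" and y: "y \<in> carrier (fsa opr A)"
  shows "x \<otimes>\<^bsub>fsa opr A\<^esub> y \<in> carrier (fsa opr A)"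
proof -
  interpret abelian_group A using A by (rule algebra_abelian_group)
  let ?F = "{i. x i \<noteq> \<zero>\<^bsub>A\<^esub>}" and ?G = "{i. y i \<noteq> \<zero>\<^bsub>A\<^esub>}"
  have c: "x i \<in> carrier A" "y i \<in> carrier A" for i using x y by (auto simp: fsa_simps)
  have fin: "finite ?F" "finite ?G" using x y by (auto simp: fsa_simps)
  note m = fsa_mult[OF A x y fin(1) order.refl fin(2) order.refl]
  have "{e. (x \<otimes>\<^bsub>fsa opr A\<^esub> y) e \<noteq> \<zero>\<^bsub>A\<^esub>} \<subseteq> (\<lambda>p. the (opr (fst p) (snd p))) ` (?F \<times> ?G)"
  proof
    fix e assume e: "e \<in> {e. (x \<otimes>\<^bsub>fsa opr A\<^esub> y) e \<noteq> \<zero>\<^bsub>A\<^esub>}"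
    have "(x \<otimes>\<^bsub>fsa opr A\<^esub> y) e = \<zero>\<^bsub>A\<^esub>" if "\<forall>p\<in>?F \<times> ?G. opr (fst p) (snd p) \<noteq> Some e"
      unfolding m by (rule add.finprod_one_eqI) (use that in auto)
    then have "\<exists>p\<in>?F \<times> ?G. opr (fst p) (snd p) = Some e" using e by blast
    then show "e \<in> (\<lambda>p. the (opr (fst p) (snd p))) ` (?F \<times> ?G)" by force
  qed
  then have "finite {e. (x \<otimes>\<^bsub>fsa opr A\<^esub> y) e \<noteq> \<zero>\<^bsub>A\<^esub>}" by (rule finite_subset) (use fin in auto)
  then show ?thesis by (auto simp: fsa_simps m c A intro!: finsum_closed)
qed

lemma finsum_split:
  assumes "is_algebra A" "\<And>p. p \<in> S \<Longrightarrow> f p = g p \<oplus>\<^bsub>A\<^esub> h p" "g \<in> S \<rightarrow> carrier A" "h \<in> S \<rightarrow> carrier A"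
  shows "(\<Oplus>\<^bsub>A\<^esub>p\<in>S. f p) = (\<Oplus>\<^bsub>A\<^esub>p\<in>S. g p) \<oplus>\<^bsub>A\<^esub> (\<Oplus>\<^bsub>A\<^esub>p\<in>S. h p)"
proof -
  interpret abelian_group A using assms(1) by (rule algebra_abelian_group)
  have "(\<Oplus>\<^bsub>A\<^esub>p\<in>S. f p) = (\<Oplus>\<^bsub>A\<^esub>p\<in>S. g p \<oplus>\<^bsub>A\<^esub> h p)"
    using assms(2-) by (intro finsum_cong') (auto simp: Pi_iff)
  then show ?thesis using finsum_addf[OF assms(3,4)] by simp
qed

lemma fsa_distrib:
  assumes A: "is_algebra A" and x: "x \<in> carrier (fsa opr A)" and y: "y \<in> carrier (fsa opr A)"
    and z: "z \<in> carrier (fsa opr A)"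
  shows "(x \<oplus>\<^bsub>fsa opr A\<^esub> y) \<otimes>\<^bsub>fsa opr A\<^esub> z = x \<otimes>\<^bsub>fsa opr A\<^esub> z \<oplus>\<^bsub>fsa opr A\<^esub> y \<otimes>\<^bsub>fsa opr A\<^esub> z"
    and "z \<otimes>\<^bsub>fsa opr A\<^esub> (x \<oplus>\<^bsub>fsa opr A\<^esub> y) = z \<otimes>\<^bsub>fsa opr A\<^esub> x \<oplus>\<^bsub>fsa opr A\<^esub> z \<otimes>\<^bsub>fsa opr A\<^esub> y"
proof -
  interpret abelian_group A using A by (rule algebra_abelian_group)
  let ?F = "{i. x i \<noteq> \<zero>\<^bsub>A\<^esub>} \<union> {i. y i \<noteq> \<zero>\<^bsub>A\<^esub>} \<union> {i. x i \<oplus>\<^bsub>A\<^esub> y i \<noteq> \<zero>\<^bsub>A\<^esub>}" and ?G = "{i. z i \<noteq> \<zero>\<^bsub>A\<^esub>}"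
  have c: "x i \<in> carrier A" "y i \<in> carrier A" "z i \<in> carrier A" for i using x y z by (auto simp: fsa_simps)
  have xy: "x \<oplus>\<^bsub>fsa opr A\<^esub> y \<in> carrier (fsa opr A)" using A x y by (rule fsa_add_closed)
  have F: "finite ?F" "{i. x i \<noteq> \<zero>\<^bsub>A\<^esub>} \<subseteq> ?F" "{i. y i \<noteq> \<zero>\<^bsub>A\<^esub>} \<subseteq> ?F"
    "{i. (x \<oplus>\<^bsub>fsa opr A\<^esub> y) i \<noteq> \<zero>\<^bsub>A\<^esub>} \<subseteq> ?F"
    using x y xy by (auto simp: fsa_simps)
  have G: "finite ?G" "?G \<subseteq> ?G" using z by (auto simp: fsa_simps)
  show "(x \<oplus>\<^bsub>fsa opr A\<^esub> y) \<otimes>\<^bsub>fsa opr A\<^esub> z = x \<otimes>\<^bsub>fsa opr A\<^esub> z \<oplus>\<^bsub>fsa opr A\<^esub> y \<otimes>\<^bsub>fsa opr A\<^esub> z"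
  proof
    fix e
    show "((x \<oplus>\<^bsub>fsa opr A\<^esub> y) \<otimes>\<^bsub>fsa opr A\<^esub> z) e = (x \<otimes>\<^bsub>fsa opr A\<^esub> z \<oplus>\<^bsub>fsa opr A\<^esub> y \<otimes>\<^bsub>fsa opr A\<^esub> z) e"
      unfolding fsa_simps(2)[of _ _ "x \<otimes>\<^bsub>fsa opr A\<^esub> z"] fsa_mult[OF A xy z F(1,4) G]
        fsa_mult[OF A x z F(1,2) G] fsa_mult[OF A y z F(1,3) G]
      by (rule finsum_split[OF A]) (simp_all add: Pi_iff fsa_simps(2) c A algebra_distrib_r)
  qed
  show "z \<otimes>\<^bsub>fsa opr A\<^esub> (x \<oplus>\<^bsub>fsa opr A\<^esub> y) = z \<otimes>\<^bsub>fsa opr A\<^esub> x \<oplus>\<^bsub>fsa opr A\<^esub> z \<otimes>\<^bsub>fsa opr A\<^esub> y"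
  proof
    fix e
    show "(z \<otimes>\<^bsub>fsa opr A\<^esub> (x \<oplus>\<^bsub>fsa opr A\<^esub> y)) e = (z \<otimes>\<^bsub>fsa opr A\<^esub> x \<oplus>\<^bsub>fsa opr A\<^esub> z \<otimes>\<^bsub>fsa opr A\<^esub> y) e"
      unfolding fsa_simps(2)[of _ _ "z \<otimes>\<^bsub>fsa opr A\<^esub> x"] fsa_mult[OF A z xy G F(1,4)]
        fsa_mult[OF A z x G F(1,2)] fsa_mult[OF A z y G F(1,3)]
      by (rule finsum_split[OF A]) (simp_all add: Pi_iff fsa_simps(2) c A algebra_distrib_l)
  qed
qed

lemma fsa_mult_zero:
  assumes "is_algebra A" "x \<in> carrier (fsa opr A)"
  shows "\<zero>\<^bsub>fsa opr A\<^esub> \<otimes>\<^bsub>fsa opr A\<^esub> x = \<zero>\<^bsub>fsa opr A\<^esub>" "x \<otimes>\<^bsub>fsa opr A\<^esub> \<zero>\<^bsub>fsa opr A\<^esub> = \<zero>\<^bsub>fsa opr A\<^esub>"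
proof -
  interpret abelian_group A using assms(1) by (rule algebra_abelian_group)
  show "\<zero>\<^bsub>fsa opr A\<^esub> \<otimes>\<^bsub>fsa opr A\<^esub> x = \<zero>\<^bsub>fsa opr A\<^esub>" "x \<otimes>\<^bsub>fsa opr A\<^esub> \<zero>\<^bsub>fsa opr A\<^esub> = \<zero>\<^bsub>fsa opr A\<^esub>"
    by (auto simp: fsa_def)
qed

lemma fmono_mult:
  assumes A: "is_algebra A" and a: "a \<in> carrier A" and b: "b \<in> carrier A"
  shows "fmono A i a \<otimes>\<^bsub>fsa opr A\<^esub> fmono A j b =
    (case opr i j of None \<Rightarrow> \<zero>\<^bsub>fsa opr A\<^esub> | Some e \<Rightarrow> fmono A e (a \<otimes>\<^bsub>A\<^esub> b))"
proof
  fix e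
  interpret abelian_group A using A by (rule algebra_abelian_group)
  have "(fmono A i a \<otimes>\<^bsub>fsa opr A\<^esub> fmono A j b) e =
    (\<Oplus>\<^bsub>A\<^esub>p\<in>{i} \<times> {j}. if opr (fst p) (snd p) = Some e then fmono A i a (fst p) \<otimes>\<^bsub>A\<^esub> fmono A j b (snd p) else \<zero>\<^bsub>A\<^esub>)"
    by (rule fsa_mult) (use A a b in \<open>auto simp: fmono_closed\<close>, auto simp: fmono_def split: if_splits)
  also have "\<dots> = (if opr i j = Some e then a \<otimes>\<^bsub>A\<^esub> b else \<zero>\<^bsub>A\<^esub>)"
    using A a b by (simp add: fmono_def)
  finally show "(fmono A i a \<otimes>\<^bsub>fsa opr A\<^esub> fmono A j b) e =
    (case opr i j of None \<Rightarrow> \<zero>\<^bsub>fsa opr A\<^esub> | Some e \<Rightarrow> fmono A e (a \<otimes>\<^bsub>A\<^esub> b)) e"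
    by (auto simp: fsa_simps fmono_def split: option.split)
qed

lemma fsa_induct [consumes 2, case_names zero mono add]:
  assumes A: "is_algebra A" and x: "x \<in> carrier (fsa opr A)"
    and 0: "P \<zero>\<^bsub>fsa opr A\<^esub>" and m: "\<And>i a. x i \<noteq> \<zero>\<^bsub>A\<^esub> \<Longrightarrow> a \<in> carrier A \<Longrightarrow> P (fmono A i a)"
    and add: "\<And>y z. y \<in> carrier (fsa opr A) \<Longrightarrow> z \<in> carrier (fsa opr A) \<Longrightarrow> P y \<Longrightarrow> P z \<Longrightarrow> P (y \<oplus>\<^bsub>fsa opr A\<^esub> z)"
  shows "P x"
proof -
  have "P y" if "finite F" "y \<in> carrier (fsa opr A)" "{i. y i \<noteq> \<zero>\<^bsub>A\<^esub>} = F" "F \<subseteq> {i. x i \<noteq> \<zero>\<^bsub>A\<^esub>}" for F y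
    using that
  proof (induction F arbitrary: y)
    case empty
    then have "y = \<zero>\<^bsub>fsa opr A\<^esub>" by (auto simp: fsa_simps)
    then show ?case using 0 by simp
  next
    case (insert i F)
    let ?y = "y(i := \<zero>\<^bsub>A\<^esub>)"
    have c: "y j \<in> carrier A" for j using insert.prems(1) by (auto simp: fsa_simps)
    have s: "{j. ?y j \<noteq> \<zero>\<^bsub>A\<^esub>} = F" using insert.prems(2) insert.hyps(2) by auto
    then have y: "?y \<in> carrier (fsa opr A)" using insert.hyps(1) c A by (auto simp: fsa_simps)
    have Py: "P ?y" by (rule insert.IH[OF y s]) (use insert.prems(3) in auto)
    have "P (?y \<oplus>\<^bsub>fsa opr A\<^esub> fmono A i (y i))"
      by (intro add y Py m fmono_closed A c) (use insert.prems(3) in auto)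
    also have "?y \<oplus>\<^bsub>fsa opr A\<^esub> fmono A i (y i) = y"
      using A c by (auto simp: fsa_simps fmono_def)
    finally show ?case .
  qed
  then show ?thesis using x by (auto simp: fsa_simps)
qed

lemma fmono_act:
  assumes "is_algebra A" "h \<in> carrier H"
  shows "lact (fsa opr A) h (fmono A i a) = fmono A i (lact A h a)"
    "ract (fsa opr A) (fmono A i a) h = fmono A i (ract A a h)"
  using assms by (auto simp: fmono_def fsa_simps)

lemma fsa_act_closed:
  assumes "is_algebra A" "h \<in> carrier H" "x \<in> carrier (fsa opr A)"
  shows "lact (fsa opr A) h x \<in> carrier (fsa opr A)" "ract (fsa opr A) x h \<in> carrier (fsa opr A)"
  using assms by (auto simp: fsa_simps elim!: finite_subset[rotated])

lemma fsa_act_add: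
  assumes "is_algebra A" "h \<in> carrier H" "x \<in> carrier (fsa opr A)" "y \<in> carrier (fsa opr A)"
  shows "lact (fsa opr A) h (x \<oplus>\<^bsub>fsa opr A\<^esub> y) = lact (fsa opr A) h x \<oplus>\<^bsub>fsa opr A\<^esub> lact (fsa opr A) h y"
    "ract (fsa opr A) (x \<oplus>\<^bsub>fsa opr A\<^esub> y) h = ract (fsa opr A) x h \<oplus>\<^bsub>fsa opr A\<^esub> ract (fsa opr A) y h"
  using assms by (auto simp: fsa_simps algebra_lact_add algebra_ract_add)

text \<open>Products are biadditive, so associativity and the bimodule axioms need only be checked on functions
  supported at one index.\<close>

lemma fsa_algebra:
  fixes opr :: "'i \<Rightarrow> 'i \<Rightarrow> 'i option"
  assumes A: "is_algebra A" and opr: "opr_assoc opr"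
  shows "is_algebra (fsa opr A)"
proof -
  let ?S = "fsa opr A"
  note cl [simp] = fsa_mult_closed[OF A] fsa_add_closed[OF A] fmono_closed[OF A] fsa_act_closed[OF A]
  have z [simp]: "\<zero>\<^bsub>?S\<^esub> \<in> carrier ?S" "lact ?S h \<zero>\<^bsub>?S\<^esub> = \<zero>\<^bsub>?S\<^esub>" "ract ?S \<zero>\<^bsub>?S\<^esub> h = \<zero>\<^bsub>?S\<^esub>"
    if "h \<in> carrier H" for h using A that by (auto simp: fsa_simps)
  have z0 [simp]: "\<zero>\<^bsub>?S\<^esub> \<in> carrier ?S" "\<zero>\<^bsub>?S\<^esub> \<oplus>\<^bsub>?S\<^esub> \<zero>\<^bsub>?S\<^esub> = \<zero>\<^bsub>?S\<^esub>"
    using A by (auto simp: fsa_simps)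
  note [simp] = fsa_mult_zero[OF A]
  have c3: "(fmono A i a \<otimes>\<^bsub>?S\<^esub> fmono A j b) \<otimes>\<^bsub>?S\<^esub> fmono A k c = fmono A i a \<otimes>\<^bsub>?S\<^esub> (fmono A j b \<otimes>\<^bsub>?S\<^esub> fmono A k c)"
    if "a \<in> carrier A" "b \<in> carrier A" "c \<in> carrier A" for i j k a b c
    using opr[unfolded opr_assoc_def, rule_format, where i = i and j = j and k = k] that A
    by (auto simp: fmono_mult algebra_mult_assoc split: option.splits)
  have assoc: "(x \<otimes>\<^bsub>?S\<^esub> y) \<otimes>\<^bsub>?S\<^esub> z = x \<otimes>\<^bsub>?S\<^esub> (y \<otimes>\<^bsub>?S\<^esub> z)"
    if x: "x \<in> carrier ?S" and y: "y \<in> carrier ?S" and z: "z \<in> carrier ?S" for x y z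
    using A x
  proof (induction rule: fsa_induct)
    case (mono i a)
    show ?case using A y
    proof (induction rule: fsa_induct)
      case (mono j b)
      show ?case using A z
        by (induction rule: fsa_induct)
          (use \<open>a \<in> carrier A\<close> \<open>b \<in> carrier A\<close> in \<open>simp_all add: fsa_distrib[OF A] c3\<close>)
    qed (use mono z in \<open>simp_all add: fsa_distrib[OF A]\<close>)
  qed (use y z in \<open>simp_all add: fsa_distrib[OF A]\<close>)
  have bi: "lact ?S h (x \<otimes>\<^bsub>?S\<^esub> y) = lact ?S h x \<otimes>\<^bsub>?S\<^esub> y \<and> ract ?S (x \<otimes>\<^bsub>?S\<^esub> y) h = x \<otimes>\<^bsub>?S\<^esub> ract ?S y h
    \<and> ract ?S x h \<otimes>\<^bsub>?S\<^esub> y = x \<otimes>\<^bsub>?S\<^esub> lact ?S h y"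
    if h: "h \<in> carrier H" and x: "x \<in> carrier ?S" and y: "y \<in> carrier ?S" for h x y
    using A x
  proof (induction rule: fsa_induct)
    case (mono i a)
    show ?case using A y
      by (induction rule: fsa_induct)
        (use A h mono in \<open>simp_all add: fsa_distrib[OF A] fsa_act_add[OF A] fmono_act[OF A] fmono_mult
          algebra_lact_mult algebra_ract_mult algebra_balanced split: option.split\<close>)
  qed (use h y in \<open>simp_all add: fsa_distrib[OF A] fsa_act_add[OF A]\<close>)
  have neg: "\<exists>y\<in>carrier ?S. y \<oplus>\<^bsub>?S\<^esub> x = \<zero>\<^bsub>?S\<^esub>" if x: "x \<in> carrier ?S" for x
    using x A by (intro bexI[of _ "\<lambda>i. \<ominus>\<^bsub>A\<^esub> x i"])
      (auto simp: fsa_simps elim!: finite_subset[rotated])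
  have comm: "x \<oplus>\<^bsub>?S\<^esub> y = y \<oplus>\<^bsub>?S\<^esub> x" if "x \<in> carrier ?S" "y \<in> carrier ?S" for x y
    using that A by (auto simp: fsa_simps algebra_add_comm)
  have cent: "lact ?S h x = ract ?S x h" if "central" "h \<in> carrier H" "x \<in> carrier ?S" for h x
    using that algebra_central[OF A] unfolding fsa_simps by metis
  show ?thesis
    unfolding is_algebra_def by (intro conjI impI ballI abelian_groupI neg comm cent assoc)
      (simp_all add: bi fsa_distrib[OF A] fsa_act_add[OF A], simp_all add: fsa_simps A algebra_add_assoc
        algebra_lact_one algebra_ract_one algebra_act_add algebra_act_mult algebra_lact_ract)
qed

text \<open>Polynomial algebras and matrix algebras are the subalgebras of functions supported in a set of
  exponents, respectively of pairs of indices, wrapped in a constructor \<open>\<psi>\<close>.\<close>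

lemma fsa_sub_algebra:
  fixes B :: "('h, 'y) algebra" and opr :: "'i \<Rightarrow> 'i \<Rightarrow> 'i option" and A :: "('h, 'x) algebra"
  assumes A: "is_algebra A" and opr: "opr_assoc opr" and S: "\<And>i j e. i \<in> S \<Longrightarrow> j \<in> S \<Longrightarrow> opr i j = Some e \<Longrightarrow> e \<in> S"
    and C: "\<And>x. x \<in> carrier B \<longleftrightarrow> x = \<psi> (\<phi> x) \<and> \<phi> x \<in> carrier (fsa opr A) \<and> (\<forall>i. \<phi> x i \<noteq> \<zero>\<^bsub>A\<^esub> \<longrightarrow> i \<in> S)"
    and inv: "\<And>f. \<phi> (\<psi> f) = f" and zero: "\<zero>\<^bsub>B\<^esub> = \<psi> \<zero>\<^bsub>fsa opr A\<^esub>" and add: "\<And>x y. x \<oplus>\<^bsub>B\<^esub> y = \<psi> (\<phi> x \<oplus>\<^bsub>fsa opr A\<^esub> \<phi> y)"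
    and mult: "\<And>x y. x \<in> carrier B \<Longrightarrow> y \<in> carrier B \<Longrightarrow> x \<otimes>\<^bsub>B\<^esub> y = \<psi> (\<phi> x \<otimes>\<^bsub>fsa opr A\<^esub> \<phi> y)"
    and act: "\<And>h x. lact B h x = \<psi> (lact (fsa opr A) h (\<phi> x))" "\<And>h x. ract B x h = \<psi> (ract (fsa opr A) (\<phi> x) h)"
  shows "is_algebra B" and "\<phi> \<in> alg_hom B (fsa opr A)"
proof -
  let ?F = "fsa opr A"
  note F = fsa_algebra[OF A opr]
  interpret abelian_group A using A by (rule algebra_abelian_group)
  have mem: "\<psi> f \<in> carrier B" if "f \<in> carrier ?F" "\<And>i. i \<notin> S \<Longrightarrow> f i = \<zero>\<^bsub>A\<^esub>" for f using that unfolding C inv by blast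
  have ev: "(\<lambda>f. f i) \<in> add_hom ?F A" for i by (auto simp: add_hom_def fsa_simps)
  have cl: "\<phi> x \<in> carrier ?F" "x = \<psi> (\<phi> x)" "i \<notin> S \<Longrightarrow> \<phi> x i = \<zero>\<^bsub>A\<^esub>" if "x \<in> carrier B" for x i using that C by blast+
  have ms: "(\<phi> x \<otimes>\<^bsub>?F\<^esub> \<phi> y) i = \<zero>\<^bsub>A\<^esub>" if "x \<in> carrier B" "y \<in> carrier B" "i \<notin> S" for x y i
  proof -
    have "opr (fst p) (snd p) \<noteq> Some i" if "\<phi> x (fst p) \<noteq> \<zero>\<^bsub>A\<^esub>" "\<phi> y (snd p) \<noteq> \<zero>\<^bsub>A\<^esub>" for p
      using S[of "fst p" "snd p" i] cl(3)[OF \<open>x \<in> carrier B\<close>, of "fst p"] cl(3)[OF \<open>y \<in> carrier B\<close>, of "snd p"] that \<open>i \<notin> S\<close> by blast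
    then have e: "{p \<in> {i. \<phi> x i \<noteq> \<zero>\<^bsub>A\<^esub>} \<times> {i. \<phi> y i \<noteq> \<zero>\<^bsub>A\<^esub>}. opr (fst p) (snd p) = Some i} = {}" by auto
    show ?thesis unfolding fsa_def monoid.simps e by simp
  qed
  have m: "x \<oplus>\<^bsub>B\<^esub> y \<in> carrier B" "x \<otimes>\<^bsub>B\<^esub> y \<in> carrier B" if "x \<in> carrier B" "y \<in> carrier B" for x y
    by (simp_all only: add mult[OF that]) (rule mem, simp add: F cl(1) that, simp add: ms that fsa_simps A cl(3))+
  have l: "lact B h x \<in> carrier B" "ract B x h \<in> carrier B" if "x \<in> carrier B" "h \<in> carrier H" for h x
    by (simp_all only: act) (rule mem, simp add: F cl(1) that, simp add: that fsa_simps A cl(3))+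
  have neg: "\<exists>y\<in>carrier B. \<phi> y = \<ominus>\<^bsub>?F\<^esub> \<phi> x" if x: "x \<in> carrier B" for x
  proof (rule bexI[of _ "\<psi> (\<ominus>\<^bsub>?F\<^esub> \<phi> x)"])
    show "\<psi> (\<ominus>\<^bsub>?F\<^esub> \<phi> x) \<in> carrier B"
      by (rule mem) (use F cl(1,3)[OF x] A add_hom_neg[OF ev F A cl(1)[OF x]] in simp_all)
  qed (rule inv)
  note J = is_algebra_jointly_injective[where I = "{()}" and C = "\<lambda>_. ?F" and B = B and \<phi> = "\<lambda>_. \<phi>"]
  have "is_algebra B \<and> (\<forall>i\<in>{()}. \<phi> \<in> alg_hom B ?F)"
  proof (intro conjI ballI)
    show "is_algebra B"
    proof (rule J(1))
      show "\<zero>\<^bsub>B\<^esub> \<in> carrier B" unfolding zero by (rule mem[OF algebra_closed(1)[OF F]]) (simp add: fsa_simps)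
    qed (use F cl(1,2) neg in \<open>auto simp: m l, simp_all add: zero add mult act inv, metis\<close>)
    show "\<phi> \<in> alg_hom B ?F" using cl(1) by (auto simp: alg_hom_def add mult act inv)
  qed
  then show "is_algebra B" "\<phi> \<in> alg_hom B ?F" by auto
qed

text \<open>Maps out of these algebras are prescribed on functions supported at one index.\<close>

definition flin :: "('h, 'x) algebra \<Rightarrow> ('h, 'y) algebra \<Rightarrow> ('i \<Rightarrow> 'x \<Rightarrow> 'y) \<Rightarrow> ('i \<Rightarrow> 'x) \<Rightarrow> 'y" where
  "flin A C \<phi> x = (\<Oplus>\<^bsub>C\<^esub>i\<in>{i. x i \<noteq> \<zero>\<^bsub>A\<^esub>}. \<phi> i (x i))"

lemma flin_eq:
  assumes "is_algebra A" "is_algebra C" "\<And>i. \<phi> i \<in> add_hom A C" "x \<in> carrier (fsa opr A)"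
    "finite F" "{i. x i \<noteq> \<zero>\<^bsub>A\<^esub>} \<subseteq> F"
  shows "flin A C \<phi> x = (\<Oplus>\<^bsub>C\<^esub>i\<in>F. \<phi> i (x i))"
proof -
  interpret abelian_group C using assms(2) by (rule algebra_abelian_group)
  show ?thesis unfolding flin_def
    by (rule add.finprod_mono_neutral_cong_left)
      (use assms add_hom_closed[OF assms(3)] add_hom_zero[OF assms(3,1,2)] in \<open>auto simp: fsa_simps\<close>)
qed

lemma flin_add_hom:
  assumes "is_algebra A" "is_algebra C" "\<And>i. \<phi> i \<in> add_hom A C"
  shows "flin A C \<phi> \<in> add_hom (fsa opr A) C"
proof -
  interpret abelian_group C using assms(2) by (rule algebra_abelian_group)
  note cl = add_hom_closed[OF assms(3)]
  { fix x y assume x: "x \<in> carrier (fsa opr A)" and y: "y \<in> carrier (fsa opr A)"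
    let ?F = "{i. x i \<noteq> \<zero>\<^bsub>A\<^esub>} \<union> {i. y i \<noteq> \<zero>\<^bsub>A\<^esub>} \<union> {i. (x \<oplus>\<^bsub>fsa opr A\<^esub> y) i \<noteq> \<zero>\<^bsub>A\<^esub>}"
    have xy: "x \<oplus>\<^bsub>fsa opr A\<^esub> y \<in> carrier (fsa opr A)" using assms(1) x y by (rule fsa_add_closed)
    have f: "finite ?F" using x y xy by (auto simp: fsa_simps)
    have "flin A C \<phi> (x \<oplus>\<^bsub>fsa opr A\<^esub> y) = (\<Oplus>\<^bsub>C\<^esub>i\<in>?F. \<phi> i ((x \<oplus>\<^bsub>fsa opr A\<^esub> y) i))"
      by (rule flin_eq[OF assms xy f]) auto
    also have "\<dots> = (\<Oplus>\<^bsub>C\<^esub>i\<in>?F. \<phi> i (x i) \<oplus>\<^bsub>C\<^esub> \<phi> i (y i))"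
      using x y by (auto simp: fsa_simps cl add_hom_add[OF assms(3)] intro!: finsum_cong')
    also have "\<dots> = (\<Oplus>\<^bsub>C\<^esub>i\<in>?F. \<phi> i (x i)) \<oplus>\<^bsub>C\<^esub> (\<Oplus>\<^bsub>C\<^esub>i\<in>?F. \<phi> i (y i))"
      using x y by (intro finsum_addf) (auto simp: fsa_simps cl)
    also have "(\<Oplus>\<^bsub>C\<^esub>i\<in>?F. \<phi> i (x i)) = flin A C \<phi> x"
      by (rule flin_eq[OF assms x f, symmetric]) auto
    also have "(\<Oplus>\<^bsub>C\<^esub>i\<in>?F. \<phi> i (y i)) = flin A C \<phi> y"
      by (rule flin_eq[OF assms y f, symmetric]) auto
    finally have "flin A C \<phi> (x \<oplus>\<^bsub>fsa opr A\<^esub> y) = flin A C \<phi> x \<oplus>\<^bsub>C\<^esub> flin A C \<phi> y" . }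
  moreover have "flin A C \<phi> x \<in> carrier C" if "x \<in> carrier (fsa opr A)" for x
    using that unfolding flin_def by (auto intro!: finsum_closed simp: cl fsa_simps)
  ultimately show ?thesis by (auto simp: add_hom_def)
qed

lemma flin_fmono:
  assumes "is_algebra A" "is_algebra C" "\<And>i. \<phi> i \<in> add_hom A C" "a \<in> carrier A"
  shows "flin A C \<phi> (fmono A i a) = \<phi> i a"
proof -
  interpret abelian_group C using assms(2) by (rule algebra_abelian_group)
  have "flin A C \<phi> (fmono A i a) = (\<Oplus>\<^bsub>C\<^esub>j\<in>{i}. \<phi> j (fmono A i a j))"
    by (rule flin_eq[OF assms(1-3) fmono_closed[OF assms(1,4)]]) (auto simp: fmono_def)
  then show ?thesis using add_hom_closed[OF assms(3,4)] by (simp add: fmono_def)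
qed

end

section \<open>Polynomials over an algebra\<close>

abbreviation expn :: "(nat \<Rightarrow>\<^sub>0 nat) \<Rightarrow> nat set" where "expn \<equiv> Poly_Mapping.keys"

text \<open>The product of polynomials is a sum over these pairs; both parts of a pair are bounded by \<open>e\<close>.\<close>

lemma finite_decompositions:
  fixes e :: "nat \<Rightarrow>\<^sub>0 nat"
  shows "finite {(f, g). f + g = e}"
proof -
  let ?c = "\<lambda>p :: (nat \<Rightarrow>\<^sub>0 nat) \<times> (nat \<Rightarrow>\<^sub>0 nat). restrict (Poly_Mapping.lookup (fst p)) (expn e)"
  have le: "Poly_Mapping.lookup f i \<le> Poly_Mapping.lookup e i" if "f + g = e" for f g i
    using that by (auto simp: lookup_add)
  have inj: "inj_on ?c {(f, g). f + g = e}"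
  proof (rule inj_onI)
    fix p q assume p: "p \<in> {(f, g). f + g = e}" and q: "q \<in> {(f, g). f + g = e}" and r0: "?c p = ?c q"
    obtain f g f' g' where pq: "p = (f, g)" "q = (f', g')" by (cases p, cases q)
    have fg: "e = f + g" "e = f' + g'" and r: "?c (f, g) = ?c (f', g')" using p q r0 pq by auto
    have "Poly_Mapping.lookup f i = Poly_Mapping.lookup f' i" for i
    proof (cases "i \<in> expn e")
      case True then show ?thesis using fun_cong[OF r, of i] by simp
    next
      case False
      then have "Poly_Mapping.lookup e i = 0" by (simp add: in_keys_iff)
      then show ?thesis using le[of f g i] le[of f' g' i] fg by auto
    qed
    then have "f = f'" by (intro poly_mapping_eqI) auto
    then show "p = q" using fg pq by auto
  qed
  have im: "?c ` {(f, g). f + g = e} \<subseteq> (\<Pi>\<^sub>E i\<in>expn e. {..Poly_Mapping.lookup e i})"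
    using le by auto
  have "finite (\<Pi>\<^sub>E i\<in>expn e. {..Poly_Mapping.lookup e i})" by (intro finite_PiE) auto
  then show ?thesis using inj im by (meson finite_imageD finite_subset)
qed

definition add_exp :: "(nat \<Rightarrow>\<^sub>0 nat) \<Rightarrow> (nat \<Rightarrow>\<^sub>0 nat) \<Rightarrow> (nat \<Rightarrow>\<^sub>0 nat) option" where
  "add_exp e f = Some (e + f)"

definition vars_in :: "nat set \<Rightarrow> zpoly \<Rightarrow> bool" where
  "vars_in V p \<longleftrightarrow> (\<forall>e\<in>Poly_Mapping.keys p. expn e \<subseteq> V)"

lemma vars_in_simps [simp]:
  "vars_in V 0" "vars_in V 1" "vars_in V (zvar i) \<longleftrightarrow> i \<in> V" "vars_in V (frag_of e) \<longleftrightarrow> expn e \<subseteq> V"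
  by (auto simp: vars_in_def zvar_def)

lemma vars_in_add: "vars_in V p \<Longrightarrow> vars_in V q \<Longrightarrow> vars_in V (p + q)"
  unfolding vars_in_def using keys_add[of p q] by blast

lemma vars_in_minus: "vars_in V p \<Longrightarrow> vars_in V (- p)"
  unfolding vars_in_def by simp

lemma vars_in_diff: "vars_in V p \<Longrightarrow> vars_in V q \<Longrightarrow> vars_in V (p - q)"
  unfolding vars_in_def using keys_diff[of p q] by blast

lemma vars_in_mult:
  assumes "vars_in V p" "vars_in V q" shows "vars_in V (p * q)"
  unfolding vars_in_def
proof
  fix e assume "e \<in> Poly_Mapping.keys (p * q)"
  then obtain a b where ab: "e = a + b" "a \<in> Poly_Mapping.keys p" "b \<in> Poly_Mapping.keys q" using keys_mult[of p q] by blast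
  then show "expn e \<subseteq> V" using assms keys_add[of a b] unfolding vars_in_def by blast
qed

lemma vars_in_sum: "(\<And>i. i \<in> I \<Longrightarrow> vars_in V (f i)) \<Longrightarrow> vars_in V (sum f I)"
  by (induction I rule: infinite_finite_induct) (auto intro: vars_in_add)

lemma vars_in_power: "vars_in V p \<Longrightarrow> vars_in V (p ^ n)"
  by (induction n) (auto intro: vars_in_mult)

lemma vars_in_prod: "(\<And>i. i \<in> I \<Longrightarrow> vars_in V (f i)) \<Longrightarrow> vars_in V (prod f I)"
  by (induction I rule: infinite_finite_induct) (auto intro: vars_in_mult)

context kk_setting
begin

lemma add_exp_assoc: "opr_assoc add_exp"
  by (simp add: opr_assoc_def add_exp_def add.assoc)

lemma poly_carrier:
  "x \<in> carrier (poly_alg V A) \<longleftrightarrow>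
    (\<exists>p. x = Poly p) \<and> coef x \<in> carrier (fsa add_exp A) \<and> (\<forall>e. coef x e \<noteq> \<zero>\<^bsub>A\<^esub> \<longrightarrow> expn e \<subseteq> V)"
  by (auto simp: poly_alg_def fsa_simps psupp_def)

lemma poly_ops:
  "\<zero>\<^bsub>poly_alg V A\<^esub> = Poly (\<lambda>_. \<zero>\<^bsub>A\<^esub>)" "x \<oplus>\<^bsub>poly_alg V A\<^esub> y = Poly (\<lambda>e. coef x e \<oplus>\<^bsub>A\<^esub> coef y e)"
  "lact (poly_alg V A) h x = Poly (\<lambda>e. lact A h (coef x e))" "ract (poly_alg V A) x h = Poly (\<lambda>e. ract A (coef x e) h)"
  by (simp_all add: poly_alg_def)

lemma poly_eqI:
  fixes A B :: "('h, 'a) ualg"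
  assumes "x \<in> carrier (poly_alg V A)" "y \<in> carrier (poly_alg W B)" "\<And>e. coef x e = coef y e"
  shows "x = y"
proof -
  obtain p q where "x = Poly p" "y = Poly q" using assms(1,2) by (auto simp: poly_carrier)
  then show ?thesis using assms(3) by auto
qed

lemma poly_mult:
  assumes A: "is_algebra A" and x: "x \<in> carrier (poly_alg V A)" and y: "y \<in> carrier (poly_alg V A)"
  shows "x \<otimes>\<^bsub>poly_alg V A\<^esub> y = Poly (coef x \<otimes>\<^bsub>fsa add_exp A\<^esub> coef y)"
proof -
  interpret abelian_group A using A by (rule algebra_abelian_group)
  have c: "coef x e \<in> carrier A" "coef y e \<in> carrier A" for e using x y by (auto simp: poly_carrier fsa_simps)
  have "(\<Oplus>\<^bsub>A\<^esub>z\<in>{(f, g). f + g = e}. coef x (fst z) \<otimes>\<^bsub>A\<^esub> coef y (snd z)) = (coef x \<otimes>\<^bsub>fsa add_exp A\<^esub> coef y) e" for e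
    unfolding fsa_def monoid.simps
  proof (rule add.finprod_mono_neutral_cong_right[OF finite_decompositions])
    show "coef x (fst i) \<otimes>\<^bsub>A\<^esub> coef y (snd i) = \<zero>\<^bsub>A\<^esub>"
      if "i \<in> {(f, g). f + g = e} - {p \<in> {i. coef x i \<noteq> \<zero>\<^bsub>A\<^esub>} \<times> {i. coef y i \<noteq> \<zero>\<^bsub>A\<^esub>}. add_exp (fst p) (snd p) = Some e}" for i
      using that A c by (auto simp: add_exp_def)
  qed (auto simp: c A add_exp_def)
  then show ?thesis by (simp add: poly_alg_def)
qed

lemma poly_algebra_coef:
  assumes A: "is_algebra A"
  shows poly_algebra: "is_algebra (poly_alg V A)" and coef_hom: "coef \<in> alg_hom (poly_alg V A) (fsa add_exp A)"
proof -
  have S: "e \<in> {e. expn e \<subseteq> V}" if "f \<in> {e. expn e \<subseteq> V}" "g \<in> {e. expn e \<subseteq> V}" "add_exp f g = Some e" for f g e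
    using that keys_add[of f g] by (auto simp: add_exp_def)
  have C: "x \<in> carrier (poly_alg V A) \<longleftrightarrow> x = Poly (coef x) \<and> coef x \<in> carrier (fsa add_exp A) \<and> (\<forall>e. coef x e \<noteq> \<zero>\<^bsub>A\<^esub> \<longrightarrow> e \<in> {e. expn e \<subseteq> V})"
    for x unfolding poly_carrier by (cases x) auto
  note F = fsa_sub_algebra[OF A add_exp_assoc S C]
  show "is_algebra (poly_alg V A)" "coef \<in> alg_hom (poly_alg V A) (fsa add_exp A)"
    by (rule F; simp add: poly_ops fsa_simps poly_mult[OF A])+
qed

lemma coef_add_hom: "is_algebra A \<Longrightarrow> (\<lambda>x. coef x e) \<in> add_hom (poly_alg V A) A"
  by (auto simp: add_hom_def poly_carrier fsa_simps poly_ops)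

definition pmono :: "('h, 'a) ualg \<Rightarrow> (nat \<Rightarrow>\<^sub>0 nat) \<Rightarrow> ('h, 'a) univ \<Rightarrow> ('h, 'a) univ" where
  "pmono A e a = Poly (fmono A e a)"

lemma pmono_closed: "is_algebra A \<Longrightarrow> a \<in> carrier A \<Longrightarrow> expn e \<subseteq> V \<Longrightarrow> pmono A e a \<in> carrier (poly_alg V A)"
  by (auto simp: poly_carrier pmono_def fmono_closed, auto simp: fmono_def split: if_splits)

lemma poly_induct [consumes 2, case_names zero mono add]:
  assumes A: "is_algebra A" and x: "x \<in> carrier (poly_alg V A)"
    and 0: "P \<zero>\<^bsub>poly_alg V A\<^esub>" and m: "\<And>e a. expn e \<subseteq> V \<Longrightarrow> a \<in> carrier A \<Longrightarrow> P (pmono A e a)"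
    and add: "\<And>y z. y \<in> carrier (poly_alg V A) \<Longrightarrow> z \<in> carrier (poly_alg V A) \<Longrightarrow> P y \<Longrightarrow> P z \<Longrightarrow> P (y \<oplus>\<^bsub>poly_alg V A\<^esub> z)"
  shows "P x"
proof -
  have cx: "coef x \<in> carrier (fsa add_exp A)" using x by (simp add: poly_carrier)
  have "Poly (coef x) \<in> carrier (poly_alg V A) \<and> P (Poly (coef x))"
    using A cx
  proof (induction rule: fsa_induct)
    case zero then show ?case using 0 poly_algebra[OF A, of V] by (simp add: fsa_simps flip: poly_ops(1)[of V])
  next
    case (mono e a)
    then have "expn e \<subseteq> V" using x by (auto simp: poly_carrier)
    then show ?case using m mono pmono_closed[OF A] unfolding pmono_def by blast
  next
    case (add y z)
    then have "P (Poly y \<oplus>\<^bsub>poly_alg V A\<^esub> Poly z)" "Poly y \<oplus>\<^bsub>poly_alg V A\<^esub> Poly z \<in> carrier (poly_alg V A)"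
      using assms(5) poly_algebra[OF A, of V] by auto
    then show ?case by (simp add: poly_ops fsa_simps)
  qed
  then show ?thesis using x by (auto simp: poly_carrier)
qed

lemma pmono_zero: "pmono A e \<zero>\<^bsub>A\<^esub> = \<zero>\<^bsub>poly_alg V A\<^esub>"
  by (auto simp: pmono_def fmono_def poly_ops)

lemma poly_add_hom_eqI:
  assumes "is_algebra A" "f \<in> add_hom (poly_alg V A) C" "g \<in> add_hom (poly_alg V A) C"
    "\<And>e a. expn e \<subseteq> V \<Longrightarrow> a \<in> carrier A \<Longrightarrow> f (pmono A e a) = g (pmono A e a)"
    "x \<in> carrier (poly_alg V A)"
  shows "f x = g x"
  using assms(1,5)
proof (induction rule: poly_induct)
  case zero
  then show ?case using assms(4)[of 0 "\<zero>\<^bsub>A\<^esub>"] assms(1) by (simp add: pmono_zero[where V = V])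
qed (simp_all add: assms(4) add_hom_add[OF assms(2)] add_hom_add[OF assms(3)])

lemma pmono_mult:
  assumes "is_algebra A" "a \<in> carrier A" "b \<in> carrier A" "expn e \<subseteq> V" "expn f \<subseteq> V"
  shows "pmono A e a \<otimes>\<^bsub>poly_alg V A\<^esub> pmono A f b = pmono A (e + f) (a \<otimes>\<^bsub>A\<^esub> b)"
  using assms by (subst poly_mult) (auto simp: pmono_closed, auto simp: pmono_def fmono_mult add_exp_def)

lemma poly_alg_homI:
  assumes A: "is_algebra A" and C: "is_algebra C" and F: "F \<in> add_hom (poly_alg V A) C"
    and m: "\<And>e f a b. a \<in> carrier A \<Longrightarrow> b \<in> carrier A \<Longrightarrow> expn e \<subseteq> V \<Longrightarrow> expn f \<subseteq> V \<Longrightarrow>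
      F (pmono A (e + f) (a \<otimes>\<^bsub>A\<^esub> b)) = F (pmono A e a) \<otimes>\<^bsub>C\<^esub> F (pmono A f b)"
    and B: "F \<in> bimod_hom (poly_alg V A) C"
  shows "F \<in> alg_hom (poly_alg V A) C"
proof -
  note P = poly_algebra[OF A, of V]
  note F0 = add_hom_zero[OF F P C] and Fa = add_hom_add[OF F] and Fc = add_hom_closed[OF F]
  have "F (x \<otimes>\<^bsub>poly_alg V A\<^esub> y) = F x \<otimes>\<^bsub>C\<^esub> F y" if x: "x \<in> carrier (poly_alg V A)" and y: "y \<in> carrier (poly_alg V A)" for x y
    using A x
  proof (induction rule: poly_induct)
    case (mono i a)
    then have [simp]: "pmono A i a \<in> carrier (poly_alg V A)" using A by (simp add: pmono_closed)
    show ?case using A y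
    proof (induction rule: poly_induct)
      case (mono j b)
      then show ?case using A \<open>a \<in> carrier A\<close> \<open>expn i \<subseteq> V\<close> by (simp add: pmono_mult m)
    qed (use P C in \<open>simp_all add: F0 Fa Fc algebra_distrib_l\<close>)
  qed (use P C y in \<open>simp_all add: F0 Fa Fc algebra_distrib_r\<close>)
  then show ?thesis using B by (auto simp: alg_hom_iff)
qed

text \<open>The element \<open>a \<otimes> p\<close>.\<close>

definition zsc :: "('h, 'a) ualg \<Rightarrow> zpoly \<Rightarrow> ('h, 'a) univ \<Rightarrow> ('h, 'a) univ" where
  "zsc A p a = Poly (\<lambda>e. zmul A (Poly_Mapping.lookup p e) a)"

lemma zsc_closed: "is_algebra A \<Longrightarrow> vars_in V p \<Longrightarrow> a \<in> carrier A \<Longrightarrow> zsc A p a \<in> carrier (poly_alg V A)"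
proof -
  assume A: "is_algebra A" "vars_in V p" "a \<in> carrier A"
  then have "{e. zmul A (Poly_Mapping.lookup p e) a \<noteq> \<zero>\<^bsub>A\<^esub>} \<subseteq> Poly_Mapping.keys p"
    by (auto simp: in_keys_iff)
  then show ?thesis using A finite_subset[OF _ finite_keys[of p]] unfolding poly_carrier zsc_def vars_in_def
    by (auto simp: fsa_simps)
qed

lemma zsc_bimod_hom: "is_algebra A \<Longrightarrow> vars_in V p \<Longrightarrow> zsc A p \<in> bimod_hom A (poly_alg V A)"
  unfolding bimod_hom_def add_hom_def
  by (auto simp: zsc_closed) (auto simp: zsc_def poly_ops bimod_homD[OF zmul_bimod_hom])

lemma zsc_zero: "is_algebra A \<Longrightarrow> a \<in> carrier A \<Longrightarrow> zsc A 0 a = \<zero>\<^bsub>poly_alg V A\<^esub>"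
  by (simp add: zsc_def poly_ops)

lemma zsc_zero_right: "is_algebra A \<Longrightarrow> zsc A p \<zero>\<^bsub>A\<^esub> = \<zero>\<^bsub>poly_alg V A\<^esub>"
  by (simp add: zsc_def poly_ops)

lemma zsc_add: "is_algebra A \<Longrightarrow> a \<in> carrier A \<Longrightarrow> zsc A (p + q) a = zsc A p a \<oplus>\<^bsub>poly_alg V A\<^esub> zsc A q a"
  by (simp add: zsc_def poly_ops lookup_add zmul_add)

lemma zsc_diff:
  assumes "is_algebra A" "a \<in> carrier A" "vars_in V p" "vars_in V q"
  shows "zsc A (p - q) a = zsc A p a \<ominus>\<^bsub>poly_alg V A\<^esub> zsc A q a"
proof -
  note P = poly_algebra[OF assms(1), of V]
  note c = zsc_closed[OF assms(1) _ assms(2), of V]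
  have "zsc A q a \<oplus>\<^bsub>poly_alg V A\<^esub> zsc A (- q) a = \<zero>\<^bsub>poly_alg V A\<^esub>"
    using zsc_add[OF assms(1,2), of q "- q" V] zsc_zero[OF assms(1,2), of V] by simp
  then have "zsc A (- q) a = \<ominus>\<^bsub>poly_alg V A\<^esub> zsc A q a"
    using assms c[OF assms(4)] c[OF vars_in_minus[OF assms(4)]] by (intro algebra_neg_unique[OF P])
  then show ?thesis using zsc_add[OF assms(1,2), of p "- q" V] by (simp add: algebra_diff)
qed

lemma zsc_frag_of: "is_algebra A \<Longrightarrow> a \<in> carrier A \<Longrightarrow> zsc A (frag_of e) a = pmono A e a"
  by (auto simp: zsc_def pmono_def fmono_def)

lemma zsc_mult:
  assumes A: "is_algebra A" and a: "a \<in> carrier A" and b: "b \<in> carrier A" and p: "vars_in V p" and q: "vars_in V q"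
  shows "zsc A p a \<otimes>\<^bsub>poly_alg V A\<^esub> zsc A q b = zsc A (p * q) (a \<otimes>\<^bsub>A\<^esub> b)"
proof -
  note P = poly_algebra[OF A, of V]
  have ab: "a \<otimes>\<^bsub>A\<^esub> b \<in> carrier A" using A a b by simp
  let ?S = "{e. expn e \<subseteq> V}"
  have cp: "vars_in V p \<longleftrightarrow> Poly_Mapping.keys p \<subseteq> ?S" for p by (auto simp: vars_in_def)
  note z = zsc_closed[OF A]
  have dist: "x \<otimes>\<^bsub>poly_alg V A\<^esub> (y \<ominus>\<^bsub>poly_alg V A\<^esub> z) = x \<otimes>\<^bsub>poly_alg V A\<^esub> y \<ominus>\<^bsub>poly_alg V A\<^esub> x \<otimes>\<^bsub>poly_alg V A\<^esub> z"
    "(y \<ominus>\<^bsub>poly_alg V A\<^esub> z) \<otimes>\<^bsub>poly_alg V A\<^esub> x = y \<otimes>\<^bsub>poly_alg V A\<^esub> x \<ominus>\<^bsub>poly_alg V A\<^esub> z \<otimes>\<^bsub>poly_alg V A\<^esub> x"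
    if "x \<in> carrier (poly_alg V A)" "y \<in> carrier (poly_alg V A)" "z \<in> carrier (poly_alg V A)" for x y z
  proof -
    have "(\<lambda>y. x \<otimes>\<^bsub>poly_alg V A\<^esub> y) \<in> add_hom (poly_alg V A) (poly_alg V A)" "(\<lambda>y. y \<otimes>\<^bsub>poly_alg V A\<^esub> x) \<in> add_hom (poly_alg V A) (poly_alg V A)"
      using that P by (auto simp: add_hom_def algebra_distrib_l algebra_distrib_r)
    then show "x \<otimes>\<^bsub>poly_alg V A\<^esub> (y \<ominus>\<^bsub>poly_alg V A\<^esub> z) = x \<otimes>\<^bsub>poly_alg V A\<^esub> y \<ominus>\<^bsub>poly_alg V A\<^esub> x \<otimes>\<^bsub>poly_alg V A\<^esub> z"
    "(y \<ominus>\<^bsub>poly_alg V A\<^esub> z) \<otimes>\<^bsub>poly_alg V A\<^esub> x = y \<otimes>\<^bsub>poly_alg V A\<^esub> x \<ominus>\<^bsub>poly_alg V A\<^esub> z \<otimes>\<^bsub>poly_alg V A\<^esub> x"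
      using add_hom_diff[OF _ P P that(2,3)] by blast+
  qed
  have gen: "zsc A (frag_of e) a \<otimes>\<^bsub>poly_alg V A\<^esub> zsc A q b = zsc A (frag_of e * q) (a \<otimes>\<^bsub>A\<^esub> b) \<and> vars_in V q"
    if e: "expn e \<subseteq> V" for e
    using q unfolding cp
  proof (induction q rule: frag_induction)
    case zero
    then show ?case using P A a b ab by (simp add: zsc_zero[where V = V] z e)
  next
    case (one f)
    then show ?case using A a b ab e by (simp add: zsc_frag_of pmono_mult mult_single flip: cp)
  next
    case (diff q r)
    then have qr: "vars_in V q" "vars_in V r" by (simp_all add: cp)
    have "vars_in V (frag_of e * q)" "vars_in V (frag_of e * r)" using qr e by (simp_all add: vars_in_mult)
    with diff qr show ?case using A a b ab e P
      by (simp add: zsc_diff dist z right_diff_distrib vars_in_diff flip: cp)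
  qed
  have "zsc A p a \<otimes>\<^bsub>poly_alg V A\<^esub> zsc A q b = zsc A (p * q) (a \<otimes>\<^bsub>A\<^esub> b) \<and> vars_in V p"
    using p unfolding cp
  proof (induction p rule: frag_induction)
    case zero
    then show ?case using P A a b ab by (simp add: zsc_zero[where V = V] z q)
  next
    case (one f)
    then show ?case using gen[of f] by (simp flip: cp)
  next
    case (diff r s)
    then have qr: "vars_in V r" "vars_in V s" by (simp_all add: cp)
    have "vars_in V (r * q)" "vars_in V (s * q)" using qr q by (simp_all add: vars_in_mult)
    with diff qr show ?case using A a b ab q P
      by (simp add: zsc_diff dist z left_diff_distrib vars_in_diff flip: cp)
  qed
  then show ?thesis by blast
qed

lemma tensor_map_flin:
  assumes A: "is_algebra A" and x: "x \<in> carrier (poly_alg V A)" and \<phi>: "\<And>e. expn e \<subseteq> V \<Longrightarrow> vars_in W (\<phi> e)"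
  shows "tensor_map A \<phi> x = flin A (poly_alg W A) (\<lambda>e. if expn e \<subseteq> V then zsc A (\<phi> e) else (\<lambda>_. \<zero>\<^bsub>poly_alg W A\<^esub>)) (coef x)"
proof -
  note P = poly_algebra[OF A, of W]
  interpret A: abelian_group A using A by (rule algebra_abelian_group)
  interpret P: abelian_group "poly_alg W A" using P by (rule algebra_abelian_group)
  let ?s = "\<lambda>e. (if expn e \<subseteq> V then zsc A (\<phi> e) else (\<lambda>_. \<zero>\<^bsub>poly_alg W A\<^esub>)) (coef x e)"
  have c: "coef x e \<in> carrier A" for e using x by (simp add: poly_carrier fsa_simps)
  have v: "expn e \<subseteq> V" if "coef x e \<noteq> \<zero>\<^bsub>A\<^esub>" for e using x that by (simp add: poly_carrier)
  have cl: "?s e \<in> carrier (poly_alg W A)" for e using zsc_closed[OF A \<phi> c] P by simp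
  have fc: "flin A (poly_alg W A) (\<lambda>e. if expn e \<subseteq> V then zsc A (\<phi> e) else (\<lambda>_. \<zero>\<^bsub>poly_alg W A\<^esub>)) (coef x) \<in> carrier (poly_alg W A)"
    unfolding flin_def using cl by (intro P.finsum_closed) auto
  have "coef (flin A (poly_alg W A) (\<lambda>e. if expn e \<subseteq> V then zsc A (\<phi> e) else (\<lambda>_. \<zero>\<^bsub>poly_alg W A\<^esub>)) (coef x)) f
    = (\<Oplus>\<^bsub>A\<^esub>e\<in>psupp A x. zmul A (Poly_Mapping.lookup (\<phi> e) f) (coef x e))" for f
  proof -
    have "coef (\<Oplus>\<^bsub>poly_alg W A\<^esub>e\<in>psupp A x. ?s e) f = (\<Oplus>\<^bsub>A\<^esub>e\<in>psupp A x. coef (?s e) f)"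
      using cl by (intro add_hom_finsum[OF coef_add_hom[OF A] P A]) auto
    also have "\<dots> = (\<Oplus>\<^bsub>A\<^esub>e\<in>psupp A x. zmul A (Poly_Mapping.lookup (\<phi> e) f) (coef x e))"
      using c A v by (intro A.finsum_cong') (auto simp: zsc_def psupp_def)
    finally show ?thesis by (simp add: flin_def psupp_def)
  qed
  then have "tensor_map A \<phi> x = Poly (coef (flin A (poly_alg W A)
      (\<lambda>e. if expn e \<subseteq> V then zsc A (\<phi> e) else (\<lambda>_. \<zero>\<^bsub>poly_alg W A\<^esub>)) (coef x)))"
    unfolding tensor_map_def by (intro arg_cong[of _ _ Poly] ext) simp
  then show ?thesis using fc by (auto simp: poly_carrier)
qed

lemma tensor_map_bimod_hom:
  assumes A: "is_algebra A" and \<phi>: "\<And>e. expn e \<subseteq> V \<Longrightarrow> vars_in W (\<phi> e)"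
  shows "tensor_map A \<phi> \<in> bimod_hom (poly_alg V A) (poly_alg W A)"
    and "\<And>e a. expn e \<subseteq> V \<Longrightarrow> a \<in> carrier A \<Longrightarrow> tensor_map A \<phi> (pmono A e a) = zsc A (\<phi> e) a"
proof -
  let ?P = "poly_alg V A" and ?Q = "poly_alg W A"
  note P = poly_algebra[OF A, of V] and Q = poly_algebra[OF A, of W]
  let ?s = "\<lambda>e. if expn e \<subseteq> V then zsc A (\<phi> e) else (\<lambda>_. \<zero>\<^bsub>?Q\<^esub>)"
  have s: "?s e \<in> bimod_hom A ?Q" for e
    using zsc_bimod_hom[OF A \<phi>[of e]] zero_bimod_hom[OF Q, of A] by simp
  then have sa: "?s e \<in> add_hom A ?Q" for e by (rule bimod_hom_add_hom)
  have F: "flin A ?Q ?s \<circ> coef \<in> add_hom ?P ?Q"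
    by (rule add_hom_comp[OF alg_hom_add_hom[OF coef_hom[OF A]] flin_add_hom[OF A Q sa]])
  have eq: "tensor_map A \<phi> x = (flin A ?Q ?s \<circ> coef) x" if "x \<in> carrier ?P" for x
    using tensor_map_flin[OF A that \<phi>] by simp
  then have T: "tensor_map A \<phi> \<in> add_hom ?P ?Q" using F P by (auto simp: add_hom_def)
  show mono: "tensor_map A \<phi> (pmono A e a) = zsc A (\<phi> e) a" if "expn e \<subseteq> V" "a \<in> carrier A" for e a
    using eq[OF pmono_closed[OF A that(2,1)]] flin_fmono[OF A Q sa that(2), where i = e] that(1) by (simp add: pmono_def)
  have mo: "lact ?P h (pmono A e a) = pmono A e (lact A h a)" "ract ?P (pmono A e a) h = pmono A e (ract A a h)"
    if "h \<in> carrier H" for h e a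
    using A that by (auto simp: poly_ops pmono_def fmono_def)
  have "tensor_map A \<phi> (lact ?P h x) = lact ?Q h (tensor_map A \<phi> x) \<and> tensor_map A \<phi> (ract ?P x h) = ract ?Q (tensor_map A \<phi> x) h"
    if h: "h \<in> carrier H" and x: "x \<in> carrier ?P" for h x
    using A x
  proof (induction rule: poly_induct)
    case zero then show ?case using P Q h add_hom_zero[OF T P Q] by simp
  next
    case (mono e a)
    then show ?case using A h bimod_homD(3,4)[OF zsc_bimod_hom[OF A \<phi>]] by (simp add: mo \<open>\<And>e a. expn e \<subseteq> V \<Longrightarrow> a \<in> carrier A \<Longrightarrow> tensor_map A \<phi> (pmono A e a) = zsc A (\<phi> e) a\<close>)
  next
    case (add y z)
    then show ?case using P Q h add_hom_closed[OF T] by (simp add: algebra_lact_add algebra_ract_add add_hom_add[OF T])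
  qed
  then show "tensor_map A \<phi> \<in> bimod_hom ?P ?Q" using T by (auto simp: bimod_hom_def)
qed

lemma tensor_map_zsc:
  assumes A: "is_algebra A" and a: "a \<in> carrier A" and p: "vars_in V p" and \<phi>: "\<And>e. expn e \<subseteq> V \<Longrightarrow> vars_in W (\<phi> e)"
  shows "tensor_map A \<phi> (zsc A p a) = zsc A (frag_extend \<phi> p) a"
proof -
  note P = poly_algebra[OF A, of V] and Q = poly_algebra[OF A, of W]
  note T = bimod_hom_add_hom[OF tensor_map_bimod_hom(1)[OF A, of V W \<phi>, OF \<phi>]]
  have cp: "vars_in V p \<longleftrightarrow> Poly_Mapping.keys p \<subseteq> {e. expn e \<subseteq> V}" for p by (auto simp: vars_in_def)
  have ext: "vars_in W (frag_extend \<phi> p)" if "vars_in V p" for p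
    unfolding vars_in_def using keys_frag_extend[of \<phi> p] \<phi> that unfolding vars_in_def by fastforce
  have "tensor_map A \<phi> (zsc A p a) = zsc A (frag_extend \<phi> p) a \<and> vars_in V p"
    using p unfolding cp
  proof (induction p rule: frag_induction)
    case zero
    then show ?case using A a add_hom_zero[OF T P Q] by (simp add: zsc_zero[where V = V]) (simp add: poly_ops)
  next
    case (one e)
    then show ?case using A a tensor_map_bimod_hom(2)[OF A, of V W \<phi>, OF \<phi>] by (simp add: zsc_frag_of flip: cp)
  next
    case (diff q r)
    then have qr: "vars_in V q" "vars_in V r" by (simp_all add: cp)
    with diff show ?case using A a ext
      by (simp add: zsc_diff[where V = V] frag_extend_diff zsc_diff[where V = W] add_hom_diff[OF T P Q] zsc_closed vars_in_diff flip: cp)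
  qed
  then show ?thesis by blast
qed

lemma tensor_map_alg_hom:
  assumes A: "is_algebra A" and \<phi>: "\<And>e. expn e \<subseteq> V \<Longrightarrow> vars_in W (\<phi> e)"
    and m: "\<And>e f. expn e \<subseteq> V \<Longrightarrow> expn f \<subseteq> V \<Longrightarrow> \<phi> (e + f) = \<phi> e * \<phi> f"
  shows "tensor_map A \<phi> \<in> alg_hom (poly_alg V A) (poly_alg W A)"
proof (rule poly_alg_homI[OF A poly_algebra[OF A] bimod_hom_add_hom])
  show *: "tensor_map A \<phi> \<in> bimod_hom (poly_alg V A) (poly_alg W A)" by (rule tensor_map_bimod_hom(1)[OF A, of V W \<phi>, OF \<phi>])
  fix e f a b assume h: "a \<in> carrier A" "b \<in> carrier A" "expn e \<subseteq> V" "expn f \<subseteq> V"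
  have "expn (e + f) \<subseteq> V" using h keys_add[of e f] by blast
  then show "tensor_map A \<phi> (pmono A (e + f) (a \<otimes>\<^bsub>A\<^esub> b)) =
     tensor_map A \<phi> (pmono A e a) \<otimes>\<^bsub>poly_alg W A\<^esub> tensor_map A \<phi> (pmono A f b)"
    using h A by (simp add: tensor_map_bimod_hom(2)[OF A, of V W \<phi>, OF \<phi>] zsc_mult \<phi> m)
qed (rule tensor_map_bimod_hom(1)[OF A, of V W \<phi>, OF \<phi>])

lemma tensor_map_comp:
  assumes A: "is_algebra A" and \<phi>: "\<And>e. expn e \<subseteq> V \<Longrightarrow> vars_in W (\<phi> e)" and \<psi>: "\<And>e. expn e \<subseteq> W \<Longrightarrow> vars_in U (\<psi> e)"
    and x: "x \<in> carrier (poly_alg V A)" and eq: "\<And>e. expn e \<subseteq> V \<Longrightarrow> frag_extend \<psi> (\<phi> e) = \<chi> e"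
  shows "tensor_map A \<psi> (tensor_map A \<phi> x) = tensor_map A \<chi> x"
proof -
  note T1 = tensor_map_bimod_hom[OF A, of V W \<phi>, OF \<phi>] and T2 = tensor_map_bimod_hom[OF A, of W U \<psi>, OF \<psi>]
  have ext: "vars_in U (frag_extend \<psi> p)" if "vars_in W p" for p
    unfolding vars_in_def using keys_frag_extend[of \<psi> p] \<psi> that unfolding vars_in_def by fastforce
  have chi: "vars_in U (\<chi> e)" if "expn e \<subseteq> V" for e using ext[OF \<phi>[OF that]] eq[OF that] by simp
  note T3 = tensor_map_bimod_hom[OF A, of V U \<chi>, OF chi]
  have "(tensor_map A \<psi> \<circ> tensor_map A \<phi>) x = tensor_map A \<chi> x"
  proof (rule poly_add_hom_eqI[OF A add_hom_comp[OF T1(1)[THEN bimod_hom_add_hom] T2(1)[THEN bimod_hom_add_hom]] T3(1)[THEN bimod_hom_add_hom] _ x])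
    fix e a assume "expn e \<subseteq> V" "a \<in> carrier A"
    then show "(tensor_map A \<psi> \<circ> tensor_map A \<phi>) (pmono A e a) = tensor_map A \<chi> (pmono A e a)"
      by (simp add: T1(2) T3(2) tensor_map_zsc[OF A _ \<phi> \<psi>] eq)
  qed
  then show ?thesis by simp
qed

lemma ev_hom:
  assumes A: "is_algebra A"
  shows "ev A c \<in> alg_hom (poly_alg V A) A"
    and "\<And>e a. a \<in> carrier A \<Longrightarrow> ev A c (pmono A e a) = zmul A (c ^ Poly_Mapping.lookup e 0) a"
proof -
  let ?s = "\<lambda>e. zmul A (c ^ Poly_Mapping.lookup e 0)"
  have sa: "?s e \<in> add_hom A A" for e by (rule zmul_add_hom[OF A])
  have eq: "ev A c = flin A A ?s \<circ> coef" by (auto simp: ev_def flin_def psupp_def)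
  have F: "ev A c \<in> add_hom (poly_alg V A) A"
    unfolding eq by (rule add_hom_comp[OF alg_hom_add_hom[OF coef_hom[OF A]] flin_add_hom[OF A A sa]])
  show mono: "ev A c (pmono A e a) = ?s e a" if "a \<in> carrier A" for e a
    unfolding eq pmono_def using flin_fmono[OF A A sa that] by simp
  note P = poly_algebra[OF A, of V]
  have mo: "lact (poly_alg V A) h (pmono A e a) = pmono A e (lact A h a)" "ract (poly_alg V A) (pmono A e a) h = pmono A e (ract A a h)"
    if "h \<in> carrier H" for h e a
    using A that by (auto simp: poly_ops pmono_def fmono_def)
  have "ev A c (lact (poly_alg V A) h x) = lact A h (ev A c x) \<and> ev A c (ract (poly_alg V A) x h) = ract A (ev A c x) h"
    if h: "h \<in> carrier H" and x: "x \<in> carrier (poly_alg V A)" for h x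
    using A x
  proof (induction rule: poly_induct)
    case zero then show ?case using P A h add_hom_zero[OF F P A] by simp
  next
    case (mono e a)
    then show ?case using A h bimod_homD(3,4)[OF zmul_bimod_hom[OF A]] by (simp add: mo \<open>\<And>e a. a \<in> carrier A \<Longrightarrow> ev A c (pmono A e a) = ?s e a\<close>)
  next
    case (add y z)
    then show ?case using P A h add_hom_closed[OF F] by (simp add: algebra_lact_add algebra_ract_add add_hom_add[OF F])
  qed
  then have "ev A c \<in> bimod_hom (poly_alg V A) A" using F by (auto simp: bimod_hom_def)
  then show "ev A c \<in> alg_hom (poly_alg V A) A"
    by (rule poly_alg_homI[OF A A F, rotated])
      (use A in \<open>simp add: mono zmul_tensor lookup_add power_add flip: zmul_mult, simp add: mult.commute\<close>)
qed

definition pmap :: "(('h, 'a) univ \<Rightarrow> ('h, 'a) univ) \<Rightarrow> ('h, 'a) univ \<Rightarrow> ('h, 'a) univ" where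
  "pmap \<phi> x = Poly (\<lambda>e. \<phi> (coef x e))"

lemma coef_pmap [simp]: "coef (pmap \<phi> x) e = \<phi> (coef x e)"
  by (simp add: pmap_def)

lemma pmap_closed:
  assumes "x \<in> carrier (poly_alg V A)" "\<And>a. a \<in> carrier A \<Longrightarrow> \<phi> a \<in> carrier B" "\<phi> \<zero>\<^bsub>A\<^esub> = \<zero>\<^bsub>B\<^esub>"
  shows "pmap \<phi> x \<in> carrier (poly_alg V B)"
proof -
  have "finite {e. \<phi> (coef x e) \<noteq> \<zero>\<^bsub>B\<^esub>}"
    by (rule finite_subset[of _ "{e. coef x e \<noteq> \<zero>\<^bsub>A\<^esub>}"]) (use assms in \<open>auto simp: poly_carrier fsa_simps\<close>)
  then show ?thesis using assms unfolding poly_carrier fsa_simps pmap_def univ.sel by metis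
qed

lemma pmap_und_hom:
  assumes "\<phi> \<in> und_hom A B" "\<phi> \<zero>\<^bsub>A\<^esub> = \<zero>\<^bsub>B\<^esub>"
  shows "pmap \<phi> \<in> und_hom (poly_alg V A) (poly_alg V B)"
proof -
  have c: "coef x e \<in> carrier A" if "x \<in> carrier (poly_alg V A)" for x e using that by (simp add: poly_carrier fsa_simps)
  have "pmap \<phi> x \<in> carrier (poly_alg V B)" if "x \<in> carrier (poly_alg V A)" for x
    using that und_hom_closed[OF assms(1)] assms(2) by (rule pmap_closed)
  moreover have "\<phi> (a \<oplus>\<^bsub>A\<^esub> b) = \<phi> a \<oplus>\<^bsub>B\<^esub> \<phi> b" if "und \<noteq> Sets" "a \<in> carrier A" "b \<in> carrier A" for a b
    using assms(1) that unfolding und_hom_def by blast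
  ultimately show ?thesis
    unfolding und_hom_def using c und_hom_act[OF assms(1)] by (simp add: poly_ops pmap_def)
qed

lemma pmap_add_hom:
  assumes "is_algebra A" "is_algebra B" "\<phi> \<in> add_hom A B"
  shows "pmap \<phi> \<in> add_hom (poly_alg V A) (poly_alg V B)"
  using pmap_closed[where A = A and B = B and \<phi> = \<phi> and V = V, OF _ add_hom_closed[OF assms(3)] add_hom_zero[OF assms(3,1,2)]]
  by (auto simp: add_hom_def) (auto simp: poly_carrier fsa_simps pmap_def poly_ops add_hom_add[OF assms(3)])

lemma pmap_pmono:
  assumes "\<phi> \<zero>\<^bsub>A\<^esub> = \<zero>\<^bsub>B\<^esub>" shows "pmap \<phi> (pmono A e a) = pmono B e (\<phi> a)"
  using assms by (auto simp: pmap_def pmono_def fmono_def)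

lemma pmap_alg_hom:
  assumes A: "is_algebra A" and B: "is_algebra B" and \<phi>: "\<phi> \<in> alg_hom A B"
  shows "pmap \<phi> \<in> alg_hom (poly_alg V A) (poly_alg V B)"
proof (rule poly_alg_homI[OF A poly_algebra[OF B]])
  note z = add_hom_zero[OF alg_hom_add_hom[OF \<phi>] A B]
  show a: "pmap \<phi> \<in> add_hom (poly_alg V A) (poly_alg V B)"
    by (rule pmap_add_hom[OF A B alg_hom_add_hom[OF \<phi>]])
  then show "pmap \<phi> \<in> bimod_hom (poly_alg V A) (poly_alg V B)"
    by (auto simp: bimod_hom_def) (auto simp: poly_ops pmap_def poly_carrier fsa_simps alg_homD[OF \<phi>])
  fix e f a b assume "a \<in> carrier A" "b \<in> carrier A" "expn e \<subseteq> V" "expn f \<subseteq> V"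
  then show "pmap \<phi> (pmono A (e + f) (a \<otimes>\<^bsub>A\<^esub> b)) = pmap \<phi> (pmono A e a) \<otimes>\<^bsub>poly_alg V B\<^esub> pmap \<phi> (pmono A f b)"
    using B by (simp add: pmap_pmono[of \<phi> A B, OF z] pmono_mult alg_hom_closed[OF \<phi>] alg_homD[OF \<phi>])
qed

lemma pmap_comp: "pmap \<psi> (pmap \<phi> x) = pmap (\<psi> \<circ> \<phi>) x"
  by (simp add: pmap_def)

lemma pmap_zsc:
  assumes "\<phi> \<in> add_hom A B" "is_algebra A" "is_algebra B" "a \<in> carrier A"
  shows "pmap \<phi> (zsc A p a) = zsc B p (\<phi> a)"
  by (simp add: pmap_def zsc_def add_hom_zmul[OF assms])

lemma pmap_tensor_map:
  assumes A: "is_algebra A" and B: "is_algebra B" and f: "f \<in> add_hom A B" and x: "x \<in> carrier (poly_alg V A)"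
  shows "pmap f (tensor_map A \<phi> x) = tensor_map B \<phi> (pmap f x)"
proof -
  interpret B: abelian_group B using B by (rule algebra_abelian_group)
  have c: "coef x e \<in> carrier A" and fin: "finite (psupp A x)" for e using x by (auto simp: poly_carrier fsa_simps psupp_def)
  note z = add_hom_zero[OF f A B]
  have "f (\<Oplus>\<^bsub>A\<^esub>e\<in>psupp A x. zmul A (Poly_Mapping.lookup (\<phi> e) k) (coef x e)) =
    (\<Oplus>\<^bsub>B\<^esub>e\<in>psupp B (pmap f x). zmul B (Poly_Mapping.lookup (\<phi> e) k) (f (coef x e)))" for k
  proof -
    have "f (\<Oplus>\<^bsub>A\<^esub>e\<in>psupp A x. zmul A (Poly_Mapping.lookup (\<phi> e) k) (coef x e)) =
      (\<Oplus>\<^bsub>B\<^esub>e\<in>psupp A x. f (zmul A (Poly_Mapping.lookup (\<phi> e) k) (coef x e)))"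
      using c A by (intro add_hom_finsum[OF f A B]) auto
    also have "\<dots> = (\<Oplus>\<^bsub>B\<^esub>e\<in>psupp B (pmap f x). zmul B (Poly_Mapping.lookup (\<phi> e) k) (f (coef x e)))"
      by (rule B.add.finprod_mono_neutral_cong_right[OF fin])
        (use c z B in \<open>auto simp: psupp_def add_hom_zmul[OF f A B] add_hom_closed[OF f]\<close>)
    finally show ?thesis .
  qed
  then show ?thesis by (simp add: pmap_def tensor_map_def)
qed

lemma pmap_subalg:
  assumes "subalg S E" shows "subalg (poly_alg V S) (poly_alg V E)"
proof -
  have S: "is_algebra S" and E: "is_algebra E" and i: "id \<in> alg_hom S E" using assms by (auto simp: subalg_def)
  have "id \<in> alg_hom (poly_alg V S) (poly_alg V E)"
    using pmap_alg_hom[OF S E i] by (rule alg_hom_cong) (auto simp: pmap_def poly_carrier poly_algebra[OF S])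
  then show ?thesis using S E by (simp add: subalg_def poly_algebra)
qed

end

section \<open>Polynomial homotopies\<close>

context kk_setting
begin

text \<open>The parameter of a path and that of the reversed path.\<close>

definition \<tau> :: "bool \<Rightarrow> zpoly" where
  "\<tau> b = (if b then zvar 0 else 1 - zvar 0)"

lemma tau_compl: "1 - \<tau> b = \<tau> (\<not> b)" by (simp add: \<tau>_def)

lemma vars_in_tau [simp]: "vars_in {0} (\<tau> b)" by (simp add: \<tau>_def vars_in_diff)

lemma poly1_algebra [simp]: "is_algebra A \<Longrightarrow> is_algebra (poly1 A)"
  unfolding poly1_def by (rule poly_algebra)

lemma ev_alg_hom: "is_algebra A \<Longrightarrow> ev A c \<in> alg_hom (poly1 A) A"
  unfolding poly1_def by (rule ev_hom(1))

lemma pmap_poly1: "is_algebra A \<Longrightarrow> is_algebra B \<Longrightarrow> f \<in> alg_hom A B \<Longrightarrow> pmap f \<in> alg_hom (poly1 A) (poly1 B)"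
  unfolding poly1_def by (rule pmap_alg_hom)

lemma zsc_poly1_closed [simp]: "is_algebra A \<Longrightarrow> vars_in {0} p \<Longrightarrow> a \<in> carrier A \<Longrightarrow> zsc A p a \<in> carrier (poly1 A)"
  unfolding poly1_def by (rule zsc_closed)

lemma zsc_poly1_bimod: "is_algebra A \<Longrightarrow> vars_in {0} p \<Longrightarrow> zsc A p \<in> bimod_hom A (poly1 A)"
  unfolding poly1_def by (rule zsc_bimod_hom)

lemma zsc_poly1_und: "is_algebra A \<Longrightarrow> vars_in {0} p \<Longrightarrow> zsc A p \<in> und_hom A (poly1 A)"
  by (intro bimod_hom_und_hom zsc_poly1_bimod)

lemma zsc_poly1_zero: "is_algebra A \<Longrightarrow> zsc A p \<zero>\<^bsub>A\<^esub> = \<zero>\<^bsub>poly1 A\<^esub>"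
  unfolding poly1_def by (rule zsc_zero_right)

lemma zsc_poly1_diff:
  "is_algebra A \<Longrightarrow> a \<in> carrier A \<Longrightarrow> vars_in {0} p \<Longrightarrow> vars_in {0} q \<Longrightarrow> zsc A (p - q) a = zsc A p a \<ominus>\<^bsub>poly1 A\<^esub> zsc A q a"
  unfolding poly1_def by (rule zsc_diff)

lemma zsc_one_alg_hom: "is_algebra A \<Longrightarrow> zsc A 1 \<in> alg_hom A (poly1 A)"
  using zsc_mult[where A = A and p = 1 and q = 1 and V = "{0}"] by (simp add: alg_hom_iff zsc_poly1_bimod flip: poly1_def)

lemma ev_zsc_basic:
  assumes A: "is_algebra A" and a: "a \<in> carrier A"
  shows "ev A c (zsc A 1 a) = a" "ev A c (zsc A (zvar 0) a) = zmul A c a"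
proof -
  have "ev A c (zsc A (frag_of e) a) = zmul A (c ^ Poly_Mapping.lookup e 0) a" for e
    using A a by (simp add: zsc_frag_of ev_hom(2))
  from this[of 0] this[of "Poly_Mapping.single 0 1"]
  show "ev A c (zsc A 1 a) = a" "ev A c (zsc A (zvar 0) a) = zmul A c a"
    using A a by (simp_all add: zvar_def)
qed

lemma ev_zsc_tau:
  assumes A: "is_algebra A" and a: "a \<in> carrier A"
  shows "ev A 0 (zsc A (\<tau> b) a) = (if b then \<zero>\<^bsub>A\<^esub> else a)"
    and "ev A 1 (zsc A (\<tau> b) a) = (if b then a else \<zero>\<^bsub>A\<^esub>)"
  using A a add_hom_diff[OF alg_hom_add_hom[OF ev_alg_hom[OF A]] poly1_algebra[OF A] A]
  by (auto simp: \<tau>_def zsc_poly1_diff ev_zsc_basic)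

lemma ev_pmap:
  assumes A: "is_algebra A" and B: "is_algebra B" and f: "f \<in> add_hom A B" and x: "x \<in> carrier (poly_alg V A)"
  shows "ev B c (pmap f x) = f (ev A c x)"
proof -
  have "(ev B c \<circ> pmap f) x = (f \<circ> ev A c) x"
  proof (rule poly_add_hom_eqI[OF A _ _ _ x])
    show "ev B c \<circ> pmap f \<in> add_hom (poly_alg V A) B"
      by (rule add_hom_comp[OF pmap_add_hom[OF A B f] alg_hom_add_hom[OF ev_hom(1)[OF B]]])
    show "f \<circ> ev A c \<in> add_hom (poly_alg V A) B"
      by (rule add_hom_comp[OF alg_hom_add_hom[OF ev_hom(1)[OF A]] f])
    fix e a assume a: "a \<in> carrier A"
    show "(ev B c \<circ> pmap f) (pmono A e a) = (f \<circ> ev A c) (pmono A e a)"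
      using a by (simp add: pmap_pmono[of f A B, OF add_hom_zero[OF f A B]] ev_hom(2)[OF A] ev_hom(2)[OF B]
        add_hom_closed[OF f] add_hom_zmul[OF f A B])
  qed
  then show ?thesis by simp
qed

lemma ev_subalg:
  assumes "subalg S E" "x \<in> carrier (poly_alg V S)"
  shows "ev E c x = ev S c x"
proof -
  have "pmap id x = x" using assms(2) by (auto simp: pmap_def poly_carrier)
  then show ?thesis
    using ev_pmap[of S E id x V c] assms alg_hom_add_hom by (auto simp: subalg_def)
qed

lemma zsc_subalg:
  assumes "subalg S E" "x \<in> carrier S" shows "zsc S p x = zsc E p x"
proof -
  have S: "is_algebra S" "is_algebra E" and i: "id \<in> add_hom S E"
    using assms(1) alg_hom_add_hom unfolding subalg_def by blast+
  show ?thesis using add_hom_zmul[OF i S assms(2)] by (simp add: zsc_def)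
qed

lemma poly_subalg_mem:
  assumes "subalg S E" "z \<in> carrier (poly_alg V E)" "\<And>e. coef z e \<in> carrier S"
  shows "z \<in> carrier (poly_alg V S)"
  using assms(2,3) subalg_zero[OF assms(1)] by (simp add: poly_carrier fsa_simps)

lemma poly1_subalg: "subalg S E \<Longrightarrow> subalg (poly1 S) (poly1 E)"
  unfolding poly1_def by (rule pmap_subalg)

lemma pmap_eq_zero: "pmap f z = \<zero>\<^bsub>poly1 B\<^esub> \<Longrightarrow> f (coef z e) = \<zero>\<^bsub>B\<^esub>"
  by (auto simp: pmap_def poly1_def poly_ops dest: fun_cong)

lemma poly1_J_mem:
  assumes "is_algebra X" "z \<in> carrier (poly1 (T X))" "pmap (counit X) z = \<zero>\<^bsub>poly1 X\<^esub>"
  shows "z \<in> carrier (poly1 (J X))"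
  using pmap_eq_zero[OF assms(3)] poly_subalg_mem[OF J_subalg[OF assms(1)], of z "{0}"] assms(2)
  by (auto simp: poly1_def J_carrier) (auto simp: poly_carrier fsa_simps)

lemma T_lift_subalg:
  assumes "subalg S E" "is_algebra X" "y \<in> und_hom X S" "x \<in> carrier (T X)"
  shows "T_lift E y x = T_lift S y x"
  using T_lift_natural[of X S E y id x] assms by (simp add: subalg_def)

lemma T_lift_zero:
  assumes "is_algebra X" "is_algebra E" "x \<in> carrier (T X)"
  shows "T_lift E (\<lambda>_. \<zero>\<^bsub>E\<^esub>) x = \<zero>\<^bsub>E\<^esub>"
  using T_lift_of_hom[OF assms(1,2) zero_alg_hom[OF assms(2)] assms(3)] .

lemma T_lift_T_unit:
  assumes "is_algebra X" "x \<in> carrier (T X)" shows "T_lift (T X) (T_unit X) x = x"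
  using T_lift_eqI[OF assms(1) T_algebra T_unit_und_hom alg_hom_id _ assms(2)] by simp

lemma elem_homotopic_cong:
  assumes "is_algebra B" "f \<in> alg_hom A B" "\<And>x. x \<in> carrier A \<Longrightarrow> g x = f x"
  shows "elem_homotopic A B f g" "elem_homotopic A B g f"
proof -
  have h: "zsc B 1 \<circ> f \<in> alg_hom A (poly1 B)" by (rule alg_hom_comp[OF assms(2) zsc_one_alg_hom[OF assms(1)]])
  show "elem_homotopic A B f g" "elem_homotopic A B g f"
    unfolding elem_homotopic_def
    by (rule bexI[OF _ h], use assms in \<open>simp add: ev_zsc_basic alg_hom_closed\<close>)+
qed

lemma elem_homotopic_comp:
  assumes "is_algebra B" "is_algebra C" "elem_homotopic A B f g" "k \<in> alg_hom B C"
  shows "elem_homotopic A C (k \<circ> f) (k \<circ> g)"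
proof -
  obtain h where h: "h \<in> alg_hom A (poly1 B)" "\<And>a. a \<in> carrier A \<Longrightarrow> ev B 0 (h a) = f a \<and> ev B 1 (h a) = g a"
    using assms(3) unfolding elem_homotopic_def by blast
  have "h a \<in> carrier (poly_alg {0} B)" if "a \<in> carrier A" for a using alg_hom_closed[OF h(1) that] by (simp add: poly1_def)
  then show ?thesis unfolding elem_homotopic_def
    by (intro bexI[OF _ alg_hom_comp[OF h(1) pmap_poly1[OF assms(1,2,4)]]])
      (simp add: h(2) ev_pmap[OF assms(1,2) alg_hom_add_hom[OF assms(4)], where V = "{0}"])
qed

lemma elem_homotopic_precomp:
  assumes "elem_homotopic A B f g" "k \<in> alg_hom Z A"
  shows "elem_homotopic Z B (f \<circ> k) (g \<circ> k)"
proof -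
  obtain h where h: "h \<in> alg_hom A (poly1 B)" "\<And>a. a \<in> carrier A \<Longrightarrow> ev B 0 (h a) = f a \<and> ev B 1 (h a) = g a"
    using assms(1) unfolding elem_homotopic_def by blast
  show ?thesis unfolding elem_homotopic_def
    by (rule bexI[OF _ alg_hom_comp[OF assms(2) h(1)]]) (simp add: h(2) alg_hom_closed[OF assms(2)])
qed

section \<open>Sections and homotopies on free algebras\<close>

text \<open>The insertion of generators normalised to preserve zero. When the underlying category is that
  of sets, the insertion does not do so, and only the normalised map acts on polynomials
  coefficient by coefficient.\<close>

definition sig :: "('h, 'a) ualg \<Rightarrow> ('h, 'a) univ \<Rightarrow> ('h, 'a) univ" where
  "sig X a = T_unit X a \<ominus>\<^bsub>T X\<^esub> T_unit X \<zero>\<^bsub>X\<^esub>"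

lemma sig_zero: "is_algebra X \<Longrightarrow> sig X \<zero>\<^bsub>X\<^esub> = \<zero>\<^bsub>T X\<^esub>"
  by (simp add: sig_def T_algebra)

lemma counit_sig: "is_algebra X \<Longrightarrow> a \<in> carrier X \<Longrightarrow> counit X (sig X a) = a"
  by (simp add: sig_def add_hom_diff[OF alg_hom_add_hom[OF counit_hom] T_algebra] counit_unit)

lemma const_und_hom:
  assumes "is_algebra X" "is_algebra E" "f \<in> und_hom X E"
  shows "(\<lambda>_. f \<zero>\<^bsub>X\<^esub>) \<in> und_hom X E"
proof (cases "und = Sets")
  case True then show ?thesis using und_hom_closed[OF assms(3), of "\<zero>\<^bsub>X\<^esub>"] assms(1) unfolding und_hom_def by simp
next
  case False
  then have "f \<in> add_hom X E" using assms(3) unfolding und_hom_def add_hom_def by blast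
  then have "f \<zero>\<^bsub>X\<^esub> = \<zero>\<^bsub>E\<^esub>" using add_hom_zero assms by blast
  then show ?thesis using bimod_hom_und_hom[OF zero_bimod_hom[OF assms(2)]] by simp
qed

lemma sig_und_hom: "is_algebra X \<Longrightarrow> sig X \<in> und_hom X (T X)"
  unfolding sig_def
  by (intro und_hom_diff T_algebra T_unit_und_hom const_und_hom)

text \<open>A lift of a polynomial along the counit with prescribed values at \<open>0\<close> and \<open>1\<close>. The corrections
  are invisible after the counit if the prescribed values lift those of \<open>p\<close>.\<close>

definition clift :: "('h, 'a) ualg \<Rightarrow> ('h, 'a) univ \<Rightarrow> ('h, 'a) univ \<Rightarrow> ('h, 'a) univ \<Rightarrow> ('h, 'a) univ" where
  "clift X c0 c1 p = (pmap (sig X) p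
     \<oplus>\<^bsub>poly1 (T X)\<^esub> zsc (T X) (\<tau> False) (c0 \<ominus>\<^bsub>T X\<^esub> ev (T X) 0 (pmap (sig X) p)))
     \<oplus>\<^bsub>poly1 (T X)\<^esub> zsc (T X) (\<tau> True) (c1 \<ominus>\<^bsub>T X\<^esub> ev (T X) 1 (pmap (sig X) p))"

lemma pmap_sig_und_hom: "is_algebra X \<Longrightarrow> pmap (sig X) \<in> und_hom (poly1 X) (poly1 (T X))"
  unfolding poly1_def by (intro pmap_und_hom sig_und_hom sig_zero)

lemma clift_und_hom:
  assumes X: "is_algebra X" and Z: "is_algebra Z" and y: "y \<in> und_hom Z (poly1 X)"
    and c0: "c0 \<in> und_hom Z (T X)" and c1: "c1 \<in> und_hom Z (T X)"
  shows "(\<lambda>z. clift X (c0 z) (c1 z) (y z)) \<in> und_hom Z (poly1 (T X))"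
proof -
  note TX = T_algebra[of X] and P = poly1_algebra[OF T_algebra[of X]]
  have s: "(\<lambda>z. pmap (sig X) (y z)) \<in> und_hom Z (poly1 (T X))"
    using und_hom_comp[OF y pmap_sig_und_hom[OF X]] by (simp add: comp_def)
  have e: "(\<lambda>z. ev (T X) c (pmap (sig X) (y z))) \<in> und_hom Z (T X)" for c
    using und_hom_comp[OF s alg_hom_und_hom[OF ev_alg_hom[OF TX]]] by (simp add: comp_def)
  have d: "(\<lambda>z. zsc (T X) (\<tau> b) (k z \<ominus>\<^bsub>T X\<^esub> ev (T X) c (pmap (sig X) (y z)))) \<in> und_hom Z (poly1 (T X))"
    if "k \<in> und_hom Z (T X)" for b c k
    using und_hom_comp[OF und_hom_diff[OF TX Z that e] zsc_poly1_und[OF TX vars_in_tau]] by (simp add: comp_def)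
  show ?thesis unfolding clift_def by (intro und_hom_add P Z s d c0 c1)
qed

lemma clift:
  assumes X: "is_algebra X" and p: "p \<in> carrier (poly1 X)" and c: "c0 \<in> carrier (T X)" "c1 \<in> carrier (T X)"
  shows "clift X c0 c1 p \<in> carrier (poly1 (T X))"
    and "ev (T X) 0 (clift X c0 c1 p) = c0" and "ev (T X) 1 (clift X c0 c1 p) = c1"
    and "counit X c0 = ev X 0 p \<Longrightarrow> counit X c1 = ev X 1 p \<Longrightarrow> pmap (counit X) (clift X c0 c1 p) = p"
proof -
  note TX = T_algebra[of X] and P = poly1_algebra[OF T_algebra[of X]] and PX = poly1_algebra[OF X]
  note [simp] = TX P X
  have s [simp]: "pmap (sig X) p \<in> carrier (poly1 (T X))" by (rule und_hom_closed[OF pmap_sig_und_hom[OF X] p])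
  have e [simp]: "ev (T X) i (pmap (sig X) p) \<in> carrier (T X)" for i by (rule alg_hom_closed[OF ev_alg_hom[OF TX] s])
  show "clift X c0 c1 p \<in> carrier (poly1 (T X))" using c by (simp add: clift_def)
  note ea = alg_homD(1)[OF ev_alg_hom[OF TX]]
  show "ev (T X) 0 (clift X c0 c1 p) = c0" "ev (T X) 1 (clift X c0 c1 p) = c1"
    using c by (simp_all add: clift_def ea ev_zsc_tau algebra_add_diff_cancel)
  have pc: "pmap (counit X) \<in> alg_hom (poly1 (T X)) (poly1 X)" by (rule pmap_poly1[OF TX X counit_hom[OF X]])
  note pa = alg_homD(1)[OF pc]
  have cs: "pmap (counit X) (pmap (sig X) p) = p"
    using p by (auto simp: pmap_comp poly1_def poly_carrier fsa_simps counit_sig pmap_def)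
  have ce: "counit X (ev (T X) i (pmap (sig X) p)) = ev X i p" for i
    using ev_pmap[OF TX X alg_hom_add_hom[OF counit_hom[OF X]], of "pmap (sig X) p" "{0}" i] s cs by (simp add: poly1_def)
  assume a: "counit X c0 = ev X 0 p" "counit X c1 = ev X 1 p"
  have ei: "ev X i p \<in> carrier X" for i by (rule alg_hom_closed[OF ev_alg_hom[OF X] p])
  show "pmap (counit X) (clift X c0 c1 p) = p"
    using c a p by (simp add: clift_def pa cs pmap_zsc[OF alg_hom_add_hom[OF counit_hom[OF X]]]
      add_hom_diff[OF alg_hom_add_hom[OF counit_hom[OF X]]] ce ei zsc_poly1_zero)
qed

text \<open>The homotopy \<open>h\<close> is lifted along the counit with the given ends and extended to the free algebra. After
  the counit the lift is the homomorphism \<open>h\<close>, so \<open>T_lift_kernel\<close> places the extension over \<open>J B\<close>.\<close>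

lemma J_homotopy:
  assumes A: "is_algebra A" and B: "is_algebra B" and h: "h \<in> alg_hom A (poly1 B)"
    and c0: "c0 \<in> und_hom A (T B)" and c1: "c1 \<in> und_hom A (T B)"
    and e0: "\<And>a. a \<in> carrier A \<Longrightarrow> counit B (c0 a) = ev B 0 (h a)"
    and e1: "\<And>a. a \<in> carrier A \<Longrightarrow> counit B (c1 a) = ev B 1 (h a)"
  shows "elem_homotopic (J A) (J B) (T_lift (T B) c0) (T_lift (T B) c1)"
proof -
  let ?y = "\<lambda>a. clift B (c0 a) (c1 a) (h a)"
  note TB = T_algebra[of B] and P = poly1_algebra[OF T_algebra[of B]]
  have y: "?y \<in> und_hom A (poly1 (T B))" by (rule clift_und_hom[OF B A alg_hom_und_hom[OF h] c0 c1])
  let ?Y = "T_lift (poly1 (T B)) ?y"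
  have Y: "?Y \<in> alg_hom (J A) (poly1 (T B))" by (rule alg_hom_restrict[OF J_subalg[OF A] T_lift_hom[OF P y A]])
  have cl: "h a \<in> carrier (poly1 B)" "c0 a \<in> carrier (T B)" "c1 a \<in> carrier (T B)" if "a \<in> carrier A" for a
    using that alg_hom_closed[OF h] und_hom_closed[OF c0] und_hom_closed[OF c1] by auto
  have mem: "?Y x \<in> carrier (poly1 (J B))" if x: "x \<in> carrier (J A)" for x
    by (rule poly1_J_mem[OF B alg_hom_closed[OF Y x] T_lift_kernel[OF A P poly1_algebra[OF B] y pmap_poly1[OF TB B counit_hom[OF B]] h _ x]])
      (simp add: clift(4)[OF B cl] e0 e1)
  have Y': "?Y \<in> alg_hom (J A) (poly1 (J B))"
    by (rule alg_hom_into_subalg[OF poly1_subalg[OF J_subalg[OF B]] Y mem])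
  have "ev (J B) i (?Y x) = T_lift (T B) (if i = 0 then c0 else c1) x" if x: "x \<in> carrier (J A)" and i: "i = 0 \<or> i = 1" for x i
  proof -
    have xT: "x \<in> carrier (T A)" using x by (simp add: J_carrier)
    have "ev (J B) i (?Y x) = ev (T B) i (?Y x)"
      using ev_subalg[OF J_subalg[OF B]] mem[OF x] by (simp add: poly1_def)
    also have "\<dots> = T_lift (T B) (ev (T B) i \<circ> ?y) x" by (rule T_lift_natural[OF A P TB y ev_alg_hom[OF TB] xT])
    also have "\<dots> = T_lift (T B) (if i = 0 then c0 else c1) x"
      by (rule T_lift_cong[OF A TB _ und_hom_comp[OF y alg_hom_und_hom[OF ev_alg_hom[OF TB]]] _ xT])
        (use i c0 c1 in \<open>auto simp: clift(2,3)[OF B cl]\<close>)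
    finally show ?thesis .
  qed
  then show ?thesis unfolding elem_homotopic_def by (intro bexI[OF _ Y']) simp
qed

lemma J_map_homotopic:
  assumes A: "is_algebra A" and B: "is_algebra B" and f: "f \<in> alg_hom A B" and g: "g \<in> alg_hom A B"
    and fg: "elem_homotopic A B f g"
  shows "elem_homotopic (J A) (J B) (J_map B f) (J_map B g)"
proof -
  obtain h where h: "h \<in> alg_hom A (poly1 B)" "\<And>a. a \<in> carrier A \<Longrightarrow> ev B 0 (h a) = f a \<and> ev B 1 (h a) = g a"
    using fg unfolding elem_homotopic_def by blast
  show ?thesis unfolding J_map_def
    by (rule J_homotopy[OF A B h(1) und_hom_comp[OF alg_hom_und_hom[OF f] T_unit_und_hom]
          und_hom_comp[OF alg_hom_und_hom[OF g] T_unit_und_hom]])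
      (simp_all add: h(2) counit_unit[OF B] alg_hom_closed[OF f] alg_hom_closed[OF g])
qed

definition contractible :: "('h, 'a) ualg \<Rightarrow> bool" where
  "contractible X \<longleftrightarrow> elem_homotopic X X (\<lambda>_. \<zero>\<^bsub>X\<^esub>) id"

lemma contractible_J:
  assumes X: "is_algebra X" and c: "contractible X" shows "contractible (J X)"
proof -
  note JX = J_algebra[OF X]
  obtain h where h: "h \<in> alg_hom X (poly1 X)" "\<And>a. a \<in> carrier X \<Longrightarrow> ev X 0 (h a) = \<zero>\<^bsub>X\<^esub> \<and> ev X 1 (h a) = a"
    using c unfolding elem_homotopic_def contractible_def by auto
  have "elem_homotopic (J X) (J X) (T_lift (T X) (\<lambda>_. \<zero>\<^bsub>T X\<^esub>)) (T_lift (T X) (T_unit X))"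
    by (rule J_homotopy[OF X X h(1) bimod_hom_und_hom[OF zero_bimod_hom[OF T_algebra]] T_unit_und_hom])
      (simp_all add: h(2) counit_unit[OF X] add_hom_zero[OF alg_hom_add_hom[OF counit_hom[OF X]] T_algebra X])
  then show ?thesis unfolding contractible_def elem_homotopic_def
    by (simp add: J_carrier T_lift_zero[OF X T_algebra] T_lift_T_unit[OF X] subalg_zero[OF J_subalg[OF X]])
qed

lemma contractible_homotopic_zero:
  assumes "is_algebra X" "is_algebra D" "contractible X" "f \<in> alg_hom X D"
  shows "elem_homotopic X D (\<lambda>_. \<zero>\<^bsub>D\<^esub>) f"
  using elem_homotopic_comp[OF assms(1,2) assms(3)[unfolded contractible_def] assms(4)]
    add_hom_zero[OF alg_hom_add_hom[OF assms(4)] assms(1,2)] by (simp add: comp_def)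

section \<open>Polynomial loops\<close>

text \<open>The loop algebra \<open>\<Omega> X\<close> in its polynomial form. All homotopies are constructed here; simplicial loops
  enter only when the results are transferred to kk.\<close>

definition Om :: "('h, 'a) ualg \<Rightarrow> ('h, 'a) ualg" where
  "Om X = (poly1 X)\<lparr>carrier := {p \<in> carrier (poly1 X). ev X 0 p = \<zero>\<^bsub>X\<^esub> \<and> ev X 1 p = \<zero>\<^bsub>X\<^esub>}\<rparr>"

lemma Om_carrier: "p \<in> carrier (Om X) \<longleftrightarrow> p \<in> carrier (poly1 X) \<and> ev X 0 p = \<zero>\<^bsub>X\<^esub> \<and> ev X 1 p = \<zero>\<^bsub>X\<^esub>"
  by (simp add: Om_def)

lemma Om_subalg: assumes X: "is_algebra X" shows "subalg (Om X) (poly1 X)"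
proof -
  note P = poly1_algebra[OF X]
  note e = ev_alg_hom[OF X]
  note e0 = add_hom_zero[OF alg_hom_add_hom[OF e] P X] and en = add_hom_neg[OF alg_hom_add_hom[OF e] P X]
  have "is_algebra (Om X) \<and> id \<in> alg_hom (Om X) (poly1 X)" unfolding Om_def
    by (intro conjI; rule sub_algebra; use P X in \<open>auto simp: e0 en alg_homD[OF e] alg_hom_closed[OF e]\<close>)
  then show ?thesis using P by (simp add: subalg_def)
qed

lemma Om_algebra: "is_algebra X \<Longrightarrow> is_algebra (Om X)"
  using Om_subalg unfolding subalg_def by blast

lemma Om_map:
  assumes X: "is_algebra X" and Y: "is_algebra Y" and f: "f \<in> alg_hom X Y"
  shows "pmap f \<in> alg_hom (Om X) (Om Y)"
proof (rule alg_hom_into_subalg[OF Om_subalg[OF Y] alg_hom_restrict[OF Om_subalg[OF X] pmap_poly1[OF X Y f]]])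
  fix p assume p: "p \<in> carrier (Om X)"
  then show "pmap f p \<in> carrier (Om Y)"
    using alg_hom_closed[OF pmap_poly1[OF X Y f]] ev_pmap[OF X Y alg_hom_add_hom[OF f], of p "{0}"]
      add_hom_zero[OF alg_hom_add_hom[OF f] X Y]
    by (simp add: Om_carrier flip: poly1_def)
qed

text \<open>The suspension map from \<open>J X\<close> to \<open>\<Omega> X\<close>, induced by \<open>a \<mapsto> \<tau> a\<close>; for \<open>b = False\<close> the loops are reversed.\<close>

definition rho' :: "bool \<Rightarrow> ('h, 'a) ualg \<Rightarrow> ('h, 'a) univ \<Rightarrow> ('h, 'a) univ" where
  "rho' b X = T_lift (poly1 X) (zsc X (\<tau> b))"

lemma rho'_T_hom: "is_algebra X \<Longrightarrow> rho' b X \<in> alg_hom (T X) (poly1 X)"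
  unfolding rho'_def by (intro T_lift_hom poly1_algebra zsc_poly1_und vars_in_tau)

lemma ev_rho':
  assumes X: "is_algebra X" and x: "x \<in> carrier (T X)"
  shows "ev X 0 (rho' b X x) = (if b then \<zero>\<^bsub>X\<^esub> else counit X x)"
    and "ev X 1 (rho' b X x) = (if b then counit X x else \<zero>\<^bsub>X\<^esub>)"
proof -
  have *: "ev X i (rho' b X x) = (if c then \<zero>\<^bsub>X\<^esub> else counit X x)"
    if c: "\<And>a. a \<in> carrier X \<Longrightarrow> ev X i (zsc X (\<tau> b) a) = (if c then \<zero>\<^bsub>X\<^esub> else a)" for i c
  proof -
    note P = poly1_algebra[OF X] and z = zsc_poly1_und[OF X vars_in_tau[of b]]
    have "ev X i (rho' b X x) = T_lift X (ev X i \<circ> zsc X (\<tau> b)) x"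
      unfolding rho'_def by (rule T_lift_natural[OF X P X z ev_alg_hom[OF X] x])
    also have "\<dots> = T_lift X (if c then (\<lambda>_. \<zero>\<^bsub>X\<^esub>) else id) x"
      by (rule T_lift_cong[OF X X _ und_hom_comp[OF z alg_hom_und_hom[OF ev_alg_hom[OF X]]] _ x])
        (use X in \<open>auto simp: that intro: bimod_hom_und_hom[OF zero_bimod_hom] alg_hom_und_hom alg_hom_id\<close>)
    finally show ?thesis using T_lift_zero[OF X X x] by (simp add: counit_def)
  qed
  show "ev X 0 (rho' b X x) = (if b then \<zero>\<^bsub>X\<^esub> else counit X x)" by (rule *) (simp add: ev_zsc_tau[OF X])
  show "ev X 1 (rho' b X x) = (if b then counit X x else \<zero>\<^bsub>X\<^esub>)" using *[of 1 "\<not> b"] by (simp add: ev_zsc_tau[OF X])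
qed

lemma rho'_hom:
  assumes X: "is_algebra X" shows "rho' b X \<in> alg_hom (J X) (Om X)"
proof (rule alg_hom_into_subalg[OF Om_subalg[OF X] alg_hom_restrict[OF J_subalg[OF X] rho'_T_hom[OF X]]])
  fix x assume x: "x \<in> carrier (J X)"
  then show "rho' b X x \<in> carrier (Om X)"
    using alg_hom_closed[OF rho'_T_hom[OF X]] by (simp add: Om_carrier J_carrier ev_rho'[OF X])
qed

lemma rho'_natural:
  assumes X: "is_algebra X" and Y: "is_algebra Y" and f: "f \<in> alg_hom X Y" and x: "x \<in> carrier (T X)"
  shows "rho' b Y (J_map Y f x) = pmap f (rho' b X x)"
proof -
  note u = alg_hom_und_hom[OF f] and z = zsc_poly1_und[OF Y vars_in_tau[of b]] and z' = zsc_poly1_und[OF X vars_in_tau[of b]]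
  note pf = pmap_poly1[OF X Y f]
  have "rho' b Y (J_map Y f x) = T_lift (poly1 Y) (zsc Y (\<tau> b) \<circ> f) x"
    unfolding rho'_def by (rule T_lift_J_map[OF X Y poly1_algebra[OF Y] u z x])
  also have "\<dots> = T_lift (poly1 Y) (pmap f \<circ> zsc X (\<tau> b)) x"
    by (rule T_lift_cong[OF X poly1_algebra[OF Y] und_hom_comp[OF z' alg_hom_und_hom[OF pf]] und_hom_comp[OF u z] _ x])
      (simp add: pmap_zsc[OF alg_hom_add_hom[OF f] X Y])
  also have "\<dots> = pmap f (rho' b X x)"
    unfolding rho'_def by (rule T_lift_natural[OF X poly1_algebra[OF X] poly1_algebra[OF Y] z' pf x, symmetric])
  finally show ?thesis .
qed

lemma Om_J_subalg:
  assumes X: "is_algebra X" shows "subalg (Om (J X)) (poly1 (T X))"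
  by (rule subalg_trans[OF Om_subalg[OF J_algebra[OF X]] poly1_subalg[OF J_subalg[OF X]]])

lemma Om_J_mem:
  assumes X: "is_algebra X" and z: "z \<in> carrier (poly1 (T X))" "pmap (counit X) z = \<zero>\<^bsub>poly1 X\<^esub>"
    "ev (T X) 0 z = \<zero>\<^bsub>T X\<^esub>" "ev (T X) 1 z = \<zero>\<^bsub>T X\<^esub>"
  shows "z \<in> carrier (Om (J X))"
proof -
  have m: "z \<in> carrier (poly1 (J X))" by (rule poly1_J_mem[OF X z(1,2)])
  then show ?thesis
    using ev_subalg[OF J_subalg[OF X]] z subalg_zero[OF J_subalg[OF X]] by (simp add: Om_carrier poly1_def)
qed

text \<open>The map from \<open>J(\<Omega> X)\<close> to \<open>\<Omega>(J X)\<close> induced by lifting loops in \<open>X\<close> to loops in \<open>T X\<close>.\<close>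

definition Phi :: "('h, 'a) ualg \<Rightarrow> ('h, 'a) univ \<Rightarrow> ('h, 'a) univ" where
  "Phi X = T_lift (poly1 (T X)) (clift X \<zero>\<^bsub>T X\<^esub> \<zero>\<^bsub>T X\<^esub>)"

lemma clift0_und_hom:
  assumes X: "is_algebra X"
  shows "clift X \<zero>\<^bsub>T X\<^esub> \<zero>\<^bsub>T X\<^esub> \<in> und_hom (Om X) (poly1 (T X))"
proof -
  have i: "id \<in> und_hom (Om X) (poly1 X)" using Om_subalg[OF X] unfolding subalg_def by (blast intro: alg_hom_und_hom)
  have z: "(\<lambda>_. \<zero>\<^bsub>T X\<^esub>) \<in> und_hom (Om X) (T X)" by (rule bimod_hom_und_hom[OF zero_bimod_hom[OF T_algebra]])
  show ?thesis using clift_und_hom[OF X Om_algebra[OF X] i z z] by simp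
qed

lemma clift0:
  assumes X: "is_algebra X" and p: "p \<in> carrier (Om X)"
  shows "pmap (counit X) (clift X \<zero>\<^bsub>T X\<^esub> \<zero>\<^bsub>T X\<^esub> p) = p"
    "ev (T X) 0 (clift X \<zero>\<^bsub>T X\<^esub> \<zero>\<^bsub>T X\<^esub> p) = \<zero>\<^bsub>T X\<^esub>" "ev (T X) 1 (clift X \<zero>\<^bsub>T X\<^esub> \<zero>\<^bsub>T X\<^esub> p) = \<zero>\<^bsub>T X\<^esub>"
  using p clift[OF X, of p "\<zero>\<^bsub>T X\<^esub>" "\<zero>\<^bsub>T X\<^esub>"] add_hom_zero[OF alg_hom_add_hom[OF counit_hom[OF X]] T_algebra X]
  by (auto simp: Om_carrier T_algebra)

lemma Phi_hom:
  assumes X: "is_algebra X" shows "Phi X \<in> alg_hom (J (Om X)) (Om (J X))"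
proof -
  note O = Om_algebra[OF X] and TX = T_algebra[of X] and P = poly1_algebra[OF T_algebra[of X]] and PX = poly1_algebra[OF X]
  note u = clift0_und_hom[OF X]
  have i: "id \<in> alg_hom (Om X) (poly1 X)" using Om_subalg[OF X] by (simp add: subalg_def)
  have h: "Phi X \<in> alg_hom (J (Om X)) (poly1 (T X))"
    unfolding Phi_def by (rule alg_hom_restrict[OF J_subalg[OF O] T_lift_hom[OF P u O]])
  show ?thesis
  proof (rule alg_hom_into_subalg[OF Om_J_subalg[OF X] h], rule Om_J_mem[OF X])
    fix x assume x: "x \<in> carrier (J (Om X))"
    show "Phi X x \<in> carrier (poly1 (T X))" by (rule alg_hom_closed[OF h x])
    show "pmap (counit X) (Phi X x) = \<zero>\<^bsub>poly1 X\<^esub>" unfolding Phi_def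
      by (rule T_lift_kernel[OF O P PX u pmap_poly1[OF TX X counit_hom[OF X]] i _ x]) (simp add: clift0[OF X])
    show "ev (T X) 0 (Phi X x) = \<zero>\<^bsub>T X\<^esub>" "ev (T X) 1 (Phi X x) = \<zero>\<^bsub>T X\<^esub>" unfolding Phi_def
      by (rule T_lift_kernel[OF O P TX u ev_alg_hom[OF TX] zero_alg_hom[OF TX] _ x]; simp add: clift0[OF X])+
  qed
qed

text \<open>Suspension commutes with \<open>J\<close> up to homotopy and reversal of the loop. With homotopy parameter \<open>s\<close> and
  \<open>\<tau> = \<tau> b\<close>, the homotopy is induced by
  \<open>y(x) = W(x) - s (w(x) - u(x)) - (1 - s) (1 - \<tau>) x\<close>, where \<open>W\<close> and \<open>w\<close> are the homomorphisms on \<open>T X\<close> that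
  multiply generators by \<open>1 - s \<tau>\<close> and by \<open>1 - \<tau>\<close>, and \<open>u(x)\<close> lifts the reversed suspension of \<open>x\<close> to a loop
  in \<open>T X\<close>. For \<open>s = 0\<close> this is \<open>\<tau> x\<close> and for \<open>s = 1\<close> it is \<open>u(x)\<close>. On \<open>J X\<close> it coincides with the homomorphism \<open>W\<close>
  after the counit, because \<open>w\<close> and \<open>u\<close> do and the counit kills \<open>x\<close>; it also does so at \<open>\<tau> = 1\<close>, and it vanishes at
  \<open>\<tau> = 0\<close>. By \<open>T_lift_kernel\<close> the values of the induced map are therefore paths in \<open>\<Omega>(J X)\<close>.\<close>

lemma rho'_J_homotopic:
  assumes X: "is_algebra X"
  shows "elem_homotopic (J (J X)) (Om (J X)) (rho' b (J X)) (Phi X \<circ> J_map (Om X) (rho' (\<not> b) X))"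
proof -
  note JX = J_algebra[OF X] and TX = T_algebra[of X] and O = Om_algebra[OF X] and PX = poly1_algebra[OF X]
  note JS = J_subalg[OF X]
  define P where "P = poly1 (T X)"
  define Q where "Q = poly1 P"
  have P: "is_algebra P" and Q: "is_algebra Q" unfolding P_def Q_def using TX by simp_all
  note [simp] = P Q TX X PX JX
  note zP = zsc_poly1_und[OF P, folded Q_def] and zT = zsc_poly1_und[OF TX, folded P_def]
  have zPc [simp]: "vars_in {0} p \<Longrightarrow> q \<in> carrier P \<Longrightarrow> zsc P p q \<in> carrier Q" for p q
    using zsc_poly1_closed[OF P] by (simp add: Q_def)
  have zTc [simp]: "vars_in {0} p \<Longrightarrow> x \<in> carrier (T X) \<Longrightarrow> zsc (T X) p x \<in> carrier P" for p x
    using zsc_poly1_closed[OF TX] by (simp add: P_def)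
  let ?t = "zvar 0"
  define w2 where "w2 = (\<lambda>a. zsc P 1 (zsc (T X) 1 (T_unit X a)) \<ominus>\<^bsub>Q\<^esub> zsc P ?t (zsc (T X) (\<tau> b) (T_unit X a)))"
  have zz: "(\<lambda>a. zsc P p (zsc (T X) q (T_unit X a))) \<in> und_hom X Q" if "vars_in {0} p" "vars_in {0} q" for p q
    using und_hom_comp[OF und_hom_comp[OF T_unit_und_hom zT[OF that(2)]] zP[OF that(1)]] by (simp add: comp_def)
  have w2: "w2 \<in> und_hom X Q" unfolding w2_def by (intro und_hom_diff Q X zz) auto
  define W2 where "W2 = T_lift Q w2"
  have W2: "W2 \<in> alg_hom (T X) Q" unfolding W2_def by (rule T_lift_hom[OF Q w2 X])
  define w where "w = T_lift P (zsc (T X) (\<tau> (\<not> b)) \<circ> T_unit X)"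
  have wu: "zsc (T X) (\<tau> (\<not> b)) \<circ> T_unit X \<in> und_hom X P" by (rule und_hom_comp[OF T_unit_und_hom zT[OF vars_in_tau]])
  have w: "w \<in> alg_hom (T X) P" unfolding w_def by (rule T_lift_hom[OF P wu X])
  define r where "r = rho' (\<not> b) X"
  have r: "r \<in> alg_hom (J X) (Om X)" unfolding r_def by (rule rho'_hom[OF X])
  define u where "u = clift X \<zero>\<^bsub>T X\<^esub> \<zero>\<^bsub>T X\<^esub> \<circ> r"
  have u: "u \<in> und_hom (J X) P"
    unfolding u_def P_def by (rule und_hom_comp[OF alg_hom_und_hom[OF r] clift0_und_hom[OF X]])
  have wJ: "w \<in> und_hom (J X) P" by (rule alg_hom_und_hom[OF alg_hom_restrict[OF JS w]])
  define y where "y = (\<lambda>x. (W2 x \<ominus>\<^bsub>Q\<^esub> zsc P ?t (w x \<ominus>\<^bsub>P\<^esub> u x)) \<ominus>\<^bsub>Q\<^esub> zsc P (\<tau> False) (zsc (T X) (\<tau> (\<not> b)) x))"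
  have idJ: "id \<in> und_hom (J X) (T X)" using JS alg_hom_und_hom by (simp add: subalg_def)
  have y: "y \<in> und_hom (J X) Q"
  proof -
    have "(\<lambda>x. zsc P ?t (w x \<ominus>\<^bsub>P\<^esub> u x)) \<in> und_hom (J X) Q"
      using und_hom_comp[OF und_hom_diff[OF P JX wJ u] zP[of ?t]] by (simp add: comp_def)
    moreover have "(\<lambda>x. zsc P (\<tau> False) (zsc (T X) (\<tau> (\<not> b)) x)) \<in> und_hom (J X) Q"
      using und_hom_comp[OF und_hom_comp[OF idJ zT[of "\<tau> (\<not> b)"]] zP[of "\<tau> False"]] by (simp add: comp_def)
    ultimately show ?thesis unfolding y_def
      by (intro und_hom_diff Q JX alg_hom_und_hom[OF alg_hom_restrict[OF JS W2]])
  qed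
  define Y where "Y = T_lift Q y"
  have Y: "Y \<in> alg_hom (J (J X)) Q" unfolding Y_def by (rule alg_hom_restrict[OF J_subalg[OF JX] T_lift_hom[OF Q y JX]])
  have xT [simp]: "x \<in> carrier (T X)" if "x \<in> carrier (J X)" for x using that by (simp add: J_carrier)
  have Wc [simp]: "W2 x \<in> carrier Q" "w x \<in> carrier P" if "x \<in> carrier (T X)" for x
    using alg_hom_closed[OF W2 that] alg_hom_closed[OF w that] by auto
  have uc [simp]: "u x \<in> carrier P" if "x \<in> carrier (J X)" for x by (rule und_hom_closed[OF u that])
  have yF: "F (y x) = (F (W2 x) \<ominus>\<^bsub>C\<^esub> F (zsc P ?t (w x \<ominus>\<^bsub>P\<^esub> u x))) \<ominus>\<^bsub>C\<^esub> F (zsc P (\<tau> False) (zsc (T X) (\<tau> (\<not> b)) x))"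
    if "is_algebra C" "F \<in> alg_hom Q C" "x \<in> carrier (J X)" for F C x
    unfolding y_def using that add_hom_diff[OF alg_hom_add_hom[OF that(2)] Q that(1)] by simp
  have w2F: "F (W2 x) = T_lift C (F \<circ> w2) x" if "is_algebra C" "F \<in> alg_hom Q C" "x \<in> carrier (T X)" for F C x
    unfolding W2_def by (rule T_lift_natural[OF X Q that(1) w2 that(2,3)])
  have w2F': "F (w2 a) = F (zsc P 1 (zsc (T X) 1 (T_unit X a))) \<ominus>\<^bsub>C\<^esub> F (zsc P ?t (zsc (T X) (\<tau> b) (T_unit X a)))"
    if "is_algebra C" "F \<in> alg_hom Q C" "a \<in> carrier X" for F C a
    unfolding w2_def using that add_hom_diff[OF alg_hom_add_hom[OF that(2)] Q that(1)] by simp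
  have pm: "pmap f \<in> alg_hom Q (poly1 C)" "vars_in {0} p \<Longrightarrow> q \<in> carrier P \<Longrightarrow> pmap f (zsc P p q) = zsc C p (f q)"
    if "f \<in> alg_hom P C" "is_algebra C" for f C p q
    using pmap_poly1[OF P that(2,1)] pmap_zsc[OF alg_hom_add_hom[OF that(1)] P that(2)] by (simp_all add: Q_def)
  have evP: "ev (T X) i \<in> alg_hom P (T X)" for i unfolding P_def by (rule ev_alg_hom[OF TX])
  have evQ: "ev P i \<in> alg_hom Q P" for i unfolding Q_def by (rule ev_alg_hom[OF P])
  have pc: "pmap (counit X) \<in> alg_hom P (poly1 X)" unfolding P_def by (rule pmap_poly1[OF TX X counit_hom[OF X]])
  \<comment> \<open>values of the auxiliary paths\<close>
  have wr: "pmap (counit X) (w x) = rho' (\<not> b) X x" if "x \<in> carrier (T X)" for x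
  proof -
    have "pmap (counit X) (w x) = T_lift (poly1 X) (pmap (counit X) \<circ> (zsc (T X) (\<tau> (\<not> b)) \<circ> T_unit X)) x"
      unfolding w_def by (rule T_lift_natural[OF X P PX wu pc that])
    also have "\<dots> = rho' (\<not> b) X x" unfolding rho'_def
      by (rule T_lift_cong[OF X PX zsc_poly1_und[OF X vars_in_tau] und_hom_comp[OF wu alg_hom_und_hom[OF pc]] _ that])
        (simp add: pmap_zsc[OF alg_hom_add_hom[OF counit_hom[OF X]] TX X] counit_unit)
    finally show ?thesis .
  qed
  have we: "ev (T X) i (w x) = (if c then x else \<zero>\<^bsub>T X\<^esub>)"
    if x: "x \<in> carrier (T X)" and c: "\<And>a. a \<in> carrier (T X) \<Longrightarrow> ev (T X) i (zsc (T X) (\<tau> (\<not> b)) a) = (if c then a else \<zero>\<^bsub>T X\<^esub>)" for x i c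
  proof -
    have "ev (T X) i (w x) = T_lift (T X) (ev (T X) i \<circ> (zsc (T X) (\<tau> (\<not> b)) \<circ> T_unit X)) x"
      unfolding w_def by (rule T_lift_natural[OF X P TX wu evP x])
    also have "\<dots> = T_lift (T X) (if c then T_unit X else (\<lambda>_. \<zero>\<^bsub>T X\<^esub>)) x"
      by (rule T_lift_cong[OF X TX _ und_hom_comp[OF wu alg_hom_und_hom[OF evP]] _ x])
        (use c in \<open>auto intro: T_unit_und_hom bimod_hom_und_hom[OF zero_bimod_hom]\<close>)
    also have "\<dots> = (if c then x else \<zero>\<^bsub>T X\<^esub>)" using T_lift_T_unit[OF X x] T_lift_zero[OF X TX x] by simp
    finally show ?thesis .
  qed
  have uc0: "pmap (counit X) (u x) = r x" "ev (T X) 0 (u x) = \<zero>\<^bsub>T X\<^esub>" "ev (T X) 1 (u x) = \<zero>\<^bsub>T X\<^esub>" if "x \<in> carrier (J X)" for x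
    using clift0[OF X alg_hom_closed[OF r that]] by (simp_all add: u_def)
  have one_T: "T_lift C (f \<circ> T_unit X) x = f x" if "f \<in> alg_hom (T X) C" "is_algebra C" "x \<in> carrier (T X)" for f C x
    using T_lift_natural[OF X TX that(2) T_unit_und_hom that(1,3)] T_lift_T_unit[OF X that(3)] by simp
  \<comment> \<open>the values of \<open>Y\<close> have coefficients in loops in \<open>J X\<close>: they vanish after the counit and at both ends\<close>
  have k1: "pmap (pmap (counit X)) (Y z) = \<zero>\<^bsub>poly1 (poly1 X)\<^esub>" if z: "z \<in> carrier (J (J X))" for z
  proof -
    note F = pm(1)[OF pc PX] and Fz = pm(2)[OF pc PX]
    have g: "pmap (pmap (counit X)) \<circ> W2 \<in> alg_hom (J X) (poly1 (poly1 X))"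
      by (rule alg_hom_comp[OF alg_hom_restrict[OF JS W2] F])
    show ?thesis unfolding Y_def
    proof (rule T_lift_kernel[OF JX Q poly1_algebra[OF PX] y F g _ z])
      fix x assume x: "x \<in> carrier (J X)"
      have 1: "pmap (counit X) (w x \<ominus>\<^bsub>P\<^esub> u x) = \<zero>\<^bsub>poly1 X\<^esub>"
        using x alg_hom_closed[OF r x] subalg_carrier[OF Om_subalg[OF X], of "r x"]
        by (simp add: add_hom_diff[OF alg_hom_add_hom[OF pc] P PX] wr uc0 r_def)
      have 2: "pmap (counit X) (zsc (T X) (\<tau> (\<not> b)) x) = \<zero>\<^bsub>poly1 X\<^esub>"
        using x by (simp add: pmap_zsc[OF alg_hom_add_hom[OF counit_hom[OF X]] TX X] J_carrier zsc_poly1_zero)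
      show "pmap (pmap (counit X)) (y x) = (pmap (pmap (counit X)) \<circ> W2) x"
        unfolding yF[OF poly1_algebra[OF PX] F x] using x alg_hom_closed[OF F, of "W2 x"]
        by (simp add: Fz 1 2 zsc_poly1_zero)
    qed
  qed
  have k2: "pmap (ev (T X) i) (Y z) = \<zero>\<^bsub>poly1 (T X)\<^esub>" if z: "z \<in> carrier (J (J X))" and i: "i = 0 \<or> i = 1" for z i
  proof -
    note F = pm(1)[OF evP TX, folded P_def] and Fz = pm(2)[OF evP TX]
    define c where "c \<longleftrightarrow> (i = 0) = b"
    have ec: "ev (T X) i (zsc (T X) (\<tau> (\<not> b)) a) = (if c then a else \<zero>\<^bsub>T X\<^esub>)"
      "ev (T X) i (zsc (T X) (\<tau> b) a) = (if c then \<zero>\<^bsub>T X\<^esub> else a)" if "a \<in> carrier (T X)" for a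
      using i that by (auto simp: c_def ev_zsc_tau)
    have vi: "ev (T X) i (w x \<ominus>\<^bsub>P\<^esub> u x) = (if c then x else \<zero>\<^bsub>T X\<^esub>)" if x: "x \<in> carrier (J X)" for x
      using x i by (auto simp: add_hom_diff[OF alg_hom_add_hom[OF evP] P TX] we[OF _ ec(1)] uc0)
    show ?thesis
    proof (cases c)
      case True
      have W: "pmap (ev (T X) i) (W2 x) = zsc (T X) 1 x" if x: "x \<in> carrier (T X)" for x
      proof -
        have "pmap (ev (T X) i) (W2 x) = T_lift P (pmap (ev (T X) i) \<circ> w2) x" by (rule w2F[OF P F x])
        also have "\<dots> = T_lift P (zsc (T X) 1 \<circ> T_unit X) x"
          by (rule T_lift_cong[OF X P und_hom_comp[OF T_unit_und_hom zT] und_hom_comp[OF w2 alg_hom_und_hom[OF F]] _ x])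
            (use True in \<open>auto simp: w2F'[OF P F] Fz ec ev_zsc_basic zsc_poly1_zero[OF TX, folded P_def]\<close>)
        also have "\<dots> = zsc (T X) 1 x"
          by (rule one_T) (use zsc_one_alg_hom[OF TX] x in \<open>simp_all add: P_def\<close>)
        finally show ?thesis .
      qed
      have "pmap (ev (T X) i) (Y z) = \<zero>\<^bsub>P\<^esub>" unfolding Y_def
      proof (rule T_lift_kernel[OF JX Q P y F zero_alg_hom[OF P] _ z])
        fix x assume x: "x \<in> carrier (J X)"
        have "pmap (ev (T X) i) (y x) = (zsc (T X) 1 x \<ominus>\<^bsub>P\<^esub> zsc (T X) ?t x) \<ominus>\<^bsub>P\<^esub> zsc (T X) (\<tau> False) x"
          unfolding yF[OF P F x] using x True by (simp add: Fz W vi ec)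
        also have "\<dots> = \<zero>\<^bsub>P\<^esub>"
          using x zsc_poly1_diff[OF TX, of x 1 ?t, folded P_def] by (simp add: \<tau>_def vars_in_diff flip: zsc_poly1_diff)
        finally show "pmap (ev (T X) i) (y x) = \<zero>\<^bsub>P\<^esub>" .
      qed
      then show ?thesis by (simp add: P_def)
    next
      case False
      have g: "pmap (ev (T X) i) \<circ> W2 \<in> alg_hom (J X) P" by (rule alg_hom_comp[OF alg_hom_restrict[OF JS W2] F])
      have "pmap (ev (T X) i) (Y z) = \<zero>\<^bsub>P\<^esub>" unfolding Y_def
      proof (rule T_lift_kernel[OF JX Q P y F g _ z])
        fix x assume x: "x \<in> carrier (J X)"
        show "pmap (ev (T X) i) (y x) = (pmap (ev (T X) i) \<circ> W2) x"
          unfolding yF[OF P F x] using x False alg_hom_closed[OF F, of "W2 x"]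
          by (simp add: Fz vi ec zsc_poly1_zero[OF TX, folded P_def])
      qed
      then show ?thesis by (simp add: P_def)
    qed
  qed
  have mem: "Y z \<in> carrier (poly1 (Om (J X)))" if z: "z \<in> carrier (J (J X))" for z
  proof -
    have Yc: "Y z \<in> carrier (poly_alg {0} P)" using alg_hom_closed[OF Y z] by (simp add: Q_def poly1_def)
    have "coef (Y z) e \<in> carrier (Om (J X))" for e
    proof (rule Om_J_mem[OF X])
      show "coef (Y z) e \<in> carrier (poly1 (T X))" using Yc by (simp add: poly_carrier fsa_simps P_def)
      show "pmap (counit X) (coef (Y z) e) = \<zero>\<^bsub>poly1 X\<^esub>" by (rule pmap_eq_zero[OF k1[OF z]])
      show "ev (T X) 0 (coef (Y z) e) = \<zero>\<^bsub>T X\<^esub>" "ev (T X) 1 (coef (Y z) e) = \<zero>\<^bsub>T X\<^esub>"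
        by (rule pmap_eq_zero[OF k2[OF z]]; simp)+
    qed
    then show ?thesis unfolding poly1_def by (rule poly_subalg_mem[OF Om_J_subalg[OF X] Yc[unfolded P_def]])
  qed
  have sub: "subalg (poly1 (Om (J X))) Q" unfolding Q_def P_def by (rule poly1_subalg[OF Om_J_subalg[OF X]])
  have Y': "Y \<in> alg_hom (J (J X)) (poly1 (Om (J X)))" by (rule alg_hom_into_subalg[OF sub Y mem])
  have evY: "ev (Om (J X)) i (Y z) = T_lift P (ev P i \<circ> y) z" if z: "z \<in> carrier (J (J X))" for z i
  proof -
    have "ev (Om (J X)) i (Y z) = ev P i (Y z)"
      using ev_subalg[OF Om_J_subalg[OF X]] mem[OF z] by (simp add: poly1_def P_def)
    also have "\<dots> = T_lift P (ev P i \<circ> y) z" unfolding Y_def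
      by (rule T_lift_natural[OF JX Q P y evQ]) (use z in \<open>simp add: J_carrier\<close>)
    finally show ?thesis .
  qed
  have evW: "ev P i (W2 x) = (if i = 0 then zsc (T X) 1 x else w x)" if x: "x \<in> carrier (T X)" and i: "i = 0 \<or> i = 1" for x i
  proof -
    have "ev P i (W2 x) = T_lift P (ev P i \<circ> w2) x" by (rule w2F[OF P evQ x])
    also have "\<dots> = T_lift P ((if i = 0 then zsc (T X) 1 else zsc (T X) (\<tau> (\<not> b))) \<circ> T_unit X) x"
    proof (rule T_lift_cong[OF X P _ und_hom_comp[OF w2 alg_hom_und_hom[OF evQ]] _ x])
      show "(if i = 0 then zsc (T X) 1 else zsc (T X) (\<tau> (\<not> b))) \<circ> T_unit X \<in> und_hom X P"
        using und_hom_comp[OF T_unit_und_hom zT] by auto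
      fix a assume a: "a \<in> carrier X"
      show "(ev P i \<circ> w2) a = ((if i = 0 then zsc (T X) 1 else zsc (T X) (\<tau> (\<not> b))) \<circ> T_unit X) a"
        using a i zsc_poly1_diff[OF TX, of "T_unit X a" 1 "\<tau> b", folded P_def]
        by (auto simp: w2F'[OF P evQ] ev_zsc_basic tau_compl)
    qed
    also have "\<dots> = (if i = 0 then zsc (T X) 1 x else w x)"
      using one_T[of "zsc (T X) 1" P x] zsc_one_alg_hom[OF TX] x by (simp add: w_def P_def)
    finally show ?thesis .
  qed
  have ev0: "ev P 0 (y x) = zsc (T X) (\<tau> b) x" and ev1: "ev P 1 (y x) = u x" if x: "x \<in> carrier (J X)" for x
  proof -
    have "ev P 0 (y x) = zsc (T X) 1 x \<ominus>\<^bsub>P\<^esub> zsc (T X) (\<tau> (\<not> b)) x"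
      unfolding yF[OF P evQ x] using x by (simp add: evW ev_zsc_basic ev_zsc_tau)
    also have "\<dots> = zsc (T X) (\<tau> b) x"
      using x zsc_poly1_diff[OF TX, of x 1 "\<tau> (\<not> b)", folded P_def] tau_compl[of "\<not> b"] by simp
    finally show "ev P 0 (y x) = zsc (T X) (\<tau> b) x" .
    have "ev P 1 (y x) = w x \<ominus>\<^bsub>P\<^esub> (w x \<ominus>\<^bsub>P\<^esub> u x)"
      unfolding yF[OF P evQ x] using x by (simp add: evW ev_zsc_basic ev_zsc_tau)
    also have "\<dots> = u x"
    proof -
      interpret PG: abelian_group P using P by (rule algebra_abelian_group)
      show ?thesis using x by (simp add: PG.minus_eq PG.minus_add PG.r_neg2)
    qed
    finally show "ev P 1 (y x) = u x" .
  qed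
  show ?thesis unfolding elem_homotopic_def
  proof (intro bexI[OF _ Y'] ballI conjI)
    fix z assume z: "z \<in> carrier (J (J X))"
    then have zT': "z \<in> carrier (T (J X))" by (simp add: J_carrier)
    have zJ: "zsc (J X) (\<tau> b) \<in> und_hom (J X) (poly1 (J X))" by (rule zsc_poly1_und[OF JX vars_in_tau])
    have zJP: "zsc (J X) (\<tau> b) \<in> und_hom (J X) P"
      using und_hom_comp[OF zJ, of id P] alg_hom_und_hom[of id "poly1 (J X)" P] poly1_subalg[OF JS] by (simp add: subalg_def P_def)
    have "ev (Om (J X)) 0 (Y z) = T_lift P (zsc (J X) (\<tau> b)) z"
      unfolding evY[OF z]
      by (rule T_lift_cong[OF JX P zJP und_hom_comp[OF y alg_hom_und_hom[OF evQ]] _ zT'])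
        (simp add: ev0 zsc_subalg[OF JS])
    also have "\<dots> = rho' b (J X) z"
      unfolding rho'_def P_def by (rule T_lift_subalg[OF poly1_subalg[OF JS] JX zJ zT'])
    finally show "ev (Om (J X)) 0 (Y z) = rho' b (J X) z" .
    have "ev (Om (J X)) 1 (Y z) = T_lift P u z"
      unfolding evY[OF z]
      by (rule T_lift_cong[OF JX P u und_hom_comp[OF y alg_hom_und_hom[OF evQ]] _ zT']) (simp add: ev1)
    also have "\<dots> = Phi X (J_map (Om X) r z)"
      unfolding u_def Phi_def P_def
      by (rule T_lift_J_map[OF JX O P[unfolded P_def] alg_hom_und_hom[OF r] clift0_und_hom[OF X] zT', symmetric])
    finally show "ev (Om (J X)) 1 (Y z) = (Phi X \<circ> J_map (Om X) (rho' (\<not> b) X)) z" by (simp add: r_def)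
  qed
qed

end

section \<open>Maps that become null homotopic after suspension\<close>

context kk_setting
begin

definition homotopic :: "('h, 'a) ualg \<Rightarrow> ('h, 'a) ualg \<Rightarrow> (('h, 'a) univ \<Rightarrow> ('h, 'a) univ) \<Rightarrow> (('h, 'a) univ \<Rightarrow> ('h, 'a) univ) \<Rightarrow> bool" where
  "homotopic X D = (\<lambda>f g. f \<in> alg_hom X D \<and> g \<in> alg_hom X D \<and> (elem_homotopic X D f g \<or> elem_homotopic X D g f))\<^sup>*\<^sup>*"

lemma homotopic_mono:
  assumes "homotopic X D f g"
    and "\<And>f g. f \<in> alg_hom X D \<Longrightarrow> g \<in> alg_hom X D \<Longrightarrow> elem_homotopic X D f g \<Longrightarrow>
      F f \<in> alg_hom Y E \<and> F g \<in> alg_hom Y E \<and> elem_homotopic Y E (F f) (F g)"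
  shows "homotopic Y E (F f) (F g)"
  using assms(1) unfolding homotopic_def
proof (induction rule: rtranclp_induct)
  case (step g k)
  then show ?case using assms(2)[of g k] assms(2)[of k g] by (auto intro: rtranclp.rtrancl_into_rtrancl)
qed simp

lemma homotopic_trans: "homotopic X D f g \<Longrightarrow> homotopic X D g k \<Longrightarrow> homotopic X D f k"
  unfolding homotopic_def by (rule rtranclp_trans)

lemma elem_homotopic_homotopic:
  "f \<in> alg_hom X D \<Longrightarrow> g \<in> alg_hom X D \<Longrightarrow> elem_homotopic X D f g \<Longrightarrow> homotopic X D f g"
  unfolding homotopic_def by auto

lemma homotopic_cong:
  assumes "is_algebra D" "is_algebra X" "f \<in> alg_hom X D" "\<And>x. x \<in> carrier X \<Longrightarrow> g x = f x"
  shows "homotopic X D f g"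
  using elem_homotopic_homotopic[OF assms(3) alg_hom_cong[OF assms(3) _ assms(2)] elem_homotopic_cong(1)[OF assms(1,3,4)]] assms(4)
  by simp

text \<open>The maps that homotopies and suspensions reduce to zero. Neither step changes the class of a
  representative in kk.\<close>

inductive null :: "('h, 'a) ualg \<Rightarrow> ('h, 'a) ualg \<Rightarrow> (('h, 'a) univ \<Rightarrow> ('h, 'a) univ) \<Rightarrow> bool" where
  zero: "f \<in> alg_hom X D \<Longrightarrow> (\<And>x. x \<in> carrier X \<Longrightarrow> f x = \<zero>\<^bsub>D\<^esub>) \<Longrightarrow> null X D f"
| homotopy: "f \<in> alg_hom X D \<Longrightarrow> elem_homotopic X D f g \<or> elem_homotopic X D g f \<Longrightarrow> null X D g \<Longrightarrow> null X D f"
| suspend: "f \<in> alg_hom X D \<Longrightarrow> null (J X) (Om D) (rho' True D \<circ> J_map D f) \<Longrightarrow> null X D f"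

lemma null_alg_hom: "null X D f \<Longrightarrow> f \<in> alg_hom X D"
  by (induction rule: null.induct)

lemma null_homotopic: "homotopic X D f g \<Longrightarrow> null X D g \<Longrightarrow> null X D f"
  unfolding homotopic_def
  by (induction rule: converse_rtranclp_induct) (auto intro: null.homotopy)

lemma null_precomp:
  assumes "null X D f" "is_algebra X" "is_algebra D" "is_algebra Z" "k \<in> alg_hom Z X"
  shows "null Z D (f \<circ> k)"
  using assms
proof (induction arbitrary: Z k rule: null.induct)
  case (zero f X D)
  then show ?case by (intro null.zero alg_hom_comp) (auto simp: alg_hom_closed)
next
  case (homotopy f X D g)
  have "elem_homotopic Z D (f \<circ> k) (g \<circ> k) \<or> elem_homotopic Z D (g \<circ> k) (f \<circ> k)"
    using homotopy.hyps(2) elem_homotopic_precomp[OF _ homotopy.prems(4)] by blast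
  then show ?case
    by (rule null.homotopy[OF alg_hom_comp[OF homotopy.prems(4) homotopy.hyps(1)] _ homotopy.IH[OF homotopy.prems]])
next
  case (suspend f X D)
  note f = suspend.hyps(1) and k = suspend.prems(4) and X = suspend.prems(1) and D = suspend.prems(2) and Z = suspend.prems(3)
  note fk = alg_hom_comp[OF k f]
  have 1: "null (J Z) (Om D) ((rho' True D \<circ> J_map D f) \<circ> J_map X k)"
    by (rule suspend.IH[OF J_algebra[OF X] Om_algebra[OF D] J_algebra[OF Z] J_map_hom[OF Z X k]])
  have 2: "rho' True D \<circ> J_map D (f \<circ> k) \<in> alg_hom (J Z) (Om D)"
    by (rule alg_hom_comp[OF J_map_hom[OF Z D fk] rho'_hom[OF D]])
  have "null (J Z) (Om D) (rho' True D \<circ> J_map D (f \<circ> k))"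
  proof (rule null_homotopic[OF homotopic_cong[OF Om_algebra[OF D] J_algebra[OF Z] 2] 1])
    fix x assume "x \<in> carrier (J Z)"
    then show "((rho' True D \<circ> J_map D f) \<circ> J_map X k) x = (rho' True D \<circ> J_map D (f \<circ> k)) x"
      using J_map_comp[OF Z X D alg_hom_und_hom[OF k] alg_hom_und_hom[OF f], of x] by (simp add: J_carrier)
  qed
  then show ?case by (rule null.suspend[OF fk])
qed

section \<open>Nilpotent algebras\<close>

text \<open>\<open>\<iota>\<close> embeds an ideal of \<open>A\<close> that contains all products. The loop algebras then stand in the same relation
  (\<open>mult_into_Om\<close>), which keeps the induction over \<open>\<Omega>\<^sup>q\<close> going.\<close>

definition mult_into :: "('h, 'a) ualg \<Rightarrow> ('h, 'a) ualg \<Rightarrow> (('h, 'a) univ \<Rightarrow> ('h, 'a) univ) \<Rightarrow> bool" where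
  "mult_into I A \<iota> \<longleftrightarrow> is_algebra I \<and> is_algebra A \<and> \<iota> \<in> alg_hom I A \<and> inj_on \<iota> (carrier I) \<and>
    (\<forall>x\<in>carrier A. \<forall>y\<in>carrier A. x \<otimes>\<^bsub>A\<^esub> y \<in> \<iota> ` carrier I)"

text \<open>Nilpotence as a finite chain of algebras that ends in zero, each of which contains the products of the one before.\<close>

inductive dnil :: "('h, 'a) ualg \<Rightarrow> bool" where
  zero: "is_algebra A \<Longrightarrow> carrier A = {\<zero>\<^bsub>A\<^esub>} \<Longrightarrow> dnil A"
| step: "mult_into I A \<iota> \<Longrightarrow> dnil I \<Longrightarrow> dnil A"

lemma dnil_algebra: "dnil A \<Longrightarrow> is_algebra A"
  by (induction rule: dnil.induct) (auto simp: mult_into_def)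

lemma pmap_image:
  assumes I: "is_algebra I" and A: "is_algebra A" and i: "\<iota> \<in> add_hom I A" "inj_on \<iota> (carrier I)"
    and z: "z \<in> carrier (poly_alg V A)" and c: "\<And>e. coef z e \<in> \<iota> ` carrier I"
  shows "z \<in> pmap \<iota> ` carrier (poly_alg V I)"
proof -
  let ?k = "inv_into (carrier I) \<iota>"
  note z0 = add_hom_zero[OF i(1) I A]
  have k0: "?k \<zero>\<^bsub>A\<^esub> = \<zero>\<^bsub>I\<^esub>" using inv_into_f_f[OF i(2), of "\<zero>\<^bsub>I\<^esub>"] I z0 by simp
  have fin: "finite {e. ?k (coef z e) \<noteq> \<zero>\<^bsub>I\<^esub>}"
    by (rule finite_subset[of _ "{e. coef z e \<noteq> \<zero>\<^bsub>A\<^esub>}"]) (use z k0 in \<open>auto simp: poly_carrier fsa_simps\<close>)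
  have V: "expn e \<subseteq> V" if "?k (coef z e) \<noteq> \<zero>\<^bsub>I\<^esub>" for e
    using that k0 z unfolding poly_carrier by metis
  have "pmap ?k z \<in> carrier (poly_alg V I)"
    unfolding poly_carrier fsa_simps pmap_def univ.sel
    using fin inv_into_into[OF c] V by auto
  moreover have "z = pmap \<iota> (pmap ?k z)"
    using z f_inv_into_f[OF c] by (auto simp: poly_carrier pmap_def)
  ultimately show ?thesis by blast
qed

lemma mult_into_poly:
  assumes m: "mult_into I A \<iota>" and p: "p \<in> carrier (poly_alg V A)" and q: "q \<in> carrier (poly_alg V A)"
  shows "p \<otimes>\<^bsub>poly_alg V A\<^esub> q \<in> pmap \<iota> ` carrier (poly_alg V I)"
proof -
  have I: "is_algebra I" and A: "is_algebra A" and i: "\<iota> \<in> alg_hom I A" "inj_on \<iota> (carrier I)"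
    and pr: "\<And>x y. x \<in> carrier A \<Longrightarrow> y \<in> carrier A \<Longrightarrow> x \<otimes>\<^bsub>A\<^esub> y \<in> \<iota> ` carrier I"
    using m by (auto simp: mult_into_def)
  note ia = alg_hom_add_hom[OF i(1)]
  interpret A: abelian_group A using A by (rule algebra_abelian_group)
  interpret I: abelian_group I using I by (rule algebra_abelian_group)
  have c: "coef p e \<in> carrier A" "coef q e \<in> carrier A" for e using p q by (auto simp: poly_carrier fsa_simps)
  have "coef (p \<otimes>\<^bsub>poly_alg V A\<^esub> q) e \<in> \<iota> ` carrier I" for e
  proof -
    let ?S = "{(f, g). f + g = e}"
    let ?g = "\<lambda>z. inv_into (carrier I) \<iota> (coef p (fst z) \<otimes>\<^bsub>A\<^esub> coef q (snd z))"
    have g: "?g z \<in> carrier I" "\<iota> (?g z) = coef p (fst z) \<otimes>\<^bsub>A\<^esub> coef q (snd z)" for z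
      using inv_into_into[OF pr[OF c]] f_inv_into_f[OF pr[OF c]] by auto
    have "coef (p \<otimes>\<^bsub>poly_alg V A\<^esub> q) e = (\<Oplus>\<^bsub>A\<^esub>z\<in>?S. \<iota> (?g z))"
      by (simp add: g poly_alg_def)
    also have "\<dots> = \<iota> (\<Oplus>\<^bsub>I\<^esub>z\<in>?S. ?g z)"
      using g by (intro add_hom_finsum[OF ia I A, symmetric]) auto
    finally show ?thesis using g(1) by (auto intro!: I.finsum_closed)
  qed
  then show ?thesis using p q poly_algebra[OF A, of V] by (intro pmap_image[OF I A ia i(2)]) auto
qed

lemma pmap_inj:
  assumes "inj_on \<iota> (carrier I)" shows "inj_on (pmap \<iota>) (carrier (poly_alg V I))"
proof (rule inj_onI)
  fix x y assume x: "x \<in> carrier (poly_alg V I)" and y: "y \<in> carrier (poly_alg V I)" and eq: "pmap \<iota> x = pmap \<iota> y"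
  have "coef x e = coef y e" for e
    using assms x y eq[THEN arg_cong, of "\<lambda>z. coef z e"] by (auto simp: poly_carrier fsa_simps dest: inj_onD)
  then show "x = y" by (rule poly_eqI[OF x y])
qed

lemma pmap_image_Om:
  assumes I: "is_algebra I" and A: "is_algebra A" and i: "\<iota> \<in> alg_hom I A" "inj_on \<iota> (carrier I)"
    and z: "z \<in> carrier (Om A)" "z \<in> pmap \<iota> ` carrier (poly1 I)"
  shows "z \<in> pmap \<iota> ` carrier (Om I)"
proof -
  note ia = alg_hom_add_hom[OF i(1)]
  obtain w where w: "w \<in> carrier (poly1 I)" "z = pmap \<iota> w" using z(2) by auto
  have "\<iota> (ev I c w) = \<iota> \<zero>\<^bsub>I\<^esub>" if "c = 0 \<or> c = 1" for c
    using that z(1) w ev_pmap[OF I A ia, of w "{0}" c] add_hom_zero[OF ia I A] by (auto simp: Om_carrier poly1_def)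
  then have "ev I c w = \<zero>\<^bsub>I\<^esub>" if "c = 0 \<or> c = 1" for c
    using inj_onD[OF i(2)] alg_hom_closed[OF ev_alg_hom[OF I] w(1)] I that by auto
  then show ?thesis using w by (auto simp: Om_carrier)
qed

lemma mult_into_Om:
  assumes m: "mult_into I A \<iota>" shows "mult_into (Om I) (Om A) (pmap \<iota>)"
proof -
  have I: "is_algebra I" and A: "is_algebra A" and i: "\<iota> \<in> alg_hom I A" "inj_on \<iota> (carrier I)"
    using m by (auto simp: mult_into_def)
  have "inj_on (pmap \<iota>) (carrier (Om I))"
    by (rule inj_on_subset[OF pmap_inj[OF i(2), of "{0}"]]) (auto simp: Om_carrier poly1_def)
  moreover have "x \<otimes>\<^bsub>Om A\<^esub> y \<in> pmap \<iota> ` carrier (Om I)" if "x \<in> carrier (Om A)" "y \<in> carrier (Om A)" for x y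
  proof (rule pmap_image_Om[OF I A i])
    show "x \<otimes>\<^bsub>Om A\<^esub> y \<in> carrier (Om A)" using that Om_algebra[OF A] by simp
    show "x \<otimes>\<^bsub>Om A\<^esub> y \<in> pmap \<iota> ` carrier (poly1 I)"
      using mult_into_poly[OF m, of x "{0}" y] that subalg_ops(2)[OF Om_subalg[OF A] that(1,2)] by (simp add: Om_carrier poly1_def)
  qed
  ultimately show ?thesis using I A Om_map[OF I A i(1)] by (simp add: mult_into_def Om_algebra)
qed

text \<open>Modulo polynomials with coefficients in \<open>I\<close> all products vanish, so \<open>a \<mapsto> \<tau> a\<close> is multiplicative there, and the
  suspension of \<open>x\<close> agrees with \<open>\<tau>\<close> times the counit of \<open>x\<close>. The latter is zero on \<open>J A\<close>.\<close>

lemma rho'_factor: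
  assumes m: "mult_into I A \<iota>"
  shows "\<exists>e\<in>alg_hom (J A) (Om I). \<forall>x\<in>carrier (J A). pmap \<iota> (e x) = rho' b A x"
proof -
  have I: "is_algebra I" and A: "is_algebra A" and i: "\<iota> \<in> alg_hom I A" "inj_on \<iota> (carrier I)"
    and pr: "\<And>x y. x \<in> carrier A \<Longrightarrow> y \<in> carrier A \<Longrightarrow> x \<otimes>\<^bsub>A\<^esub> y \<in> \<iota> ` carrier I"
    using m by (auto simp: mult_into_def)
  let ?P = "poly1 A"
  note P = poly1_algebra[OF A] and PI = poly1_algebra[OF I] and pi = pmap_poly1[OF I A i(1)]
  note pia = alg_hom_add_hom[OF pi]
  define M where "M = pmap \<iota> ` carrier (poly1 I)"
  have M0: "\<zero>\<^bsub>?P\<^esub> \<in> M" unfolding M_def using add_hom_zero[OF pia PI P] algebra_closed(1)[OF PI] by (metis image_eqI)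
  have Ma: "x \<oplus>\<^bsub>?P\<^esub> y \<in> M" if "x \<in> M" "y \<in> M" for x y
    using that PI unfolding M_def by (auto simp flip: alg_homD(1)[OF pi])
  have Mn: "\<ominus>\<^bsub>?P\<^esub> x \<in> M" if "x \<in> M" for x
    using that PI unfolding M_def by (auto simp flip: add_hom_neg[OF pia PI P])
  have Ml: "lact ?P h x \<in> M" "ract ?P x h \<in> M" if "x \<in> M" "h \<in> carrier H" for x h
    using that PI unfolding M_def by (auto simp flip: alg_homD(3,4)[OF pi])
  have Mm: "x \<otimes>\<^bsub>?P\<^esub> y \<in> M" if "x \<in> carrier ?P" "y \<in> carrier ?P" for x y
    using mult_into_poly[OF m, of x "{0}" y] that unfolding M_def poly1_def by simp
  have Mz: "zsc A p a \<in> M" if a: "a \<in> \<iota> ` carrier I" and p: "vars_in {0} p" for p a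
  proof -
    obtain a' where a': "a' \<in> carrier I" "a = \<iota> a'" using a by auto
    then have "zsc A p a = pmap \<iota> (zsc I p a')" using pmap_zsc[OF alg_hom_add_hom[OF i(1)] I A] by simp
    then show ?thesis unfolding M_def using zsc_poly1_closed[OF I p a'(1)] by blast
  qed
  let ?r = "rho' b A" and ?z = "\<lambda>x. zsc A (\<tau> b) (counit A x)"
  note r = rho'_T_hom[OF A, of b]
  have zh: "zsc A (\<tau> b) \<circ> counit A \<in> bimod_hom (T A) ?P"
    by (rule bimod_hom_comp[OF alg_hom_bimod_hom[OF counit_hom[OF A]] zsc_poly1_bimod[OF A vars_in_tau]])
  note za = bimod_hom_add_hom[OF zh]
  have rc [simp]: "?r x \<in> carrier ?P" "?z x \<in> carrier ?P" if "x \<in> carrier (T A)" for x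
    using alg_hom_closed[OF r that] bimod_homD(1)[OF zh that] by auto
  interpret PG: abelian_group ?P using P by (rule algebra_abelian_group)
  \<comment> \<open>modulo the ideal the map \<open>a \<mapsto> \<tau> a\<close> is multiplicative because all products vanish there\<close>
  have D: "?r x \<ominus>\<^bsub>?P\<^esub> ?z x \<in> M" if "x \<in> carrier (T A)" for x
    using that
  proof (induction rule: T_induct)
    case (unit a)
    have "?r (T_unit A a) = zsc A (\<tau> b) a" unfolding rho'_def by (rule T_lift_unit[OF P zsc_poly1_und[OF A vars_in_tau] A unit])
    then show ?case using unit A P M0 by (simp add: counit_unit)
  next
    case zero
    then show ?case using add_hom_zero[OF alg_hom_add_hom[OF r] T_algebra P] add_hom_zero[OF za T_algebra P] M0 P by simp
  next
    case (add x y)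
    have "?r (x \<oplus>\<^bsub>T A\<^esub> y) \<ominus>\<^bsub>?P\<^esub> ?z (x \<oplus>\<^bsub>T A\<^esub> y) = (?r x \<ominus>\<^bsub>?P\<^esub> ?z x) \<oplus>\<^bsub>?P\<^esub> (?r y \<ominus>\<^bsub>?P\<^esub> ?z y)"
      using add add_hom_add[OF za, of x y] alg_homD(1)[OF r, of x y] by (simp add: PG.minus_eq PG.minus_add PG.a_ac)
    then show ?case using Ma add by simp
  next
    case (neg x)
    have "?r (\<ominus>\<^bsub>T A\<^esub> x) \<ominus>\<^bsub>?P\<^esub> ?z (\<ominus>\<^bsub>T A\<^esub> x) = \<ominus>\<^bsub>?P\<^esub> (?r x \<ominus>\<^bsub>?P\<^esub> ?z x)"
      using neg add_hom_neg[OF za T_algebra P, of x] add_hom_neg[OF alg_hom_add_hom[OF r] T_algebra P, of x]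
      by (simp add: PG.minus_eq PG.minus_add)
    then show ?case using Mn neg by simp
  next
    case (mult x y)
    have "counit A (x \<otimes>\<^bsub>T A\<^esub> y) \<in> \<iota> ` carrier I"
      using mult pr alg_hom_closed[OF counit_hom[OF A]] by (simp add: alg_homD(2)[OF counit_hom[OF A]])
    then have "?z (x \<otimes>\<^bsub>T A\<^esub> y) \<in> M" by (rule Mz) simp
    moreover have "?r (x \<otimes>\<^bsub>T A\<^esub> y) \<in> M" using mult Mm by (simp add: alg_homD(2)[OF r])
    ultimately show ?case using Ma Mn by (simp add: PG.minus_eq)
  next
    case (lact h x)
    have "?r (lact (T A) h x) \<ominus>\<^bsub>?P\<^esub> ?z (lact (T A) h x) = lact ?P h (?r x \<ominus>\<^bsub>?P\<^esub> ?z x)"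
      using lact bimod_homD(3)[OF zh, of x h] alg_homD(3)[OF r, of x h] P
      by (simp add: PG.minus_eq algebra_lact_add algebra_act_neg)
    then show ?case using Ml lact by simp
  next
    case (ract h x)
    have "?r (ract (T A) x h) \<ominus>\<^bsub>?P\<^esub> ?z (ract (T A) x h) = ract ?P (?r x \<ominus>\<^bsub>?P\<^esub> ?z x) h"
      using ract bimod_homD(4)[OF zh, of x h] alg_homD(4)[OF r, of x h] P
      by (simp add: PG.minus_eq algebra_ract_add algebra_act_neg)
    then show ?case using Ml ract by simp
  qed
  have im: "?r x \<in> pmap \<iota> ` carrier (Om I)" if x: "x \<in> carrier (J A)" for x
  proof (rule pmap_image_Om[OF I A i alg_hom_closed[OF rho'_hom[OF A] x]])
    have "?z x = \<zero>\<^bsub>?P\<^esub>" "x \<in> carrier (T A)" using x A by (auto simp: J_carrier zsc_poly1_zero)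
    then show "?r x \<in> pmap \<iota> ` carrier (poly1 I)" using D[of x] P by (simp add: M_def)
  qed
  have pO: "pmap \<iota> \<in> alg_hom (Om I) (Om A)" "inj_on (pmap \<iota>) (carrier (Om I))"
    using mult_into_Om[OF m] by (auto simp: mult_into_def)
  show ?thesis
    by (rule bexI[OF _ alg_hom_corestrict[OF J_algebra[OF A] Om_algebra[OF I] rho'_hom[OF A] pO im]])
      (use f_inv_into_f[OF im] in simp_all)
qed

lemma J_pow_Suc: "(J ^^ Suc n) A = J ((J ^^ n) A)"
  by simp

text \<open>By \<open>rho'_J_homotopic\<close>, the suspension of \<open>J\<^sup>n(A)\<close> is obtained from that of \<open>A\<close> by \<open>n\<close> applications of \<open>J\<close>, each
  of which reverses loops; the direction \<open>b\<close> therefore varies in the induction.\<close>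

lemma rho'_J_pow_factor:
  assumes m: "mult_into I A \<iota>"
  shows "\<exists>\<Psi> e. \<Psi> \<in> alg_hom ((J ^^ n) (Om I)) (Om ((J ^^ n) A)) \<and> e \<in> alg_hom ((J ^^ Suc n) A) ((J ^^ n) (Om I)) \<and>
    homotopic ((J ^^ Suc n) A) (Om ((J ^^ n) A)) (rho' b ((J ^^ n) A)) (\<Psi> \<circ> e)"
proof (induction n arbitrary: b)
  case 0
  have I: "is_algebra I" and A: "is_algebra A" and i: "\<iota> \<in> alg_hom I A" using m by (auto simp: mult_into_def)
  obtain e where e: "e \<in> alg_hom (J A) (Om I)" "\<And>x. x \<in> carrier (J A) \<Longrightarrow> pmap \<iota> (e x) = rho' b A x"
    using rho'_factor[OF m] by blast
  have "homotopic (J A) (Om A) (rho' b A) (pmap \<iota> \<circ> e)"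
    by (rule homotopic_cong[OF Om_algebra[OF A] J_algebra[OF A] rho'_hom[OF A]]) (simp add: e(2))
  then show ?case using e(1) Om_map[OF I A i] unfolding J_pow_Suc funpow_0 by blast
next
  case (Suc n)
  have I: "is_algebra I" and A: "is_algebra A" using m by (auto simp: mult_into_def)
  let ?X = "(J ^^ n) A" and ?Y = "(J ^^ n) (Om I)"
  have X: "is_algebra ?X" and Y: "is_algebra ?Y" using A I by (simp_all add: J_pow_algebra Om_algebra)
  obtain \<Psi> e where h: "\<Psi> \<in> alg_hom ?Y (Om ?X)" "e \<in> alg_hom (J ?X) ?Y"
    "homotopic (J ?X) (Om ?X) (rho' (\<not> b) ?X) (\<Psi> \<circ> e)"
    using Suc.IH[of "\<not> b"] unfolding J_pow_Suc by blast
  note O = Om_algebra[OF X] and JX = J_algebra[OF X]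
  let ?\<Psi> = "Phi ?X \<circ> J_map (Om ?X) \<Psi>" and ?e = "J_map ?Y e"
  have p: "?\<Psi> \<in> alg_hom (J ?Y) (Om (J ?X))" by (rule alg_hom_comp[OF J_map_hom[OF Y O h(1)] Phi_hom[OF X]])
  have e: "?e \<in> alg_hom (J (J ?X)) (J ?Y)" by (rule J_map_hom[OF JX Y h(2)])
  have F: "Phi ?X \<circ> J_map (Om ?X) f \<in> alg_hom (J (J ?X)) (Om (J ?X))" if "f \<in> alg_hom (J ?X) (Om ?X)" for f
    by (rule alg_hom_comp[OF J_map_hom[OF JX O that] Phi_hom[OF X]])
  have "homotopic (J (J ?X)) (Om (J ?X)) (rho' b (J ?X)) (Phi ?X \<circ> J_map (Om ?X) (rho' (\<not> b) ?X))"
    by (rule elem_homotopic_homotopic[OF rho'_hom[OF JX] F[OF rho'_hom[OF X]] rho'_J_homotopic[OF X]])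
  moreover have "homotopic (J (J ?X)) (Om (J ?X)) (Phi ?X \<circ> J_map (Om ?X) (rho' (\<not> b) ?X)) (Phi ?X \<circ> J_map (Om ?X) (\<Psi> \<circ> e))"
    using h(3) by (rule homotopic_mono)
      (intro conjI F elem_homotopic_comp[OF J_algebra[OF O] Om_algebra[OF JX] _ Phi_hom[OF X]] J_map_homotopic[OF JX O])
  moreover have "homotopic (J (J ?X)) (Om (J ?X)) (Phi ?X \<circ> J_map (Om ?X) (\<Psi> \<circ> e)) (?\<Psi> \<circ> ?e)"
    by (rule homotopic_cong[OF Om_algebra[OF JX] J_algebra[OF JX] F[OF alg_hom_comp[OF h(2,1)]]])
      (simp add: J_map_comp[OF JX Y O alg_hom_und_hom[OF h(2)] alg_hom_und_hom[OF h(1)]] J_carrier)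
  ultimately have "homotopic (J (J ?X)) (Om (J ?X)) (rho' b (J ?X)) (?\<Psi> \<circ> ?e)"
    by (blast intro: homotopic_trans)
  then show ?case using p e unfolding J_pow_Suc by blast
qed

text \<open>After one suspension a map out of \<open>J\<^sup>n(\<Omega>\<^sup>q A)\<close> factors, up to homotopy, through \<open>J\<^sup>n(\<Omega>\<^sup>q\<^sup>+\<^sup>1 I)\<close>, where \<open>I\<close> is
  the next algebra of the chain. At the end of the chain the source is contractible.\<close>

theorem dnil_null:
  assumes "dnil A" "is_algebra D" "f \<in> alg_hom ((J ^^ n) ((Om ^^ q) A)) D"
  shows "null ((J ^^ n) ((Om ^^ q) A)) D f"
  using assms
proof (induction arbitrary: n q D f rule: dnil.induct)
  case (zero A)
  have Oq: "is_algebra ((Om ^^ q) A) \<and> carrier ((Om ^^ q) A) = {\<zero>\<^bsub>(Om ^^ q) A\<^esub>}"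
  proof (induction q)
    case (Suc q)
    let ?B = "(Om ^^ q) A"
    have B: "is_algebra ?B" "carrier ?B = {\<zero>\<^bsub>?B\<^esub>}" using Suc by auto
    have "p = \<zero>\<^bsub>Om ?B\<^esub>" if "p \<in> carrier (Om ?B)" for p
    proof -
      have "p \<in> carrier (poly_alg {0} ?B)" using that by (simp add: Om_carrier poly1_def)
      then obtain g where g: "p = Poly g" "\<And>e. g e \<in> carrier ?B" by (auto simp: poly_carrier fsa_simps)
      then have "g = (\<lambda>_. \<zero>\<^bsub>?B\<^esub>)" using B(2) by auto
      then show ?thesis using g(1) by (simp add: Om_def poly1_def poly_ops)
    qed
    then show ?case using Om_algebra[OF B(1)] algebra_closed(1)[OF Om_algebra[OF B(1)]] by auto
  qed (use zero in auto)
  let ?B = "(Om ^^ q) A"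
  have "elem_homotopic ?B ?B (\<lambda>_. \<zero>\<^bsub>?B\<^esub>) id"
    by (rule elem_homotopic_cong(1)[OF _ zero_alg_hom]) (use Oq in auto)
  then have c: "contractible ((J ^^ n) ?B)"
    by (induction n) (use Oq in \<open>auto simp: contractible_def[symmetric] intro: contractible_J J_pow_algebra\<close>)
  have X: "is_algebra ((J ^^ n) ?B)" using Oq by (simp add: J_pow_algebra)
  show ?case
    by (rule null.homotopy[OF zero.prems(2) disjI2[OF contractible_homotopic_zero[OF X zero.prems(1) c zero.prems(2)]]
        null.zero[OF zero_alg_hom[OF zero.prems(1)]]]) simp
next
  case (step I A \<iota>)
  let ?A = "(Om ^^ q) A" and ?I = "(Om ^^ q) I"
  have m: "mult_into ?I ?A ((pmap ^^ q) \<iota>)"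
    by (induction q) (use step.hyps mult_into_Om in auto)
  let ?X = "(J ^^ n) ?A"
  note D = step.prems(1) and f = step.prems(2)
  have X: "is_algebra ?X" and Y: "is_algebra ((J ^^ n) (Om ?I))" using m by (simp_all add: mult_into_def J_pow_algebra Om_algebra)
  note JX = J_algebra[OF X] and OD = Om_algebra[OF D] and OX = Om_algebra[OF X] and pf = Om_map[OF X D f]
  obtain \<Psi> e where h: "\<Psi> \<in> alg_hom ((J ^^ n) (Om ?I)) (Om ?X)" "e \<in> alg_hom (J ?X) ((J ^^ n) (Om ?I))"
    "homotopic (J ?X) (Om ?X) (rho' True ?X) (\<Psi> \<circ> e)"
    using rho'_J_pow_factor[OF m, of n True] unfolding J_pow_Suc by blast
  have g: "pmap f \<circ> \<Psi> \<in> alg_hom ((J ^^ n) ((Om ^^ Suc q) I)) (Om D)" using alg_hom_comp[OF h(1) pf] by simp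
  have OS: "(Om ^^ Suc q) I = Om ?I" by simp
  have "null ((J ^^ n) (Om ?I)) (Om D) (pmap f \<circ> \<Psi>)" using step.IH[OF OD g] unfolding OS .
  then have 1: "null (J ?X) (Om D) ((pmap f \<circ> \<Psi>) \<circ> e)" by (rule null_precomp[OF _ Y OD JX h(2)])
  have 2: "homotopic (J ?X) (Om D) (pmap f \<circ> rho' True ?X) (pmap f \<circ> (\<Psi> \<circ> e))"
    using h(3) by (rule homotopic_mono) (intro conjI alg_hom_comp[OF _ pf] elem_homotopic_comp[OF OX OD _ pf])
  have 3: "homotopic (J ?X) (Om D) (rho' True D \<circ> J_map D f) (pmap f \<circ> rho' True ?X)"
    by (rule homotopic_cong[OF OD JX alg_hom_comp[OF J_map_hom[OF X D f] rho'_hom[OF D]]])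
      (simp add: rho'_natural[OF X D f] J_carrier)
  have "null (J ?X) (Om D) (rho' True D \<circ> J_map D f)"
    using null_homotopic[OF 3 null_homotopic[OF 2]] 1 by (simp add: comp_assoc)
  then show ?case by (rule null.suspend[OF f])
qed

definition alg_prods :: "('h, 'x) algebra \<Rightarrow> nat \<Rightarrow> 'x set" where
  "alg_prods A m = {x \<otimes>\<^bsub>A\<^esub> y | x y. x \<in> carrier A \<and> y \<in> alg_pow A m}"

lemma alg_prodsI: "x \<in> carrier A \<Longrightarrow> y \<in> alg_pow A m \<Longrightarrow> x \<otimes>\<^bsub>A\<^esub> y \<in> alg_prods A m"
  by (auto simp: alg_prods_def)

lemma alg_prodsE:
  assumes "a \<in> alg_prods A m" obtains x y where "a = x \<otimes>\<^bsub>A\<^esub> y" "x \<in> carrier A" "y \<in> alg_pow A m"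
  using assms by (auto simp: alg_prods_def)

lemma alg_pow_Suc: "1 \<le> m \<Longrightarrow> alg_pow A (Suc m) = generate (add_monoid A) (alg_prods A m)"
  by (simp add: alg_prods_def)

lemma span_induct [consumes 3, case_names zero gen neg add]:
  assumes "is_algebra A" "G \<subseteq> carrier A" "x \<in> generate (add_monoid A) G" "P \<zero>\<^bsub>A\<^esub>" "\<And>a. a \<in> G \<Longrightarrow> P a"
    "\<And>a. a \<in> carrier A \<Longrightarrow> P a \<Longrightarrow> P (\<ominus>\<^bsub>A\<^esub> a)"
    "\<And>a b. a \<in> carrier A \<Longrightarrow> b \<in> carrier A \<Longrightarrow> P a \<Longrightarrow> P b \<Longrightarrow> P (a \<oplus>\<^bsub>A\<^esub> b)"
  shows "P x"
proof -
  have "x \<in> carrier A \<and> P x" using assms(3)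
  proof (induction rule: generate.induct)
    case (inv h)
    then show ?case using assms(1,2,5,6) unfolding a_inv_def[symmetric] by auto
  qed (use assms(1,2,4,5,7) in auto)
  then show ?thesis by blast
qed

lemma alg_pow_subgroup:
  assumes A: "is_algebra A" and m: "1 \<le> m"
  shows "alg_pow A m \<subseteq> carrier A" "\<zero>\<^bsub>A\<^esub> \<in> alg_pow A m"
    "x \<in> alg_pow A m \<Longrightarrow> y \<in> alg_pow A m \<Longrightarrow> x \<oplus>\<^bsub>A\<^esub> y \<in> alg_pow A m" "x \<in> alg_pow A m \<Longrightarrow> \<ominus>\<^bsub>A\<^esub> x \<in> alg_pow A m"
proof -
  interpret abelian_group A using A by (rule algebra_abelian_group)
  have *: "subgroup (alg_pow A m) (add_monoid A) \<and> alg_pow A m \<subseteq> carrier A" using m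
  proof (induction m rule: dec_induct)
    case base
    show ?case using add.subgroup_self by simp
  next
    case (step n)
    have G: "alg_prods A n \<subseteq> carrier A" using step.IH A by (auto simp: alg_prods_def)
    then have "subgroup (generate (add_monoid A) (alg_prods A n)) (add_monoid A)"
      by (intro add.generate_is_subgroup) simp
    then show ?case using step.hyps(1) subgroup.subset by (fastforce simp: alg_pow_Suc simp del: alg_pow.simps)
  qed
  then interpret S: subgroup "alg_pow A m" "add_monoid A" by blast
  show "alg_pow A m \<subseteq> carrier A" "\<zero>\<^bsub>A\<^esub> \<in> alg_pow A m"
    "x \<in> alg_pow A m \<Longrightarrow> y \<in> alg_pow A m \<Longrightarrow> x \<oplus>\<^bsub>A\<^esub> y \<in> alg_pow A m" "x \<in> alg_pow A m \<Longrightarrow> \<ominus>\<^bsub>A\<^esub> x \<in> alg_pow A m"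
    using * S.one_closed S.m_closed S.m_inv_closed by (auto simp: a_inv_def)
qed

lemma alg_pow_module:
  assumes A: "is_algebra A" and m: "1 \<le> m" and x: "x \<in> alg_pow A m"
  shows "(\<forall>h\<in>carrier H. lact A h x \<in> alg_pow A m \<and> ract A x h \<in> alg_pow A m) \<and> (\<forall>z\<in>carrier A. z \<otimes>\<^bsub>A\<^esub> x \<in> alg_pow A m)"
  using m x
proof (induction m arbitrary: x rule: dec_induct)
  case base
  then show ?case using A by simp
next
  case (step n)
  have n: "1 \<le> Suc n" by simp
  have G: "alg_prods A n \<subseteq> carrier A" using alg_pow_subgroup(1)[OF A step.hyps(1)] A by (auto simp: alg_prods_def)
  note S = alg_pow_Suc[OF step.hyps(1), of A] and P = alg_pow_subgroup[OF A n]
  show ?case using A G step.prems[unfolded S]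
  proof (induction rule: span_induct)
    case zero
    show ?case using P(2) A by (simp del: alg_pow.simps)
  next
    case (gen a)
    then obtain u v where a: "a = u \<otimes>\<^bsub>A\<^esub> v" "u \<in> carrier A" "v \<in> alg_pow A n" by (rule alg_prodsE)
    have v: "v \<in> carrier A" using a(3) alg_pow_subgroup(1)[OF A step.hyps(1)] by blast
    have i: "b \<in> alg_prods A n \<Longrightarrow> b \<in> alg_pow A (Suc n)" for b unfolding S by (rule generate.incl)
    have "lact A h a \<in> alg_prods A n" "ract A a h \<in> alg_prods A n" if h: "h \<in> carrier H" for h
      unfolding a(1) algebra_lact_mult[OF A a(2) v h] algebra_ract_mult[OF A a(2) v h]
      using alg_prodsI[of "lact A h u" A v n] alg_prodsI[of u A "ract A v h" n] step.IH[OF a(3)] a A h by auto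
    moreover have "z \<otimes>\<^bsub>A\<^esub> a \<in> alg_prods A n" if z: "z \<in> carrier A" for z
      unfolding a(1) algebra_mult_assoc[OF A z a(2) v, symmetric]
      using alg_prodsI[of "z \<otimes>\<^bsub>A\<^esub> u" A v n] a A z by auto
    ultimately show ?case using i by blast
  next
    case (neg a)
    have "z \<otimes>\<^bsub>A\<^esub> (\<ominus>\<^bsub>A\<^esub> a) = \<ominus>\<^bsub>A\<^esub> (z \<otimes>\<^bsub>A\<^esub> a)" if "z \<in> carrier A" for z
      using add_hom_neg[of "\<lambda>x. z \<otimes>\<^bsub>A\<^esub> x" A A a] A neg(1) that by (auto simp: add_hom_def algebra_distrib_l)
    then show ?case using neg P(4) A by (simp add: algebra_act_neg del: alg_pow.simps)
  next
    case (add a b)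
    then show ?case using P(3) A by (simp add: algebra_lact_add algebra_ract_add algebra_distrib_l del: alg_pow.simps)
  qed
qed

lemma alg_pow_mult:
  assumes A: "is_algebra A" and i: "1 \<le> i" and j: "1 \<le> j" and x: "x \<in> alg_pow A i" and y: "y \<in> alg_pow A j"
  shows "x \<otimes>\<^bsub>A\<^esub> y \<in> alg_pow A (i + j)"
  using i x
proof (induction i arbitrary: x rule: dec_induct)
  case base
  then show ?case using y j generate.incl[OF alg_prodsI, of x A y j "add_monoid A"] by (simp add: alg_prods_def)
next
  case (step n)
  have yc: "y \<in> carrier A" using y alg_pow_subgroup(1)[OF A j] by auto
  have n: "1 \<le> Suc n + j" and n': "1 \<le> n + j" using j by auto
  note P = alg_pow_subgroup[OF A n]
  have G: "alg_prods A n \<subseteq> carrier A" using alg_pow_subgroup(1)[OF A step.hyps(1)] A by (auto simp: alg_prods_def)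
  have my: "(\<lambda>x. x \<otimes>\<^bsub>A\<^esub> y) \<in> add_hom A A" using A yc by (auto simp: add_hom_def algebra_distrib_r)
  show ?case using A G step.prems[unfolded alg_pow_Suc[OF step.hyps(1)]]
  proof (induction rule: span_induct)
    case zero
    then show ?case using P(2) A yc by (simp del: alg_pow.simps)
  next
    case (gen a)
    then obtain u v where a: "a = u \<otimes>\<^bsub>A\<^esub> v" "u \<in> carrier A" "v \<in> alg_pow A n" by (rule alg_prodsE)
    have v: "v \<in> carrier A" using a(3) alg_pow_subgroup(1)[OF A step.hyps(1)] by blast
    have "u \<otimes>\<^bsub>A\<^esub> (v \<otimes>\<^bsub>A\<^esub> y) \<in> alg_pow A (Suc (n + j))"
      unfolding alg_pow_Suc[OF n'] by (intro generate.incl alg_prodsI a step.IH)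
    then show ?case using a v yc A by (simp add: algebra_mult_assoc del: alg_pow.simps)
  next
    case (neg a)
    then show ?case using P(4) add_hom_neg[OF my A A] by (simp del: alg_pow.simps)
  next
    case (add a b)
    then show ?case using P(3) add_hom_add[OF my] by (simp del: alg_pow.simps)
  qed
qed

lemma alg_pow_antimono:
  assumes A: "is_algebra A" and i: "1 \<le> i" and ij: "i \<le> j" shows "alg_pow A j \<subseteq> alg_pow A i"
  using ij
proof (induction j rule: dec_induct)
  case (step n)
  have n: "1 \<le> n" using i step.hyps by simp
  have G: "alg_prods A n \<subseteq> alg_pow A n" using alg_pow_module[OF A n] by (auto simp: alg_prods_def)
  have G': "alg_prods A n \<subseteq> carrier A" using G alg_pow_subgroup(1)[OF A n] by blast
  have "x \<in> alg_pow A n" if "x \<in> alg_pow A (Suc n)" for x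
    using A G' that[unfolded alg_pow_Suc[OF n]]
    by (induction rule: span_induct) (use G alg_pow_subgroup[OF A n] in auto)
  then show ?case using step.IH by blast
qed simp

lemma sub_pow_algebra:
  assumes A: "is_algebra A" and m: "1 \<le> m"
  shows "is_algebra (sub_pow A m)" "id \<in> alg_hom (sub_pow A m) A"
  unfolding sub_pow_def by (rule sub_algebra; use A alg_pow_subgroup[OF A m] alg_pow_module[OF A m] alg_pow_mult[OF A m m] alg_pow_antimono[OF A m, of "m + m"] in auto)+

text \<open>The chain consists of the powers \<open>A\<close>, \<open>A\<^sup>2\<close>, \<open>A\<^sup>4\<close>, \<open>A\<^sup>8\<close> and so on.\<close>

lemma nilpotent_dnil:
  assumes A: "is_algebra A" and n: "nilpotent_alg A" shows "dnil A"
proof -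
  obtain m where m: "1 \<le> m" "alg_pow A m = {\<zero>\<^bsub>A\<^esub>}" using n unfolding nilpotent_alg_def by blast
  have 1: "1 \<le> (2::nat) ^ d" for d by simp
  note alg = sub_pow_algebra[OF A 1]
  have "m \<le> 2 ^ m" by (simp add: less_imp_le)
  then have top: "carrier (sub_pow A (2 ^ m)) = {\<zero>\<^bsub>A\<^esub>}"
    using alg_pow_antimono[OF A m(1), of "2 ^ m"] alg_pow_subgroup(2)[OF A 1, of m] m(2) by (auto simp: sub_pow_def)
  have "dnil (sub_pow A (2 ^ (m - j)))" for j
  proof (induction j)
    case 0
    show ?case using top by (intro dnil.zero alg) (simp add: sub_pow_def)
  next
    case (Suc j)
    show ?case
    proof (cases "m \<le> j")
      case False
      then have e: "m - j = Suc (m - Suc j)" by simp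
      let ?d = "m - Suc j"
      have "mult_into (sub_pow A (2 ^ Suc ?d)) (sub_pow A (2 ^ ?d)) id"
        unfolding mult_into_def
      proof (intro conjI ballI alg)
        have c: "carrier (sub_pow A (2 ^ Suc ?d)) \<subseteq> carrier (sub_pow A (2 ^ ?d))"
          using alg_pow_antimono[OF A 1, of ?d "2 ^ Suc ?d"] by (simp add: sub_pow_def)
        then show "id \<in> alg_hom (sub_pow A (2 ^ Suc ?d)) (sub_pow A (2 ^ ?d))"
          by (auto simp: alg_hom_def sub_pow_def)
        fix x y assume "x \<in> carrier (sub_pow A (2 ^ ?d))" "y \<in> carrier (sub_pow A (2 ^ ?d))"
        then show "x \<otimes>\<^bsub>sub_pow A (2 ^ ?d)\<^esub> y \<in> id ` carrier (sub_pow A (2 ^ Suc ?d))"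
          using alg_pow_mult[OF A 1 1, of x ?d y ?d] by (simp add: sub_pow_def mult_2)
      qed simp
      then show ?thesis using Suc.IH e by (auto intro: dnil.step)
    qed (use Suc.IH in simp)
  qed
  from this[of m] have "dnil (sub_pow A 1)" by simp
  then show ?thesis by (simp add: sub_pow_def)
qed

end

section \<open>Matrices over an algebra\<close>

text \<open>The product of two matrix units is a matrix unit or zero.\<close>

definition mat_op :: "(nat \<times> nat) \<times> (nat \<times> nat) \<Rightarrow> (nat \<times> nat) \<times> (nat \<times> nat) \<Rightarrow> ((nat \<times> nat) \<times> (nat \<times> nat)) option" where
  "mat_op p q = (if snd p = fst q then Some (fst p, snd q) else None)"

context kk_setting
begin

lemma mat_op_assoc: "opr_assoc mat_op"
  by (simp add: opr_assoc_def mat_op_def)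

definition ment :: "('h, 'a) univ \<Rightarrow> (nat \<times> nat) \<times> (nat \<times> nat) \<Rightarrow> ('h, 'a) univ" where
  "ment x = (\<lambda>(i, j). entry x i j)"

lemma mat_carrier:
  "x \<in> carrier (mat_alg k A) \<longleftrightarrow>
    (\<exists>f. x = Mtx f) \<and> ment x \<in> carrier (fsa mat_op A) \<and> (\<forall>i j. entry x i j \<noteq> \<zero>\<^bsub>A\<^esub> \<longrightarrow> fst i < k \<and> fst j < k)"
proof -
  have 1: "{i. ment x i \<noteq> \<zero>\<^bsub>A\<^esub>} = {(i, j). entry x i j \<noteq> \<zero>\<^bsub>A\<^esub>}" by (auto simp: ment_def)
  have 2: "(\<forall>p. ment x p \<in> carrier A) \<longleftrightarrow> (\<forall>i j. entry x i j \<in> carrier A)" by (simp add: ment_def)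
  have 3: "x \<in> carrier (mat_alg k A) \<longleftrightarrow> (\<exists>f. x = Mtx f) \<and> (\<forall>i j. entry x i j \<in> carrier A) \<and>
      finite {(i, j). entry x i j \<noteq> \<zero>\<^bsub>A\<^esub>} \<and> (\<forall>i j. entry x i j \<noteq> \<zero>\<^bsub>A\<^esub> \<longrightarrow> fst i < k \<and> fst j < k)"
    unfolding mat_alg_def by (cases x; simp)
  show ?thesis unfolding 3 fsa_simps 1 2 by blast
qed

lemma mat_ops:
  "\<zero>\<^bsub>mat_alg k A\<^esub> = Mtx (\<lambda>_ _. \<zero>\<^bsub>A\<^esub>)" "x \<oplus>\<^bsub>mat_alg k A\<^esub> y = Mtx (\<lambda>i j. entry x i j \<oplus>\<^bsub>A\<^esub> entry y i j)"
  "lact (mat_alg k A) h x = Mtx (\<lambda>i j. lact A h (entry x i j))" "ract (mat_alg k A) x h = Mtx (\<lambda>i j. ract A (entry x i j) h)"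
  by (simp_all add: mat_alg_def)

lemma mat_bound: fixes A :: "('h, 'a) ualg" shows "x \<in> carrier (mat_alg k A) \<Longrightarrow> entry x i j \<noteq> \<zero>\<^bsub>A\<^esub> \<Longrightarrow> fst i < k \<and> fst j < k"
  unfolding mat_carrier by blast

lemma mat_memI:
  fixes A :: "('h, 'a) ualg" shows "ment (Mtx f) \<in> carrier (fsa mat_op A) \<Longrightarrow> (\<And>i j. f i j \<noteq> \<zero>\<^bsub>A\<^esub> \<Longrightarrow> fst i < k \<and> fst j < k) \<Longrightarrow> Mtx f \<in> carrier (mat_alg k A)"
  unfolding mat_carrier univ.sel by blast

lemma mat_eqI:
  fixes A B :: "('h, 'a) ualg"
  assumes "x \<in> carrier (mat_alg k A)" "y \<in> carrier (mat_alg l B)" "\<And>i j. entry x i j = entry y i j"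
  shows "x = y"
proof -
  obtain p q where pq: "x = Mtx p" "y = Mtx q" using assms(1,2) unfolding mat_carrier by blast
  have "p = q" by (intro ext) (use assms(3)[unfolded pq] in simp)
  then show ?thesis using pq by simp
qed

lemma entry_closed:
  fixes A :: "('h, 'a) ualg" shows "x \<in> carrier (mat_alg k A) \<Longrightarrow> entry x i j \<in> carrier A"
  by (drule mat_carrier[THEN iffD1], unfold fsa_simps, elim conjE allE[of _ "(i, j)"]) (simp add: ment_def)

lemma mat_mult:
  assumes A: "is_algebra A" and x: "x \<in> carrier (mat_alg k A)" and y: "y \<in> carrier (mat_alg k A)"
  shows "x \<otimes>\<^bsub>mat_alg k A\<^esub> y = Mtx (\<lambda>i j. (ment x \<otimes>\<^bsub>fsa mat_op A\<^esub> ment y) (i, j))"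
proof -
  interpret abelian_group A using A by (rule algebra_abelian_group)
  note c = entry_closed[OF x] entry_closed[OF y]
  have fin: "finite {l. entry x i l \<noteq> \<zero>\<^bsub>A\<^esub>}" for i
  proof -
    have "finite {(i, j). entry x i j \<noteq> \<zero>\<^bsub>A\<^esub>}" using x by (auto simp: mat_alg_def)
    then have "finite (Pair i -` {(i, j). entry x i j \<noteq> \<zero>\<^bsub>A\<^esub>})" by (rule finite_vimageI) (simp add: inj_on_def)
    then show ?thesis by (simp add: vimage_def)
  qed
  have "(\<Oplus>\<^bsub>A\<^esub>l\<in>{l. entry x i l \<noteq> \<zero>\<^bsub>A\<^esub>}. entry x i l \<otimes>\<^bsub>A\<^esub> entry y l j) = (ment x \<otimes>\<^bsub>fsa mat_op A\<^esub> ment y) (i, j)" for i j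
  proof -
    let ?L = "{l. entry x i l \<noteq> \<zero>\<^bsub>A\<^esub> \<and> entry y l j \<noteq> \<zero>\<^bsub>A\<^esub>}" and ?h = "\<lambda>l. ((i, l), (l, j))"
    let ?S = "{p \<in> {i. ment x i \<noteq> \<zero>\<^bsub>A\<^esub>} \<times> {i. ment y i \<noteq> \<zero>\<^bsub>A\<^esub>}. mat_op (fst p) (snd p) = Some (i, j)}"
    let ?g = "\<lambda>p. ment x (fst p) \<otimes>\<^bsub>A\<^esub> ment y (snd p)"
    have S: "?S = ?h ` ?L" by (auto simp: mat_op_def ment_def split: if_splits)
    have "(\<Oplus>\<^bsub>A\<^esub>l\<in>{l. entry x i l \<noteq> \<zero>\<^bsub>A\<^esub>}. entry x i l \<otimes>\<^bsub>A\<^esub> entry y l j) = (\<Oplus>\<^bsub>A\<^esub>l\<in>?L. ?g (?h l))"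
      by (rule add.finprod_mono_neutral_cong_right[OF fin]) (auto simp: ment_def c A)
    also have "\<dots> = (\<Oplus>\<^bsub>A\<^esub>p\<in>?h ` ?L. ?g p)"
      by (rule add.finprod_reindex[symmetric]) (auto simp: ment_def inj_on_def c A)
    finally show ?thesis unfolding S[symmetric] by (simp add: fsa_def)
  qed
  then show ?thesis by (simp add: mat_alg_def)
qed

lemma mat_algebra: assumes A: "is_algebra A" shows "is_algebra (mat_alg k A)"
proof -
  let ?S = "{p :: (nat \<times> nat) \<times> nat \<times> nat. fst (fst p) < k \<and> fst (snd p) < k}"
  have S: "r \<in> ?S" if "p \<in> ?S" "q \<in> ?S" "mat_op p q = Some r" for p q r
    using that by (auto simp: mat_op_def split: if_splits)
  have C: "x \<in> carrier (mat_alg k A) \<longleftrightarrow> x = Mtx (\<lambda>i j. ment x (i, j)) \<and> ment x \<in> carrier (fsa mat_op A) \<and> (\<forall>p. ment x p \<noteq> \<zero>\<^bsub>A\<^esub> \<longrightarrow> p \<in> ?S)"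
    for x unfolding mat_carrier split_paired_All by (cases x) (auto simp: ment_def)
  have i: "ment (Mtx (\<lambda>i j. f (i, j))) = f" for f :: "(nat \<times> nat) \<times> nat \<times> nat \<Rightarrow> ('h, 'a) univ" by (auto simp: ment_def)
  show ?thesis
    by (rule fsa_sub_algebra(1)[OF A mat_op_assoc S C i]) (simp_all add: mat_mult[OF A], simp_all add: mat_ops fsa_simps ment_def)
qed

lemma entry_add_hom: "is_algebra A \<Longrightarrow> (\<lambda>x. entry x i j) \<in> add_hom (mat_alg k A) A"
  by (auto simp: add_hom_def entry_closed mat_ops)

lemma mat_subalg:
  assumes A: "is_algebra A" and k: "k \<le> l" shows "subalg (mat_alg k A) (mat_alg l A)"
proof -
  have "x \<in> carrier (mat_alg l A)" if x: "x \<in> carrier (mat_alg k A)" for x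
  proof -
    obtain f where f: "x = Mtx f" using x unfolding mat_carrier by blast
    have m: "ment x \<in> carrier (fsa mat_op A)" using x unfolding mat_carrier by blast
    show ?thesis unfolding f
      by (rule mat_memI[OF m[unfolded f]]) (use mat_bound[OF x] k in \<open>fastforce simp: f dest: less_le_trans\<close>)
  qed
  then show ?thesis unfolding subalg_def alg_hom_def using A by (auto simp: mat_algebra) (auto simp: mat_alg_def)
qed

definition mmono :: "('h, 'a) ualg \<Rightarrow> nat \<times> nat \<Rightarrow> nat \<times> nat \<Rightarrow> ('h, 'a) univ \<Rightarrow> ('h, 'a) univ" where
  "mmono A i j a = Mtx (\<lambda>i' j'. if i' = i \<and> j' = j then a else \<zero>\<^bsub>A\<^esub>)"

lemma ment_mmono: "ment (mmono A i j a) = fmono A (i, j) a"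
  by (auto simp: ment_def mmono_def fmono_def)

lemma mmono_closed: "is_algebra A \<Longrightarrow> a \<in> carrier A \<Longrightarrow> fst i < k \<Longrightarrow> fst j < k \<Longrightarrow> mmono A i j a \<in> carrier (mat_alg k A)"
  unfolding mat_carrier ment_mmono by (auto simp: fmono_closed) (auto simp: mmono_def split: if_splits)

lemma mat_induct [consumes 2, case_names zero mono add]:
  assumes A: "is_algebra A" and x: "x \<in> carrier (mat_alg k A)"
    and 0: "P \<zero>\<^bsub>mat_alg k A\<^esub>" and m: "\<And>i j a. fst i < k \<Longrightarrow> fst j < k \<Longrightarrow> a \<in> carrier A \<Longrightarrow> P (mmono A i j a)"
    and add: "\<And>y z. y \<in> carrier (mat_alg k A) \<Longrightarrow> z \<in> carrier (mat_alg k A) \<Longrightarrow> P y \<Longrightarrow> P z \<Longrightarrow> P (y \<oplus>\<^bsub>mat_alg k A\<^esub> z)"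
  shows "P x"
proof -
  have cx: "ment x \<in> carrier (fsa mat_op A)" using x by (simp add: mat_carrier)
  let ?M = "\<lambda>f. Mtx (\<lambda>i j. f (i, j)) :: ('h, 'a) univ"
  have "?M (ment x) \<in> carrier (mat_alg k A) \<and> P (?M (ment x))"
    using A cx
  proof (induction rule: fsa_induct)
    case zero then show ?case using 0 mat_algebra[OF A, of k] by (simp add: fsa_simps flip: mat_ops(1)[of k])
  next
    case (mono p a)
    obtain i j where p: "p = (i, j)" by (cases p)
    then have ij: "fst i < k" "fst j < k" using mat_bound[OF x, of i j] mono(1) by (simp_all add: ment_def)
    have "?M (fmono A p a) = mmono A i j a" by (auto simp: p mmono_def fmono_def)
    then show ?case using m[OF ij] mono(2) mmono_closed[OF A mono(2) ij] by simp
  next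
    case (add y z)
    then have "P (?M y \<oplus>\<^bsub>mat_alg k A\<^esub> ?M z)" "?M y \<oplus>\<^bsub>mat_alg k A\<^esub> ?M z \<in> carrier (mat_alg k A)"
      using assms(5) mat_algebra[OF A, of k] by auto
    then show ?case by (simp add: mat_ops fsa_simps)
  qed
  moreover have "?M (ment x) = x" using x by (auto simp: mat_carrier ment_def)
  ultimately show ?thesis by simp
qed

lemma mmono_zero: "mmono A i j \<zero>\<^bsub>A\<^esub> = \<zero>\<^bsub>mat_alg k A\<^esub>"
  by (auto simp: mmono_def mat_ops)

lemma mmono_mult:
  assumes "is_algebra A" "a \<in> carrier A" "b \<in> carrier A" "fst i < k" "fst j < k" "fst j' < k" "fst l < k"
  shows "mmono A i j a \<otimes>\<^bsub>mat_alg k A\<^esub> mmono A j' l b = (if j = j' then mmono A i l (a \<otimes>\<^bsub>A\<^esub> b) else \<zero>\<^bsub>mat_alg k A\<^esub>)"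
  using assms by (subst mat_mult)
    (auto simp: mmono_closed, auto simp: ment_mmono fmono_mult mat_op_def, auto simp: mmono_def fmono_def mat_ops fsa_simps)

lemma mat_mult_hom:
  assumes A: "is_algebra A" and C: "is_algebra C" and F: "F \<in> add_hom (mat_alg k A) C"
    and m: "\<And>i j j' l a b. a \<in> carrier A \<Longrightarrow> b \<in> carrier A \<Longrightarrow> fst i < k \<Longrightarrow> fst j < k \<Longrightarrow> fst j' < k \<Longrightarrow> fst l < k \<Longrightarrow>
      F (mmono A i j a) \<otimes>\<^bsub>C\<^esub> F (mmono A j' l b) = (if j = j' then F (mmono A i l (a \<otimes>\<^bsub>A\<^esub> b)) else \<zero>\<^bsub>C\<^esub>)"
    and x: "x \<in> carrier (mat_alg k A)" and y: "y \<in> carrier (mat_alg k A)"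
  shows "F (x \<otimes>\<^bsub>mat_alg k A\<^esub> y) = F x \<otimes>\<^bsub>C\<^esub> F y"
proof -
  note P = mat_algebra[OF A, of k]
  note F0 = add_hom_zero[OF F P C] and Fa = add_hom_add[OF F] and Fc = add_hom_closed[OF F]
  show ?thesis
    using A x
  proof (induction rule: mat_induct)
    case (mono i j a)
    then have [simp]: "mmono A i j a \<in> carrier (mat_alg k A)" using A by (simp add: mmono_closed)
    note ija = mono
    show ?case using A y
    proof (induction rule: mat_induct)
      case (mono i' j' b)
      then show ?case using A ija by (simp add: mmono_mult m F0)
    qed (use P C in \<open>simp_all add: F0 Fa Fc algebra_distrib_l\<close>)
  qed (use P C y in \<open>simp_all add: F0 Fa Fc algebra_distrib_r\<close>)
qed

lemma mat_map_closed:
  fixes A B :: "('h, 'a) ualg"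
  assumes "x \<in> carrier (mat_alg k A)" "\<And>a. a \<in> carrier A \<Longrightarrow> \<phi> a \<in> carrier B" "\<phi> \<zero>\<^bsub>A\<^esub> = \<zero>\<^bsub>B\<^esub>"
  shows "mat_map \<phi> x \<in> carrier (mat_alg k B)"
proof -
  have "finite {p. \<phi> (ment x p) \<noteq> \<zero>\<^bsub>B\<^esub>}"
    by (rule finite_subset[of _ "{p. ment x p \<noteq> \<zero>\<^bsub>A\<^esub>}"]) (use assms in \<open>auto simp: mat_carrier fsa_simps\<close>)
  moreover have m: "ment (mat_map \<phi> x) = (\<lambda>p. \<phi> (ment x p))" by (auto simp: ment_def mat_map_def)
  ultimately have "ment (mat_map \<phi> x) \<in> carrier (fsa mat_op B)" using assms(1,2) unfolding mat_carrier fsa_simps m by blast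
  then show ?thesis unfolding mat_map_def by (rule mat_memI) (use mat_bound[OF assms(1)] assms(3) in metis)
qed

lemma entry_mat_map [simp]: "entry (mat_map \<phi> x) i j = \<phi> (entry x i j)"
  by (simp add: mat_map_def)

lemma mat_map_und_hom:
  assumes "\<phi> \<in> und_hom A B" "\<phi> \<zero>\<^bsub>A\<^esub> = \<zero>\<^bsub>B\<^esub>"
  shows "mat_map \<phi> \<in> und_hom (mat_alg k A) (mat_alg k B)"
proof -
  have "mat_map \<phi> x \<in> carrier (mat_alg k B)" if "x \<in> carrier (mat_alg k A)" for x
    using that und_hom_closed[OF assms(1)] assms(2) by (rule mat_map_closed)
  moreover have "\<phi> (a \<oplus>\<^bsub>A\<^esub> b) = \<phi> a \<oplus>\<^bsub>B\<^esub> \<phi> b" if "und \<noteq> Sets" "a \<in> carrier A" "b \<in> carrier A" for a b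
    using assms(1) that unfolding und_hom_def by blast
  ultimately show ?thesis
    unfolding und_hom_def using und_hom_act[OF assms(1)] by (simp add: mat_ops mat_map_def entry_closed)
qed

lemma mat_map_add_hom:
  assumes "is_algebra A" "is_algebra B" "\<phi> \<in> add_hom A B"
  shows "mat_map \<phi> \<in> add_hom (mat_alg k A) (mat_alg k B)"
  using mat_map_closed[where A = A and B = B and \<phi> = \<phi> and k = k, OF _ add_hom_closed[OF assms(3)] add_hom_zero[OF assms(3,1,2)]]
  by (auto simp: add_hom_def) (auto simp: mat_map_def mat_ops entry_closed add_hom_add[OF assms(3)])

lemma mat_map_mmono: "\<phi> \<zero>\<^bsub>A\<^esub> = \<zero>\<^bsub>B\<^esub> \<Longrightarrow> mat_map \<phi> (mmono A i j a) = mmono B i j (\<phi> a)"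
  by (auto simp: mat_map_def mmono_def fun_eq_iff)

lemma mat_map_alg_hom:
  assumes A: "is_algebra A" and B: "is_algebra B" and \<phi>: "\<phi> \<in> alg_hom A B"
  shows "mat_map \<phi> \<in> alg_hom (mat_alg k A) (mat_alg k B)"
proof -
  note z = add_hom_zero[OF alg_hom_add_hom[OF \<phi>] A B]
  note a = mat_map_add_hom[OF A B alg_hom_add_hom[OF \<phi>], of k]
  have "mat_map \<phi> \<in> bimod_hom (mat_alg k A) (mat_alg k B)"
    using a by (auto simp: bimod_hom_def) (auto simp: mat_ops mat_map_def entry_closed alg_homD[OF \<phi>])
  moreover have "mat_map \<phi> (x \<otimes>\<^bsub>mat_alg k A\<^esub> y) = mat_map \<phi> x \<otimes>\<^bsub>mat_alg k B\<^esub> mat_map \<phi> y"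
    if "x \<in> carrier (mat_alg k A)" "y \<in> carrier (mat_alg k A)" for x y
    by (rule mat_mult_hom[OF A mat_algebra[OF B] a _ that])
      (use B in \<open>simp add: mat_map_mmono[of \<phi> A B, OF z] mmono_mult alg_hom_closed[OF \<phi>] alg_homD[OF \<phi>]\<close>)
  ultimately show ?thesis by (auto simp: alg_hom_iff)
qed

lemma mat_map_comp: "mat_map \<psi> (mat_map \<phi> x) = mat_map (\<psi> \<circ> \<phi>) x"
  by (simp add: mat_map_def)

lemma mat_map_subalg: "subalg S E \<Longrightarrow> subalg (mat_alg k S) (mat_alg k E)"
proof -
  assume sub: "subalg S E"
  then have S: "is_algebra S" and E: "is_algebra E" and i: "id \<in> alg_hom S E" by (auto simp: subalg_def)
  have "id \<in> alg_hom (mat_alg k S) (mat_alg k E)"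
    using mat_map_alg_hom[OF S E i] by (rule alg_hom_cong) (auto simp: mat_map_def mat_carrier mat_algebra[OF S])
  then show ?thesis using S E by (simp add: subalg_def mat_algebra)
qed

lemma corner_hom: assumes A: "is_algebra A" and k: "0 < k" shows "corner A \<in> alg_hom A (mat_alg k A)"
proof -
  have c: "corner A a = mmono A (0, 0) (0, 0) a" for a by (simp add: corner_def mmono_def)
  have "mmono A (0, 0) (0, 0) (a \<otimes>\<^bsub>A\<^esub> b) = mmono A (0, 0) (0, 0) a \<otimes>\<^bsub>mat_alg k A\<^esub> mmono A (0, 0) (0, 0) b" if "a \<in> carrier A" "b \<in> carrier A" for a b
    using A k that by (subst mmono_mult) auto
  then show ?thesis using A k unfolding alg_hom_def
    by (auto simp: c mmono_closed) (auto simp: mmono_def mat_ops fun_eq_iff)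
qed

text \<open>The second summand of a block sum. Both summands are homomorphisms and annihilate each other, so
  their sum is a homomorphism.\<close>

definition mshift :: "('h, 'a) ualg \<Rightarrow> nat \<Rightarrow> ('h, 'a) univ \<Rightarrow> ('h, 'a) univ" where
  "mshift A k y = Mtx (\<lambda>(i, a) (j, b). if k \<le> i \<and> k \<le> j then entry y (i - k, a) (j - k, b) else \<zero>\<^bsub>A\<^esub>)"

lemma mshift_closed:
  assumes A: "is_algebra A" and y: "y \<in> carrier (mat_alg l A)" shows "mshift A k y \<in> carrier (mat_alg (k + l) A)"
proof -
  let ?r = "\<lambda>((i, a), (j, b)). ((i + k, a), (j + k, b))"
  have "{p. ment (mshift A k y) p \<noteq> \<zero>\<^bsub>A\<^esub>} \<subseteq> ?r ` {p. ment y p \<noteq> \<zero>\<^bsub>A\<^esub>}"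
  proof
    fix p assume "p \<in> {p. ment (mshift A k y) p \<noteq> \<zero>\<^bsub>A\<^esub>}"
    moreover obtain i a j b where p: "p = ((i, a), (j, b))" by (metis surj_pair)
    ultimately have "k \<le> i" "k \<le> j" "entry y (i - k, a) (j - k, b) \<noteq> \<zero>\<^bsub>A\<^esub>" by (auto simp: ment_def mshift_def split: if_splits)
    then show "p \<in> ?r ` {p. ment y p \<noteq> \<zero>\<^bsub>A\<^esub>}" unfolding p
      by (intro image_eqI[of _ _ "((i - k, a), (j - k, b))"]) (auto simp: ment_def)
  qed
  then have "finite {p. ment (mshift A k y) p \<noteq> \<zero>\<^bsub>A\<^esub>}"
    by (rule finite_subset) (use y in \<open>auto simp: mat_carrier fsa_simps\<close>)
  moreover have "ment (mshift A k y) p \<in> carrier A" for p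
    using entry_closed[OF y] A by (auto simp: ment_def mshift_def split: prod.split)
  moreover have "fst i < k + l \<and> fst j < k + l" if "entry (mshift A k y) i j \<noteq> \<zero>\<^bsub>A\<^esub>" for i j
  proof -
    obtain i' a j' b where ij: "i = (i', a)" "j = (j', b)" by (metis surj_pair)
    with that have "k \<le> i'" "k \<le> j'" "entry y (i' - k, a) (j' - k, b) \<noteq> \<zero>\<^bsub>A\<^esub>" by (auto simp: mshift_def split: if_splits)
    then show ?thesis using y unfolding mat_carrier ij by fastforce
  qed
  ultimately show ?thesis unfolding mat_carrier fsa_simps by (auto simp: mshift_def)
qed

lemma mshift_hom: assumes A: "is_algebra A" shows "mshift A k \<in> alg_hom (mat_alg l A) (mat_alg (k + l) A)"
proof -
  have m: "mshift A k (mmono A (i, a) (j, b) x) = mmono A (i + k, a) (j + k, b) x" for i a j b x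
    by (auto simp: mshift_def mmono_def fun_eq_iff)
  have a: "mshift A k \<in> add_hom (mat_alg l A) (mat_alg (k + l) A)"
    using A by (auto simp: add_hom_def mshift_closed) (auto simp: mat_ops mshift_def fun_eq_iff)
  have b: "mshift A k \<in> bimod_hom (mat_alg l A) (mat_alg (k + l) A)"
    using A a by (auto simp: bimod_hom_def) (auto simp: mat_ops mshift_def fun_eq_iff)
  have "mshift A k (x \<otimes>\<^bsub>mat_alg l A\<^esub> y) = mshift A k x \<otimes>\<^bsub>mat_alg (k + l) A\<^esub> mshift A k y"
    if "x \<in> carrier (mat_alg l A)" "y \<in> carrier (mat_alg l A)" for x y
  proof (rule mat_mult_hom[OF A mat_algebra[OF A] a _ that])
    fix i j j' n :: "nat \<times> nat" and a b assume h: "a \<in> carrier A" "b \<in> carrier A" "fst i < l" "fst j < l" "fst j' < l" "fst n < l"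
    show "mshift A k (mmono A i j a) \<otimes>\<^bsub>mat_alg (k + l) A\<^esub> mshift A k (mmono A j' n b) =
       (if j = j' then mshift A k (mmono A i n (a \<otimes>\<^bsub>A\<^esub> b)) else \<zero>\<^bsub>mat_alg (k + l) A\<^esub>)"
      using h A by (cases i; cases j; cases j'; cases n) (simp add: m mmono_mult)
  qed
  then show ?thesis using b by (auto simp: alg_hom_iff)
qed

lemma block_sum_hom:
  assumes A: "is_algebra A" and f: "f \<in> alg_hom X (mat_alg k A)" and g: "g \<in> alg_hom X (mat_alg l A)" and X: "is_algebra X"
  shows "(\<lambda>x. block_sum A k (f x) (g x)) \<in> alg_hom X (mat_alg (k + l) A)"
proof -
  let ?M = "mat_alg (k + l) A"
  note M = mat_algebra[OF A, of "k + l"] and Mk = mat_algebra[OF A, of k] and Ml = mat_algebra[OF A, of l]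
  have sub: "subalg (mat_alg k A) ?M" by (rule mat_subalg[OF A]) simp
  have f': "f \<in> alg_hom X ?M" by (rule subalg_alg_hom[OF sub f])
  have g': "(\<lambda>x. mshift A k (g x)) \<in> alg_hom X ?M" using alg_hom_comp[OF g mshift_hom[OF A]] by (simp add: comp_def)
  have eq: "block_sum A k x y = x \<oplus>\<^bsub>?M\<^esub> mshift A k y" if x: "x \<in> carrier (mat_alg k A)" and y: "y \<in> carrier (mat_alg l A)" for x y
  proof -
    have "entry x (i, a) (j, b) = \<zero>\<^bsub>A\<^esub>" if "\<not> (i < k \<and> j < k)" for i a j b using x that unfolding mat_carrier by fastforce
    then show ?thesis using A entry_closed[OF x] entry_closed[OF y]
      by (auto simp: block_sum_def mat_ops mshift_def fun_eq_iff)
  qed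
  note ml = alg_homD(1)[OF mshift_hom[OF A]] and mc = alg_hom_closed[OF mshift_hom[OF A]]
  have s0: "mshift A k \<zero>\<^bsub>mat_alg l A\<^esub> = \<zero>\<^bsub>?M\<^esub>" by (rule add_hom_zero[OF alg_hom_add_hom[OF mshift_hom[OF A]] Ml M])
  have z0: "\<zero>\<^bsub>mat_alg k A\<^esub> = \<zero>\<^bsub>?M\<^esub>" by (rule subalg_zero[OF sub])
  have orth: "x \<otimes>\<^bsub>?M\<^esub> mshift A k y = \<zero>\<^bsub>?M\<^esub> \<and> mshift A k y \<otimes>\<^bsub>?M\<^esub> x = \<zero>\<^bsub>?M\<^esub>"
    if x: "x \<in> carrier (mat_alg k A)" and y: "y \<in> carrier (mat_alg l A)" for x y
    using A x
  proof (induction rule: mat_induct)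
    case zero
    then show ?case using M mc[OF y] by (simp add: z0)
  next
    case (mono i j a)
    note ija = mono
    have mm: "mmono A i j a \<in> carrier ?M" using mono A by (auto simp: mmono_closed)
    show ?case using A y
    proof (induction rule: mat_induct)
      case zero
      then show ?case using M mm by (simp add: s0)
    next
      case (mono i' j' b)
      obtain i1 a1 j1 b1 where p: "i' = (i1, a1)" "j' = (j1, b1)" by (cases i', cases j')
      have m: "mshift A k (mmono A i' j' b) = mmono A (i1 + k, a1) (j1 + k, b1) b"
        by (auto simp: p mshift_def mmono_def fun_eq_iff)
      show ?case unfolding m using mono ija A p by (auto simp: mmono_mult)
    next
      case (add y z)
      then show ?case using M mm mc by (simp add: ml algebra_distrib_l algebra_distrib_r)
    qed
  next
    case (add u v)
    have c: "u \<in> carrier ?M" "v \<in> carrier ?M" using add subalg_carrier[OF sub] by auto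
    then show ?case using add M mc[OF y] by (simp add: subalg_ops(1)[OF sub] algebra_distrib_l algebra_distrib_r)
  qed
  have cl: "f x \<in> carrier ?M" "mshift A k (g x) \<in> carrier ?M" "f x \<in> carrier (mat_alg k A)" "g x \<in> carrier (mat_alg l A)"
    if "x \<in> carrier X" for x
    using alg_hom_closed[OF f' that] alg_hom_closed[OF g' that] alg_hom_closed[OF f that] alg_hom_closed[OF g that] by auto
  have "(\<lambda>x. f x \<oplus>\<^bsub>?M\<^esub> mshift A k (g x)) \<in> alg_hom X ?M"
    unfolding alg_hom_def using M cl orth
    by (auto simp: alg_homD[OF f'] alg_homD[OF g'] algebra_ac algebra_lact_add algebra_ract_add algebra_distrib_l algebra_distrib_r)
  then show ?thesis by (rule alg_hom_cong[OF _ _ X]) (simp add: eq cl)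
qed

text \<open>Where \<open>mat_tensor\<close> puts position \<open>i\<close> of the block at position \<open>I\<close>.\<close>

definition tens_index :: "nat \<Rightarrow> nat \<times> nat \<Rightarrow> nat \<times> nat \<Rightarrow> nat \<times> nat" where
  "tens_index l I i = (fst I * l + fst i, prod_encode (snd I, snd i))"

lemma tens_index:
  assumes "fst i < l"
  shows "(p div l, fst (prod_decode a)) = I \<and> (p mod l, snd (prod_decode a)) = i \<longleftrightarrow> (p, a) = tens_index l I i"
proof
  assume h: "(p div l, fst (prod_decode a)) = I \<and> (p mod l, snd (prod_decode a)) = i"
  have "p = p div l * l + p mod l" by simp
  moreover have "a = prod_encode (fst (prod_decode a), snd (prod_decode a))" by simp
  ultimately show "(p, a) = tens_index l I i" using h unfolding tens_index_def by (metis fst_conv snd_conv)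
next
  assume "(p, a) = tens_index l I i"
  then show "(p div l, fst (prod_decode a)) = I \<and> (p mod l, snd (prod_decode a)) = i"
    using assms by (cases I, cases i) (auto simp: tens_index_def)
qed

lemma mat_tensor_closed:
  assumes A: "is_algebra A" and x: "x \<in> carrier (mat_alg k (mat_alg l A))"
  shows "mat_tensor l x \<in> carrier (mat_alg (k * l) A)"
proof -
  have c1: "entry x I K \<in> carrier (mat_alg l A)" for I K by (rule entry_closed[OF x])
  have nz: "entry x I K \<noteq> \<zero>\<^bsub>mat_alg l A\<^esub> \<and> fst i < l \<and> fst j < l \<and> fst I < k \<and> fst K < k" if "entry (entry x I K) i j \<noteq> \<zero>\<^bsub>A\<^esub>" for I K i j
  proof -
    have 1: "entry x I K \<noteq> \<zero>\<^bsub>mat_alg l A\<^esub>" using that by (auto simp: mat_ops)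
    then show ?thesis using x c1[of I K] that unfolding mat_carrier by blast
  qed
  let ?S = "SIGMA p:{p. ment x p \<noteq> \<zero>\<^bsub>mat_alg l A\<^esub>}. {q. ment (ment x p) q \<noteq> \<zero>\<^bsub>A\<^esub>}"
  let ?r = "\<lambda>((I, K), (i, j)). (tens_index l I i, tens_index l K j)"
  have e: "entry (mat_tensor l x) i j = entry (entry x (fst i div l, fst (prod_decode (snd i))) (fst j div l, fst (prod_decode (snd j))))
       (fst i mod l, snd (prod_decode (snd i))) (fst j mod l, snd (prod_decode (snd j)))" for i j
    by (cases i, cases j) (simp add: mat_tensor_def)
  have sup: "{p. ment (mat_tensor l x) p \<noteq> \<zero>\<^bsub>A\<^esub>} \<subseteq> ?r ` ?S"
  proof
    fix p assume p: "p \<in> {p. ment (mat_tensor l x) p \<noteq> \<zero>\<^bsub>A\<^esub>}"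
    obtain i a j b where ij: "p = ((i, a), (j, b))" by (metis surj_pair)
    let ?I = "(i div l, fst (prod_decode a))" and ?K = "(j div l, fst (prod_decode b))"
    let ?i = "(i mod l, snd (prod_decode a))" and ?j = "(j mod l, snd (prod_decode b))"
    have n: "entry (entry x ?I ?K) ?i ?j \<noteq> \<zero>\<^bsub>A\<^esub>" using p by (simp add: ij ment_def e)
    have "p = ?r ((?I, ?K), (?i, ?j))"
      using tens_index[of ?i l i a ?I] tens_index[of ?j l j b ?K] nz[OF n] by (auto simp: ij)
    moreover have "((?I, ?K), (?i, ?j)) \<in> ?S" using n nz[OF n] by (auto simp: ment_def)
    ultimately show "p \<in> ?r ` ?S" by (rule image_eqI)
  qed
  have "finite ?S"
  proof (rule finite_SigmaI)
    show "finite {p. ment x p \<noteq> \<zero>\<^bsub>mat_alg l A\<^esub>}" using x by (simp add: mat_carrier fsa_simps)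
    show "finite {q. ment (ment x p) q \<noteq> \<zero>\<^bsub>A\<^esub>}" for p
      using c1[of "fst p" "snd p"] by (cases p) (simp add: mat_carrier fsa_simps ment_def[of x])
  qed
  then have "finite {p. ment (mat_tensor l x) p \<noteq> \<zero>\<^bsub>A\<^esub>}" using sup finite_surj by blast
  moreover have "ment (mat_tensor l x) p \<in> carrier A" for p
    using entry_closed[OF c1] by (cases p) (simp add: ment_def e)
  moreover have "fst i < k * l \<and> fst j < k * l" if "entry (mat_tensor l x) i j \<noteq> \<zero>\<^bsub>A\<^esub>" for i j
    using nz[OF that[unfolded e]] by (auto simp: less_mult_imp_div_less div_less_iff_less_mult)
  ultimately show ?thesis unfolding mat_carrier fsa_simps by (auto simp: mat_tensor_def)
qed

lemma mat_tensor_mmono: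
  assumes A: "is_algebra A" and "fst i < l" "fst j < l"
  shows "mat_tensor l (mmono (mat_alg l A) I K (mmono A i j a)) = mmono A (tens_index l I i) (tens_index l K j) a"
proof -
  have "entry (entry (mmono (mat_alg l A) I K (mmono A i j a)) (p div l, fst (prod_decode c)) (q div l, fst (prod_decode d)))
     (p mod l, snd (prod_decode c)) (q mod l, snd (prod_decode d)) =
     (if (p, c) = tens_index l I i \<and> (q, d) = tens_index l K j then a else \<zero>\<^bsub>A\<^esub>)" for p c q d
    using tens_index[OF assms(2), of p c I] tens_index[OF assms(3), of q d K] by (auto simp: mmono_def mat_ops)
  then show ?thesis by (auto simp: mat_tensor_def mmono_def[of A "tens_index l I i"] fun_eq_iff split: prod.splits)
qed

lemma mat_tensor_hom:
  assumes A: "is_algebra A" shows "mat_tensor l \<in> alg_hom (mat_alg k (mat_alg l A)) (mat_alg (k * l) A)"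
proof -
  let ?M = "mat_alg l A" and ?N = "mat_alg (k * l) A"
  note M = mat_algebra[OF A, of l] and N = mat_algebra[OF A, of "k * l"] and P = mat_algebra[OF mat_algebra[OF A, of l], of k]
  have a: "mat_tensor l \<in> add_hom (mat_alg k ?M) ?N"
    using A by (auto simp: add_hom_def mat_tensor_closed) (auto simp: mat_ops mat_tensor_def fun_eq_iff)
  have b: "mat_tensor l \<in> bimod_hom (mat_alg k ?M) ?N"
    using A a by (auto simp: bimod_hom_def) (auto simp: mat_ops mat_tensor_def fun_eq_iff)
  note a0 = add_hom_zero[OF a P N]
  have lt: "fst (tens_index l I i) < k * l" if "fst I < k" "fst i < l" for I i
  proof -
    have "fst I * l + fst i < Suc (fst I) * l" using that by simp
    also have "\<dots> \<le> k * l" using that by (intro mult_le_mono1) simp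
    finally show ?thesis by (simp add: tens_index_def)
  qed
  have inj: "tens_index l I i = tens_index l K j \<longleftrightarrow> I = K \<and> i = j" if "fst i < l" "fst j < l" for I K i j
    using tens_index[OF that(1), of _ _ I] tens_index[OF that(2), of _ _ K] by (metis surj_pair)
  have madd: "mmono ?M I K (u \<oplus>\<^bsub>?M\<^esub> v) = mmono ?M I K u \<oplus>\<^bsub>mat_alg k ?M\<^esub> mmono ?M I K v" for I K u v
    using M by (auto simp: mmono_def mat_ops(2)[where k = k] fun_eq_iff)
  have z: "mmono ?M I K \<zero>\<^bsub>?M\<^esub> = \<zero>\<^bsub>mat_alg k ?M\<^esub>" for I K by (rule mmono_zero)
  have "mat_tensor l (x \<otimes>\<^bsub>mat_alg k ?M\<^esub> y) = mat_tensor l x \<otimes>\<^bsub>?N\<^esub> mat_tensor l y"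
    if "x \<in> carrier (mat_alg k ?M)" "y \<in> carrier (mat_alg k ?M)" for x y
  proof (rule mat_mult_hom[OF M N a _ that])
    fix I K K' L :: "nat \<times> nat" and u v assume u: "u \<in> carrier ?M" and v: "v \<in> carrier ?M" and ix: "fst I < k" "fst K < k" "fst K' < k" "fst L < k"
    have mc: "mmono ?M I K w \<in> carrier (mat_alg k ?M)" "mmono ?M K' L w \<in> carrier (mat_alg k ?M)" "mmono ?M I L w \<in> carrier (mat_alg k ?M)"
      if "w \<in> carrier ?M" for w using M ix that by (simp_all add: mmono_closed)
    note tc = add_hom_closed[OF a mc(1)] add_hom_closed[OF a mc(2)] add_hom_closed[OF a mc(3)]
    show "mat_tensor l (mmono ?M I K u) \<otimes>\<^bsub>?N\<^esub> mat_tensor l (mmono ?M K' L v) =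
       (if K = K' then mat_tensor l (mmono ?M I L (u \<otimes>\<^bsub>?M\<^esub> v)) else \<zero>\<^bsub>?N\<^esub>)"
      using A u
    proof (induction rule: mat_induct)
      case zero
      then show ?case using N M v tc(2)[OF v] by (simp add: z a0)
    next
      case (mono i j c)
      note ijc = mono
      have mm: "mmono A i j c \<in> carrier ?M" using A mono by (simp add: mmono_closed)
      show ?case using A v
      proof (induction rule: mat_induct)
        case zero
        then show ?case using N M tc(1)[OF mm] mm by (simp add: z a0)
      next
        case (mono i' j' d)
        then show ?case using A ijc ix
          by (auto simp: mat_tensor_mmono mmono_mult lt inj z a0)
      next
        case (add y w)
        then show ?case using N M mm tc by (simp add: algebra_distrib_l madd add_hom_add[OF a] mc)
      qed
    next
      case (add y w)
      then show ?case using N M v tc by (simp add: algebra_distrib_r madd add_hom_add[OF a] mc)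
    qed
  qed
  then show ?thesis using b by (auto simp: alg_hom_iff)
qed

end

section \<open>Polynomials on simplices\<close>

definition subst_mono :: "(nat \<Rightarrow> zpoly) \<Rightarrow> (nat \<Rightarrow>\<^sub>0 nat) \<Rightarrow> zpoly" where
  "subst_mono v e = (\<Prod>i\<in>expn e. v i ^ Poly_Mapping.lookup e i)"

abbreviation subst :: "(nat \<Rightarrow> zpoly) \<Rightarrow> zpoly \<Rightarrow> zpoly" where
  "subst v \<equiv> frag_extend (subst_mono v)"

lemma subst_mono_superset:
  "finite F \<Longrightarrow> expn e \<subseteq> F \<Longrightarrow> subst_mono v e = (\<Prod>i\<in>F. v i ^ Poly_Mapping.lookup e i)"
  unfolding subst_mono_def by (rule prod.mono_neutral_left) (auto simp: in_keys_iff)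

lemma subst_mono_add: "subst_mono v (e + f) = subst_mono v e * subst_mono v f"
proof -
  let ?F = "expn e \<union> expn f"
  have "subst_mono v (e + f) = (\<Prod>i\<in>?F. v i ^ Poly_Mapping.lookup (e + f) i)"
    by (rule subst_mono_superset) (use keys_add[of e f] in auto)
  also have "\<dots> = (\<Prod>i\<in>?F. v i ^ Poly_Mapping.lookup e i) * (\<Prod>i\<in>?F. v i ^ Poly_Mapping.lookup f i)"
    by (simp add: lookup_add power_add prod.distrib)
  also have "\<dots> = subst_mono v e * subst_mono v f"
    by (subst (1 2) subst_mono_superset[of ?F]) auto
  finally show ?thesis .
qed

lemma subst_mult: "subst v (p * q) = subst v p * subst v q"
proof -
  have 1: "subst v (frag_of e * q) = subst_mono v e * subst v q" for e q
    using subset_UNIV[of "Poly_Mapping.keys q"]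
    by (induction q rule: frag_induction)
      (simp_all add: mult_single subst_mono_add frag_extend_diff right_diff_distrib)
  show ?thesis using subset_UNIV[of "Poly_Mapping.keys p"]
    by (induction p rule: frag_induction) (simp_all add: 1 frag_extend_diff left_diff_distrib)
qed

lemma subst_one [simp]: "subst v 1 = 1"
  using frag_extend_of[of "subst_mono v" 0] by (simp add: subst_mono_def)

lemma subst_zvar [simp]: "subst v (zvar i) = v i"
  by (simp add: zvar_def subst_mono_def)

lemma subst_sum: "subst v (sum f I) = (\<Sum>i\<in>I. subst v (f i))"
  by (induction I rule: infinite_finite_induct) (simp_all add: frag_extend_add)

lemma subst_power: "subst v (p ^ n) = subst v p ^ n"
  by (induction n) (simp_all add: subst_mult)

lemma subst_prod: "subst v (prod f I) = (\<Prod>i\<in>I. subst v (f i))"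
  by (induction I rule: infinite_finite_induct) (simp_all add: subst_mult)

lemma subst_subst_mono: "subst w (subst_mono v e) = subst_mono (\<lambda>i. subst w (v i)) e"
  by (simp add: subst_mono_def subst_prod subst_power)

lemma subst_mono_cong: "(\<And>i. i \<in> expn e \<Longrightarrow> v i = w i) \<Longrightarrow> subst_mono v e = subst_mono w e"
  by (simp add: subst_mono_def)

lemma vars_in_subst_mono: "(\<And>i. i \<in> V \<Longrightarrow> vars_in W (v i)) \<Longrightarrow> expn e \<subseteq> V \<Longrightarrow> vars_in W (subst_mono v e)"
  unfolding subst_mono_def by (intro vars_in_prod vars_in_power) auto

lemma vars_in_frag_extend:
  assumes "\<And>e. expn e \<subseteq> V \<Longrightarrow> vars_in W (\<phi> e)" "vars_in V p" shows "vars_in W (frag_extend \<phi> p)"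
  unfolding vars_in_def
proof
  fix e assume "e \<in> Poly_Mapping.keys (frag_extend \<phi> p)"
  then obtain x where "x \<in> Poly_Mapping.keys p" "e \<in> Poly_Mapping.keys (\<phi> x)" using keys_frag_extend[of \<phi> p] by blast
  then show "expn e \<subseteq> W" using assms[unfolded vars_in_def] by blast
qed

lemma frag_of_prod: "frag_of e = subst_mono zvar e"
proof -
  have pw: "zvar i ^ n = frag_of (Poly_Mapping.single i n)" for i n
    by (induction n) (simp_all add: zvar_def mult_single flip: single_add)
  have *: "(\<Prod>i\<in>F. zvar i ^ g i) = frag_of (\<Sum>i\<in>F. Poly_Mapping.single i (g i))" if "finite F" for F g
    using that by (induction F) (simp_all add: pw mult_single)
  have "(\<Sum>i\<in>expn e. Poly_Mapping.single i (Poly_Mapping.lookup e i)) = e"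
    by (rule poly_mapping_eqI) (simp add: lookup_sum lookup_single when_def in_keys_iff)
  then show ?thesis by (simp add: subst_mono_def *)
qed

text \<open>Eliminating the variable \<open>t\<^sub>0\<close> by \<open>t\<^sub>0 \<mapsto> 1 - \<Sum>\<^bsub>i>0\<^esub> t\<^sub>i\<close> gives normal forms modulo \<open>1 - \<Sum> t\<^sub>i\<close>.\<close>

definition rel_poly :: "nat \<Rightarrow> zpoly" where
  "rel_poly n = 1 - (\<Sum>i\<le>n. zvar i)"

definition elim0 :: "nat \<Rightarrow> nat \<Rightarrow> zpoly" where
  "elim0 n i = (if i = 0 then zvar 0 + rel_poly n else zvar i)"

lemma vars_in_rel_poly [simp]: "vars_in {..n} (rel_poly n)"
  unfolding rel_poly_def by (intro vars_in_diff vars_in_sum) auto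

lemma vars_in_elim0 [simp]: "i \<le> n \<Longrightarrow> vars_in {..n} (elim0 n i)"
  unfolding elim0_def by (auto intro: vars_in_add)

lemma subst_rel_poly_gen: "subst v (rel_poly n) = 1 - (\<Sum>i\<le>n. v i)"
  by (simp add: rel_poly_def frag_extend_diff subst_sum)

lemma subst_elim0_rel_poly: "subst (elim0 n) (rel_poly n) = 0"
proof -
  have "(\<Sum>i\<le>n. elim0 n i) = (\<Sum>i\<le>n. zvar i + (if i = 0 then rel_poly n else 0))"
    by (intro sum.cong) (auto simp: elim0_def)
  also have "\<dots> = (\<Sum>i\<le>n. zvar i) + rel_poly n" by (simp add: sum.distrib)
  also have "\<dots> = 1" by (simp add: rel_poly_def)
  finally show ?thesis by (simp only: subst_rel_poly_gen diff_self)
qed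

lemma prod_diff_multiple:
  assumes "finite I" "\<And>i. i \<in> I \<Longrightarrow> vars_in V (a i) \<and> vars_in V (b i) \<and> (\<exists>q. vars_in V q \<and> a i - b i = q * d)"
  shows "\<exists>q. vars_in V q \<and> prod a I - prod b I = q * d"
  using assms
proof (induction I)
  case empty
  show ?case by (rule exI[of _ 0]) simp
next
  case (insert i I)
  obtain q where q: "vars_in V q" "prod a I - prod b I = q * d" using insert by auto
  obtain r where r: "vars_in V r" "a i - b i = r * d" using insert.prems by blast
  have "prod a (insert i I) - prod b (insert i I) = a i * (prod a I - prod b I) + (a i - b i) * prod b I"
    using insert.hyps by (simp add: algebra_simps)
  also have "\<dots> = (a i * q + r * prod b I) * d" unfolding q r by (simp add: algebra_simps)
  finally show ?case using q(1) r(1) insert.prems by (intro exI[of _ "a i * q + r * prod b I"]) (auto intro!: vars_in_add vars_in_mult vars_in_prod)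
qed

lemma elim0_mono_diff:
  assumes "expn e \<subseteq> {..n}"
  shows "\<exists>q. vars_in {..n} q \<and> frag_of e - subst_mono (elim0 n) e = q * rel_poly n"
proof -
  have 1: "\<exists>q. vars_in {..n} q \<and> zvar i ^ k - elim0 n i ^ k = q * rel_poly n" if "i \<le> n" for i k
  proof -
    have "\<exists>q. vars_in {..n} q \<and> (\<Prod>j<k. zvar i) - (\<Prod>j<k. elim0 n i) = q * rel_poly n"
    proof (rule prod_diff_multiple)
      show "vars_in {..n} (zvar i) \<and> vars_in {..n} (elim0 n i) \<and> (\<exists>q. vars_in {..n} q \<and> zvar i - elim0 n i = q * rel_poly n)" for j
      proof (cases "i = 0")
        case True
        then have "zvar i - elim0 n i = - 1 * rel_poly n" "vars_in {..n} (- 1)" by (simp_all add: elim0_def vars_in_minus)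
        then show ?thesis using that by auto
      next
        case False
        then have "zvar i - elim0 n i = 0 * rel_poly n" by (simp add: elim0_def)
        then show ?thesis using that by (intro conjI exI[of _ "0 :: zpoly"]) simp_all
      qed
    qed simp
    then show ?thesis by simp
  qed
  show ?thesis unfolding frag_of_prod subst_mono_def
    by (rule prod_diff_multiple) (use assms 1 in \<open>auto intro!: vars_in_power\<close>)
qed

lemma opers_nth: "\<theta> \<in> opers m n \<Longrightarrow> i \<le> m \<Longrightarrow> \<theta> ! i \<le> n"
  unfolding opers_def by (metis (mono_tags, lifting) atMost_iff less_Suc_eq_le mem_Collect_eq nth_mem subsetD)

lemma opers_mono: "\<theta> \<in> opers m n \<Longrightarrow> i \<le> j \<Longrightarrow> j \<le> m \<Longrightarrow> \<theta> ! i \<le> \<theta> ! j"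
  using sorted_nth_mono[of \<theta> i j] by (auto simp: opers_def)

lemma opers_length: "\<theta> \<in> opers m n \<Longrightarrow> length \<theta> = Suc m"
  by (simp add: opers_def)

lemma opers_set: "\<theta> \<in> opers m n \<Longrightarrow> i \<in> set \<theta> \<Longrightarrow> i \<le> n"
  by (auto simp: opers_def)

lemma opers_comp: "\<theta> \<in> opers m n \<Longrightarrow> \<eta> \<in> opers k m \<Longrightarrow> map (\<lambda>i. \<theta> ! i) \<eta> \<in> opers k n"
proof -
  assume t: "\<theta> \<in> opers m n" and e: "\<eta> \<in> opers k m"
  have "sorted (map (\<lambda>i. \<theta> ! i) \<eta>)"
    unfolding sorted_iff_nth_mono using opers_mono[OF t] opers_mono[OF e] opers_nth[OF e] opers_length[OF e]
    by (simp add: less_Suc_eq_le)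
  then show ?thesis using opers_nth[OF t] opers_set[OF e] e by (auto simp: opers_def)
qed

text \<open>The image of \<open>t\<^sub>i\<close> under a monotone map.\<close>

definition act_var :: "nat list \<Rightarrow> nat \<Rightarrow> zpoly" where
  "act_var \<theta> i = (\<Sum>j\<in>{j. j < length \<theta> \<and> \<theta> ! j = i}. zvar j)"

lemma vars_in_act_var [simp]: "length \<theta> = Suc m \<Longrightarrow> vars_in {..m} (act_var \<theta> i)"
  unfolding act_var_def by (intro vars_in_sum) auto

lemma sum_act_var:
  assumes "\<theta> \<in> opers m n" shows "(\<Sum>i\<le>n. act_var \<theta> i) = (\<Sum>j\<le>m. zvar j)"
proof -
  have l: "length \<theta> = Suc m" "set \<theta> \<subseteq> {..n}" using assms by (auto simp: opers_def)
  have "(\<Sum>i\<le>n. act_var \<theta> i) = (\<Sum>i\<le>n. \<Sum>j\<in>{j. j \<in> {..m} \<and> \<theta> ! j = i}. zvar j)"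
    unfolding act_var_def l(1) by (intro sum.cong) (auto simp: less_Suc_eq_le)
  also have "\<dots> = (\<Sum>j\<le>m. zvar j)"
  proof (rule sum.group)
    show "(!) \<theta> ` {..m} \<subseteq> {..n}"
    proof (rule image_subsetI)
      fix j assume "j \<in> {..m}"
      then have "\<theta> ! j \<in> set \<theta>" using l(1) by simp
      then show "\<theta> ! j \<in> {..n}" using l(2) by blast
    qed
  qed simp_all
  finally show ?thesis .
qed

lemma act_var_comp:
  assumes "\<theta> \<in> opers m n" "\<eta> \<in> opers k m"
  shows "subst (act_var \<eta>) (act_var \<theta> i) = act_var (map (\<lambda>i. \<theta> ! i) \<eta>) i"
proof -
  have l: "length \<theta> = Suc m" "length \<eta> = Suc k" "set \<eta> \<subseteq> {..m}" using assms by (auto simp: opers_def)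
  let ?T = "{j. j < length \<theta> \<and> \<theta> ! j = i}" and ?U = "{l. l < length \<eta> \<and> \<theta> ! (\<eta> ! l) = i}"
  have in_m: "\<eta> ! x \<le> m" if "x < length \<eta>" for x using l(3) nth_mem[OF that] by auto
  have "subst (act_var \<eta>) (act_var \<theta> i) = (\<Sum>j\<in>?T. \<Sum>l\<in>{l. l < length \<eta> \<and> \<eta> ! l = j}. zvar l)"
    unfolding act_var_def[of \<theta>] subst_sum by (simp add: act_var_def[of \<eta>])
  also have "\<dots> = (\<Sum>j\<in>?T. \<Sum>l\<in>{l \<in> ?U. \<eta> ! l = j}. zvar l)"
    by (intro sum.cong refl) auto
  also have "\<dots> = (\<Sum>l\<in>?U. zvar l)"
    by (rule sum.group) (use in_m l(1) in \<open>auto simp: less_Suc_eq_le\<close>)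
  also have "\<dots> = act_var (map (\<lambda>i. \<theta> ! i) \<eta>) i" unfolding act_var_def by (intro sum.cong) auto
  finally show ?thesis .
qed

context kk_setting
begin

text \<open>For the normal form map as \<open>N\<close>, this describes the algebras \<open>A \<otimes> \<int>[t\<^sub>0, \<dots>, t\<^sub>n]\<close> modulo \<open>1 - \<Sum> t\<^sub>i\<close>.\<close>

lemma kernel_quotient:
  fixes N :: "'x \<Rightarrow> 'y"
  assumes A: "is_algebra A" and C: "is_algebra C" and N: "N \<in> alg_hom A C"
    and R: "\<And>x y. R x y \<longleftrightarrow> x \<in> carrier A \<and> y \<in> carrier A \<and> N x = N y"
  shows "x \<in> carrier A \<Longrightarrow> N (rep R x) = N x"
    and "x \<in> carrier A \<Longrightarrow> rep R x \<in> carrier A"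
    and "x \<in> carrier A \<Longrightarrow> y \<in> carrier A \<Longrightarrow> N x = N y \<Longrightarrow> rep R x = rep R y"
    and "is_algebra (quot_alg A R)" and "rep R \<in> alg_hom A (quot_alg A R)"
    and "N \<in> alg_hom (quot_alg A R) C" and "inj_on N (carrier (quot_alg A R))"
    and "x \<in> carrier (quot_alg A R) \<Longrightarrow> x \<in> carrier A"
    and "x \<in> carrier (quot_alg A R) \<Longrightarrow> rep R x = x"
proof -
  have rp: "R x (rep R x)" if "x \<in> carrier A" for x by (rule rep_rel) (simp add: R that)
  show Nr: "N (rep R x) = N x" and cl: "rep R x \<in> carrier A" if "x \<in> carrier A" for x using rp[OF that] by (auto simp: R)
  show eq: "rep R x = rep R y" if "x \<in> carrier A" "y \<in> carrier A" "N x = N y" for x y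
    by (rule rep_eq) (use that in \<open>auto simp: R\<close>)
  let ?Q = "quot_alg A R"
  have Qc: "carrier ?Q = rep R ` carrier A" by (simp add: quot_alg_def)
  show Qsub: "x \<in> carrier A" if "x \<in> carrier ?Q" for x using that cl by (auto simp: Qc)
  show Qrep: "rep R x = x" if "x \<in> carrier ?Q" for x using that cl Nr by (auto simp: Qc intro: eq)
  have ops: "\<zero>\<^bsub>?Q\<^esub> = rep R \<zero>\<^bsub>A\<^esub>" "x \<oplus>\<^bsub>?Q\<^esub> y = rep R (x \<oplus>\<^bsub>A\<^esub> y)" "x \<otimes>\<^bsub>?Q\<^esub> y = rep R (x \<otimes>\<^bsub>A\<^esub> y)"
    "lact ?Q h x = rep R (lact A h x)" "ract ?Q x h = rep R (ract A x h)" for x y h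
    by (simp_all add: quot_alg_def)
  have inj: "x = y" if "x \<in> carrier ?Q" "y \<in> carrier ?Q" "N x = N y" for x y
    using eq[OF Qsub[OF that(1)] Qsub[OF that(2)] that(3)] Qrep that by simp
  have Qr: "rep R x \<in> carrier ?Q" if "x \<in> carrier A" for x using that by (simp add: Qc)
  note N0 = add_hom_zero[OF alg_hom_add_hom[OF N] A C]
  have neg: "\<exists>y\<in>carrier ?Q. N y = \<ominus>\<^bsub>C\<^esub> N x" if x: "x \<in> carrier ?Q" for x
    using Qsub[OF x] A by (intro bexI[OF _ Qr[of "\<ominus>\<^bsub>A\<^esub> x"]]) (auto simp: Nr add_hom_neg[OF alg_hom_add_hom[OF N] A C])
  show "is_algebra ?Q"
    by (rule is_algebra_jointly_injective(1)[where I = "{()}" and C = "\<lambda>_. C" and \<phi> = "\<lambda>_. N"])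
      (simp_all add: inj neg C ops Nr N0 Qsub Qr A alg_homD[OF N] alg_hom_closed[OF N])
  show "N \<in> alg_hom ?Q C" unfolding alg_hom_def by (simp add: ops Nr Qsub A alg_homD[OF N] alg_hom_closed[OF N])
  show "inj_on N (carrier ?Q)" using inj by (auto simp: inj_on_def)
  show "rep R \<in> alg_hom A ?Q"
    unfolding alg_hom_def mem_Collect_eq
    by (intro conjI ballI funcsetI; (rule Qr, assumption)?; (unfold ops, rule eq)?; simp add: A cl Nr alg_homD[OF N])
qed

definition nf :: "nat \<Rightarrow> ('h, 'a) ualg \<Rightarrow> ('h, 'a) univ \<Rightarrow> ('h, 'a) univ" where
  "nf n A = tensor_map A (subst_mono (elim0 n))"

abbreviation sP :: "nat \<Rightarrow> ('h, 'a) ualg \<Rightarrow> ('h, 'a) ualg" where "sP n A \<equiv> poly_alg {..n} A"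

lemma vars_in_elim0_mono: "expn e \<subseteq> {..n} \<Longrightarrow> vars_in {..n} (subst_mono (elim0 n) e)"
  by (rule vars_in_subst_mono[where V = "{..n}"]) auto

lemma nf_hom: "is_algebra A \<Longrightarrow> nf n A \<in> alg_hom (sP n A) (sP n A)"
  unfolding nf_def by (rule tensor_map_alg_hom) (auto simp: vars_in_elim0_mono subst_mono_add)

lemma simplex_rel_mult:
  assumes A: "is_algebra A"
  shows "tensor_map A (\<lambda>e. frag_of e * rel_poly n) \<in> bimod_hom (sP n A) (sP n A)"
    and "\<And>q a. vars_in {..n} q \<Longrightarrow> a \<in> carrier A \<Longrightarrow> tensor_map A (\<lambda>e. frag_of e * rel_poly n) (zsc A q a) = zsc A (q * rel_poly n) a"
proof -
  have z: "vars_in {..n} (frag_of e * rel_poly n)" if "expn e \<subseteq> {..n}" for e using that by (intro vars_in_mult) auto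
  show "tensor_map A (\<lambda>e. frag_of e * rel_poly n) \<in> bimod_hom (sP n A) (sP n A)" by (rule tensor_map_bimod_hom(1)[OF A z])
  have fe: "frag_extend (\<lambda>e. frag_of e * rel_poly n) q = q * rel_poly n" for q
    using subset_UNIV[of "Poly_Mapping.keys q"]
    by (induction q rule: frag_induction) (simp_all add: frag_extend_diff left_diff_distrib)
  show "tensor_map A (\<lambda>e. frag_of e * rel_poly n) (zsc A q a) = zsc A (q * rel_poly n) a" if "vars_in {..n} q" "a \<in> carrier A" for q a
    using tensor_map_zsc[OF A that(2,1), of "{..n}" "\<lambda>e. frag_of e * rel_poly n", OF z] fe by simp
qed

text \<open>A polynomial differs from its normal form by a multiple of \<open>1 - \<Sum> t\<^sub>i\<close>, and these multiples have
  normal form zero.\<close>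

lemma simplex_rel_nf:
  assumes A: "is_algebra A"
  shows "simplex_rel A n x y \<longleftrightarrow> x \<in> carrier (sP n A) \<and> y \<in> carrier (sP n A) \<and> nf n A x = nf n A y"
proof -
  let ?P = "sP n A" and ?m = "tensor_map A (\<lambda>e. frag_of e * rel_poly n)"
  note P = poly_algebra[OF A, of "{..n}"] and N = nf_hom[OF A, of n]
  note Na = alg_hom_add_hom[OF N] and M = bimod_hom_add_hom[OF simplex_rel_mult(1)[OF A, of n]]
  interpret PG: abelian_group ?P using P by (rule algebra_abelian_group)
  have kill: "nf n A (?m r) = \<zero>\<^bsub>?P\<^esub>" if r: "r \<in> carrier ?P" for r
  proof -
    have "(nf n A \<circ> ?m) r = (\<lambda>_. \<zero>\<^bsub>?P\<^esub>) r"
    proof (rule poly_add_hom_eqI[OF A add_hom_comp[OF M Na] bimod_hom_add_hom[OF zero_bimod_hom[OF P]] _ r])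
      fix e a assume e: "expn e \<subseteq> {..n}" and a: "a \<in> carrier A"
      have z: "vars_in {..n} (frag_of e * rel_poly n)" using e by (intro vars_in_mult) auto
      have "nf n A (zsc A (frag_of e * rel_poly n) a) = zsc A (subst (elim0 n) (frag_of e * rel_poly n)) a"
        unfolding nf_def by (rule tensor_map_zsc[OF A a z vars_in_elim0_mono])
      also have "\<dots> = \<zero>\<^bsub>?P\<^esub>" by (simp add: subst_mult subst_elim0_rel_poly zsc_zero[OF A a])
      finally show "(nf n A \<circ> ?m) (pmono A e a) = \<zero>\<^bsub>?P\<^esub>"
        using simplex_rel_mult(2)[OF A, of n "frag_of e" a] e a A by (simp add: zsc_frag_of)
    qed
    then show ?thesis by simp
  qed
  have diff: "\<exists>r\<in>carrier ?P. x = nf n A x \<oplus>\<^bsub>?P\<^esub> ?m r" if x: "x \<in> carrier ?P" for x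
    using A x
  proof (induction rule: poly_induct)
    case zero
    show ?case by (rule bexI[of _ "\<zero>\<^bsub>?P\<^esub>"]) (use P in \<open>simp_all add: add_hom_zero[OF Na P P] add_hom_zero[OF M P P]\<close>)
  next
    case (mono e a)
    obtain q where q: "vars_in {..n} q" "frag_of e - subst_mono (elim0 n) e = q * rel_poly n"
      using elim0_mono_diff[OF mono(1)] by blast
    have n: "nf n A (pmono A e a) = zsc A (subst_mono (elim0 n) e) a"
      unfolding nf_def by (rule tensor_map_bimod_hom(2)[OF A vars_in_elim0_mono mono])
    have "pmono A e a = zsc A (subst_mono (elim0 n) e + q * rel_poly n) a"
      unfolding q(2)[symmetric] using A mono by (simp add: zsc_frag_of)
    also have "\<dots> = nf n A (pmono A e a) \<oplus>\<^bsub>?P\<^esub> ?m (zsc A q a)"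
      using A mono q(1) by (simp add: n zsc_add[where V = "{..n}"] simplex_rel_mult(2))
    finally show ?case using zsc_closed[OF A q(1) mono(2)] by blast
  next
    case (add y z)
    then obtain r s where rs: "r \<in> carrier ?P" "s \<in> carrier ?P" "y = nf n A y \<oplus>\<^bsub>?P\<^esub> ?m r" "z = nf n A z \<oplus>\<^bsub>?P\<^esub> ?m s" by blast
    have c: "nf n A y \<in> carrier ?P" "nf n A z \<in> carrier ?P" "?m r \<in> carrier ?P" "?m s \<in> carrier ?P"
      using add rs add_hom_closed[OF Na] add_hom_closed[OF M] by auto
    have yz: "y \<oplus>\<^bsub>?P\<^esub> z = (nf n A y \<oplus>\<^bsub>?P\<^esub> nf n A z) \<oplus>\<^bsub>?P\<^esub> (?m r \<oplus>\<^bsub>?P\<^esub> ?m s)"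
      by (subst rs(3), subst rs(4)) (use c in \<open>simp add: PG.a_ac\<close>)
    have "y \<oplus>\<^bsub>?P\<^esub> z = nf n A (y \<oplus>\<^bsub>?P\<^esub> z) \<oplus>\<^bsub>?P\<^esub> ?m (r \<oplus>\<^bsub>?P\<^esub> s)"
      unfolding add_hom_add[OF Na add(1,2)] add_hom_add[OF M rs(1,2)] by (rule yz)
    then show ?case using algebra_closed(2)[OF P rs(1,2)] by blast
  qed
  show ?thesis
  proof
    assume "simplex_rel A n x y"
    then obtain r where r: "x \<in> carrier ?P" "y \<in> carrier ?P" "r \<in> carrier ?P" "x = y \<oplus>\<^bsub>?P\<^esub> ?m r"
      unfolding simplex_rel_def rel_poly_def by blast
    have "nf n A x = nf n A y"
      using r(2,3) P by (subst r(4)) (simp add: add_hom_add[OF Na] kill add_hom_closed[OF M] add_hom_closed[OF Na])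
    then show "x \<in> carrier ?P \<and> y \<in> carrier ?P \<and> nf n A x = nf n A y" using r by blast
  next
    assume h: "x \<in> carrier ?P \<and> y \<in> carrier ?P \<and> nf n A x = nf n A y"
    obtain r where r: "r \<in> carrier ?P" "x = nf n A x \<oplus>\<^bsub>?P\<^esub> ?m r" using diff[of x] h by blast
    obtain s where s: "s \<in> carrier ?P" "y = nf n A y \<oplus>\<^bsub>?P\<^esub> ?m s" using diff[of y] h by blast
    note rs = r(1) s(1) r(2) s(2)
    have c: "nf n A y \<in> carrier ?P" "?m r \<in> carrier ?P" "?m s \<in> carrier ?P"
      using h rs add_hom_closed[OF Na] add_hom_closed[OF M] by auto
    have "y \<oplus>\<^bsub>?P\<^esub> ?m (r \<ominus>\<^bsub>?P\<^esub> s) = (nf n A y \<oplus>\<^bsub>?P\<^esub> ?m s) \<oplus>\<^bsub>?P\<^esub> (?m r \<ominus>\<^bsub>?P\<^esub> ?m s)"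
      unfolding add_hom_diff[OF M P P rs(1,2)] by (rule arg_cong[where f = "\<lambda>v. v \<oplus>\<^bsub>?P\<^esub> (?m r \<ominus>\<^bsub>?P\<^esub> ?m s)", OF rs(4)])
    also have "\<dots> = nf n A x \<oplus>\<^bsub>?P\<^esub> ?m r"
    proof -
      have "(?m s) \<oplus>\<^bsub>?P\<^esub> (?m r \<ominus>\<^bsub>?P\<^esub> ?m s) = ?m r" by (rule algebra_add_diff_cancel[OF P c(3,2)])
      then show ?thesis using h c PG.a_assoc[OF c(1) c(3), of "?m r \<ominus>\<^bsub>?P\<^esub> ?m s"] by simp
    qed
    also have "\<dots> = x" by (rule rs(3)[symmetric])
    finally have "x = y \<oplus>\<^bsub>?P\<^esub> ?m (r \<ominus>\<^bsub>?P\<^esub> s)" by simp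
    then show "simplex_rel A n x y" unfolding simplex_rel_def rel_poly_def[symmetric]
      using h algebra_closed(5)[OF P rs(1,2)] by blast
  qed
qed

abbreviation sproj :: "nat \<Rightarrow> ('h, 'a) ualg \<Rightarrow> ('h, 'a) univ \<Rightarrow> ('h, 'a) univ" where
  "sproj n A \<equiv> rep (simplex_rel A n)"

lemma simplex:
  assumes A: "is_algebra A"
  shows simplex_algebra: "is_algebra (simplex_alg A n)"
    and sproj_hom: "sproj n A \<in> alg_hom (sP n A) (simplex_alg A n)"
    and nf_simplex_hom: "nf n A \<in> alg_hom (simplex_alg A n) (sP n A)"
    and nf_inj: "inj_on (nf n A) (carrier (simplex_alg A n))"
    and simplex_sub: "x \<in> carrier (simplex_alg A n) \<Longrightarrow> x \<in> carrier (sP n A)"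
    and sproj_id: "x \<in> carrier (simplex_alg A n) \<Longrightarrow> sproj n A x = x"
    and nf_sproj: "x \<in> carrier (sP n A) \<Longrightarrow> nf n A (sproj n A x) = nf n A x"
    and sproj_eq: "x \<in> carrier (sP n A) \<Longrightarrow> y \<in> carrier (sP n A) \<Longrightarrow> nf n A x = nf n A y \<Longrightarrow> sproj n A x = sproj n A y"
  unfolding simplex_alg_def
  using kernel_quotient[OF A[THEN poly_algebra] A[THEN poly_algebra] nf_hom[OF A] simplex_rel_nf[OF A]] by blast+

lemma sproj_closed: "is_algebra A \<Longrightarrow> x \<in> carrier (sP n A) \<Longrightarrow> sproj n A x \<in> carrier (simplex_alg A n)"
  by (rule alg_hom_closed[OF sproj_hom])

lemma nf_idem:
  assumes A: "is_algebra A" and x: "x \<in> carrier (sP n A)" shows "nf n A (nf n A x) = nf n A x"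
  unfolding nf_def
proof (rule tensor_map_comp[OF A vars_in_elim0_mono vars_in_elim0_mono x])
  fix e assume e: "expn e \<subseteq> {..n}"
  have "subst (elim0 n) (elim0 n i) = elim0 n i" for i
  proof (cases "i = 0")
    case True
    have "subst (elim0 n) (zvar 0 + rel_poly n) = elim0 n 0" by (simp only: frag_extend_add subst_elim0_rel_poly subst_zvar add_0_right)
    then show ?thesis by (simp add: True elim0_def[of n 0])
  next
    case False
    then have "elim0 n i = zvar i" by (simp add: elim0_def)
    then show ?thesis by simp
  qed
  then show "subst (elim0 n) (subst_mono (elim0 n) e) = subst_mono (elim0 n) e" unfolding subst_subst_mono by presburger
qed

lemma act_mono:
  assumes A: "is_algebra A" and \<theta>: "\<theta> \<in> opers m n"
  shows "tensor_map A (subst_mono (act_var \<theta>)) \<in> alg_hom (sP n A) (sP m A)"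
    and "\<And>e. expn e \<subseteq> {..n} \<Longrightarrow> vars_in {..m} (subst_mono (act_var \<theta>) e)"
proof -
  have l: "length \<theta> = Suc m" using \<theta> by (simp add: opers_def)
  show z: "vars_in {..m} (subst_mono (act_var \<theta>) e)" if "expn e \<subseteq> {..n}" for e
    using l that by (intro vars_in_subst_mono[where V = "{..n}"]) auto
  show "tensor_map A (subst_mono (act_var \<theta>)) \<in> alg_hom (sP n A) (sP m A)"
    by (rule tensor_map_alg_hom[OF A z]) (auto simp: subst_mono_add)
qed

lemma simplex_act_eq: "simplex_act A \<theta> x = sproj (length \<theta> - 1) A (tensor_map A (subst_mono (act_var \<theta>)) x)"
  unfolding simplex_act_def subst_mono_def[abs_def] act_var_def[abs_def] by simp

lemma nf_act:
  assumes A: "is_algebra A" and \<theta>: "\<theta> \<in> opers m n" and x: "x \<in> carrier (sP n A)"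
  shows "nf m A (tensor_map A (subst_mono (act_var \<theta>)) (nf n A x)) = nf m A (tensor_map A (subst_mono (act_var \<theta>)) x)"
proof -
  note z = act_mono(2)[OF A \<theta>] and h = act_mono(1)[OF A \<theta>]
  let ?S = "tensor_map A (subst_mono (act_var \<theta>))"
  let ?w = "\<lambda>i. subst (elim0 m) (act_var \<theta> i)"
  have c: "subst (elim0 m) (subst (act_var \<theta>) (elim0 n i)) = ?w i" if "i \<le> n" for i
  proof (cases "i = 0")
    case True
    have "subst (act_var \<theta>) (rel_poly n) = rel_poly m" unfolding subst_rel_poly_gen sum_act_var[OF \<theta>] by (simp add: rel_poly_def)
    then have "subst (act_var \<theta>) (elim0 n 0) = act_var \<theta> 0 + rel_poly m" by (simp add: elim0_def frag_extend_add)
    then show ?thesis by (simp add: True frag_extend_add subst_elim0_rel_poly)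
  next
    case False
    then have "elim0 n i = zvar i" by (simp add: elim0_def)
    then show ?thesis by simp
  qed
  have zw: "vars_in {..m} (subst_mono ?w e)" if "expn e \<subseteq> {..n}" for e
  proof -
    have "vars_in {..m} (subst (elim0 m) p)" if "vars_in {..m} p" for p
      by (rule vars_in_frag_extend[OF vars_in_elim0_mono that])
    moreover have "vars_in {..m} (act_var \<theta> i)" for i using \<theta> by (simp add: opers_def)
    ultimately have "vars_in {..m} (?w i)" for i by blast
    then show ?thesis using that by (rule vars_in_subst_mono)
  qed
  have S: "nf m A (?S x) = tensor_map A (subst_mono ?w) x" if "x \<in> carrier (sP n A)" for x
    unfolding nf_def by (rule tensor_map_comp[OF A z vars_in_elim0_mono that]) (assumption | rule subst_subst_mono)+
  have "tensor_map A (subst_mono ?w) (nf n A x) = tensor_map A (subst_mono ?w) x"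
    unfolding nf_def
  proof (rule tensor_map_comp[OF A vars_in_elim0_mono zw x])
    fix e assume e: "expn e \<subseteq> {..n}"
    have "subst ?w (elim0 n i) = ?w i" if "i \<in> expn e" for i
    proof -
      have "subst ?w (elim0 n i) = subst (elim0 m) (subst (act_var \<theta>) (elim0 n i))"
        by (cases "i = 0") (simp_all add: elim0_def[of n] frag_extend_add subst_rel_poly_gen subst_sum frag_extend_diff)
      then show ?thesis using c[of i] that e by auto
    qed
    then show "subst ?w (subst_mono (elim0 n) e) = subst_mono ?w e"
      unfolding subst_subst_mono by (rule subst_mono_cong)
  qed
  then show ?thesis using S[OF x] S[OF alg_hom_closed[OF nf_hom[OF A] x]] by simp
qed

lemma simplex_act_sproj:
  assumes A: "is_algebra A" and \<theta>: "\<theta> \<in> opers m n" and x: "x \<in> carrier (sP n A)"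
  shows "simplex_act A \<theta> (sproj n A x) = sproj m A (tensor_map A (subst_mono (act_var \<theta>)) x)"
proof -
  have l: "length \<theta> - 1 = m" using \<theta> by (simp add: opers_def)
  note h = act_mono(1)[OF A \<theta>]
  have x': "sproj n A x \<in> carrier (sP n A)" by (rule simplex_sub[OF A sproj_closed[OF A x]])
  show ?thesis unfolding simplex_act_eq l
    by (rule sproj_eq[OF A alg_hom_closed[OF h x'] alg_hom_closed[OF h x]])
      (use nf_act[OF A \<theta> x'] nf_act[OF A \<theta> x] nf_sproj[OF A x] in simp)
qed

lemma simplex_cases:
  assumes "x \<in> carrier (simplex_alg A n)" obtains y where "y \<in> carrier (sP n A)" "x = sproj n A y"
  using assms by (auto simp: simplex_alg_def quot_alg_def)

lemma simplex_lift_hom: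
  assumes A: "is_algebra A" and B: "is_algebra B" and F: "F \<in> alg_hom (sP n A) (sP m B)"
    and G: "\<And>x. x \<in> carrier (sP n A) \<Longrightarrow> G (sproj n A x) = sproj m B (F x)"
  shows "G \<in> alg_hom (simplex_alg A n) (simplex_alg B m)"
proof -
  note p = sproj_hom[OF A, of n] and q = sproj_hom[OF B, of m] and P = poly_algebra[OF A, of "{..n}"]
  note pc = alg_hom_closed[OF p] and Fc = alg_hom_closed[OF F] and qc = alg_hom_closed[OF q]
  show ?thesis unfolding alg_hom_def mem_Collect_eq
  proof (intro conjI ballI funcsetI)
    fix x assume "x \<in> carrier (simplex_alg A n)"
    then obtain x' where x: "x' \<in> carrier (sP n A)" "x = sproj n A x'" by (rule simplex_cases)
    then show "G x \<in> carrier (simplex_alg B m)" using G qc Fc by simp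
    fix y assume "y \<in> carrier (simplex_alg A n)"
    then obtain y' where y: "y' \<in> carrier (sP n A)" "y = sproj n A y'" by (rule simplex_cases)
    show "G (x \<oplus>\<^bsub>simplex_alg A n\<^esub> y) = G x \<oplus>\<^bsub>simplex_alg B m\<^esub> G y" "G (x \<otimes>\<^bsub>simplex_alg A n\<^esub> y) = G x \<otimes>\<^bsub>simplex_alg B m\<^esub> G y"
      using x y P by (simp_all add: G Fc alg_homD[OF q] alg_homD[OF F] flip: alg_homD[OF p])
  next
    fix h x assume h: "h \<in> carrier H" and "x \<in> carrier (simplex_alg A n)"
    then obtain x' where x: "x' \<in> carrier (sP n A)" "x = sproj n A x'" by (auto elim: simplex_cases)
    show "G (lact (simplex_alg A n) h x) = lact (simplex_alg B m) h (G x)" "G (ract (simplex_alg A n) x h) = ract (simplex_alg B m) (G x) h"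
      using x P h by (simp_all add: G Fc alg_homD[OF q] alg_homD[OF F] flip: alg_homD[OF p])
  qed
qed

lemma simplex_lift_add_hom:
  assumes A: "is_algebra A" and B: "is_algebra B" and F: "F \<in> add_hom (sP n A) (sP m B)"
    and G: "\<And>x. x \<in> carrier (sP n A) \<Longrightarrow> G (sproj n A x) = sproj m B (F x)"
  shows "G \<in> add_hom (simplex_alg A n) (simplex_alg B m)"
proof -
  note p = sproj_hom[OF A, of n] and q = sproj_hom[OF B, of m] and P = poly_algebra[OF A, of "{..n}"]
  note Fc = add_hom_closed[OF F] and qc = alg_hom_closed[OF q]
  show ?thesis unfolding add_hom_def mem_Collect_eq
  proof (intro conjI ballI funcsetI)
    fix x assume "x \<in> carrier (simplex_alg A n)"
    then obtain x' where x: "x' \<in> carrier (sP n A)" "x = sproj n A x'" by (rule simplex_cases)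
    then show "G x \<in> carrier (simplex_alg B m)" using G qc Fc by simp
    fix y assume "y \<in> carrier (simplex_alg A n)"
    then obtain y' where y: "y' \<in> carrier (sP n A)" "y = sproj n A y'" by (rule simplex_cases)
    show "G (x \<oplus>\<^bsub>simplex_alg A n\<^esub> y) = G x \<oplus>\<^bsub>simplex_alg B m\<^esub> G y"
      using x y P by (simp add: G Fc alg_homD[OF q] add_hom_add[OF F] flip: alg_homD[OF p])
  qed
qed

lemma simplex_act_hom:
  "is_algebra A \<Longrightarrow> \<theta> \<in> opers m n \<Longrightarrow> simplex_act A \<theta> \<in> alg_hom (simplex_alg A n) (simplex_alg A m)"
  by (rule simplex_lift_hom[OF _ _ act_mono(1) simplex_act_sproj])

lemma simplex_act_comp:
  assumes A: "is_algebra A" and \<theta>: "\<theta> \<in> opers m n" and \<eta>: "\<eta> \<in> opers k m" and x: "x \<in> carrier (simplex_alg A n)"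
  shows "simplex_act A \<eta> (simplex_act A \<theta> x) = simplex_act A (map (\<lambda>i. \<theta> ! i) \<eta>) x"
proof -
  obtain y where y: "y \<in> carrier (sP n A)" "x = sproj n A y" using x by (rule simplex_cases)
  have "tensor_map A (subst_mono (act_var \<eta>)) (tensor_map A (subst_mono (act_var \<theta>)) y) =
    tensor_map A (subst_mono (act_var (map (\<lambda>i. \<theta> ! i) \<eta>))) y"
    by (rule tensor_map_comp[OF A act_mono(2)[OF A \<theta>] act_mono(2)[OF A \<eta>] y(1)])
      (assumption | (unfold subst_subst_mono, intro subst_mono_cong act_var_comp[OF \<theta> \<eta>]))+
  then show ?thesis
    unfolding y(2) simplex_act_sproj[OF A \<theta> y(1)] simplex_act_sproj[OF A \<eta> alg_hom_closed[OF act_mono(1)[OF A \<theta>] y(1)]]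
      simplex_act_sproj[OF A opers_comp[OF \<theta> \<eta>] y(1)] by simp
qed

lemma nf_pmap:
  "is_algebra A \<Longrightarrow> is_algebra B \<Longrightarrow> f \<in> add_hom A B \<Longrightarrow> x \<in> carrier (sP n A) \<Longrightarrow> nf n B (pmap f x) = pmap f (nf n A x)"
  unfolding nf_def by (rule pmap_tensor_map[symmetric])

lemma simplex_map_eq: "simplex_map n B f x = sproj n B (pmap f x)"
  by (simp add: simplex_map_def pmap_def)

lemma simplex_map_sproj:
  assumes A: "is_algebra A" and B: "is_algebra B" and f: "f \<in> add_hom A B" and x: "x \<in> carrier (sP n A)"
  shows "simplex_map n B f (sproj n A x) = sproj n B (pmap f x)"
proof -
  have x': "sproj n A x \<in> carrier (sP n A)" by (rule simplex_sub[OF A sproj_closed[OF A x]])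
  note pc = add_hom_closed[OF pmap_add_hom[OF A B f]]
  show ?thesis unfolding simplex_map_eq
    by (rule sproj_eq[OF B pc[OF x'] pc[OF x]]) (simp add: nf_pmap[OF A B f] x x' nf_sproj[OF A x])
qed

lemma simplex_map_hom:
  "is_algebra A \<Longrightarrow> is_algebra B \<Longrightarrow> f \<in> alg_hom A B \<Longrightarrow> simplex_map n B f \<in> alg_hom (simplex_alg A n) (simplex_alg B n)"
  by (rule simplex_lift_hom[OF _ _ pmap_alg_hom simplex_map_sproj[OF _ _ alg_hom_add_hom]])

lemma simplex_map_add_hom:
  "is_algebra A \<Longrightarrow> is_algebra B \<Longrightarrow> f \<in> add_hom A B \<Longrightarrow> simplex_map n B f \<in> add_hom (simplex_alg A n) (simplex_alg B n)"
  by (rule simplex_lift_add_hom[OF _ _ pmap_add_hom simplex_map_sproj])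

lemma simplex_map_act:
  assumes A: "is_algebra A" and B: "is_algebra B" and f: "f \<in> add_hom A B" and \<theta>: "\<theta> \<in> opers m n" and x: "x \<in> carrier (simplex_alg A n)"
  shows "simplex_map m B f (simplex_act A \<theta> x) = simplex_act B \<theta> (simplex_map n B f x)"
proof -
  obtain y where y: "y \<in> carrier (sP n A)" "x = sproj n A y" using x by (rule simplex_cases)
  show ?thesis
    unfolding y(2) simplex_act_sproj[OF A \<theta> y(1)] simplex_map_sproj[OF A B f y(1)]
      simplex_map_sproj[OF A B f alg_hom_closed[OF act_mono(1)[OF A \<theta>] y(1)]]
      simplex_act_sproj[OF B \<theta> add_hom_closed[OF pmap_add_hom[OF A B f] y(1)]] pmap_tensor_map[OF A B f y(1)] ..
qed

lemma simplex_map_comp: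
  assumes A: "is_algebra A" and B: "is_algebra B" and C: "is_algebra C" and f: "f \<in> add_hom A B" and g: "g \<in> add_hom B C"
    and x: "x \<in> carrier (simplex_alg A n)"
  shows "simplex_map n C g (simplex_map n B f x) = simplex_map n C (g \<circ> f) x"
proof -
  have x': "x \<in> carrier (sP n A)" by (rule simplex_sub[OF A x])
  have "simplex_map n C g (simplex_map n B f x) = sproj n C (pmap g (pmap f x))"
    unfolding simplex_map_eq[of n B f] by (rule simplex_map_sproj[OF B C g add_hom_closed[OF pmap_add_hom[OF A B f] x']])
  then show ?thesis by (simp add: simplex_map_eq pmap_comp)
qed

lemma nf_simplex_map:
  assumes A: "is_algebra A" and B: "is_algebra B" and f: "f \<in> add_hom A B" and x: "x \<in> carrier (simplex_alg A n)"
  shows "nf n B (simplex_map n B f x) = pmap f (nf n A x)"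
proof -
  have x': "x \<in> carrier (sP n A)" by (rule simplex_sub[OF A x])
  show ?thesis unfolding simplex_map_eq nf_sproj[OF B add_hom_closed[OF pmap_add_hom[OF A B f] x']] by (rule nf_pmap[OF A B f x'])
qed

lemma simplex_map_inj:
  assumes A: "is_algebra A" and B: "is_algebra B" and f: "f \<in> add_hom A B" "inj_on f (carrier A)"
  shows "inj_on (simplex_map n B f) (carrier (simplex_alg A n))"
proof (rule inj_onI)
  fix x y assume x: "x \<in> carrier (simplex_alg A n)" and y: "y \<in> carrier (simplex_alg A n)" and eq: "simplex_map n B f x = simplex_map n B f y"
  have "pmap f (nf n A x) = pmap f (nf n A y)" using eq nf_simplex_map[OF A B f(1)] x y by metis
  moreover have "nf n A x \<in> carrier (sP n A)" "nf n A y \<in> carrier (sP n A)" using alg_hom_closed[OF nf_simplex_hom[OF A]] x y by auto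
  ultimately have "nf n A x = nf n A y" using pmap_inj[OF f(2)] by (auto dest: inj_onD)
  then show "x = y" using nf_inj[OF A] x y by (auto dest: inj_onD)
qed

text \<open>Kernel and image can be read off the coefficients of normal forms.\<close>

lemma simplex_map_exact:
  assumes A: "is_algebra A" and B: "is_algebra B" and C: "is_algebra C" and f: "f \<in> add_hom A B" "inj_on f (carrier A)" and g: "g \<in> add_hom B C"
    and ker: "\<And>b. b \<in> carrier B \<Longrightarrow> g b = \<zero>\<^bsub>C\<^esub> \<Longrightarrow> b \<in> f ` carrier A"
    and x: "x \<in> carrier (simplex_alg B n)" "simplex_map n C g x = \<zero>\<^bsub>simplex_alg C n\<^esub>"
  shows "x \<in> simplex_map n B f ` carrier (simplex_alg A n)"
proof -
  have x': "x \<in> carrier (sP n B)" and nx: "nf n B x \<in> carrier (sP n B)"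
    using simplex_sub[OF B x(1)] alg_hom_closed[OF nf_simplex_hom[OF B] x(1)] by auto
  have "pmap g (nf n B x) = \<zero>\<^bsub>sP n C\<^esub>"
    using nf_simplex_map[OF B C g x(1)] x(2) add_hom_zero[OF alg_hom_add_hom[OF nf_simplex_hom[OF C]] simplex_algebra[OF C] poly_algebra[OF C]] by simp
  then have "g (coef (nf n B x) e) = \<zero>\<^bsub>C\<^esub>" for e by (auto simp: pmap_def poly_ops dest: fun_cong)
  then have "coef (nf n B x) e \<in> f ` carrier A" for e using nx by (intro ker) (auto simp: poly_carrier fsa_simps)
  then obtain w where w: "w \<in> carrier (sP n A)" "nf n B x = pmap f w" using pmap_image[OF A B f nx] by blast
  have "simplex_map n B f (sproj n A w) = x"
  proof (rule inj_onD[OF nf_inj[OF B]])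
    show "simplex_map n B f (sproj n A w) \<in> carrier (simplex_alg B n)"
      using add_hom_closed[OF simplex_map_add_hom[OF A B f(1)] sproj_closed[OF A w(1)]] .
    have "nf n B (simplex_map n B f (sproj n A w)) = pmap f (nf n A w)"
      using nf_simplex_map[OF A B f(1) sproj_closed[OF A w(1)]] nf_sproj[OF A w(1)] by simp
    also have "\<dots> = nf n B (pmap f w)" by (rule nf_pmap[OF A B f(1) w(1), symmetric])
    also have "\<dots> = nf n B x" unfolding w(2)[symmetric] by (rule nf_idem[OF B x'])
    finally show "nf n B (simplex_map n B f (sproj n A w)) = nf n B x" .
  qed (rule x(1))
  then show ?thesis using sproj_closed[OF A w(1)] by blast
qed

end

section \<open>Simplicial sets\<close>

text \<open>Pointed simplicial sets generated by finitely many simplices. Finite generation bounds the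
  support of simplicial families of finite matrices.\<close>

definition sset_ok :: "sset \<Rightarrow> bool" where
  "sset_ok K \<longleftrightarrow>
    (\<forall>m n \<theta> x. \<theta> \<in> opers m n \<and> x \<in> simp K n \<longrightarrow> sact K \<theta> x \<in> simp K m) \<and>
    (\<forall>k m n \<theta> \<eta> x. \<theta> \<in> opers m n \<and> \<eta> \<in> opers k m \<and> x \<in> simp K n \<longrightarrow>
       sact K \<eta> (sact K \<theta> x) = sact K (map (\<lambda>i. \<theta> ! i) \<eta>) x) \<and>
    spt K \<in> simp K 0 \<and> sact K [0] (spt K) = spt K \<and>
    (\<exists>G\<subseteq>cells K. finite G \<and> (\<forall>z\<in>cells K. \<exists>g\<in>G. \<exists>\<theta>\<in>opers (fst z) (fst g). snd z = sact K \<theta> (snd g)))"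

definition smap :: "sset \<Rightarrow> sset \<Rightarrow> (cell \<Rightarrow> cell) \<Rightarrow> bool" where
  "smap L K u \<longleftrightarrow> (\<forall>n. \<forall>x\<in>simp L n. u x \<in> simp K n) \<and>
    (\<forall>m n \<theta> x. \<theta> \<in> opers m n \<and> x \<in> simp L n \<longrightarrow> u (sact L \<theta> x) = sact K \<theta> (u x)) \<and> u (spt L) = spt K"

lemma smap_comp: "smap M L v \<Longrightarrow> smap L K u \<Longrightarrow> smap M K (u \<circ> v)"
  unfolding smap_def comp_def by metis

lemma sset_okD:
  assumes "sset_ok K"
  shows "\<theta> \<in> opers m n \<Longrightarrow> x \<in> simp K n \<Longrightarrow> sact K \<theta> x \<in> simp K m"
    and "\<theta> \<in> opers m n \<Longrightarrow> \<eta> \<in> opers k m \<Longrightarrow> x \<in> simp K n \<Longrightarrow> sact K \<eta> (sact K \<theta> x) = sact K (map (\<lambda>i. \<theta> ! i) \<eta>) x"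
    and "spt K \<in> simp K 0" and "sact K [0] (spt K) = spt K"
  using assms unfolding sset_ok_def by blast+

lemma map_nth_map:
  assumes "\<eta> \<in> opers k m" "length v = Suc m"
  shows "map (\<lambda>i. map f v ! i) \<eta> = map f (map (\<lambda>i. v ! i) \<eta>)"
  using opers_set[OF assms(1)] assms(2) by (auto simp: nth_map less_Suc_eq_le)

lemma interval_simps [simp]:
  "simp interval m = Smplx ` opers m 1" "sact interval \<theta> x = Smplx (map (\<lambda>i. verts x ! i) \<theta>)" "spt interval = Smplx [0]"
  by (simp_all add: interval_def)

lemma interval_ok: "sset_ok interval"
proof -
  have id: "map (\<lambda>i. [0, 1] ! i) v = v" if "v \<in> opers m 1" for v m
    using opers_set[OF that] by (intro map_idI) (fastforce simp: le_Suc_eq)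
  have comp: "map (\<lambda>i. map (\<lambda>i. v ! i) \<theta> ! i) \<eta> = map (\<lambda>i. v ! i) (map (\<lambda>i. \<theta> ! i) \<eta>)" if "\<theta> \<in> opers m n" "\<eta> \<in> opers k m" for v \<theta> \<eta> :: "nat list" and m n k
    using map_nth_map[OF that(2) opers_length[OF that(1)]] .
  have g: "(1, Smplx [0, 1]) \<in> cells interval" by (auto simp: cells_def opers_def)
  show ?thesis
    unfolding sset_ok_def
  proof (intro conjI allI impI)
    show "\<exists>G\<subseteq>cells interval. finite G \<and> (\<forall>z\<in>cells interval. \<exists>g\<in>G. \<exists>\<theta>\<in>opers (fst z) (fst g). snd z = sact interval \<theta> (snd g))"
    proof (intro exI[of _ "{(1, Smplx [0, 1])}"] conjI ballI)
      fix z assume "z \<in> cells interval"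
      then obtain v where v: "v \<in> opers (fst z) 1" "snd z = Smplx v" by (auto simp: cells_def)
      then have "snd z = sact interval v (Smplx [0, 1])" using id[OF v(1)] by simp
      then show "\<exists>g\<in>{(1, Smplx [0, 1])}. \<exists>\<theta>\<in>opers (fst z) (fst g). snd z = sact interval \<theta> (snd g)" using v(1) by auto
    qed (use g in auto)
  qed (auto simp: comp opers_comp simp del: map_map, auto simp: opers_def)
qed

text \<open>An operator takes simplices of the boundary to simplices of the boundary.\<close>

lemma collapse_collapse_act:
  assumes "x \<in> simp interval n" "\<theta> \<in> opers m n"
  shows "collapse (sact interval \<theta> (collapse x)) = collapse (sact interval \<theta> x)"
proof -
  obtain v where v: "v \<in> opers n 1" "x = Smplx v" using assms(1) by auto
  show ?thesis
  proof (cases "set v = {0, 1}")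
    case False
    have sv: "set v \<subseteq> {0, 1}" using opers_set[OF v(1)] by (fastforce simp: le_Suc_eq)
    have "set (map (\<lambda>i. v ! i) \<theta>) \<subseteq> set v"
      using opers_set[OF assms(2)] opers_length[OF v(1)] by (auto simp: less_Suc_eq_le)
    then have 1: "set (map (\<lambda>i. v ! i) \<theta>) \<noteq> {0, 1}" using False sv by blast
    have "replicate (length v) 0 ! i = (0 :: nat)" if "i \<in> set \<theta>" for i
      by (rule List.nth_replicate) (use opers_set[OF assms(2) that] opers_length[OF v(1)] in simp)
    then have "set (map (\<lambda>i. replicate (length v) 0 ! i) \<theta>) \<subseteq> {0 :: nat}" by auto
    then have "set (map (\<lambda>i. replicate (length v) 0 ! i) \<theta>) \<noteq> {0, 1 :: nat}" by force
    then show ?thesis using 1 False by (simp add: v(2) collapse_def)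
  qed (simp add: v(2) collapse_def)
qed

lemma circle_simps:
  "simp circle m = collapse ` simp interval m" "sact circle \<theta> x = collapse (sact interval \<theta> x)" "spt circle = collapse (spt interval)"
  by (simp_all add: circle_def)

lemma collapse_smap: "smap interval circle collapse"
  unfolding smap_def circle_simps using collapse_collapse_act by (auto simp del: interval_simps)

lemma circle_ok: "sset_ok circle"
proof -
  note I = sset_okD[OF interval_ok]
  have act: "sact circle \<theta> (collapse x) = collapse (sact interval \<theta> x)" if "x \<in> simp interval n" "\<theta> \<in> opers m n" for x \<theta> m n
    unfolding circle_simps by (rule collapse_collapse_act[OF that])
  obtain G where G: "G \<subseteq> cells interval" "finite G"
    "\<And>z. z \<in> cells interval \<Longrightarrow> \<exists>g\<in>G. \<exists>\<theta>\<in>opers (fst z) (fst g). snd z = sact interval \<theta> (snd g)"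
    using interval_ok unfolding sset_ok_def by blast
  show ?thesis unfolding sset_ok_def
  proof (intro conjI allI impI)
    show "sact circle [0] (spt circle) = spt circle" by (simp add: circle_simps collapse_def)
    show "\<exists>G\<subseteq>cells circle. finite G \<and> (\<forall>z\<in>cells circle. \<exists>g\<in>G. \<exists>\<theta>\<in>opers (fst z) (fst g). snd z = sact circle \<theta> (snd g))"
    proof (intro exI[of _ "map_prod id collapse ` G"] conjI ballI)
      show "map_prod id collapse ` G \<subseteq> cells circle" using G(1) by (auto simp: cells_def circle_simps simp del: interval_simps)
      fix z assume "z \<in> cells circle"
      then obtain x where x: "x \<in> simp interval (fst z)" "snd z = collapse x" by (auto simp: cells_def circle_simps simp del: interval_simps)
      then have "(fst z, x) \<in> cells interval" by (simp add: cells_def)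
      then obtain g \<theta> where g: "g \<in> G" "\<theta> \<in> opers (fst z) (fst g)" "x = sact interval \<theta> (snd g)" using G(3) by fastforce
      then have "snd g \<in> simp interval (fst g)" using G(1) by (auto simp: cells_def simp del: interval_simps)
      then have "snd z = sact circle \<theta> (collapse (snd g))" using act[OF _ g(2)] x(2) g(3) by simp
      then show "\<exists>g\<in>map_prod id collapse ` G. \<exists>\<theta>\<in>opers (fst z) (fst g). snd z = sact circle \<theta> (snd g)"
        using g(1,2) by (intro bexI[of _ "map_prod id collapse g"]) auto
    qed (use G(2) in simp)
  next
    fix m n \<theta> x assume h: "\<theta> \<in> opers m n \<and> x \<in> simp circle n"
    then obtain y where "y \<in> simp interval n" "x = collapse y" by (auto simp: circle_simps simp del: interval_simps)
    then show "sact circle \<theta> x \<in> simp circle m" using act h I(1) by (auto simp: circle_simps(1) simp del: interval_simps)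
  next
    fix k m n \<theta> \<eta> x assume h: "\<theta> \<in> opers m n \<and> \<eta> \<in> opers k m \<and> x \<in> simp circle n"
    then obtain y where y: "y \<in> simp interval n" "x = collapse y" by (auto simp: circle_simps simp del: interval_simps)
    have "sact interval \<theta> y \<in> simp interval m" by (rule I(1)[OF _ y(1)]) (use h in blast)
    then show "sact circle \<eta> (sact circle \<theta> x) = sact circle (map (\<lambda>i. \<theta> ! i) \<eta>) x"
      using h y act[OF y(1)] act[of "sact interval \<theta> y" m \<eta> k] I(2)[of \<theta> m n \<eta> k y] opers_comp[of \<theta> m n \<eta> k] by metis
  qed (use I(3) in \<open>simp add: circle_simps(1,3) del: interval_simps\<close>)
qed

definition sd_flags :: "sset \<Rightarrow> nat \<Rightarrow> cell set" where
  "sd_flags K m = {Flag n x c | n x c. x \<in> simp K n \<and> c \<in> flags n m}"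

primrec flag_act :: "nat list \<Rightarrow> cell \<Rightarrow> cell" where
  "flag_act \<theta> (Flag n x c) = Flag n x (map (\<lambda>i. c ! i) \<theta>)"
| "flag_act \<theta> (Smplx v) = Smplx v"

lemma flags_nth: "c \<in> flags n m \<Longrightarrow> i \<le> m \<Longrightarrow> c ! i \<noteq> {} \<and> c ! i \<subseteq> {..n}"
  using nth_mem[of i c] by (auto simp: flags_def)

lemma flags_mono:
  assumes "c \<in> flags n m" "i \<le> j" "j \<le> m" shows "c ! i \<subseteq> c ! j"
proof (cases "i = j")
  case False
  then show ?thesis using assms by (auto simp: flags_def sorted_wrt_iff_nth_less)
qed simp

lemma flagsI:
  assumes "length c = Suc m" "\<And>i j. i < j \<Longrightarrow> j \<le> m \<Longrightarrow> c ! i \<subseteq> c ! j" "\<And>i. i \<le> m \<Longrightarrow> c ! i \<noteq> {} \<and> c ! i \<subseteq> {..n}"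
  shows "c \<in> flags n m"
  unfolding flags_def mem_Collect_eq
proof (intro conjI ballI)
  show "sorted_wrt (\<subseteq>) c" unfolding sorted_wrt_iff_nth_less using assms(1,2) by (simp add: less_Suc_eq_le)
  fix S assume "S \<in> set c"
  then obtain i where "i < length c" "c ! i = S" by (auto simp: in_set_conv_nth)
  then show "S \<noteq> {}" "S \<subseteq> {..n}" using assms(1) assms(3)[of i] by (auto simp: less_Suc_eq_le)
qed (rule assms(1))

lemma flags_comp:
  assumes c: "c \<in> flags n m" and t: "\<theta> \<in> opers l m" shows "map (\<lambda>i. c ! i) \<theta> \<in> flags n l"
  using opers_length[OF t] flags_mono[OF c] opers_mono[OF t] opers_nth[OF t] flags_nth[OF c]
  by (intro flagsI) (auto simp: less_Suc_eq_le)

lemma flags_image: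
  assumes c: "c \<in> flags k m" and t: "\<theta> \<in> opers k n" shows "map (image (\<lambda>i. \<theta> ! i)) c \<in> flags n m"
proof (rule flagsI)
  have l: "length c = Suc m" using c by (simp add: flags_def)
  then show "length (map (image (\<lambda>i. \<theta> ! i)) c) = Suc m" by simp
  show "map (image (\<lambda>i. \<theta> ! i)) c ! i \<subseteq> map (image (\<lambda>i. \<theta> ! i)) c ! j" if "i < j" "j \<le> m" for i j
    using flags_mono[OF c, of i j] that l by (auto simp: less_Suc_eq_le)
  show "map (image (\<lambda>i. \<theta> ! i)) c ! i \<noteq> {} \<and> map (image (\<lambda>i. \<theta> ! i)) c ! i \<subseteq> {..n}" if "i \<le> m" for i
    using flags_nth[OF c that] that l opers_nth[OF t] by (auto simp: less_Suc_eq_le)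
qed

lemma flags_Max:
  assumes c: "c \<in> flags n m" shows "map Max c \<in> opers m n"
proof -
  have len: "length c = Suc m" using c by (simp add: flags_def)
  have M: "Max (c ! i) \<le> n \<and> finite (c ! i) \<and> c ! i \<noteq> {}" if "i \<le> m" for i
    using flags_nth[OF c that] by (meson Max_in atMost_iff finite_atMost finite_subset subsetD)
  have "Max (c ! i) \<le> Max (c ! j)" if "i \<le> j" "j \<le> m" for i j
    by (rule Max_mono) (use flags_mono[OF c that] M[of i] M[of j] that in auto)
  then have "sorted (map Max c)" unfolding sorted_iff_nth_mono using len by (simp add: less_Suc_eq_le)
  moreover have "set (map Max c) \<subseteq> {..n}" using M len by (fastforce simp: in_set_conv_nth less_Suc_eq_le)
  ultimately show ?thesis using len by (simp add: opers_def)
qed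

lemma finite_flags: "finite (flags n m)"
proof (rule finite_subset)
  show "flags n m \<subseteq> {c. set c \<subseteq> Pow {..n} \<and> length c = Suc m}" by (auto simp: flags_def)
  show "finite {c. set c \<subseteq> Pow {..n} \<and> length c = Suc m}" by (intro finite_lists_length_eq) simp
qed

lemma sd_gen_props:
  assumes K: "sset_ok K" and g: "sd_gen K F F'"
  shows "\<exists>m. F \<in> sd_flags K m \<and> F' \<in> sd_flags K m" and "F \<in> sd_flags K m \<longleftrightarrow> F' \<in> sd_flags K m"
    and "F \<in> sd_flags K m \<Longrightarrow> \<theta> \<in> opers l m \<Longrightarrow> sd_gen K (flag_act \<theta> F) (flag_act \<theta> F')"
    and "last_vertex K F = last_vertex K F'"
proof -
  obtain x n \<theta>' k c m' where h: "F = Flag k (sact K \<theta>' x) c" "F' = Flag n x (map (image (\<lambda>i. \<theta>' ! i)) c)"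
    "x \<in> simp K n" "\<theta>' \<in> opers k n" "c \<in> flags k m'"
    using g by cases
  have len: "length c = Suc m'" using h(5) by (simp add: flags_def)
  have F: "F \<in> sd_flags K m'" "F' \<in> sd_flags K m'"
    unfolding h(1,2) sd_flags_def using h(3-5) flags_image[OF h(5,4)] sset_okD(1)[OF K h(4,3)] by blast+
  then show "\<exists>m. F \<in> sd_flags K m \<and> F' \<in> sd_flags K m" by blast
  have m: "m = m'" if "F \<in> sd_flags K m \<or> F' \<in> sd_flags K m" for m
    using that len unfolding h(1,2) sd_flags_def flags_def by auto
  show "F \<in> sd_flags K m \<longleftrightarrow> F' \<in> sd_flags K m" using F m by blast
  show "sd_gen K (flag_act \<theta> F) (flag_act \<theta> F')" if "F \<in> sd_flags K m" "\<theta> \<in> opers l m"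
  proof -
    have t: "\<theta> \<in> opers l m'" using that m by blast
    have e: "map (\<lambda>i. map (image (\<lambda>i. \<theta>' ! i)) c ! i) \<theta> = map (image (\<lambda>i. \<theta>' ! i)) (map (\<lambda>i. c ! i) \<theta>)"
      by (rule map_nth_map[OF t len])
    show ?thesis unfolding h(1,2) flag_act.simps e by (rule sd_gen.intros[OF h(3,4) flags_comp[OF h(5) t]])
  qed
  have "map Max (map (image (\<lambda>i. \<theta>' ! i)) c) = map (\<lambda>i. \<theta>' ! i) (map Max c)"
  proof (rule nth_equalityI)
    fix i assume "i < length (map Max (map (image (\<lambda>i. \<theta>' ! i)) c))"
    then have i: "i \<le> m'" using len by (simp add: less_Suc_eq_le)
    then have S: "c ! i \<noteq> {}" "c ! i \<subseteq> {..k}" using flags_nth[OF h(5)] by auto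
    then have fin: "finite (c ! i)" by (meson finite_atMost finite_subset)
    have "Max ((\<lambda>i. \<theta>' ! i) ` (c ! i)) = \<theta>' ! Max (c ! i)"
    proof (rule Max_eqI)
      show "\<theta>' ! Max (c ! i) \<in> (\<lambda>i. \<theta>' ! i) ` (c ! i)" using fin S by simp
      fix y assume "y \<in> (\<lambda>i. \<theta>' ! i) ` (c ! i)"
      then obtain j where j: "j \<in> c ! i" "y = \<theta>' ! j" by auto
      have "Max (c ! i) \<le> k" using fin S by (meson Max_in atMost_iff subsetD)
      then show "y \<le> \<theta>' ! Max (c ! i)" using opers_mono[OF h(4)] Max_ge[OF fin j(1)] j(2) by simp
    qed (use fin in simp)
    then show "map Max (map (image (\<lambda>i. \<theta>' ! i)) c) ! i = map (\<lambda>i. \<theta>' ! i) (map Max c) ! i"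
      using i len by simp
  qed simp
  then show "last_vertex K F = last_vertex K F'"
    unfolding h(1,2) last_vertex_def cell.case using sset_okD(2)[OF K h(4) flags_Max[OF h(5)] h(3)] by (simp only:)
qed

text \<open>What the generating relation of the colimit respects, its equivalence relation respects. Hence the operators
  and the last vertex map are well defined on the chosen representatives.\<close>

lemma sd_equiv_props:
  assumes K: "sset_ok K" and e: "equivclp (sd_gen K) F F'"
  shows "F \<in> sd_flags K m \<longleftrightarrow> F' \<in> sd_flags K m"
    and "F \<in> sd_flags K m \<Longrightarrow> \<theta> \<in> opers l m \<Longrightarrow> equivclp (sd_gen K) (flag_act \<theta> F) (flag_act \<theta> F')"
    and "last_vertex K F = last_vertex K F'"
proof -
  have "(F \<in> sd_flags K m \<longleftrightarrow> F' \<in> sd_flags K m) \<and> last_vertex K F = last_vertex K F' \<and>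
    (F \<in> sd_flags K m \<longrightarrow> \<theta> \<in> opers l m \<longrightarrow> equivclp (sd_gen K) (flag_act \<theta> F) (flag_act \<theta> F'))"
    using e
  proof (induction rule: equivclp_induct)
    case base
    then show ?case by (simp add: equivclp_refl)
  next
    case (step y z)
    have "(y \<in> sd_flags K m \<longleftrightarrow> z \<in> sd_flags K m) \<and> last_vertex K y = last_vertex K z"
      using step(2) sd_gen_props(2,4)[OF K, of y z] sd_gen_props(2,4)[OF K, of z y] by metis
    moreover have "equivclp (sd_gen K) (flag_act \<theta> y) (flag_act \<theta> z)" if "y \<in> sd_flags K m" "\<theta> \<in> opers l m"
      using step(2) sd_gen_props(2,3)[OF K] that by (blast intro: r_into_equivclp equivclp_sym)
    ultimately show ?case using step(3) by (metis equivclp_trans)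
  qed
  then show "F \<in> sd_flags K m \<longleftrightarrow> F' \<in> sd_flags K m"
    "F \<in> sd_flags K m \<Longrightarrow> \<theta> \<in> opers l m \<Longrightarrow> equivclp (sd_gen K) (flag_act \<theta> F) (flag_act \<theta> F')"
    "last_vertex K F = last_vertex K F'" by blast+
qed

lemma sd_rep_equiv: "equivclp (sd_gen K) F (sd_rep K F)"
  unfolding sd_rep_def by (rule rep_rel) (rule equivclp_refl)

lemma sd_rep_eq: "equivclp (sd_gen K) F F' \<Longrightarrow> sd_rep K F = sd_rep K F'"
  unfolding sd_rep_def by (rule rep_eq) (blast intro: equivclp_sym equivclp_trans)+

lemma sd_simp: "simp (sd K) m = sd_rep K ` sd_flags K m"
  by (simp add: sd_def sd_flags_def)

lemma sd_act:
  assumes K: "sset_ok K" and F: "F \<in> sd_flags K m" and t: "\<theta> \<in> opers l m"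
  shows "sact (sd K) \<theta> (sd_rep K F) = sd_rep K (flag_act \<theta> F)" "flag_act \<theta> F \<in> sd_flags K l"
proof -
  have r: "sd_rep K F \<in> sd_flags K m" using sd_equiv_props(1)[OF K sd_rep_equiv] F by blast
  then obtain n x c where "sd_rep K F = Flag n x c" by (auto simp: sd_flags_def)
  then have "sact (sd K) \<theta> (sd_rep K F) = sd_rep K (flag_act \<theta> (sd_rep K F))" by (simp add: sd_def)
  also have "\<dots> = sd_rep K (flag_act \<theta> F)"
    by (rule sd_rep_eq[symmetric]) (rule sd_equiv_props(2)[OF K sd_rep_equiv F t])
  finally show "sact (sd K) \<theta> (sd_rep K F) = sd_rep K (flag_act \<theta> F)" .
  show "flag_act \<theta> F \<in> sd_flags K l" using F flags_comp[OF _ t] by (auto simp: sd_flags_def)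
qed

text \<open>A chain of subsets of \<open>{0, \<dots>, n}\<close> is a degeneracy of a chain of length \<open>n + 1\<close>, indexed by
  cardinality; so flags in a fixed simplex are generated by finitely many.\<close>

lemma flag_degenerate:
  assumes c: "c \<in> flags n m"
  shows "\<exists>d\<in>flags n n. \<exists>\<eta>\<in>opers m n. c = map (\<lambda>i. d ! i) \<eta>"
proof -
  have len: "length c = Suc m" using c by (simp add: flags_def)
  have fin: "finite (c ! i) \<and> c ! i \<noteq> {} \<and> c ! i \<subseteq> {..n}" if "i \<le> m" for i
    using flags_nth[OF c that] by (meson finite_atMost finite_subset)
  \<comment> \<open>\<open>d ! j\<close> is the largest member with at most \<open>j + 1\<close> elements, or the smallest member if there is none\<close>
  define d where "d = map (\<lambda>j. c ! 0 \<union> \<Union>{c ! i | i. i \<le> m \<and> card (c ! i) \<le> Suc j}) [0..<Suc n]"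
  define \<eta> where "\<eta> = map (\<lambda>i. card (c ! i) - 1) [0..<Suc m]"
  have dn: "d ! j = c ! 0 \<union> \<Union>{c ! i | i. i \<le> m \<and> card (c ! i) \<le> Suc j}" if "j \<le> n" for j
    using that by (simp add: d_def del: upt_Suc)
  have d: "d \<in> flags n n"
  proof (rule flagsI)
    show "d ! i \<subseteq> d ! j" if "i < j" "j \<le> n" for i j
    proof -
      have "card S \<le> Suc j" if "card S \<le> Suc i" for S :: "nat set" using that \<open>i < j\<close> by simp
      then show ?thesis using that unfolding dn[OF that(2)] dn[OF order.strict_implies_order[OF less_le_trans[OF that]]] by blast
    qed
    show "d ! i \<noteq> {} \<and> d ! i \<subseteq> {..n}" if "i \<le> n" for i
      unfolding dn[OF that] using fin fin[of 0] by blast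
  qed (simp add: d_def)
  have cp: "1 \<le> card (c ! i) \<and> card (c ! i) \<le> Suc n" if "i \<le> m" for i
    using fin[OF that] card_mono[of "{..n}" "c ! i"] card_gt_0_iff[of "c ! i"] by auto
  have en: "\<eta> ! i = card (c ! i) - 1" if "i \<le> m" for i using that by (simp add: \<eta>_def del: upt_Suc)
  have el: "length \<eta> = Suc m" by (simp add: \<eta>_def)
  have "sorted \<eta>" unfolding sorted_iff_nth_mono
    using el en flags_mono[OF c] fin by (auto simp: less_Suc_eq_le intro!: diff_le_mono card_mono)
  moreover have "card (c ! i) - 1 \<le> n" if "i \<le> m" for i using cp[OF that] by linarith
  then have "set \<eta> \<subseteq> {..n}" unfolding \<eta>_def set_map set_upt by (auto simp: less_Suc_eq_le)
  ultimately have e: "\<eta> \<in> opers m n" using el by (simp add: opers_def)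
  have "c = map (\<lambda>i. d ! i) \<eta>"
  proof (rule nth_equalityI)
    fix i assume "i < length c"
    then have i: "i \<le> m" using len by (simp add: less_Suc_eq_le)
    have sub: "c ! k \<subseteq> c ! i" if "k \<le> m" "card (c ! k) \<le> card (c ! i)" for k
    proof (cases "k \<le> i")
      case True then show ?thesis using flags_mono[OF c] i by blast
    next
      case False
      then have "c ! i \<subseteq> c ! k" using flags_mono[OF c] that by simp
      then show ?thesis using card_subset_eq[of "c ! k" "c ! i"] fin[OF that(1)] that(2) card_mono[of "c ! k" "c ! i"] by auto
    qed
    have j: "\<eta> ! i \<le> n" "Suc (\<eta> ! i) = card (c ! i)" using en[OF i] cp[OF i] by auto
    have "d ! (\<eta> ! i) = c ! i"
      unfolding dn[OF j(1)] j(2) using sub flags_mono[OF c, of 0 i] i by auto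
    then show "c ! i = map (\<lambda>i. d ! i) \<eta> ! i" using i el by (simp add: less_Suc_eq_le)
  qed (simp add: len el)
  then show ?thesis using d e by blast
qed

lemma sd_ok:
  assumes K: "sset_ok K" shows "sset_ok (sd K)"
proof -
  obtain G where G: "G \<subseteq> cells K" "finite G"
    "\<And>z. z \<in> cells K \<Longrightarrow> \<exists>g\<in>G. \<exists>\<theta>\<in>opers (fst z) (fst g). snd z = sact K \<theta> (snd g)"
    using K unfolding sset_ok_def by blast
  have pt: "Flag 0 (spt K) [{0}] \<in> sd_flags K 0" using sset_okD(3)[OF K] by (auto simp: sd_flags_def flags_def)
  have spt: "spt (sd K) = sd_rep K (Flag 0 (spt K) [{0}])" by (simp add: sd_def)
  have o0: "[0] \<in> opers 0 0" by (simp add: opers_def)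
  show ?thesis unfolding sset_ok_def
  proof (intro conjI allI impI)
    show "spt (sd K) \<in> simp (sd K) 0" using pt by (simp add: spt sd_simp)
    show "sact (sd K) [0] (spt (sd K)) = spt (sd K)" unfolding spt sd_act(1)[OF K pt o0] by simp
  next
    fix m n \<theta> x assume h: "\<theta> \<in> opers m n \<and> x \<in> simp (sd K) n"
    then obtain F where "F \<in> sd_flags K n" "x = sd_rep K F" by (auto simp: sd_simp)
    then show "sact (sd K) \<theta> x \<in> simp (sd K) m" using sd_act[OF K] h by (simp add: sd_simp)
  next
    fix k m n \<theta> \<eta> x assume h: "\<theta> \<in> opers m n \<and> \<eta> \<in> opers k m \<and> x \<in> simp (sd K) n"
    then obtain F where F: "F \<in> sd_flags K n" "x = sd_rep K F" by (auto simp: sd_simp)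
    have t: "\<theta> \<in> opers m n" and e: "\<eta> \<in> opers k m" using h by auto
    have "flag_act \<eta> (flag_act \<theta> F) = flag_act (map (\<lambda>i. \<theta> ! i) \<eta>) F"
      using F(1) opers_set[OF e] opers_length[OF t] by (auto simp: sd_flags_def less_Suc_eq_le)
    then show "sact (sd K) \<eta> (sact (sd K) \<theta> x) = sact (sd K) (map (\<lambda>i. \<theta> ! i) \<eta>) x"
      unfolding F(2) sd_act(1)[OF K F(1) t] sd_act(1)[OF K sd_act(2)[OF K F(1) t] e] sd_act(1)[OF K F(1) opers_comp[OF t e]] by simp
  next
    let ?G = "(\<lambda>(g, d). (fst g, sd_rep K (Flag (fst g) (snd g) d))) ` (SIGMA g:G. flags (fst g) (fst g))"
    show "\<exists>G\<subseteq>cells (sd K). finite G \<and> (\<forall>z\<in>cells (sd K). \<exists>g\<in>G. \<exists>\<theta>\<in>opers (fst z) (fst g). snd z = sact (sd K) \<theta> (snd g))"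
    proof (intro exI[of _ ?G] conjI ballI)
      show "?G \<subseteq> cells (sd K)" using G(1) by (fastforce simp: cells_def sd_simp sd_flags_def)
      show "finite ?G" using G(2) finite_flags by blast
      fix z assume "z \<in> cells (sd K)"
      then obtain n x c where z: "snd z = sd_rep K (Flag n x c)" "x \<in> simp K n" "c \<in> flags n (fst z)"
        by (auto simp: cells_def sd_simp sd_flags_def)
      have "(n, x) \<in> cells K" using z(2) by (simp add: cells_def)
      then obtain g \<theta> where g: "g \<in> G" "\<theta> \<in> opers n (fst g)" "x = sact K \<theta> (snd g)" using G(3) by fastforce
      have gK: "snd g \<in> simp K (fst g)" using g(1) G(1) by (auto simp: cells_def)
      let ?c = "map (image (\<lambda>i. \<theta> ! i)) c"
      have "sd_rep K (Flag n x c) = sd_rep K (Flag (fst g) (snd g) ?c)"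
        unfolding g(3) by (rule sd_rep_eq, rule r_into_equivclp, rule sd_gen.intros[OF gK g(2) z(3)])
      moreover obtain d \<eta> where d: "d \<in> flags (fst g) (fst g)" "\<eta> \<in> opers (fst z) (fst g)" "?c = map (\<lambda>i. d ! i) \<eta>"
        using flag_degenerate[OF flags_image[OF z(3) g(2)]] by blast
      moreover have "Flag (fst g) (snd g) d \<in> sd_flags K (fst g)" using gK d(1) by (auto simp: sd_flags_def)
      ultimately have "snd z = sact (sd K) \<eta> (sd_rep K (Flag (fst g) (snd g) d))"
        using sd_act(1)[OF K _ d(2)] z(1) by simp
      then show "\<exists>g\<in>?G. \<exists>\<theta>\<in>opers (fst z) (fst g). snd z = sact (sd K) \<theta> (snd g)" using d(1,2) g(1) by force
    qed
  qed
qed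

lemma last_vertex_smap:
  assumes K: "sset_ok K" shows "smap (sd K) K (last_vertex K)"
proof -
  have lv: "last_vertex K (sd_rep K F) = last_vertex K F" for F
    using sd_equiv_props(3)[OF K sd_rep_equiv] by simp
  show ?thesis unfolding smap_def
  proof (intro conjI allI ballI impI)
    fix n y assume "y \<in> simp (sd K) n"
    then obtain k x c where "y = sd_rep K (Flag k x c)" "x \<in> simp K k" "c \<in> flags k n" by (auto simp: sd_simp sd_flags_def)
    then show "last_vertex K y \<in> simp K n" using sset_okD(1)[OF K flags_Max] by (simp add: lv) (simp add: last_vertex_def)
  next
    fix m n \<theta> y assume h: "\<theta> \<in> opers m n \<and> y \<in> simp (sd K) n"
    then obtain k x c where y: "y = sd_rep K (Flag k x c)" "x \<in> simp K k" "c \<in> flags k n" by (auto simp: sd_simp sd_flags_def)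
    have F: "Flag k x c \<in> sd_flags K n" using y by (auto simp: sd_flags_def)
    have t: "\<theta> \<in> opers m n" and len: "length c = Suc n" using h y(3) by (auto simp: flags_def)
    have "map (\<lambda>i. map Max c ! i) \<theta> = map Max (map (\<lambda>i. c ! i) \<theta>)" by (rule map_nth_map[OF t len])
    then show "last_vertex K (sact (sd K) \<theta> y) = sact K \<theta> (last_vertex K y)"
      unfolding y(1) sd_act(1)[OF K F t] lv unfolding last_vertex_def flag_act.simps cell.case
      using sset_okD(2)[OF K flags_Max[OF y(3)] t y(2)] by (simp only:)
  next
    show "last_vertex K (spt (sd K)) = spt K"
      using lv[of "Flag 0 (spt K) [{0}]"] sset_okD(4)[OF K] by (simp add: sd_def last_vertex_def)
  qed
qed

lemma sd_circle_ok: "sset_ok (sd_circle p)"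
  unfolding sd_circle_def by (induction p) (auto intro: circle_ok sd_ok)

lemma last_vertices_smap: "smap (sd_circle (p + d)) (sd_circle p) (last_vertices p d)"
proof (induction d)
  case (Suc d)
  have "smap (sd_circle (Suc (p + d))) (sd_circle (p + d)) (last_vertex (sd_circle (p + d)))"
    using last_vertex_smap[OF sd_circle_ok[of "p + d"]] by (simp add: sd_circle_def)
  then show ?case unfolding last_vertices.simps add_Suc_right by (rule smap_comp[OF _ Suc.IH])
qed (simp add: smap_def)

section \<open>Mapping algebras and loops\<close>

context kk_setting
begin

lemma pmap_carrier:
  "x \<in> carrier (pmap_alg K A) \<longleftrightarrow> (\<exists>f\<in>extensional (cells K). x = SMap f) \<and>
    (\<forall>z\<in>cells K. sval x z \<in> carrier (simplex_alg A (fst z))) \<and>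
    (\<forall>m n \<theta> c. \<theta> \<in> opers m n \<and> c \<in> simp K n \<longrightarrow> sval x (m, sact K \<theta> c) = simplex_act A \<theta> (sval x (n, c))) \<and>
    sval x (0, spt K) = \<zero>\<^bsub>simplex_alg A 0\<^esub>"
  unfolding pmap_alg_def map_alg_def PiE_def by (cases x) auto

lemma pmap_ops:
  "\<zero>\<^bsub>pmap_alg K A\<^esub> = SMap (\<lambda>z\<in>cells K. \<zero>\<^bsub>simplex_alg A (fst z)\<^esub>)"
  "x \<oplus>\<^bsub>pmap_alg K A\<^esub> y = SMap (\<lambda>z\<in>cells K. sval x z \<oplus>\<^bsub>simplex_alg A (fst z)\<^esub> sval y z)"
  "x \<otimes>\<^bsub>pmap_alg K A\<^esub> y = SMap (\<lambda>z\<in>cells K. sval x z \<otimes>\<^bsub>simplex_alg A (fst z)\<^esub> sval y z)"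
  "lact (pmap_alg K A) h x = SMap (\<lambda>z\<in>cells K. lact (simplex_alg A (fst z)) h (sval x z))"
  "ract (pmap_alg K A) x h = SMap (\<lambda>z\<in>cells K. ract (simplex_alg A (fst z)) (sval x z) h)"
  by (simp_all add: pmap_alg_def map_alg_def)

lemma pmap_simp:
  assumes "x \<in> carrier (pmap_alg K A)"
  shows "z \<in> cells K \<Longrightarrow> sval x z \<in> carrier (simplex_alg A (fst z))"
    and "\<theta> \<in> opers m n \<Longrightarrow> c \<in> simp K n \<Longrightarrow> sval x (m, sact K \<theta> c) = simplex_act A \<theta> (sval x (n, c))"
    and "sval x (0, spt K) = \<zero>\<^bsub>simplex_alg A 0\<^esub>"
  using assms unfolding pmap_carrier by blast+

lemma pmapI:
  assumes "\<And>n c. c \<in> simp K n \<Longrightarrow> f (n, c) \<in> carrier (simplex_alg A n)"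
    and "\<And>m n \<theta> c. \<theta> \<in> opers m n \<Longrightarrow> c \<in> simp K n \<Longrightarrow> f (m, sact K \<theta> c) = simplex_act A \<theta> (f (n, c))"
    and "f (0, spt K) = \<zero>\<^bsub>simplex_alg A 0\<^esub>" and K: "sset_ok K"
  shows "SMap (\<lambda>z\<in>cells K. f z) \<in> carrier (pmap_alg K A)"
  unfolding pmap_carrier
  using assms(1-3) sset_okD(1,3)[OF K] by (fastforce simp: cells_def)

lemma pmap_eqI:
  fixes A B :: "('h, 'a) ualg"
  assumes "x \<in> carrier (pmap_alg K A)" "y \<in> carrier (pmap_alg K B)" "\<And>z. z \<in> cells K \<Longrightarrow> sval x z = sval y z"
  shows "x = y"
proof -
  obtain f where f: "x = SMap f" "f \<in> extensional (cells K)" using assms(1) unfolding pmap_carrier by blast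
  obtain g where g: "y = SMap g" "g \<in> extensional (cells K)" using assms(2) unfolding pmap_carrier by blast
  have "f = g" by (rule extensionalityI[OF f(2) g(2)]) (use assms(3) f(1) g(1) in simp)
  then show ?thesis using f g by simp
qed

lemma pmap_eqI_generators:
  fixes A :: "('h, 'a) ualg"
  assumes K: "\<forall>z\<in>cells K. \<exists>g\<in>G. \<exists>\<theta>\<in>opers (fst z) (fst g). snd z = sact K \<theta> (snd g)" "G \<subseteq> cells K"
    and x: "x \<in> carrier (pmap_alg K A)" and y: "y \<in> carrier (pmap_alg K A)" and eq: "\<And>g. g \<in> G \<Longrightarrow> sval x g = sval y g"
  shows "x = y"
proof (rule pmap_eqI[OF x y])
  fix z assume z: "z \<in> cells K"
  then obtain g \<theta> where g: "g \<in> G" "\<theta> \<in> opers (fst z) (fst g)" "snd z = sact K \<theta> (snd g)" using K(1) by blast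
  have gK: "snd g \<in> simp K (fst g)" using g(1) K(2) by (auto simp: cells_def)
  have "z = (fst z, sact K \<theta> (snd g))" using g(3) by (metis prod.collapse)
  then show "sval x z = sval y z" using pmap_simp(2)[OF x g(2) gK] pmap_simp(2)[OF y g(2) gK] eq[OF g(1)] by simp
qed

lemma pmap_algebra_sval:
  assumes K: "sset_ok K" and A: "is_algebra A"
  shows pmap_alg_algebra: "is_algebra (pmap_alg K A)"
    and sval_hom: "z \<in> cells K \<Longrightarrow> (\<lambda>x. sval x z) \<in> alg_hom (pmap_alg K A) (simplex_alg A (fst z))"
proof -
  note S = simplex_algebra[OF A] and a = simplex_act_hom[OF A]
  note a0 = add_hom_zero[OF alg_hom_add_hom[OF a] S S] and an = add_hom_neg[OF alg_hom_add_hom[OF a] S S]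
  have c: "(n, x) \<in> cells K \<longleftrightarrow> x \<in> simp K n" for n x by (simp add: cells_def)
  have pt: "(0, spt K) \<in> cells K" using sset_okD(3)[OF K] by (simp add: c)
  have cl: "sval x (n, s) \<in> carrier (simplex_alg A n)" if "x \<in> carrier (pmap_alg K A)" "s \<in> simp K n" for x n s
    using pmap_simp(1)[OF that(1), of "(n, s)"] that(2) by (simp add: c)
  have "is_algebra (pmap_alg K A) \<and> (\<forall>z\<in>cells K. (\<lambda>x. sval x z) \<in> alg_hom (pmap_alg K A) (simplex_alg A (fst z)))"
  proof (intro conjI ballI)
    note J = is_algebra_jointly_injective[of "cells K" "\<lambda>z. simplex_alg A (fst z)" "pmap_alg K A" "\<lambda>z x. sval x z"]
    have 0: "\<zero>\<^bsub>pmap_alg K A\<^esub> \<in> carrier (pmap_alg K A)"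
      unfolding pmap_ops by (rule pmapI[OF _ _ _ K]) (simp_all add: S a0)
    have 1: "x \<oplus>\<^bsub>pmap_alg K A\<^esub> y \<in> carrier (pmap_alg K A)" "x \<otimes>\<^bsub>pmap_alg K A\<^esub> y \<in> carrier (pmap_alg K A)"
      if "x \<in> carrier (pmap_alg K A)" "y \<in> carrier (pmap_alg K A)" for x y
      unfolding pmap_ops by (rule pmapI[OF _ _ _ K]; simp add: S cl that pmap_simp(2,3)[OF that(1)] pmap_simp(2,3)[OF that(2)] alg_homD[OF a])+
    have 2: "lact (pmap_alg K A) h x \<in> carrier (pmap_alg K A)" "ract (pmap_alg K A) x h \<in> carrier (pmap_alg K A)"
      if "x \<in> carrier (pmap_alg K A)" "h \<in> carrier H" for x h
      unfolding pmap_ops by (rule pmapI[OF _ _ _ K]; simp add: S cl that pmap_simp(2,3)[OF that(1)] alg_homD[OF a])+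
    have 3: "\<exists>y\<in>carrier (pmap_alg K A). \<forall>z\<in>cells K. sval y z = \<ominus>\<^bsub>simplex_alg A (fst z)\<^esub> sval x z" if x: "x \<in> carrier (pmap_alg K A)" for x
    proof (rule bexI)
      show "SMap (\<lambda>z\<in>cells K. \<ominus>\<^bsub>simplex_alg A (fst z)\<^esub> sval x z) \<in> carrier (pmap_alg K A)"
        by (rule pmapI[OF _ _ _ K]) (simp_all add: S cl x pmap_simp(2,3)[OF x] an)
    qed simp
    show "is_algebra (pmap_alg K A)"
      by (rule J(1)) (use 1 2 in \<open>simp_all add: S pmap_simp(1) 0 3\<close>, rule pmap_eqI, simp_all add: pmap_ops)
    show "(\<lambda>x. sval x z) \<in> alg_hom (pmap_alg K A) (simplex_alg A (fst z))" if "z \<in> cells K" for z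
      using that unfolding alg_hom_def by (auto simp: pmap_simp(1)) (simp_all add: pmap_ops)
  qed
  then show "is_algebra (pmap_alg K A)" "z \<in> cells K \<Longrightarrow> (\<lambda>x. sval x z) \<in> alg_hom (pmap_alg K A) (simplex_alg A (fst z))" by blast+
qed

lemma pmap_homI:
  assumes "\<And>x. x \<in> carrier X \<Longrightarrow> F x \<in> carrier (pmap_alg K A)"
    and "\<And>z. z \<in> cells K \<Longrightarrow> (\<lambda>x. sval (F x) z) \<in> alg_hom X (simplex_alg A (fst z))"
    and K: "sset_ok K" and A: "is_algebra A" and X: "is_algebra X"
  shows "F \<in> alg_hom X (pmap_alg K A)"
  unfolding alg_hom_def mem_Collect_eq
  by (intro conjI ballI funcsetI)
    ((rule assms(1), assumption) | (rule pmap_eqI[of _ K A _ A], simp_all add: assms(1) X pmap_alg_algebra[OF K A], simp add: pmap_ops alg_homD[OF assms(2)]))+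

lemma pmap_add_homI:
  assumes "\<And>x. x \<in> carrier X \<Longrightarrow> F x \<in> carrier (pmap_alg K A)"
    and "\<And>z. z \<in> cells K \<Longrightarrow> (\<lambda>x. sval (F x) z) \<in> add_hom X (simplex_alg A (fst z))"
    and K: "sset_ok K" and A: "is_algebra A" and X: "is_algebra X"
  shows "F \<in> add_hom X (pmap_alg K A)"
  unfolding add_hom_def mem_Collect_eq
  by (intro conjI ballI funcsetI)
    ((rule assms(1), assumption) | (rule pmap_eqI[of _ K A _ A], simp_all add: assms(1) X pmap_alg_algebra[OF K A], simp add: pmap_ops add_hom_add[OF assms(2)]))+

lemma sval_push: "z \<in> cells K \<Longrightarrow> sval (push K B f x) z = simplex_map (fst z) B f (sval x z)"
  by (simp add: push_def)

lemma push_closed: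
  assumes K: "sset_ok K" and A: "is_algebra A" and B: "is_algebra B" and f: "f \<in> add_hom A B" and x: "x \<in> carrier (pmap_alg K A)"
  shows "push K B f x \<in> carrier (pmap_alg K B)"
proof -
  have cl: "sval x (n, s) \<in> carrier (simplex_alg A n)" if "s \<in> simp K n" for n s
    using pmap_simp(1)[OF x, of "(n, s)"] that by (simp add: cells_def)
  note m = simplex_map_add_hom[OF A B f]
  show ?thesis unfolding push_def
    by (rule pmapI[OF _ _ _ K])
      (simp_all add: cl pmap_simp(2,3)[OF x] simplex_map_act[OF A B f] add_hom_closed[OF m] add_hom_zero[OF m simplex_algebra[OF A] simplex_algebra[OF B]])
qed

lemma push_hom:
  assumes K: "sset_ok K" and A: "is_algebra A" and B: "is_algebra B" and f: "f \<in> alg_hom A B"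
  shows "push K B f \<in> alg_hom (pmap_alg K A) (pmap_alg K B)"
proof (rule pmap_homI[OF push_closed[OF K A B alg_hom_add_hom[OF f]] _ K B pmap_alg_algebra[OF K A]])
  fix z assume z: "z \<in> cells K"
  show "(\<lambda>x. sval (push K B f x) z) \<in> alg_hom (pmap_alg K A) (simplex_alg B (fst z))"
    using alg_hom_comp[OF sval_hom[OF K A z] simplex_map_hom[OF A B f]] by (simp add: sval_push z comp_def)
qed

lemma push_add_hom:
  assumes K: "sset_ok K" and A: "is_algebra A" and B: "is_algebra B" and f: "f \<in> add_hom A B"
  shows "push K B f \<in> add_hom (pmap_alg K A) (pmap_alg K B)"
proof (rule pmap_add_homI[OF push_closed[OF K A B f] _ K B pmap_alg_algebra[OF K A]])
  fix z assume z: "z \<in> cells K"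
  show "(\<lambda>x. sval (push K B f x) z) \<in> add_hom (pmap_alg K A) (simplex_alg B (fst z))"
    using add_hom_comp[OF alg_hom_add_hom[OF sval_hom[OF K A z]] simplex_map_add_hom[OF A B f]] by (simp add: sval_push z comp_def)
qed

lemma push_comp:
  assumes A: "is_algebra A" and B: "is_algebra B" and C: "is_algebra C" and f: "f \<in> add_hom A B" and g: "g \<in> add_hom B C"
    and x: "x \<in> carrier (pmap_alg K A)"
  shows "push K C g (push K B f x) = push K C (g \<circ> f) x"
  unfolding push_def[of K C] using simplex_map_comp[OF A B C f g pmap_simp(1)[OF x]]
  by (intro arg_cong[where f = SMap] restrict_ext) (simp add: sval_push)

lemma pull_hom:
  assumes L: "sset_ok L" and K: "sset_ok K" and u: "smap L K u" and A: "is_algebra A"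
  shows "pull L u \<in> alg_hom (pmap_alg K A) (pmap_alg L A)"
proof (rule pmap_homI[OF _ _ L A pmap_alg_algebra[OF K A]])
  have uc: "(n, u s) \<in> cells K" if "s \<in> simp L n" for n s using u that by (auto simp: smap_def cells_def)
  show "pull L u x \<in> carrier (pmap_alg L A)" if x: "x \<in> carrier (pmap_alg K A)" for x
  proof -
    have "sval x (m, u (sact L \<theta> c)) = simplex_act A \<theta> (sval x (n, u c))" if "\<theta> \<in> opers m n" "c \<in> simp L n" for m n \<theta> c
      using pmap_simp(2)[OF x that(1), of "u c"] u that by (simp add: smap_def)
    moreover have "sval x (0, u (spt L)) = \<zero>\<^bsub>simplex_alg A 0\<^esub>" using pmap_simp(3)[OF x] u by (simp add: smap_def)
    moreover have "sval x (n, u c) \<in> carrier (simplex_alg A n)" if "c \<in> simp L n" for n c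
      using pmap_simp(1)[OF x uc[OF that]] by simp
    ultimately show ?thesis unfolding pull_def by (intro pmapI[OF _ _ _ L]) simp_all
  qed
  fix z assume z: "z \<in> cells L"
  then have "(fst z, u (snd z)) \<in> cells K" using uc by (auto simp: cells_def)
  from sval_hom[OF K A this] show "(\<lambda>x. sval (pull L u x) z) \<in> alg_hom (pmap_alg K A) (simplex_alg A (fst z))"
    using z by (simp add: pull_def)
qed

lemma push_inj:
  assumes "is_algebra A" "is_algebra B" "f \<in> add_hom A B" "inj_on f (carrier A)"
  shows "inj_on (push K B f) (carrier (pmap_alg K A))"
proof (rule inj_onI)
  fix x y assume x: "x \<in> carrier (pmap_alg K A)" and y: "y \<in> carrier (pmap_alg K A)" and eq: "push K B f x = push K B f y"
  show "x = y"
  proof (rule pmap_eqI[OF x y])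
    fix z assume z: "z \<in> cells K"
    have "simplex_map (fst z) B f (sval x z) = simplex_map (fst z) B f (sval y z)" using eq sval_push[OF z] by metis
    then show "sval x z = sval y z" using simplex_map_inj[OF assms] pmap_simp(1)[OF x z] pmap_simp(1)[OF y z] by (auto dest: inj_onD)
  qed
qed

text \<open>Preimages are unique on each simplex, and therefore compatible with the operators.\<close>

lemma push_exact:
  assumes K: "sset_ok K" and A: "is_algebra A" and B: "is_algebra B" and C: "is_algebra C" and f: "f \<in> add_hom A B" "inj_on f (carrier A)" and g: "g \<in> add_hom B C"
    and ker: "\<And>b. b \<in> carrier B \<Longrightarrow> g b = \<zero>\<^bsub>C\<^esub> \<Longrightarrow> b \<in> f ` carrier A"
    and x: "x \<in> carrier (pmap_alg K B)" "push K C g x = \<zero>\<^bsub>pmap_alg K C\<^esub>"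
  shows "x \<in> push K B f ` carrier (pmap_alg K A)"
proof -
  let ?w = "\<lambda>z. inv_into (carrier (simplex_alg A (fst z))) (simplex_map (fst z) B f) (sval x z)"
  note SA = simplex_algebra[OF A] and SB = simplex_algebra[OF B] and m = simplex_map_add_hom[OF A B f(1)]
  have im: "sval x z \<in> simplex_map (fst z) B f ` carrier (simplex_alg A (fst z))" if z: "z \<in> cells K" for z
  proof (rule simplex_map_exact[OF A B C f g ker pmap_simp(1)[OF x(1) z]])
    show "simplex_map (fst z) C g (sval x z) = \<zero>\<^bsub>simplex_alg C (fst z)\<^esub>"
      using sval_push[OF z, of C g x] z unfolding x(2) by (simp add: pmap_ops)
  qed
  have w: "?w z \<in> carrier (simplex_alg A (fst z))" "simplex_map (fst z) B f (?w z) = sval x z" if "z \<in> cells K" for z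
    using im[OF that] by (rule inv_into_into, rule f_inv_into_f)
  have c: "(n, s) \<in> cells K \<longleftrightarrow> s \<in> simp K n" for n s by (simp add: cells_def)
  note inj = inj_onD[OF simplex_map_inj[OF A B f]]
  have mem: "SMap (\<lambda>z\<in>cells K. ?w z) \<in> carrier (pmap_alg K A)"
  proof (rule pmapI[OF _ _ _ K])
    show "?w (n, s) \<in> carrier (simplex_alg A n)" if "s \<in> simp K n" for n s using w(1)[of "(n, s)"] that by (simp add: c)
    show "?w (m, sact K \<theta> s) = simplex_act A \<theta> (?w (n, s))" if t: "\<theta> \<in> opers m n" and s: "s \<in> simp K n" for m n \<theta> s
    proof (rule inj)
      have z: "(n, s) \<in> cells K" "(m, sact K \<theta> s) \<in> cells K" using s sset_okD(1)[OF K t s] by (simp_all add: c)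
      show "?w (m, sact K \<theta> s) \<in> carrier (simplex_alg A m)" using w(1)[OF z(2)] by simp
      have wn: "?w (n, s) \<in> carrier (simplex_alg A n)" using w(1)[OF z(1)] by simp
      then show "simplex_act A \<theta> (?w (n, s)) \<in> carrier (simplex_alg A m)" by (rule alg_hom_closed[OF simplex_act_hom[OF A t]])
      show "simplex_map m B f (?w (m, sact K \<theta> s)) = simplex_map m B f (simplex_act A \<theta> (?w (n, s)))"
        using w(2)[OF z(2)] w(2)[OF z(1)] simplex_map_act[OF A B f(1) t wn] pmap_simp(2)[OF x(1) t s] by simp
    qed
    show "?w (0, spt K) = \<zero>\<^bsub>simplex_alg A 0\<^esub>"
    proof (rule inj)
      have z: "(0, spt K) \<in> cells K" using sset_okD(3)[OF K] by (simp add: c)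
      show "?w (0, spt K) \<in> carrier (simplex_alg A 0)" using w(1)[OF z] by simp
      show "\<zero>\<^bsub>simplex_alg A 0\<^esub> \<in> carrier (simplex_alg A 0)" using SA by simp
      show "simplex_map 0 B f (?w (0, spt K)) = simplex_map 0 B f \<zero>\<^bsub>simplex_alg A 0\<^esub>"
        using w(2)[OF z] add_hom_zero[OF m SA SB] pmap_simp(3)[OF x(1)] by simp
    qed
  qed
  have eq: "push K B f (SMap (\<lambda>z\<in>cells K. ?w z)) = x"
    by (rule pmap_eqI[OF push_closed[OF K A B f(1) mem] x(1)]) (simp add: sval_push w(2))
  show ?thesis using imageI[OF mem, of "push K B f"] unfolding eq .
qed

lemma loops_algebra [simp]: "is_algebra A \<Longrightarrow> is_algebra (loops p A)"
  unfolding loops_def by (rule pmap_alg_algebra[OF sd_circle_ok])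

lemma iloops_algebra [simp]: "is_algebra A \<Longrightarrow> is_algebra (iloops ps A)"
  by (induction ps) simp_all

lemma loops_map_hom: "is_algebra A \<Longrightarrow> is_algebra B \<Longrightarrow> f \<in> alg_hom A B \<Longrightarrow> loops_map p B f \<in> alg_hom (loops p A) (loops p B)"
  unfolding loops_def loops_map_def by (rule push_hom[OF sd_circle_ok])

lemma iloops_map_hom: "is_algebra A \<Longrightarrow> is_algebra B \<Longrightarrow> f \<in> alg_hom A B \<Longrightarrow> iloops_map ps B f \<in> alg_hom (iloops ps A) (iloops ps B)"
  by (induction ps) (simp_all add: loops_map_hom)

lemma iloops_append: "iloops (ps @ qs) A = iloops ps (iloops qs A)"
  by (induction ps) simp_all

lemma loops_trans_hom:
  assumes A: "is_algebra A" and pq: "p \<le> q" shows "loops_trans p q \<in> alg_hom (loops p A) (loops q A)"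
  using pull_hom[OF sd_circle_ok sd_circle_ok last_vertices_smap A, of p "q - p"] pq by (simp add: loops_trans_def loops_def)

lemma iloops_trans_hom:
  assumes A: "is_algebra A" and pq: "list_all2 (\<le>) ps qs"
  shows "iloops_trans A ps qs \<in> alg_hom (iloops ps A) (iloops qs A)"
  using pq
proof (induction rule: list_all2_induct)
  case Nil
  then show ?case unfolding iloops_trans.simps iloops.simps by (rule alg_hom_id)
next
  case (Cons p ps q qs)
  show ?case unfolding iloops_trans.simps iloops.simps
    by (rule alg_hom_comp[OF loops_map_hom[OF _ _ Cons.IH] loops_trans_hom[OF _ Cons.hyps(1)]]) (use A in simp_all)
qed

lemma counit_kernel:
  "is_algebra A \<Longrightarrow> b \<in> carrier (T A) \<Longrightarrow> counit A b = \<zero>\<^bsub>A\<^esub> \<Longrightarrow> b \<in> id ` carrier (J A)"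
  by (simp add: J_carrier)

lemma gamma1_hom:
  assumes A: "is_algebra A" and g: "g \<in> gamma1 p A" shows "g \<in> alg_hom (J (loops p A)) (loops p (J A))"
proof -
  obtain s where s: "s \<in> sections (loops p (T A)) (loops p A) (loops_map p A (counit A))"
    "g = classifying_map (loops p (J A)) (loops_map p (T A) id) (loops p (T A)) s"
    using g unfolding gamma1_def classifying_maps_def by blast
  note JA = J_algebra[OF A] and TA = T_algebra[of A]
  have i: "id \<in> alg_hom (J A) (T A)" using J_subalg[OF A] by (simp add: subalg_def)
  show ?thesis unfolding s(2)
  proof (rule classifying_map(2)[OF _ _ _ loops_map_hom[OF JA TA i] _ loops_map_hom[OF TA A counit_hom[OF A]] _ s(1)])
    show "inj_on (loops_map p (T A) id) (carrier (loops p (J A)))"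
      unfolding loops_map_def loops_def by (rule push_inj[OF JA TA alg_hom_add_hom[OF i]]) simp
    show "b \<in> loops_map p (T A) id ` carrier (loops p (J A))"
      if "b \<in> carrier (loops p (T A))" "loops_map p A (counit A) b = \<zero>\<^bsub>loops p A\<^esub>" for b
      using that push_exact[OF sd_circle_ok JA TA A alg_hom_add_hom[OF i] inj_on_id alg_hom_add_hom[OF counit_hom[OF A]] counit_kernel[OF A], of b p]
      unfolding loops_map_def loops_def by blast
  qed (use A JA TA in simp_all)
qed

lemma gamma_hom: "is_algebra A \<Longrightarrow> g \<in> gamma ps A \<Longrightarrow> g \<in> alg_hom (J (iloops ps A)) (iloops ps (J A))"
proof (induction ps arbitrary: g)
  case Nil
  then have "g = id" by simp
  then show ?case unfolding iloops.simps using alg_hom_id by blast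
next
  case (Cons p ps)
  then obtain g' g1 where g: "g = loops_map p (iloops ps (J A)) g' \<circ> g1" "g' \<in> gamma ps A" "g1 \<in> gamma1 p (iloops ps A)" by auto
  have "loops_map p (iloops ps (J A)) g' \<in> alg_hom (loops p (J (iloops ps A))) (loops p (iloops ps (J A)))"
    using Cons by (intro loops_map_hom Cons.IH g(2)) (simp_all add: J_algebra)
  from alg_hom_comp[OF gamma1_hom[OF _ g(3)] this] show ?case unfolding g(1) iloops.simps using Cons.prems iloops_algebra by blast
qed

lemma gamma_pow_hom:
  "is_algebra A \<Longrightarrow> g \<in> gamma_pow n ps A \<Longrightarrow> g \<in> alg_hom ((J ^^ n) (iloops ps A)) (iloops ps ((J ^^ n) A))"
proof (induction n arbitrary: g)
  case 0
  then have "g = id" by simp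
  then show ?case unfolding funpow_0 using alg_hom_id by blast
next
  case (Suc n)
  then obtain g' g1 where g: "g = g1 \<circ> J_map (iloops ps ((J ^^ n) A)) g'" "g' \<in> gamma_pow n ps A" "g1 \<in> gamma ps ((J ^^ n) A)" by auto
  have "J_map (iloops ps ((J ^^ n) A)) g' \<in> alg_hom (J ((J ^^ n) (iloops ps A))) (J (iloops ps ((J ^^ n) A)))"
    using Suc by (intro J_map_hom Suc.IH g(2)) (simp_all add: J_pow_algebra)
  from alg_hom_comp[OF this gamma_hom[OF _ g(3)]] show ?case unfolding g(1) J_pow_Suc using J_pow_algebra Suc.prems(1) by blast
qed

lemma mat_J_kernel:
  assumes A: "is_algebra A" and b: "b \<in> carrier (mat_alg k (T A))" "mat_map (counit A) b = \<zero>\<^bsub>mat_alg k A\<^esub>"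
  shows "b \<in> id ` carrier (mat_alg k (J A))"
proof -
  have e: "counit A (entry b i j) = \<zero>\<^bsub>A\<^esub>" for i j
    using arg_cong[OF b(2), of "\<lambda>x. entry x i j"] by (simp add: mat_ops)
  obtain f where f: "b = Mtx f" using b(1) unfolding mat_carrier by blast
  have z: "\<zero>\<^bsub>J A\<^esub> = \<zero>\<^bsub>T A\<^esub>" by (rule subalg_zero[OF J_subalg[OF A]])
  have "entry b i j \<in> carrier (J A)" for i j using entry_closed[OF b(1)] e by (simp add: J_carrier)
  then have "ment (Mtx f) \<in> carrier (fsa mat_op (J A))" using b(1) unfolding f mat_carrier fsa_simps z by (simp add: ment_def)
  moreover have "fst i < k \<and> fst j < k" if "f i j \<noteq> \<zero>\<^bsub>J A\<^esub>" for i j using mat_bound[OF b(1), of i j] that unfolding f z by simp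
  ultimately show ?thesis unfolding f by (simp add: mat_memI)
qed

lemma mat_J_hom:
  assumes A: "is_algebra A" and g: "g \<in> mat_J k A" shows "g \<in> alg_hom (J (mat_alg k A)) (mat_alg k (J A))"
proof -
  obtain s where s: "s \<in> sections (mat_alg k (T A)) (mat_alg k A) (mat_map (counit A))"
    "g = classifying_map (mat_alg k (J A)) id (mat_alg k (T A)) s"
    using g unfolding mat_J_def classifying_maps_def by blast
  note JA = J_algebra[OF A] and TA = T_algebra[of A]
  have i: "id \<in> alg_hom (mat_alg k (J A)) (mat_alg k (T A))" using mat_map_subalg[OF J_subalg[OF A]] by (simp add: subalg_def)
  show ?thesis unfolding s(2)
    by (rule classifying_map(2)[OF mat_algebra[OF JA] mat_algebra[OF TA] mat_algebra[OF A] i inj_on_id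
          mat_map_alg_hom[OF TA A counit_hom[OF A]] mat_J_kernel[OF A] s(1)])
qed

lemma J_pow_hom:
  "is_algebra X \<Longrightarrow> is_algebra Y \<Longrightarrow> f \<in> alg_hom X (mat_alg k Y) \<Longrightarrow> g \<in> J_pow n k Y f \<Longrightarrow> g \<in> alg_hom ((J ^^ n) X) (mat_alg k ((J ^^ n) Y))"
proof (induction n arbitrary: g)
  case (Suc n)
  then obtain g' \<mu> where g: "g = \<mu> \<circ> J_map (mat_alg k ((J ^^ n) Y)) g'" "g' \<in> J_pow n k Y f" "\<mu> \<in> mat_J k ((J ^^ n) Y)" by auto
  have "J_map (mat_alg k ((J ^^ n) Y)) g' \<in> alg_hom (J ((J ^^ n) X)) (J (mat_alg k ((J ^^ n) Y)))"
    using Suc by (intro J_map_hom Suc.IH g(2)) (simp_all add: J_pow_algebra mat_algebra)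
  from alg_hom_comp[OF this mat_J_hom[OF _ g(3)]] show ?case unfolding g(1) J_pow_Suc using J_pow_algebra Suc.prems(2) by blast
qed simp

end

section \<open>Loops of matrices and matrices of loops\<close>

context kk_setting
begin

lemma mat_columns_finite:
  assumes x: "x \<in> carrier (mat_alg k A)" shows "finite {l. \<exists>i. entry x i l \<noteq> \<zero>\<^bsub>A\<^esub>}"
proof -
  have "finite {(i, j). entry x i j \<noteq> \<zero>\<^bsub>A\<^esub>}" using x by (auto simp: mat_alg_def)
  then have "finite (snd ` {(i, j). entry x i j \<noteq> \<zero>\<^bsub>A\<^esub>})" by (rule finite_imageI)
  then show ?thesis by (rule finite_subset[rotated]) force
qed

lemma mat_mult_entry:
  assumes A: "is_algebra A" and x: "x \<in> carrier (mat_alg k A)" and y: "y \<in> carrier (mat_alg k A)"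
    and F: "finite F" "{l. \<exists>i. entry x i l \<noteq> \<zero>\<^bsub>A\<^esub>} \<subseteq> F"
  shows "entry (x \<otimes>\<^bsub>mat_alg k A\<^esub> y) i j = (\<Oplus>\<^bsub>A\<^esub>l\<in>F. entry x i l \<otimes>\<^bsub>A\<^esub> entry y l j)"
proof -
  interpret abelian_group A using A by (rule algebra_abelian_group)
  have sub: "{l. entry x i l \<noteq> \<zero>\<^bsub>A\<^esub>} \<subseteq> F" using F(2) by blast
  have "(\<Oplus>\<^bsub>A\<^esub>l\<in>{l. entry x i l \<noteq> \<zero>\<^bsub>A\<^esub>}. entry x i l \<otimes>\<^bsub>A\<^esub> entry y l j) = (\<Oplus>\<^bsub>A\<^esub>l\<in>F. entry x i l \<otimes>\<^bsub>A\<^esub> entry y l j)"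
    by (rule add.finprod_mono_neutral_cong_left[OF F(1) sub])
      (use A entry_closed[OF x] entry_closed[OF y] in simp_all)
  then show ?thesis by (simp add: mat_alg_def)
qed

lemma finsum_zero:
  assumes "is_algebra A" "\<And>i. i \<in> F \<Longrightarrow> f i = \<zero>\<^bsub>A\<^esub>" shows "(\<Oplus>\<^bsub>A\<^esub>i\<in>F. f i) = \<zero>\<^bsub>A\<^esub>"
proof -
  interpret abelian_group A using assms(1) by (rule algebra_abelian_group)
  show ?thesis by (rule add.finprod_one_eqI) (rule assms(2))
qed

lemma pmono_add_hom: "is_algebra A \<Longrightarrow> expn e \<subseteq> V \<Longrightarrow> pmono A e \<in> add_hom A (poly_alg V A)"
  by (auto simp: add_hom_def pmono_closed) (auto simp: pmono_def fmono_def poly_ops)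

lemma finsum_add_hom:
  assumes "is_algebra B" "is_algebra A" "\<And>l. l \<in> F \<Longrightarrow> \<phi> l \<in> add_hom A B"
  shows "(\<lambda>x. \<Oplus>\<^bsub>B\<^esub>l\<in>F. \<phi> l x) \<in> add_hom A B"
proof -
  interpret abelian_group B using assms(1) by (rule algebra_abelian_group)
  show ?thesis unfolding add_hom_def mem_Collect_eq
  proof (intro conjI ballI funcsetI)
    show "(\<Oplus>\<^bsub>B\<^esub>l\<in>F. \<phi> l x) \<in> carrier B" if "x \<in> carrier A" for x
      by (rule finsum_closed) (use add_hom_closed[OF assms(3)] that in blast)
    show "(\<Oplus>\<^bsub>B\<^esub>l\<in>F. \<phi> l (x \<oplus>\<^bsub>A\<^esub> y)) = (\<Oplus>\<^bsub>B\<^esub>l\<in>F. \<phi> l x) \<oplus>\<^bsub>B\<^esub> (\<Oplus>\<^bsub>B\<^esub>l\<in>F. \<phi> l y)" if "x \<in> carrier A" "y \<in> carrier A" for x y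
      by (rule finsum_split[OF assms(1)]) (use add_hom_closed[OF assms(3)] add_hom_add[OF assms(3)] that in auto)
  qed
qed

lemma mult_left_add_hom: "is_algebra A \<Longrightarrow> a \<in> carrier A \<Longrightarrow> (\<lambda>x. a \<otimes>\<^bsub>A\<^esub> x) \<in> add_hom A A"
  by (auto simp: add_hom_def algebra_distrib_l)

text \<open>The entries of a product are sums over the columns of the first factor. The finite set \<open>F0\<close> bounds these
  columns uniformly in the second factor.\<close>

definition col_bound :: "('h, 'x) algebra \<Rightarrow> ('h, 'y) algebra \<Rightarrow> ('i \<Rightarrow> 'i \<Rightarrow> 'x \<Rightarrow> 'y) \<Rightarrow> 'x \<Rightarrow> 'i set \<Rightarrow> bool" where
  "col_bound S R e x F0 \<longleftrightarrow> finite F0 \<and> (\<forall>F i j y. y \<in> carrier S \<longrightarrow> finite F \<longrightarrow> F0 \<subseteq> F \<longrightarrow>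
    e i j (x \<otimes>\<^bsub>S\<^esub> y) = (\<Oplus>\<^bsub>R\<^esub>l\<in>F. e i l x \<otimes>\<^bsub>R\<^esub> e l j y))"

lemma col_boundI:
  assumes "finite F0" "\<And>F i j y. y \<in> carrier S \<Longrightarrow> finite F \<Longrightarrow> F0 \<subseteq> F \<Longrightarrow>
    e i j (x \<otimes>\<^bsub>S\<^esub> y) = (\<Oplus>\<^bsub>R\<^esub>l\<in>F. e i l x \<otimes>\<^bsub>R\<^esub> e l j y)"
  shows "col_bound S R e x F0"
  unfolding col_bound_def using assms by blast

lemma col_boundD:
  assumes "col_bound S R e x F0"
  shows "finite F0" and "y \<in> carrier S \<Longrightarrow> finite F \<Longrightarrow> F0 \<subseteq> F \<Longrightarrow>
    e i j (x \<otimes>\<^bsub>S\<^esub> y) = (\<Oplus>\<^bsub>R\<^esub>l\<in>F. e i l x \<otimes>\<^bsub>R\<^esub> e l j y)"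
  using assms unfolding col_bound_def by blast+

text \<open>Since a bound may be enlarged, the bounds of two summands have a common one, and monomials suffice.\<close>

lemma pmap_entry_mult:
  assumes X: "is_algebra X" and x: "x \<in> carrier (poly_alg V (mat_alg k X))"
  shows "\<exists>F0. col_bound (poly_alg V (mat_alg k X)) (poly_alg V X) (\<lambda>i j. pmap (\<lambda>m. entry m i j)) x F0"
proof -
  let ?M = "mat_alg k X" and ?e = "\<lambda>i j m. entry m i j"
  let ?P = "col_bound (poly_alg V ?M) (poly_alg V X) (\<lambda>i j. pmap (?e i j))"
  note M = mat_algebra[OF X, of k] and PM = poly_algebra[OF mat_algebra[OF X, of k], of V] and PX = poly_algebra[OF X, of V]
  have e: "pmap (?e i j) \<in> add_hom (poly_alg V ?M) (poly_alg V X)" for i j by (rule pmap_add_hom[OF M X entry_add_hom[OF X]])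
  note ec = add_hom_closed[OF e] and e0 = add_hom_zero[OF e PM PX]
  have z: "?e i j \<zero>\<^bsub>?M\<^esub> = \<zero>\<^bsub>X\<^esub>" for i j by (simp add: mat_ops)
  from M x show ?thesis
  proof (induction rule: poly_induct)
    case zero
    have "?P \<zero>\<^bsub>poly_alg V ?M\<^esub> {}" by (rule col_boundI) (simp_all add: PM PX e0 ec finsum_zero)
    then show ?case by (rule exI)
  next
    case (mono e a)
    let ?F0 = "{l. \<exists>i. entry a i l \<noteq> \<zero>\<^bsub>X\<^esub>}"
    have pa: "pmono ?M e a \<in> carrier (poly_alg V ?M)" using mono M by (simp add: pmono_closed)
    have "pmap (?e i j) (pmono ?M e a \<otimes>\<^bsub>poly_alg V ?M\<^esub> y) = (\<Oplus>\<^bsub>poly_alg V X\<^esub>l\<in>F. pmap (?e i l) (pmono ?M e a) \<otimes>\<^bsub>poly_alg V X\<^esub> pmap (?e l j) y)"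
      if y: "y \<in> carrier (poly_alg V ?M)" and F: "finite F" "?F0 \<subseteq> F" for F i j y
    proof (rule poly_add_hom_eqI[OF M _ _ _ y])
      show "(\<lambda>y. pmap (?e i j) (pmono ?M e a \<otimes>\<^bsub>poly_alg V ?M\<^esub> y)) \<in> add_hom (poly_alg V ?M) (poly_alg V X)"
        using add_hom_comp[OF mult_left_add_hom[OF PM pa] e[of i j]] by (simp add: comp_def)
      show "(\<lambda>y. \<Oplus>\<^bsub>poly_alg V X\<^esub>l\<in>F. pmap (?e i l) (pmono ?M e a) \<otimes>\<^bsub>poly_alg V X\<^esub> pmap (?e l j) y) \<in> add_hom (poly_alg V ?M) (poly_alg V X)"
      proof (rule finsum_add_hom[OF PX PM])
        show "(\<lambda>y. pmap (?e i l) (pmono ?M e a) \<otimes>\<^bsub>poly_alg V X\<^esub> pmap (?e l j) y) \<in> add_hom (poly_alg V ?M) (poly_alg V X)" for l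
          using add_hom_comp[OF e[of l j] mult_left_add_hom[OF PX ec[OF pa, of i l]]] by (simp add: comp_def)
      qed
      fix f b assume f: "expn f \<subseteq> V" "b \<in> carrier ?M"
      have ef: "expn (e + f) \<subseteq> V" using mono(1) f(1) keys_add[of e f] by blast
      have "pmap (?e i j) (pmono ?M e a \<otimes>\<^bsub>poly_alg V ?M\<^esub> pmono ?M f b) = pmono X (e + f) (entry (a \<otimes>\<^bsub>?M\<^esub> b) i j)"
        using mono f M by (simp add: pmono_mult pmap_pmono[of "?e i j" ?M X, OF z])
      also have "\<dots> = pmono X (e + f) (\<Oplus>\<^bsub>X\<^esub>l\<in>F. entry a i l \<otimes>\<^bsub>X\<^esub> entry b l j)"
        unfolding mat_mult_entry[OF X mono(2) f(2) F] ..
      also have "\<dots> = (\<Oplus>\<^bsub>poly_alg V X\<^esub>l\<in>F. pmono X (e + f) (entry a i l \<otimes>\<^bsub>X\<^esub> entry b l j))"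
        by (rule add_hom_finsum[OF pmono_add_hom[OF X ef] X PX]) (use X entry_closed[OF mono(2)] entry_closed[OF f(2)] in auto)
      also have "\<dots> = (\<Oplus>\<^bsub>poly_alg V X\<^esub>l\<in>F. pmap (?e i l) (pmono ?M e a) \<otimes>\<^bsub>poly_alg V X\<^esub> pmap (?e l j) (pmono ?M f b))"
        using mono f X entry_closed[OF mono(2)] entry_closed[OF f(2)] by (simp add: pmono_mult pmap_pmono[of "?e _ _" ?M X, OF z])
      finally show "pmap (?e i j) (pmono ?M e a \<otimes>\<^bsub>poly_alg V ?M\<^esub> pmono ?M f b) = \<dots>" .
    qed
    then have "?P (pmono ?M e a) ?F0" by (rule col_boundI[OF mat_columns_finite[OF mono(2)]])
    then show ?case by (rule exI)
  next
    case (add u v)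
    obtain F0 where F0: "?P u F0" using add.IH(1) by (rule exE)
    obtain F1 where F1: "?P v F1" using add.IH(2) by (rule exE)
    have "?P (u \<oplus>\<^bsub>poly_alg V ?M\<^esub> v) (F0 \<union> F1)"
    proof (rule col_boundI)
      fix F i j y assume y: "y \<in> carrier (poly_alg V ?M)" and Fs: "finite F" "F0 \<union> F1 \<subseteq> F"
      have "pmap (?e i j) ((u \<oplus>\<^bsub>poly_alg V ?M\<^esub> v) \<otimes>\<^bsub>poly_alg V ?M\<^esub> y) =
        pmap (?e i j) (u \<otimes>\<^bsub>poly_alg V ?M\<^esub> y) \<oplus>\<^bsub>poly_alg V X\<^esub> pmap (?e i j) (v \<otimes>\<^bsub>poly_alg V ?M\<^esub> y)"
        unfolding algebra_distrib_r[OF PM add.hyps y] by (rule add_hom_add[OF e algebra_closed(3)[OF PM add.hyps(1) y] algebra_closed(3)[OF PM add.hyps(2) y]])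
      also have "\<dots> = (\<Oplus>\<^bsub>poly_alg V X\<^esub>l\<in>F. pmap (?e i l) u \<otimes>\<^bsub>poly_alg V X\<^esub> pmap (?e l j) y)
        \<oplus>\<^bsub>poly_alg V X\<^esub> (\<Oplus>\<^bsub>poly_alg V X\<^esub>l\<in>F. pmap (?e i l) v \<otimes>\<^bsub>poly_alg V X\<^esub> pmap (?e l j) y)"
        using col_boundD(2)[OF F0 y Fs(1)] col_boundD(2)[OF F1 y Fs(1)] Fs(2) by simp
      also have "\<dots> = (\<Oplus>\<^bsub>poly_alg V X\<^esub>l\<in>F. pmap (?e i l) (u \<oplus>\<^bsub>poly_alg V ?M\<^esub> v) \<otimes>\<^bsub>poly_alg V X\<^esub> pmap (?e l j) y)"
      proof (rule finsum_split[OF PX, symmetric])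
        show "pmap (?e i l) (u \<oplus>\<^bsub>poly_alg V ?M\<^esub> v) \<otimes>\<^bsub>poly_alg V X\<^esub> pmap (?e l j) y = pmap (?e i l) u \<otimes>\<^bsub>poly_alg V X\<^esub> pmap (?e l j) y
            \<oplus>\<^bsub>poly_alg V X\<^esub> pmap (?e i l) v \<otimes>\<^bsub>poly_alg V X\<^esub> pmap (?e l j) y" for l
          unfolding add_hom_add[OF e add.hyps] by (rule algebra_distrib_r[OF PX ec[OF add.hyps(1)] ec[OF add.hyps(2)] ec[OF y]])
      qed (rule funcsetI algebra_closed(3)[OF PX ec ec] add.hyps y)+
      finally show "pmap (?e i j) ((u \<oplus>\<^bsub>poly_alg V ?M\<^esub> v) \<otimes>\<^bsub>poly_alg V ?M\<^esub> y) = \<dots>" .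
    qed (use col_boundD(1)[OF F0] col_boundD(1)[OF F1] in simp)
    then show ?case by (rule exI)
  qed
qed

lemma simplex_entry_mult:
  assumes X: "is_algebra X" and x: "x \<in> carrier (simplex_alg (mat_alg k X) n)"
  shows "\<exists>F0. col_bound (simplex_alg (mat_alg k X) n) (simplex_alg X n) (\<lambda>i j. simplex_map n X (\<lambda>m. entry m i j)) x F0"
proof -
  let ?M = "mat_alg k X" and ?e = "\<lambda>i j m. entry m i j"
  note M = mat_algebra[OF X, of k] and PX = poly_algebra[OF X, of "{..n}"] and PM = poly_algebra[OF mat_algebra[OF X, of k], of "{..n}"]
  note sub = simplex_sub[OF M] and p = sproj_hom[OF M, of n] and q = sproj_hom[OF X, of n]
  have e: "pmap (?e i j) \<in> add_hom (sP n ?M) (sP n X)" for i j by (rule pmap_add_hom[OF M X entry_add_hom[OF X]])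
  obtain F0 where F0: "col_bound (sP n ?M) (sP n X) (\<lambda>i j. pmap (?e i j)) x F0"
    using pmap_entry_mult[OF X sub[OF x]] by (rule exE)
  have "col_bound (simplex_alg (mat_alg k X) n) (simplex_alg X n) (\<lambda>i j. simplex_map n X (?e i j)) x F0"
  proof (rule col_boundI[OF col_boundD(1)[OF F0]])
    fix F i j y assume y: "y \<in> carrier (simplex_alg ?M n)" and F: "finite F" "F0 \<subseteq> F"
    note xc = sub[OF x] and yc = sub[OF y]
    have "x \<otimes>\<^bsub>simplex_alg ?M n\<^esub> y = sproj n ?M (x \<otimes>\<^bsub>sP n ?M\<^esub> y)"
      unfolding alg_homD(2)[OF p xc yc] sproj_id[OF M x] sproj_id[OF M y] ..
    then have "simplex_map n X (?e i j) (x \<otimes>\<^bsub>simplex_alg ?M n\<^esub> y) = sproj n X (pmap (?e i j) (x \<otimes>\<^bsub>sP n ?M\<^esub> y))"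
      using simplex_map_sproj[OF M X entry_add_hom[OF X, where k = k] algebra_closed(3)[OF PM xc yc]] by simp
    also have "\<dots> = (\<Oplus>\<^bsub>simplex_alg X n\<^esub>l\<in>F. sproj n X (pmap (?e i l) x \<otimes>\<^bsub>sP n X\<^esub> pmap (?e l j) y))"
      unfolding col_boundD(2)[OF F0 yc F]
      by (rule add_hom_finsum[OF alg_hom_add_hom[OF q] PX simplex_algebra[OF X]])
        (rule funcsetI algebra_closed(3)[OF PX add_hom_closed[OF e] add_hom_closed[OF e]] xc yc)+
    also have "\<dots> = (\<Oplus>\<^bsub>simplex_alg X n\<^esub>l\<in>F. simplex_map n X (?e i l) x \<otimes>\<^bsub>simplex_alg X n\<^esub> simplex_map n X (?e l j) y)"
      unfolding simplex_map_eq alg_homD(2)[OF q add_hom_closed[OF e xc] add_hom_closed[OF e yc]] ..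
    finally show "simplex_map n X (?e i j) (x \<otimes>\<^bsub>simplex_alg ?M n\<^esub> y) = \<dots>" .
  qed
  then show ?thesis by (rule exI)
qed

lemma simplex_map_act_scalar:
  assumes A: "is_algebra A" and h: "h \<in> carrier H" and x: "x \<in> carrier (simplex_alg A n)"
  shows "simplex_map n A (lact A h) x = lact (simplex_alg A n) h x" "simplex_map n A (\<lambda>a. ract A a h) x = ract (simplex_alg A n) x h"
proof -
  note x' = simplex_sub[OF A x]
  have "pmap (lact A h) x = lact (sP n A) h x" "pmap (\<lambda>a. ract A a h) x = ract (sP n A) x h" by (simp_all add: pmap_def poly_ops)
  then show "simplex_map n A (lact A h) x = lact (simplex_alg A n) h x" "simplex_map n A (\<lambda>a. ract A a h) x = ract (simplex_alg A n) x h"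
    using alg_homD(3,4)[OF sproj_hom[OF A] x' h] by (simp_all add: simplex_map_eq sproj_id[OF A x])
qed

lemma act_add_hom:
  "is_algebra A \<Longrightarrow> h \<in> carrier H \<Longrightarrow> lact A h \<in> add_hom A A" "is_algebra A \<Longrightarrow> h \<in> carrier H \<Longrightarrow> (\<lambda>a. ract A a h) \<in> add_hom A A"
  by (auto simp: add_hom_def algebra_lact_add algebra_ract_add)

lemma push_act_scalar:
  assumes A: "is_algebra A" and h: "h \<in> carrier H" and x: "x \<in> carrier (pmap_alg K A)"
  shows "push K A (lact A h) x = lact (pmap_alg K A) h x" "push K A (\<lambda>a. ract A a h) x = ract (pmap_alg K A) x h"
  unfolding push_def pmap_ops
  using simplex_map_act_scalar[OF A h pmap_simp(1)[OF x]] by (auto intro!: restrict_ext)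

text \<open>The exchange of mapping algebras and matrices, of which \<open>loops_mat\<close> is the iterate over several loop
  coordinates.\<close>

definition kmat :: "sset \<Rightarrow> ('h, 'a) ualg \<Rightarrow> ('h, 'a) univ \<Rightarrow> ('h, 'a) univ" where
  "kmat K X x = Mtx (\<lambda>i j. push K X (\<lambda>m. entry m i j) x)"

text \<open>The values on finitely many generating simplices have finitely many coefficients, each a finite matrix;
  so almost all entries are zero.\<close>

lemma kmat_closed:
  assumes K: "sset_ok K" and X: "is_algebra X" and x: "x \<in> carrier (pmap_alg K (mat_alg k X))"
  shows "kmat K X x \<in> carrier (mat_alg k (pmap_alg K X))"
proof -
  let ?M = "mat_alg k X" and ?e = "\<lambda>i j m. entry m i j"
  note M = mat_algebra[OF X, of k] and e = entry_add_hom[OF X, of _ _ k]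
  note pc = push_closed[OF K M X e x] and P = pmap_alg_algebra[OF K X]
  obtain G where G: "G \<subseteq> cells K" "finite G" "\<forall>z\<in>cells K. \<exists>g\<in>G. \<exists>\<theta>\<in>opers (fst z) (fst g). snd z = sact K \<theta> (snd g)"
    using K unfolding sset_ok_def by blast
  let ?S = "\<Union>g\<in>G. \<Union>d\<in>{d. coef (sval x g) d \<noteq> \<zero>\<^bsub>?M\<^esub>}. {p. ment (coef (sval x g) d) p \<noteq> \<zero>\<^bsub>X\<^esub>}"
  have xg: "sval x g \<in> carrier (sP (fst g) ?M)" if "g \<in> G" for g using pmap_simp(1)[OF x] G(1) that simplex_sub[OF M] by blast
  have finS: "finite ?S"
  proof (intro finite_UN_I[OF G(2)] finite_UN_I)
    fix g d assume g: "g \<in> G"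
    show "finite {d. coef (sval x g) d \<noteq> \<zero>\<^bsub>?M\<^esub>}" using xg[OF g] by (simp add: poly_carrier fsa_simps)
    have "coef (sval x g) d \<in> carrier ?M" using xg[OF g] by (simp add: poly_carrier fsa_simps)
    then show "finite {p. ment (coef (sval x g) d) p \<noteq> \<zero>\<^bsub>X\<^esub>}" by (simp add: mat_carrier fsa_simps)
  qed
  have van: "push K X (?e i j) x = \<zero>\<^bsub>pmap_alg K X\<^esub>" if v: "\<And>g d. g \<in> G \<Longrightarrow> entry (coef (sval x g) d) i j = \<zero>\<^bsub>X\<^esub>" for i j
  proof (rule pmap_eqI_generators[OF G(3,1) pc])
    fix g assume g: "g \<in> G"
    then have z: "g \<in> cells K" using G(1) by blast
    have "pmap (?e i j) (sval x g) = \<zero>\<^bsub>sP (fst g) X\<^esub>" using v[OF g] by (simp add: pmap_def poly_ops)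
    then have "simplex_map (fst g) X (?e i j) (sval x g) = \<zero>\<^bsub>simplex_alg X (fst g)\<^esub>"
      using add_hom_zero[OF alg_hom_add_hom[OF sproj_hom[OF X]] poly_algebra[OF X] simplex_algebra[OF X]] by (simp add: simplex_map_eq)
    then show "sval (push K X (?e i j) x) g = sval \<zero>\<^bsub>pmap_alg K X\<^esub> g" using z by (simp add: sval_push pmap_ops)
  qed (simp add: P)
  have "(i, j) \<in> ?S" if ne: "push K X (?e i j) x \<noteq> \<zero>\<^bsub>pmap_alg K X\<^esub>" for i j
  proof (rule ccontr, rule notE[OF ne], rule van)
    fix g d assume "(i, j) \<notin> ?S" "g \<in> G"
    then show "entry (coef (sval x g) d) i j = \<zero>\<^bsub>X\<^esub>" by (cases "coef (sval x g) d = \<zero>\<^bsub>?M\<^esub>") (auto simp: ment_def mat_ops)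
  qed
  then have sub: "{p. ment (kmat K X x) p \<noteq> \<zero>\<^bsub>pmap_alg K X\<^esub>} \<subseteq> ?S" by (simp add: ment_def kmat_def subset_iff split_paired_All)
  have fin: "finite {p. ment (kmat K X x) p \<noteq> \<zero>\<^bsub>pmap_alg K X\<^esub>}" by (rule finite_subset[OF sub finS])
  show ?thesis unfolding kmat_def
  proof (rule mat_memI)
    show "ment (Mtx (\<lambda>i j. push K X (?e i j) x)) \<in> carrier (fsa mat_op (pmap_alg K X))"
      using fin pc unfolding fsa_simps kmat_def by (auto simp: ment_def)
    fix i j assume "push K X (?e i j) x \<noteq> \<zero>\<^bsub>pmap_alg K X\<^esub>"
    then obtain g d where gd: "g \<in> G" "entry (coef (sval x g) d) i j \<noteq> \<zero>\<^bsub>X\<^esub>" using van[of i j] by blast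
    have "coef (sval x g) d \<in> carrier ?M" using xg[OF gd(1)] by (simp add: poly_carrier fsa_simps)
    then show "fst i < k \<and> fst j < k" using mat_bound gd(2) by blast
  qed
qed

text \<open>On the finitely many generating simplices one finite set of columns computes all entries of the product.\<close>

lemma kmat_mult:
  assumes K: "sset_ok K" and X: "is_algebra X" and x: "x \<in> carrier (pmap_alg K (mat_alg k X))" and y: "y \<in> carrier (pmap_alg K (mat_alg k X))"
  shows "kmat K X (x \<otimes>\<^bsub>pmap_alg K (mat_alg k X)\<^esub> y) = kmat K X x \<otimes>\<^bsub>mat_alg k (pmap_alg K X)\<^esub> kmat K X y"
proof -
  let ?M = "mat_alg k X" and ?e = "\<lambda>i j m. entry m i j"
  note M = mat_algebra[OF X, of k] and e = entry_add_hom[OF X, of _ _ k]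
  note pc = push_closed[OF K M X e] and P = pmap_alg_algebra[OF K X] and PM = pmap_alg_algebra[OF K M]
  note xy = algebra_closed(3)[OF PM x y]
  obtain G where G: "G \<subseteq> cells K" "finite G" "\<forall>z\<in>cells K. \<exists>g\<in>G. \<exists>\<theta>\<in>opers (fst z) (fst g). snd z = sact K \<theta> (snd g)"
    using K unfolding sset_ok_def by blast
  let ?Q = "\<lambda>g. col_bound (simplex_alg ?M (fst g)) (simplex_alg X (fst g)) (\<lambda>i j. simplex_map (fst g) X (?e i j)) (sval x g)"
  have "\<forall>g\<in>G. \<exists>F0. ?Q g F0" using simplex_entry_mult[OF X pmap_simp(1)[OF x]] G(1) by blast
  from bchoice[OF this] obtain F0 where F0: "\<forall>g\<in>G. ?Q g (F0 g)" by blast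
  let ?C = "{l. \<exists>i. entry (kmat K X x) i l \<noteq> \<zero>\<^bsub>pmap_alg K X\<^esub>}"
  define F where "F = \<Union>(F0 ` G) \<union> ?C"
  have F: "finite F" unfolding F_def
    by (intro finite_UnI finite_UN_I G(2) mat_columns_finite[OF kmat_closed[OF K X x]]) (rule col_boundD(1)[OF bspec[OF F0]])
  have Fg: "F0 g \<subseteq> F" if "g \<in> G" for g using that by (auto simp: F_def)
  note m = algebra_closed(3)[OF P pc[OF x] pc[OF y]]
  interpret PG: abelian_group "pmap_alg K X" using P by (rule algebra_abelian_group)
  have eq: "push K X (?e i j) (x \<otimes>\<^bsub>pmap_alg K ?M\<^esub> y) = (\<Oplus>\<^bsub>pmap_alg K X\<^esub>l\<in>F. push K X (?e i l) x \<otimes>\<^bsub>pmap_alg K X\<^esub> push K X (?e l j) y)" for i j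
  proof (rule pmap_eqI_generators[OF G(3,1) pc[OF xy]])
    show "(\<Oplus>\<^bsub>pmap_alg K X\<^esub>l\<in>F. push K X (?e i l) x \<otimes>\<^bsub>pmap_alg K X\<^esub> push K X (?e l j) y) \<in> carrier (pmap_alg K X)"
      by (rule PG.finsum_closed) (use m in auto)
    fix g assume g: "g \<in> G"
    then have z: "g \<in> cells K" using G(1) by blast
    note sX = sval_hom[OF K X z] and sM = sval_hom[OF K M z]
    have "sval (push K X (?e i j) (x \<otimes>\<^bsub>pmap_alg K ?M\<^esub> y)) g = simplex_map (fst g) X (?e i j) (sval x g \<otimes>\<^bsub>simplex_alg ?M (fst g)\<^esub> sval y g)"
      using alg_homD(2)[OF sM x y] by (simp add: sval_push z)
    also have "\<dots> = (\<Oplus>\<^bsub>simplex_alg X (fst g)\<^esub>l\<in>F. simplex_map (fst g) X (?e i l) (sval x g) \<otimes>\<^bsub>simplex_alg X (fst g)\<^esub> simplex_map (fst g) X (?e l j) (sval y g))"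
      by (rule col_boundD(2)[OF bspec[OF F0 g] pmap_simp(1)[OF y z] F Fg[OF g]])
    also have "\<dots> = (\<Oplus>\<^bsub>simplex_alg X (fst g)\<^esub>l\<in>F. sval (push K X (?e i l) x \<otimes>\<^bsub>pmap_alg K X\<^esub> push K X (?e l j) y) g)"
      using alg_homD(2)[OF sX pc[OF x] pc[OF y]] by (simp add: sval_push z)
    also have "\<dots> = sval (\<Oplus>\<^bsub>pmap_alg K X\<^esub>l\<in>F. push K X (?e i l) x \<otimes>\<^bsub>pmap_alg K X\<^esub> push K X (?e l j) y) g"
      by (rule add_hom_finsum[OF alg_hom_add_hom[OF sX] P simplex_algebra[OF X], symmetric]) (use m in auto)
    finally show "sval (push K X (?e i j) (x \<otimes>\<^bsub>pmap_alg K ?M\<^esub> y)) g = \<dots>" .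
  qed
  note kx = kmat_closed[OF K X x] and ky = kmat_closed[OF K X y]
  show ?thesis
  proof (rule mat_eqI[OF kmat_closed[OF K X xy] algebra_closed(3)[OF mat_algebra[OF P] kx ky]])
    have "entry (kmat K X x \<otimes>\<^bsub>mat_alg k (pmap_alg K X)\<^esub> kmat K X y) i j =
      (\<Oplus>\<^bsub>pmap_alg K X\<^esub>l\<in>F. entry (kmat K X x) i l \<otimes>\<^bsub>pmap_alg K X\<^esub> entry (kmat K X y) l j)" for i j
      by (rule mat_mult_entry[OF P kx ky F]) (simp add: F_def)
    then show "entry (kmat K X (x \<otimes>\<^bsub>pmap_alg K ?M\<^esub> y)) i j = entry (kmat K X x \<otimes>\<^bsub>mat_alg k (pmap_alg K X)\<^esub> kmat K X y) i j" for i j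
      using eq[of i j] by (simp add: kmat_def)
  qed
qed

lemma kmat_hom:
  assumes K: "sset_ok K" and X: "is_algebra X"
  shows "kmat K X \<in> alg_hom (pmap_alg K (mat_alg k X)) (mat_alg k (pmap_alg K X))"
proof -
  let ?M = "mat_alg k X" and ?e = "\<lambda>i j m. entry m i j"
  note M = mat_algebra[OF X, of k] and e = entry_add_hom[OF X, of _ _ k]
  note pc = push_closed[OF K M X e] and pa = add_hom_add[OF push_add_hom[OF K M X e]]
  have l: "push K X (?e i j) (lact (pmap_alg K ?M) h x) = lact (pmap_alg K X) h (push K X (?e i j) x)"
    "push K X (?e i j) (ract (pmap_alg K ?M) x h) = ract (pmap_alg K X) (push K X (?e i j) x) h"
    if h: "h \<in> carrier H" and x: "x \<in> carrier (pmap_alg K ?M)" for h x i j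
    unfolding push_act_scalar[OF M h x, symmetric] push_act_scalar[OF X h pc[OF x], symmetric]
      push_comp[OF M M X act_add_hom(1)[OF M h] e x] push_comp[OF M M X act_add_hom(2)[OF M h] e x]
      push_comp[OF M X X e act_add_hom(1)[OF X h] x] push_comp[OF M X X e act_add_hom(2)[OF X h] x]
    by (simp_all add: comp_def mat_ops)
  show ?thesis unfolding alg_hom_def mem_Collect_eq
    by (intro conjI ballI funcsetI kmat_closed[OF K X] kmat_mult[OF K X])
      (simp_all add: kmat_def mat_ops pa l)
qed

lemma loops_mat_hom_entry:
  assumes X: "is_algebra X"
  shows loops_mat_hom: "loops_mat ps X \<in> alg_hom (iloops ps (mat_alg k X)) (mat_alg k (iloops ps X))"
proof (induction ps)
  case Nil
  have "x = loops_mat [] X x" if "x \<in> carrier (mat_alg k X)" for x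
    using that by (auto simp: mat_carrier loops_mat_def)
  then show ?case unfolding iloops.simps using alg_hom_cong[OF alg_hom_id, of "mat_alg k X" "loops_mat [] X"] mat_algebra[OF X] by simp
next
  case (Cons p ps)
  let ?K = "sd_circle p" and ?M = "mat_alg k X" and ?e = "\<lambda>i j m. entry m i j"
  note K = sd_circle_ok[of p] and M = mat_algebra[OF X, of k]
  note I = iloops_algebra[OF X, of ps] and IM = iloops_algebra[OF mat_algebra[OF X, of k], of ps]
  note h = loops_map_hom[OF IM mat_algebra[OF I] Cons.IH, of p]
  have "kmat ?K (iloops ps X) \<circ> loops_map p (mat_alg k (iloops ps X)) (loops_mat ps X)
      \<in> alg_hom (loops p (iloops ps ?M)) (mat_alg k (loops p (iloops ps X)))"
    by (rule alg_hom_comp[OF h]) (unfold loops_def, rule kmat_hom[OF K I])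
  moreover have "(kmat ?K (iloops ps X) \<circ> loops_map p (mat_alg k (iloops ps X)) (loops_mat ps X)) x = loops_mat (p # ps) X x"
    if x: "x \<in> carrier (loops p (iloops ps ?M))" for x
  proof -
    have "push ?K (iloops ps X) (?e i j) (push ?K (mat_alg k (iloops ps X)) (loops_mat ps X) x) = push ?K (iloops ps X) (?e i j \<circ> loops_mat ps X) x" for i j
      by (rule push_comp[OF IM mat_algebra[OF I] I alg_hom_add_hom[OF Cons.IH] entry_add_hom[OF I]]) (use x in \<open>simp add: loops_def\<close>)
    then show ?thesis by (simp add: kmat_def loops_mat_def loops_map_def comp_def)
  qed
  ultimately show ?case unfolding iloops.simps using alg_hom_cong loops_algebra[OF IM] by blast
qed

end

section \<open>Polynomial loops as simplicial loops\<close>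

context kk_setting
begin

text \<open>A polynomial in \<open>t = t\<^sub>0\<close> as an element of \<open>A\<^sup>\<Delta>\<close> in degree 1, where \<open>t = t\<^sub>1\<close>.\<close>

definition to_edge :: "('h, 'a) ualg \<Rightarrow> ('h, 'a) univ \<Rightarrow> ('h, 'a) univ" where
  "to_edge A p = sproj 1 A (tensor_map A (subst_mono (\<lambda>_. zvar 1)) p)"

lemma subst_const_hom:
  assumes A: "is_algebra A" and q: "vars_in V q"
  shows "tensor_map A (subst_mono (\<lambda>_. q)) \<in> alg_hom (poly1 A) (poly_alg V A)"
  unfolding poly1_def by (rule tensor_map_alg_hom[OF A vars_in_subst_mono]) (use q in \<open>auto simp: subst_mono_add\<close>)

lemma to_edge_hom: assumes A: "is_algebra A" shows "to_edge A \<in> alg_hom (poly1 A) (simplex_alg A 1)"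
proof -
  have "vars_in {..1} (zvar 1)" by simp
  from alg_hom_comp[OF subst_const_hom[OF A this] sproj_hom[OF A]] show ?thesis unfolding to_edge_def comp_def .
qed

lemma poly1_closed: "p \<in> carrier (poly1 A) \<longleftrightarrow> p \<in> carrier (poly_alg {0} A)"
  by (simp add: poly1_def)

lemma subst_const_comp:
  assumes A: "is_algebra A" and p: "p \<in> carrier (poly1 A)" and q: "vars_in V q" and w: "\<And>i. i \<in> V \<Longrightarrow> vars_in W (w i)"
  shows "tensor_map A (subst_mono w) (tensor_map A (subst_mono (\<lambda>_. q)) p) = tensor_map A (subst_mono (\<lambda>_. subst w q)) p"
  by (rule tensor_map_comp[OF A vars_in_subst_mono vars_in_subst_mono p[unfolded poly1_closed]])
    (use q w in \<open>auto simp: subst_subst_mono\<close>)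

lemma subst_int:
  assumes A: "is_algebra A" and p: "p \<in> carrier (poly1 A)"
  shows "tensor_map A (subst_mono (\<lambda>_. of_int c)) p = zsc A 1 (ev A c p)"
proof -
  have z: "vars_in {0} (of_int c)" by (induction c rule: int_induct[where k = 0]) (simp_all add: vars_in_add vars_in_diff)
  note T = subst_const_hom[OF A z]
  show ?thesis
  proof (rule poly_add_hom_eqI[OF A _ _ _ p[unfolded poly1_closed]])
    show "tensor_map A (subst_mono (\<lambda>_. of_int c)) \<in> add_hom (poly_alg {0} A) (poly1 A)"
      using alg_hom_add_hom[OF T] by (simp add: poly1_def)
    show "(\<lambda>p. zsc A 1 (ev A c p)) \<in> add_hom (poly_alg {0} A) (poly1 A)"
      using alg_hom_add_hom[OF alg_hom_comp[OF ev_hom(1)[OF A] zsc_one_alg_hom[OF A]]] by (simp add: comp_def)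
    fix e a assume e: "expn e \<subseteq> {0 :: nat}" "a \<in> carrier A"
    have "subst_mono (\<lambda>_. of_int c) e = (\<Prod>i\<in>{0}. of_int c ^ Poly_Mapping.lookup e i)"
      by (rule subst_mono_superset[OF _ e(1)]) simp
    then have s: "subst_mono (\<lambda>_. of_int c) e = (of_int (c ^ Poly_Mapping.lookup e 0) :: zpoly)" by simp
    have l: "Poly_Mapping.lookup (of_int m :: zpoly) f = (if f = 0 then m else 0)" for m f
      by (simp add: lookup_of_int when_def)
    have "tensor_map A (subst_mono (\<lambda>_. of_int c)) (pmono A e a) = zsc A (subst_mono (\<lambda>_. of_int c) e) a"
      by (rule tensor_map_bimod_hom(2)[OF A, of "{0}" "{0}"]) (use e z in \<open>auto intro: vars_in_subst_mono\<close>)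
    also have "\<dots> = zsc A 1 (zmul A (c ^ Poly_Mapping.lookup e 0) a)"
      unfolding s zsc_def l using A e(2) by (auto simp: lookup_one when_def)
    finally show "tensor_map A (subst_mono (\<lambda>_. of_int c)) (pmono A e a) = zsc A 1 (ev A c (pmono A e a))"
      by (simp add: ev_hom(2)[OF A e(2)])
  qed
qed

lemma to_edge_ends:
  assumes A: "is_algebra A" and p: "p \<in> carrier (poly1 A)"
  shows "ev A 0 p = \<zero>\<^bsub>A\<^esub> \<Longrightarrow> simplex_act A [0] (to_edge A p) = \<zero>\<^bsub>simplex_alg A 0\<^esub>"
    and "ev A 1 p = \<zero>\<^bsub>A\<^esub> \<Longrightarrow> simplex_act A [1] (to_edge A p) = \<zero>\<^bsub>simplex_alg A 0\<^esub>"
proof -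
  have z1: "vars_in {..1} (zvar 1)" by simp
  note P0 = poly_algebra[OF A, of "{..0}"]
  have zA: "zsc A 1 \<zero>\<^bsub>A\<^esub> = \<zero>\<^bsub>sP 0 A\<^esub>" by (rule zsc_zero_right[OF A])
  note s0 = add_hom_zero[OF alg_hom_add_hom[OF sproj_hom[OF A, of 0]] P0 simplex_algebra[OF A]]
  have act: "simplex_act A [v] (to_edge A p) = sproj 0 A (tensor_map A (subst_mono (\<lambda>_. act_var [v] 1)) p)" if v: "v \<le> 1" for v
  proof -
    have t: "[v] \<in> opers 0 1" using v by (simp add: opers_def)
    have zv: "vars_in {..0} (act_var [v] i)" for i by (rule vars_in_act_var) simp
    show ?thesis unfolding to_edge_def simplex_act_sproj[OF A t alg_hom_closed[OF subst_const_hom[OF A z1] p]]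
        subst_const_comp[OF A p z1 zv] by simp
  qed
  have "{j. j < length [0 :: nat] \<and> [0] ! j = (1 :: nat)} = {}" by auto
  then have v0: "act_var [0] 1 = of_int 0" unfolding act_var_def by (simp only: sum.empty of_int_0)
  have "{j. j < length [1 :: nat] \<and> [1] ! j = (1 :: nat)} = {0}" by auto
  then have v1: "act_var [1] 1 = zvar 0" unfolding act_var_def by (simp only:) simp
  show "simplex_act A [0] (to_edge A p) = \<zero>\<^bsub>simplex_alg A 0\<^esub>" if "ev A 0 p = \<zero>\<^bsub>A\<^esub>"
    using act[of 0] unfolding v0 subst_int[OF A p] that zA s0 by simp
  show "simplex_act A [1] (to_edge A p) = \<zero>\<^bsub>simplex_alg A 0\<^esub>" if e: "ev A 1 p = \<zero>\<^bsub>A\<^esub>"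
  proof -
    let ?q = "tensor_map A (subst_mono (\<lambda>_. zvar 0)) p"
    have z0: "vars_in {..0 :: nat} (zvar 0)" by simp
    have q: "?q \<in> carrier (sP 0 A)" by (rule alg_hom_closed[OF subst_const_hom[OF A z0] p])
    have "subst (elim0 0) (zvar 0) = of_int 1" by (simp add: elim0_def rel_poly_def)
    then have "nf 0 A ?q = \<zero>\<^bsub>sP 0 A\<^esub>"
      unfolding nf_def using subst_const_comp[OF A p z0, of "{..0}" "elim0 0"] subst_int[OF A p, of 1] e zA by simp
    then have "nf 0 A ?q = nf 0 A \<zero>\<^bsub>sP 0 A\<^esub>" using add_hom_zero[OF alg_hom_add_hom[OF nf_hom[OF A]] P0 P0] by simp
    then have "sproj 0 A ?q = sproj 0 A \<zero>\<^bsub>sP 0 A\<^esub>" by (rule sproj_eq[OF A q algebra_closed(1)[OF P0]])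
    then show ?thesis using act[of 1] unfolding v1 s0 by simp
  qed
qed

lemma opers_const:
  assumes v: "v \<in> opers n 1" "set v \<noteq> {0, 1}"
  obtains c where "c \<le> 1" "v = map (\<lambda>i. [c] ! i) (replicate (Suc n) 0)"
proof -
  have l: "length v = Suc n" using v(1) by (simp add: opers_def)
  have a: "set v \<subseteq> {0, 1}" using opers_set[OF v(1)] by (fastforce simp: le_Suc_eq)
  have b: "set v \<noteq> {}" using l by auto
  have c: "S = {0} \<or> S = {1}" if "S \<subseteq> {0, 1 :: nat}" "S \<noteq> {}" "S \<noteq> {0, 1}" for S using that by blast
  have "set v = {0} \<or> set v = {1}" by (rule c[OF a b v(2)])
  then obtain c where c: "c \<le> 1" "set v = {c}" by auto
  then have "v = replicate (Suc n) c" using l by (metis replicate_eqI singletonD)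
  then show ?thesis using that c(1) by (simp add: map_replicate)
qed

text \<open>The edge given by a loop is zero on the boundary, so it descends to the circle.\<close>

lemma to_edge_collapse:
  assumes A: "is_algebra A" and p: "p \<in> carrier (Om A)" and v: "v \<in> opers n 1"
  shows "simplex_act A (verts (collapse (Smplx v))) (to_edge A p) = simplex_act A v (to_edge A p)"
proof (cases "set v = {0, 1}")
  case False
  have p1: "p \<in> carrier (poly1 A)" "ev A 0 p = \<zero>\<^bsub>A\<^esub>" "ev A 1 p = \<zero>\<^bsub>A\<^esub>" using p by (auto simp: Om_carrier)
  have e: "to_edge A p \<in> carrier (simplex_alg A 1)" by (rule alg_hom_closed[OF to_edge_hom[OF A] p1(1)])
  have r: "replicate (Suc n) 0 \<in> opers n 0" by (simp add: opers_def set_replicate_conv_if)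
  note r0 = add_hom_zero[OF alg_hom_add_hom[OF simplex_act_hom[OF A r]] simplex_algebra[OF A] simplex_algebra[OF A]]
  have "simplex_act A (map (\<lambda>i. [c] ! i) (replicate (Suc n) 0)) (to_edge A p) = \<zero>\<^bsub>simplex_alg A n\<^esub>" if c: "c \<le> 1" for c
  proof -
    have t: "[c] \<in> opers 0 1" using c by (simp add: opers_def)
    have "simplex_act A [c] (to_edge A p) = \<zero>\<^bsub>simplex_alg A 0\<^esub>"
      using c to_edge_ends[OF A p1(1)] p1(2,3) by (auto simp: le_Suc_eq)
    then show ?thesis using simplex_act_comp[OF A t r e] r0 by simp
  qed
  note z = this
  obtain c where c: "c \<le> 1" "v = map (\<lambda>i. [c] ! i) (replicate (Suc n) 0)" by (rule opers_const[OF v False])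
  have "verts (collapse (Smplx v)) = map (\<lambda>i. [0] ! i) (replicate (Suc n) 0)"
    using False opers_length[OF v] by (simp add: collapse_def map_replicate)
  then show ?thesis using z[of 0] z[OF c(1)] c(2) by simp
qed (simp add: collapse_def)

text \<open>For the interval this is a polynomial path as a simplicial map; for the circle, a polynomial loop.\<close>

definition line :: "sset \<Rightarrow> ('h, 'a) ualg \<Rightarrow> ('h, 'a) univ \<Rightarrow> ('h, 'a) univ" where
  "line K A p = SMap (\<lambda>z\<in>cells K. simplex_act A (verts (snd z)) (to_edge A p))"

definition Pth :: "('h, 'a) ualg \<Rightarrow> ('h, 'a) ualg" where
  "Pth A = (poly1 A)\<lparr>carrier := {p \<in> carrier (poly1 A). ev A 0 p = \<zero>\<^bsub>A\<^esub>}\<rparr>"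

lemma Pth_subalg: "is_algebra A \<Longrightarrow> subalg (Pth A) (poly1 A)"
  unfolding Pth_def by (rule kernel_subalg[OF poly1_algebra _ ev_alg_hom])

lemma line_hom:
  assumes A: "is_algebra A" and K: "sset_ok K" and S: "subalg S (poly1 A)"
    and v: "\<And>n c. c \<in> simp K n \<Longrightarrow> verts c \<in> opers n 1"
    and a: "\<And>m n \<theta> c p. p \<in> carrier S \<Longrightarrow> \<theta> \<in> opers m n \<Longrightarrow> c \<in> simp K n \<Longrightarrow>
      simplex_act A (verts (sact K \<theta> c)) (to_edge A p) = simplex_act A (map (\<lambda>i. verts c ! i) \<theta>) (to_edge A p)"
    and pt: "verts (spt K) = [0]" and e: "\<And>p. p \<in> carrier S \<Longrightarrow> ev A 0 p = \<zero>\<^bsub>A\<^esub>"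
  shows "line K A \<in> alg_hom S (pmap_alg K A)"
proof (rule pmap_homI[OF _ _ K A])
  note t = alg_hom_restrict[OF S to_edge_hom[OF A]]
  show "line K A p \<in> carrier (pmap_alg K A)" if p: "p \<in> carrier S" for p
    unfolding line_def
  proof (rule pmapI[OF _ _ _ K])
    note ec = alg_hom_closed[OF t p]
    show "simplex_act A (verts (snd (n, c))) (to_edge A p) \<in> carrier (simplex_alg A n)" if "c \<in> simp K n" for n c
      using alg_hom_closed[OF simplex_act_hom[OF A v[OF that]] ec] by simp
    show "simplex_act A (verts (snd (m, sact K \<theta> c))) (to_edge A p) = simplex_act A \<theta> (simplex_act A (verts (snd (n, c))) (to_edge A p))"
      if "\<theta> \<in> opers m n" "c \<in> simp K n" for m n \<theta> c
      using a[OF p that] simplex_act_comp[OF A v[OF that(2)] that(1) ec] by simp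
    show "simplex_act A (verts (snd (0, spt K))) (to_edge A p) = \<zero>\<^bsub>simplex_alg A 0\<^esub>"
      using to_edge_ends(1)[OF A subalg_carrier[OF S p] e[OF p]] by (simp add: pt)
  qed
  show "(\<lambda>p. sval (line K A p) z) \<in> alg_hom S (simplex_alg A (fst z))" if z: "z \<in> cells K" for z
  proof -
    have "verts (snd z) \<in> opers (fst z) 1" using v z by (auto simp: cells_def)
    from alg_hom_comp[OF t simplex_act_hom[OF A this]] show ?thesis using z by (simp add: line_def comp_def)
  qed
qed (use S in \<open>simp add: subalg_def\<close>)

lemma path_line_hom: assumes A: "is_algebra A" shows "line interval A \<in> alg_hom (Pth A) (path_alg A)"
  unfolding path_alg_def by (rule line_hom[OF A interval_ok Pth_subalg[OF A]]) (auto simp: Pth_def)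

lemma sd_circle_0 [simp]: "sd_circle 0 = circle"
  by (simp add: sd_circle_def)

lemma circle_verts: assumes "c \<in> simp circle n" shows "verts c \<in> opers n 1"
proof -
  obtain v where v: "v \<in> opers n 1" "c = collapse (Smplx v)" using assms by (auto simp: circle_simps)
  have "replicate (length v) 0 \<in> opers n 1" using opers_length[OF v(1)] by (simp add: opers_def set_replicate_conv_if)
  then show ?thesis using v by (simp add: collapse_def)
qed

lemma loop_line_hom: assumes A: "is_algebra A" shows "line circle A \<in> alg_hom (Om A) (loops 0 A)"
  unfolding loops_def sd_circle_0
proof (rule line_hom[OF A circle_ok Om_subalg[OF A] circle_verts])
  fix m n \<theta> c p assume p: "p \<in> carrier (Om A)" and t: "\<theta> \<in> opers m n" and c: "c \<in> simp circle n"
  show "simplex_act A (verts (sact circle \<theta> c)) (to_edge A p) = simplex_act A (map (\<lambda>i. verts c ! i) \<theta>) (to_edge A p)"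
    using to_edge_collapse[OF A p opers_comp[OF circle_verts[OF c] t]] by (simp add: circle_simps)
qed (auto simp: Om_carrier circle_simps collapse_def)

lemma loop_to_path_hom: "is_algebra A \<Longrightarrow> loop_to_path \<in> alg_hom (loops 0 A) (path_alg A)"
  unfolding loop_to_path_def loops_def path_alg_def sd_circle_0 by (rule pull_hom[OF interval_ok circle_ok collapse_smap])

lemma sval_loop_to_path: "c \<in> simp interval n \<Longrightarrow> sval (loop_to_path x) (n, c) = sval x (n, collapse c)"
  by (auto simp: loop_to_path_def pull_def cells_def simp del: interval_simps)

lemma loop_to_path_inj:
  fixes A :: "('h, 'a) ualg" shows "inj_on loop_to_path (carrier (loops 0 A))"
proof (rule inj_onI)
  fix x y assume x: "x \<in> carrier (loops 0 A)" and y: "y \<in> carrier (loops 0 A)" and eq: "loop_to_path x = loop_to_path y"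
  show "x = y"
  proof (rule pmap_eqI[OF x[unfolded loops_def] y[unfolded loops_def]])
    fix z assume "z \<in> cells (sd_circle 0)"
    then obtain c where "c \<in> simp interval (fst z)" "z = (fst z, collapse c)"
      unfolding sd_circle_0 cells_def circle_simps by (metis (no_types, lifting) imageE mem_Sigma_iff prod.collapse)
    then show "sval x z = sval y z" using sval_loop_to_path[of c "fst z"] eq by metis
  qed
qed

lemma loop_to_path_line:
  assumes A: "is_algebra A" and p: "p \<in> carrier (Om A)"
  shows "loop_to_path (line circle A p) = line interval A p"
proof (rule pmap_eqI)
  have "p \<in> carrier (Pth A)" using p by (simp add: Om_carrier Pth_def)
  from alg_hom_closed[OF path_line_hom[OF A] this] show "line interval A p \<in> carrier (pmap_alg interval A)" by (simp add: path_alg_def)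
  from alg_hom_closed[OF loop_to_path_hom[OF A] alg_hom_closed[OF loop_line_hom[OF A] p]]
  show "loop_to_path (line circle A p) \<in> carrier (pmap_alg interval A)" by (simp add: path_alg_def)
  fix z assume z: "z \<in> cells interval"
  then obtain v where v: "v \<in> opers (fst z) 1" "snd z = Smplx v" by (auto simp: cells_def)
  have c: "collapse (Smplx v) \<in> simp circle (fst z)" using v(1) by (simp add: circle_simps)
  have "sval (loop_to_path (line circle A p)) (fst z, Smplx v) = sval (line circle A p) (fst z, collapse (Smplx v))"
    by (rule sval_loop_to_path) (use v in simp)
  also have "\<dots> = simplex_act A v (to_edge A p)" using c to_edge_collapse[OF A p v(1)] by (simp add: line_def cells_def)
  finally show "sval (loop_to_path (line circle A p)) z = sval (line interval A p) z"
    using z v(2) by (metis (no_types, lifting) cell.sel(1) line_def prod.collapse restrict_apply' univ.sel(3))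
qed

lemma linear_path_line:
  assumes A: "is_algebra A" and a: "a \<in> carrier A"
  shows "linear_path A a = line interval A (zsc A (\<tau> True) a)"
proof -
  have "tensor_map A (subst_mono (\<lambda>_. zvar 1)) (zsc A (zvar 0) a) = zsc A (subst (\<lambda>_. zvar 1) (zvar 0)) a"
    by (rule tensor_map_zsc[OF A a, of "{0}" _ "{..1}"]) (simp, rule vars_in_subst_mono, simp_all)
  also have "\<dots> = Poly (\<lambda>e. if e = Poly_Mapping.single 1 1 then a else \<zero>\<^bsub>A\<^esub>)"
    unfolding subst_zvar using A a by (auto simp: zsc_def zvar_def lookup_single when_def)
  finally show ?thesis unfolding linear_path_def line_def to_edge_def \<tau>_def by simp
qed

lemma zsc_Pth: "is_algebra A \<Longrightarrow> zsc A (\<tau> True) \<in> und_hom A (Pth A)"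
  by (rule und_hom_into_subalg[OF Pth_subalg zsc_poly1_und]) (simp_all add: Pth_def ev_zsc_tau)

lemma linear_path_und_hom: assumes A: "is_algebra A" shows "linear_path A \<in> und_hom A (path_alg A)"
proof -
  have "line interval A \<circ> zsc A (\<tau> True) \<in> und_hom A (path_alg A)"
    by (rule und_hom_comp[OF zsc_Pth[OF A] alg_hom_und_hom[OF path_line_hom[OF A]]])
  then show ?thesis using A unfolding und_hom_def by (simp add: linear_path_line Pi_iff)
qed

lemma path_algebra [simp]: "is_algebra A \<Longrightarrow> is_algebra (path_alg A)"
  unfolding path_alg_def by (rule pmap_alg_algebra[OF interval_ok])

lemma linear_path_zero: assumes A: "is_algebra A" shows "linear_path A \<zero>\<^bsub>A\<^esub> = \<zero>\<^bsub>path_alg A\<^esub>"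
  using add_hom_zero[OF alg_hom_add_hom[OF path_line_hom[OF A]]] Pth_subalg[OF A] A
  by (simp add: linear_path_line zsc_poly1_zero subalg_zero[OF Pth_subalg[OF A], symmetric]) (simp add: subalg_def)

lemma T_lift_linear_path:
  assumes A: "is_algebra A" and x: "x \<in> carrier (T A)"
  shows "T_lift (path_alg A) (linear_path A) x = line interval A (rho' True A x)"
proof -
  have P: "is_algebra (Pth A)" using Pth_subalg[OF A] by (simp add: subalg_def)
  have "line interval A (T_lift (Pth A) (zsc A (\<tau> True)) x) = T_lift (path_alg A) (line interval A \<circ> zsc A (\<tau> True)) x"
    by (rule T_lift_natural[OF A P path_algebra[OF A] zsc_Pth[OF A] path_line_hom[OF A] x])
  also have "\<dots> = T_lift (path_alg A) (linear_path A) x"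
    by (rule T_lift_cong[OF A path_algebra[OF A] linear_path_und_hom[OF A] _ _ x])
      (use und_hom_comp[OF zsc_Pth[OF A] alg_hom_und_hom[OF path_line_hom[OF A]]] A in \<open>simp_all add: linear_path_line\<close>)
  finally show ?thesis unfolding rho'_def T_lift_subalg[OF Pth_subalg[OF A] A zsc_Pth[OF A] x] by simp
qed

text \<open>The classifying map of the path extension is the polynomial one followed by the comparison of
  polynomial and simplicial loops.\<close>

lemma rho_line:
  assumes A: "is_algebra A" and x: "x \<in> carrier (J A)" shows "rho A x = line circle A (rho' True A x)"
proof -
  have p: "rho' True A x \<in> carrier (Om A)" by (rule alg_hom_closed[OF rho'_hom[OF A] x])
  have "T_lift (path_alg A) (linear_path A) x = loop_to_path (line circle A (rho' True A x))"
    unfolding T_lift_linear_path[OF A subalg_carrier[OF J_subalg[OF A] x]] loop_to_path_line[OF A p] ..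
  then show ?thesis unfolding rho_def classifying_map_def
    using inv_into_f_f[OF loop_to_path_inj alg_hom_closed[OF loop_line_hom[OF A] p]] by simp
qed

lemma rho_hom: assumes A: "is_algebra A" shows "rho A \<in> alg_hom (J A) (loops 0 A)"
  by (rule alg_hom_cong[OF alg_hom_comp[OF rho'_hom[OF A] loop_line_hom[OF A]] _ J_algebra[OF A]]) (simp add: rho_line[OF A])

lemma loop_to_path_rho:
  assumes A: "is_algebra A" and x: "x \<in> carrier (J A)"
  shows "loop_to_path (rho A x) = T_lift (path_alg A) (linear_path A) x"
  unfolding rho_line[OF A x] loop_to_path_line[OF A alg_hom_closed[OF rho'_hom[OF A] x]]
    T_lift_linear_path[OF A subalg_carrier[OF J_subalg[OF A] x]] ..

lemma push_linear_path:
  assumes A: "is_algebra A" and B: "is_algebra B" and f: "f \<in> add_hom A B" and a: "a \<in> carrier A"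
  shows "push interval B f (linear_path A a) = linear_path B (f a)"
proof -
  let ?m = "Poly_Mapping.single 1 1 :: nat \<Rightarrow>\<^sub>0 nat"
  have e: "expn ?m \<subseteq> {..1}" by simp
  have lp: "linear_path C c = SMap (\<lambda>z\<in>cells interval. simplex_act C (verts (snd z)) (sproj 1 C (pmono C ?m c)))" for C :: "('h, 'a) ualg" and c
    by (simp add: linear_path_def pmono_def fmono_def)
  have p: "pmono A ?m a \<in> carrier (sP 1 A)" by (rule pmono_closed[OF A a e])
  have "simplex_map (fst z) B f (simplex_act A (verts (snd z)) (sproj 1 A (pmono A ?m a))) = simplex_act B (verts (snd z)) (sproj 1 B (pmono B ?m (f a)))"
    if "z \<in> cells interval" for z
  proof -
    have v: "verts (snd z) \<in> opers (fst z) 1" using that by (auto simp: cells_def)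
    show ?thesis unfolding simplex_map_act[OF A B f v sproj_closed[OF A p]] simplex_map_sproj[OF A B f p]
        pmap_pmono[of f A B, OF add_hom_zero[OF f A B]] ..
  qed
  then show ?thesis unfolding lp push_def by (intro arg_cong[where f = SMap] restrict_ext) simp
qed

text \<open>Applied to the entries, \<open>sig\<close> preserves finite support, unlike \<open>T_unit\<close>, which need not send zero to zero.\<close>

definition mat_gamma :: "nat \<Rightarrow> ('h, 'a) ualg \<Rightarrow> ('h, 'a) univ \<Rightarrow> ('h, 'a) univ" where
  "mat_gamma k A = classifying_map (mat_alg k (J A)) id (mat_alg k (T A)) (mat_map (sig A))"

lemma mat_sig_section:
  assumes A: "is_algebra A"
  shows "mat_map (sig A) \<in> sections (mat_alg k (T A)) (mat_alg k A) (mat_map (counit A))"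
proof -
  have u: "mat_map (sig A) \<in> und_hom (mat_alg k A) (mat_alg k (T A))" by (rule mat_map_und_hom[OF sig_und_hom[OF A] sig_zero[OF A]])
  moreover have "mat_map (counit A) (mat_map (sig A) c) = c" if c: "c \<in> carrier (mat_alg k A)" for c
  proof (rule mat_eqI[OF _ c])
    show "mat_map (counit A) (mat_map (sig A) c) \<in> carrier (mat_alg k A)"
      by (rule alg_hom_closed[OF mat_map_alg_hom[OF T_algebra A counit_hom[OF A]] und_hom_closed[OF u c]])
  qed (simp add: counit_sig[OF A] entry_closed[OF c])
  ultimately show ?thesis by (simp add: sections_def)
qed

lemma mat_gamma_mem: "is_algebra A \<Longrightarrow> mat_gamma k A \<in> mat_J k A"
  unfolding mat_J_def classifying_maps_def mat_gamma_def by (rule imageI[OF mat_sig_section])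

lemma mat_gamma_eq:
  assumes A: "is_algebra A" and y: "y \<in> carrier (J (mat_alg k A))"
  shows "mat_gamma k A y = T_lift (mat_alg k (T A)) (mat_map (sig A)) y"
proof -
  note JA = J_algebra[OF A] and TA = T_algebra[of A]
  have i: "id \<in> alg_hom (mat_alg k (J A)) (mat_alg k (T A))" using mat_map_subalg[OF J_subalg[OF A]] by (simp add: subalg_def)
  show ?thesis unfolding mat_gamma_def
    using classifying_map(1)[OF mat_algebra[OF JA] mat_algebra[OF TA] mat_algebra[OF A] i inj_on_id
        mat_map_alg_hom[OF TA A counit_hom[OF A]] mat_J_kernel[OF A] mat_sig_section[OF A] y] by simp
qed

text \<open>Suspending a matrix-valued map amounts to the polynomial suspension over the matrix algebra.\<close>

lemma mat_rho_gamma: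
  assumes A: "is_algebra A" and y: "y \<in> carrier (J (mat_alg k A))"
  shows "mat_map (rho A) (mat_gamma k A y) = kmat circle A (line circle (mat_alg k A) (rho' True (mat_alg k A) y))"
proof -
  let ?M = "mat_alg k A" and ?e = "\<lambda>i j m. entry m i j" and ?l = "T_lift (path_alg A) (linear_path A)"
  note M = mat_algebra[OF A, of k] and PA = path_algebra[OF A] and TA = T_algebra[of A] and L = loops_algebra[OF A, of 0]
  note yT = subalg_carrier[OF J_subalg[OF M] y]
  have g: "mat_gamma k A y \<in> carrier (mat_alg k (J A))" by (rule alg_hom_closed[OF mat_J_hom[OF A mat_gamma_mem[OF A]] y])
  define p where "p = rho' True ?M y"
  have p: "p \<in> carrier (Om ?M)" unfolding p_def by (rule alg_hom_closed[OF rho'_hom[OF M] y])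
  have lp: "line circle ?M p \<in> carrier (pmap_alg circle ?M)"
    using alg_hom_closed[OF loop_line_hom[OF M] p] by (simp add: loops_def)
  have lh: "?l \<in> alg_hom (T A) (path_alg A)" by (rule T_lift_hom[OF PA linear_path_und_hom[OF A] A])
  note lu = mat_map_und_hom[OF linear_path_und_hom[OF A] linear_path_zero[OF A], of k]
  have su: "mat_map (sig A) \<in> und_hom ?M (mat_alg k (T A))" by (rule mat_map_und_hom[OF sig_und_hom[OF A] sig_zero[OF A]])
  have ls: "?l (sig A a) = linear_path A a" if a: "a \<in> carrier A" for a
    unfolding sig_def add_hom_diff[OF alg_hom_add_hom[OF lh] TA PA T_unit_closed[OF a] T_unit_closed[OF algebra_closed(1)[OF A]]]
      T_lift_unit[OF PA linear_path_und_hom[OF A] A a] T_lift_unit[OF PA linear_path_und_hom[OF A] A algebra_closed(1)[OF A]] linear_path_zero[OF A]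
    by (rule algebra_diff_zero[OF PA und_hom_closed[OF linear_path_und_hom[OF A] a]])
  have ms: "(mat_map ?l \<circ> mat_map (sig A)) m = mat_map (linear_path A) m" if m: "m \<in> carrier ?M" for m
    unfolding comp_apply mat_map_def using ls entry_closed[OF m] by simp
  have mk: "(kmat interval A \<circ> linear_path ?M) m = mat_map (linear_path A) m" if m: "m \<in> carrier ?M" for m
    unfolding comp_apply mat_map_def kmat_def push_linear_path[OF M A entry_add_hom[OF A] m] ..
  have k: "kmat interval A \<in> alg_hom (path_alg ?M) (mat_alg k (path_alg A))" unfolding path_alg_def by (rule kmat_hom[OF interval_ok A])
  have "mat_map loop_to_path (mat_map (rho A) (mat_gamma k A y)) = mat_map ?l (mat_gamma k A y)"
    unfolding mat_map_comp unfolding mat_map_def using loop_to_path_rho[OF A entry_closed[OF g]] by simp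
  also have "\<dots> = T_lift (mat_alg k (path_alg A)) (mat_map ?l \<circ> mat_map (sig A)) y"
    unfolding mat_gamma_eq[OF A y] by (rule T_lift_natural[OF M mat_algebra[OF TA] mat_algebra[OF PA] su mat_map_alg_hom[OF TA PA lh] yT])
  also have "\<dots> = T_lift (mat_alg k (path_alg A)) (mat_map (linear_path A)) y"
    by (rule T_lift_cong[OF M mat_algebra[OF PA] lu und_hom_comp[OF su alg_hom_und_hom[OF mat_map_alg_hom[OF TA PA lh]]] ms yT])
  also have "\<dots> = T_lift (mat_alg k (path_alg A)) (kmat interval A \<circ> linear_path ?M) y"
    by (rule T_lift_cong[OF M mat_algebra[OF PA] lu und_hom_comp[OF linear_path_und_hom[OF M] alg_hom_und_hom[OF k]] mk yT, symmetric])
  also have "\<dots> = kmat interval A (T_lift (path_alg ?M) (linear_path ?M) y)"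
    by (rule T_lift_natural[OF M path_algebra[OF M] mat_algebra[OF PA] linear_path_und_hom[OF M] k yT, symmetric])
  also have "\<dots> = kmat interval A (loop_to_path (line circle ?M p))"
    unfolding T_lift_linear_path[OF M yT] loop_to_path_line[OF M p] p_def[symmetric] ..
  finally have eq: "mat_map loop_to_path (mat_map (rho A) (mat_gamma k A y)) = kmat interval A (loop_to_path (line circle ?M p))" .
  have kc: "kmat circle A (line circle ?M p) \<in> carrier (mat_alg k (loops 0 A))"
    using kmat_closed[OF circle_ok A lp] by (simp add: loops_def)
  have "mat_map (rho A) (mat_gamma k A y) = kmat circle A (line circle ?M p)"
  proof (rule mat_eqI[OF alg_hom_closed[OF mat_map_alg_hom[OF J_algebra[OF A] L rho_hom[OF A]] g] kc])
    fix i j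
    have ec: "push circle A (?e i j) (line circle ?M p) \<in> carrier (loops 0 A)"
      using push_closed[OF circle_ok M A entry_add_hom[OF A] lp] by (simp add: loops_def)
    have "loop_to_path (push circle A (?e i j) (line circle ?M p)) = push interval A (?e i j) (loop_to_path (line circle ?M p))"
    proof (rule pmap_eqI)
      show "loop_to_path (push circle A (?e i j) (line circle ?M p)) \<in> carrier (pmap_alg interval A)"
        using alg_hom_closed[OF loop_to_path_hom[OF A] ec] by (simp add: path_alg_def)
      have "loop_to_path (line circle ?M p) \<in> carrier (pmap_alg interval ?M)"
        using alg_hom_closed[OF loop_to_path_hom[OF M] alg_hom_closed[OF loop_line_hom[OF M] p]] by (simp add: path_alg_def)
      then show "push interval A (?e i j) (loop_to_path (line circle ?M p)) \<in> carrier (pmap_alg interval A)"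
        by (rule push_closed[OF interval_ok M A entry_add_hom[OF A]])
      fix z assume z: "z \<in> cells interval"
      then have c: "snd z \<in> simp interval (fst z)" "(fst z, collapse (snd z)) \<in> cells circle"
        by (auto simp: cells_def circle_simps(1) simp del: interval_simps)
      have lt: "sval (loop_to_path x) z = sval x (fst z, collapse (snd z))" for x :: "('h, 'a) univ"
        using sval_loop_to_path[OF c(1), of x] by simp
      show "sval (loop_to_path (push circle A (?e i j) (line circle ?M p))) z = sval (push interval A (?e i j) (loop_to_path (line circle ?M p))) z"
        unfolding lt sval_push[OF z] sval_push[OF c(2)] by simp
    qed
    then have "loop_to_path (rho A (entry (mat_gamma k A y) i j)) = loop_to_path (push circle A (?e i j) (line circle ?M p))"
      using arg_cong[OF eq, of "\<lambda>x. entry x i j"] by (simp add: kmat_def)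
    then have "rho A (entry (mat_gamma k A y) i j) = push circle A (?e i j) (line circle ?M p)"
      by (rule inj_onD[OF loop_to_path_inj _ alg_hom_closed[OF rho_hom[OF A] entry_closed[OF g]] ec])
    then show "entry (mat_map (rho A) (mat_gamma k A y)) i j = entry (kmat circle A (line circle ?M p)) i j"
      by (simp add: kmat_def)
  qed
  then show ?thesis unfolding p_def .
qed

end

section \<open>Representatives of elements of kk\<close>

context kk_setting
begin

lemma kk_reps_iff:
  "(ps, k, f) \<in> kk_reps A B \<longleftrightarrow> 0 < k \<and> f \<in> alg_hom ((J ^^ length ps) A) (mat_alg k (iloops ps B))"
  by (simp add: kk_reps_def)

lemma kk_step_reps:
  assumes A: "is_algebra A" and B: "is_algebra B" and s: "kk_step A B x y"
  shows "x \<in> kk_reps A B \<and> y \<in> kk_reps A B"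
  using s
proof cases
  case (level ps k f qs l)
  have "mat_map (iloops_trans B ps qs) \<in> alg_hom (mat_alg k (iloops ps B)) (mat_alg k (iloops qs B))"
    by (rule mat_map_alg_hom[OF _ _ iloops_trans_hom[OF B level(4)]]) (use B in simp_all)
  then have "mat_map (iloops_trans B ps qs) \<in> alg_hom (mat_alg k (iloops ps B)) (mat_alg l (iloops qs B))"
    by (rule subalg_alg_hom[OF mat_subalg[OF _ level(5)], rotated]) (use B in simp)
  then have "(qs, l, mat_map (iloops_trans B ps qs) \<circ> f) \<in> kk_reps A B"
    using level(3,5) alg_hom_comp unfolding kk_reps_iff list_all2_lengthD[OF level(4), symmetric] by fastforce
  then show ?thesis using level by blast
next
  case (suspension ps k f g)
  let ?X = "(J ^^ length ps) A" and ?E = "iloops ps B"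
  note E = iloops_algebra[OF B, of ps]
  have "g \<in> alg_hom ((J ^^ 1) ?X) (mat_alg k ((J ^^ 1) ?E))"
    by (rule J_pow_hom[OF J_pow_algebra[OF A] E _ suspension(4)]) (use suspension(3) in \<open>simp add: kk_reps_iff\<close>)
  then have "g \<in> alg_hom (J ?X) (mat_alg k (J ?E))" by simp
  from alg_hom_comp[OF this mat_map_alg_hom[OF J_algebra[OF E] loops_algebra[OF E] rho_hom[OF E]]]
  have "(0 # ps, k, mat_map (rho ?E) \<circ> g) \<in> kk_reps A B"
    using suspension(3) by (simp add: kk_reps_iff)
  then show ?thesis using suspension by blast
qed auto

lemma equivclp_reps:
  assumes A: "is_algebra A" and B: "is_algebra B" and e: "equivclp (kk_step A B) x y"
  shows "x \<in> kk_reps A B \<longleftrightarrow> y \<in> kk_reps A B"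
  using e
proof (induction rule: equivclp_induct)
  case (step y z)
  then show ?case using kk_step_reps[OF A B, of y z] kk_step_reps[OF A B, of z y] by blast
qed simp

definition zero_rep :: "('h, 'a) ualg \<Rightarrow> nat list \<Rightarrow> nat \<Rightarrow> ('h, 'a) kk_rep_type" where
  "zero_rep B ps k = (ps, k, \<lambda>_. \<zero>\<^bsub>mat_alg k (iloops ps B)\<^esub>)"

lemma zero_rep_mem: "is_algebra B \<Longrightarrow> 0 < k \<Longrightarrow> zero_rep B ps k \<in> kk_reps A B"
  unfolding zero_rep_def kk_reps_iff by (simp add: zero_alg_hom mat_algebra)

text \<open>A representative is a function on the whole type, but homotopies see its values on the source only.\<close>

lemma cong_equiv:
  assumes A: "is_algebra A" and B: "is_algebra B" and r: "(ps, k, f) \<in> kk_reps A B"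
    and eq: "\<And>x. x \<in> carrier ((J ^^ length ps) A) \<Longrightarrow> g x = f x"
  shows "equivclp (kk_step A B) (ps, k, f) (ps, k, g)"
proof -
  note M = mat_algebra[OF iloops_algebra[OF B, of ps], of k]
  have f: "f \<in> alg_hom ((J ^^ length ps) A) (mat_alg k (iloops ps B))" using r by (simp add: kk_reps_iff)
  have "g \<in> alg_hom ((J ^^ length ps) A) (mat_alg k (iloops ps B))"
    using alg_hom_cong[OF f eq[symmetric] J_pow_algebra[OF A]] .
  then have "(ps, k, g) \<in> kk_reps A B" using r by (simp add: kk_reps_iff)
  then have "kk_step A B (ps, k, f) (ps, k, g)"
    by (rule kk_step.homotopy[OF r _ elem_homotopic_cong(1)[OF M f eq]])
  then show ?thesis by (rule r_into_equivclp)
qed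

lemma suspension_equiv:
  assumes A: "is_algebra A" and B: "is_algebra B" and r: "(ps, k, f) \<in> kk_reps A B"
    and eq: "\<And>x. x \<in> carrier (J ((J ^^ length ps) A)) \<Longrightarrow>
      g x = mat_map (rho (iloops ps B)) (mat_gamma k (iloops ps B) (J_map (mat_alg k (iloops ps B)) f x))"
  shows "equivclp (kk_step A B) (ps, k, f) (0 # ps, k, g)"
proof -
  let ?E = "iloops ps B"
  have "mat_gamma k ?E \<circ> J_map (mat_alg k ?E) f \<in> J_pow 1 k ?E f" using mat_gamma_mem[OF iloops_algebra[OF B]] by auto
  then have s: "kk_step A B (ps, k, f) (0 # ps, k, mat_map (rho ?E) \<circ> (mat_gamma k ?E \<circ> J_map (mat_alg k ?E) f))"
    by (rule kk_step.suspension[OF r])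
  then have "equivclp (kk_step A B) (0 # ps, k, mat_map (rho ?E) \<circ> (mat_gamma k ?E \<circ> J_map (mat_alg k ?E) f)) (0 # ps, k, g)"
    using kk_step_reps[OF A B s] eq by (intro cong_equiv[OF A B]) simp_all
  with r_into_equivclp[of "kk_step A B", OF s] show ?thesis by (rule equivclp_trans)
qed

text \<open>The section \<open>sig\<close> preserves zero, so the suspension of the zero map is zero, and the transition maps preserve zero.\<close>

lemma zero_rep_equiv:
  assumes A: "is_algebra A" and B: "is_algebra B" and k: "0 < k"
  shows "equivclp (kk_step A B) (zero_rep B ps k) (zero_rep B [] 1)"
proof (induction ps)
  case Nil
  have s: "kk_step A B ([], 1, \<lambda>_. \<zero>\<^bsub>mat_alg 1 B\<^esub>) ([], k, mat_map (iloops_trans B [] []) \<circ> (\<lambda>_. \<zero>\<^bsub>mat_alg 1 B\<^esub>))"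
    by (rule kk_step.level) (use zero_rep_mem[OF B, of 1 "[]" A] k in \<open>simp_all add: zero_rep_def\<close>)
  have z: "mat_map (iloops_trans B [] []) \<circ> (\<lambda>_. \<zero>\<^bsub>mat_alg 1 B\<^esub>) = (\<lambda>_. \<zero>\<^bsub>mat_alg k B\<^esub>)"
    by (simp add: mat_map_def mat_ops fun_eq_iff)
  have "kk_step A B (zero_rep B [] 1) (zero_rep B [] k)" using s unfolding z zero_rep_def iloops.simps .
  then show ?case by (intro equivclp_sym[OF r_into_equivclp])
next
  case (Cons p ps)
  let ?E = "iloops ps B" and ?M = "mat_alg k (iloops ps B)" and ?X = "(J ^^ length ps) A"
  note E = iloops_algebra[OF B, of ps] and M = mat_algebra[OF iloops_algebra[OF B, of ps], of k] and X = J_pow_algebra[OF A, of "length ps"]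
  note TE = mat_algebra[OF T_algebra[of "iloops ps B"], of k]
  have su: "mat_map (sig ?E) \<in> und_hom ?M (mat_alg k (T ?E))" by (rule mat_map_und_hom[OF sig_und_hom[OF E] sig_zero[OF E]])
  have 0: "(\<lambda>_. \<zero>\<^bsub>?M\<^esub>) \<in> alg_hom ?X ?M" by (rule zero_alg_hom[OF M])
  have sus: "equivclp (kk_step A B) (zero_rep B ps k) (zero_rep B (0 # ps) k)"
    unfolding zero_rep_def
  proof (rule suspension_equiv[OF A B])
    show "(ps, k, \<lambda>_. \<zero>\<^bsub>?M\<^esub>) \<in> kk_reps A B" using zero_rep_mem[OF B k] by (simp add: zero_rep_def)
    fix x assume x: "x \<in> carrier (J ?X)"
    then have xT: "x \<in> carrier (T ?X)" by (simp add: J_carrier)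
    have "mat_gamma k ?E (J_map ?M (\<lambda>_. \<zero>\<^bsub>?M\<^esub>) x) = T_lift (mat_alg k (T ?E)) (mat_map (sig ?E)) (J_map ?M (\<lambda>_. \<zero>\<^bsub>?M\<^esub>) x)"
      by (rule mat_gamma_eq[OF E alg_hom_closed[OF J_map_hom[OF X M 0] x]])
    also have "\<dots> = T_lift (mat_alg k (T ?E)) (mat_map (sig ?E) \<circ> (\<lambda>_. \<zero>\<^bsub>?M\<^esub>)) x"
      by (rule T_lift_J_map[OF X M TE alg_hom_und_hom[OF 0] su xT])
    also have "mat_map (sig ?E) \<circ> (\<lambda>_. \<zero>\<^bsub>?M\<^esub>) = (\<lambda>_. \<zero>\<^bsub>mat_alg k (T ?E)\<^esub>)"
      by (simp add: mat_map_def mat_ops fun_eq_iff sig_zero[OF E])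
    also have "T_lift (mat_alg k (T ?E)) (\<lambda>_. \<zero>\<^bsub>mat_alg k (T ?E)\<^esub>) x = \<zero>\<^bsub>mat_alg k (T ?E)\<^esub>" by (rule T_lift_zero[OF X TE xT])
    finally have "mat_gamma k ?E (J_map ?M (\<lambda>_. \<zero>\<^bsub>?M\<^esub>) x) = \<zero>\<^bsub>mat_alg k (T ?E)\<^esub>" .
    moreover have "rho ?E \<zero>\<^bsub>T ?E\<^esub> = \<zero>\<^bsub>loops 0 ?E\<^esub>"
      using add_hom_zero[OF alg_hom_add_hom[OF rho_hom[OF E]] J_algebra[OF E] loops_algebra[OF E]] subalg_zero[OF J_subalg[OF E]] by simp
    ultimately show "\<zero>\<^bsub>mat_alg k (iloops (0 # ps) B)\<^esub> = mat_map (rho ?E) (mat_gamma k ?E (J_map ?M (\<lambda>_. \<zero>\<^bsub>?M\<^esub>) x))"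
      by (simp add: mat_map_def mat_ops)
  qed
  have le: "list_all2 (\<le>) (0 # ps) (p # ps)" by (simp add: list_all2_refl)
  have "iloops_trans B (0 # ps) (p # ps) \<zero>\<^bsub>iloops (0 # ps) B\<^esub> = \<zero>\<^bsub>iloops (p # ps) B\<^esub>"
    by (rule add_hom_zero[OF alg_hom_add_hom[OF iloops_trans_hom[OF B le]] iloops_algebra[OF B] iloops_algebra[OF B]])
  then have z: "mat_map (iloops_trans B (0 # ps) (p # ps)) \<circ> (\<lambda>_. \<zero>\<^bsub>mat_alg k (iloops (0 # ps) B)\<^esub>) = (\<lambda>_. \<zero>\<^bsub>mat_alg k (iloops (p # ps) B)\<^esub>)"
    unfolding mat_map_def mat_ops by auto
  have "kk_step A B (0 # ps, k, \<lambda>_. \<zero>\<^bsub>mat_alg k (iloops (0 # ps) B)\<^esub>) (p # ps, k, mat_map (iloops_trans B (0 # ps) (p # ps)) \<circ> (\<lambda>_. \<zero>\<^bsub>mat_alg k (iloops (0 # ps) B)\<^esub>))"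
    by (rule kk_step.level[OF _ le order_refl]) (use zero_rep_mem[OF B k, of "0 # ps" A] in \<open>simp only: zero_rep_def\<close>)
  then have "kk_step A B (zero_rep B (0 # ps) k) (zero_rep B (p # ps) k)" unfolding z zero_rep_def .
  then have "equivclp (kk_step A B) (zero_rep B (p # ps) k) (zero_rep B (0 # ps) k)" by (intro equivclp_sym[OF r_into_equivclp])
  then show ?case using Cons.IH equivclp_sym[OF sus] by (blast intro: equivclp_trans)
qed

text \<open>The suspension of \<open>\<pi> \<circ> f\<close> is the composite of the polynomial suspension of \<open>f\<close> with a map of the same kind as
  \<open>\<pi>\<close>, namely \<open>\<Omega>(\<pi>)\<close> followed by the passage to matrices of simplicial loops.\<close>

lemma null_equiv_zero:
  assumes A: "is_algebra A" and B: "is_algebra B"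
    and n: "null X D f" and D: "is_algebra D" and X: "X = (J ^^ length ps) A" and k: "0 < k"
    and p: "\<pi> \<in> alg_hom D (mat_alg k (iloops ps B))"
  shows "equivclp (kk_step A B) (ps, k, \<pi> \<circ> f) (zero_rep B [] 1)"
  using n D X p
proof (induction arbitrary: ps \<pi> rule: null.induct)
  case (zero f X D)
  note E = mat_algebra[OF iloops_algebra[OF B, of ps], of k]
  have "(ps, k, \<pi> \<circ> f) \<in> kk_reps A B"
    using zero k alg_hom_comp[of f X D \<pi>] by (simp add: kk_reps_iff)
  moreover have "\<pi> (f x) = \<zero>\<^bsub>mat_alg k (iloops ps B)\<^esub>" if "x \<in> carrier X" for x
    using zero.hyps(2)[OF that] add_hom_zero[OF alg_hom_add_hom[OF zero.prems(3)] zero.prems(1) E] by simp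
  ultimately have "equivclp (kk_step A B) (ps, k, \<pi> \<circ> f) (zero_rep B ps k)"
    unfolding zero_rep_def using zero.prems(2) by (intro cong_equiv[OF A B]) simp_all
  then show ?case using zero_rep_equiv[OF A B k] by (rule equivclp_trans)
next
  case (homotopy f X D g)
  let ?E = "mat_alg k (iloops ps B)"
  have E: "is_algebra ?E" using B by (simp add: mat_algebra)
  have r: "(ps, k, \<pi> \<circ> h) \<in> kk_reps A B" if "h \<in> alg_hom X D" for h
    using that homotopy.prems k alg_hom_comp[of h X D \<pi>] by (simp add: kk_reps_iff)
  note rf = r[OF homotopy.hyps(1)] and rg = r[OF null_alg_hom[OF homotopy.hyps(3)]]
  have "kk_step A B (ps, k, \<pi> \<circ> f) (ps, k, \<pi> \<circ> g) \<or> kk_step A B (ps, k, \<pi> \<circ> g) (ps, k, \<pi> \<circ> f)"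
    using homotopy.hyps(2) elem_homotopic_comp[OF homotopy.prems(1) E _ homotopy.prems(3)] homotopy.prems(2)
      kk_step.homotopy[OF rf rg] kk_step.homotopy[OF rg rf] by blast
  then have "equivclp (kk_step A B) (ps, k, \<pi> \<circ> f) (ps, k, \<pi> \<circ> g)"
    using r_into_equivclp[of "kk_step A B"] equivclp_sym by metis
  then show ?case using homotopy.IH[OF homotopy.prems] by (rule equivclp_trans)
next
  case (suspend f X D)
  let ?E = "iloops ps B" and ?M = "mat_alg k (iloops ps B)"
  have E: "is_algebra ?E" using B by simp
  have M: "is_algebra ?M" by (rule mat_algebra[OF E])
  have X: "is_algebra X" using suspend.prems(2) J_pow_algebra[OF A] by simp
  note D = suspend.prems(1) and p = suspend.prems(3) and f = suspend.hyps(1)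
  let ?q = "kmat circle ?E \<circ> line circle ?M \<circ> pmap \<pi>"
  have k1: "kmat circle ?E \<in> alg_hom (loops 0 ?M) (mat_alg k (loops 0 ?E))"
    unfolding loops_def sd_circle_0 by (rule kmat_hom[OF circle_ok E])
  have q: "?q \<in> alg_hom (Om D) (mat_alg k (iloops (0 # ps) B))"
    using alg_hom_comp[OF Om_map[OF D M p] alg_hom_comp[OF loop_line_hom[OF M] k1]] by (simp add: comp_assoc)
  note pf = alg_hom_comp[OF f p]
  have r: "(ps, k, \<pi> \<circ> f) \<in> kk_reps A B" using pf k suspend.prems(2) by (simp add: kk_reps_iff)
  have "equivclp (kk_step A B) (ps, k, \<pi> \<circ> f) (0 # ps, k, ?q \<circ> (rho' True D \<circ> J_map D f))"
  proof (rule suspension_equiv[OF A B r])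
    fix x assume "x \<in> carrier (J ((J ^^ length ps) A))"
    then have x: "x \<in> carrier (J X)" by (simp add: suspend.prems(2))
    then have xT: "x \<in> carrier (T X)" by (simp add: J_carrier)
    have y: "J_map D f x \<in> carrier (J D)" by (rule alg_hom_closed[OF J_map_hom[OF X D f] x])
    then have yT: "J_map D f x \<in> carrier (T D)" by (simp add: J_carrier)
    have c: "J_map ?M (\<pi> \<circ> f) x = J_map ?M \<pi> (J_map D f x)"
      by (rule J_map_comp[OF X D M alg_hom_und_hom[OF f] alg_hom_und_hom[OF p] xT, symmetric])
    have "mat_map (rho ?E) (mat_gamma k ?E (J_map ?M \<pi> (J_map D f x))) = kmat circle ?E (line circle ?M (rho' True ?M (J_map ?M \<pi> (J_map D f x))))"
      by (rule mat_rho_gamma[OF E alg_hom_closed[OF J_map_hom[OF D M p] y]])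
    also have "\<dots> = kmat circle ?E (line circle ?M (pmap \<pi> (rho' True D (J_map D f x))))"
      unfolding rho'_natural[OF D M p yT] ..
    finally show "(?q \<circ> (rho' True D \<circ> J_map D f)) x = mat_map (rho ?E) (mat_gamma k ?E (J_map ?M (\<pi> \<circ> f) x))"
      unfolding c by simp
  qed
  moreover have "equivclp (kk_step A B) (0 # ps, k, ?q \<circ> (rho' True D \<circ> J_map D f)) (zero_rep B [] 1)"
    by (rule suspend.IH[OF Om_algebra[OF D] _ q]) (simp add: suspend.prems(2))
  ultimately show ?case by (rule equivclp_trans)
qed

lemma kk_class_zero:
  assumes A: "dnil A" and B: "is_algebra B" and r: "x \<in> kk_reps A B"
  shows "kk_class A B x = kk_zero A B"
proof -
  note alg = dnil_algebra[OF A]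
  obtain ps k f where x: "x = (ps, k, f)" by (cases x)
  have k: "0 < k" and f: "f \<in> alg_hom ((J ^^ length ps) A) (mat_alg k (iloops ps B))" using r unfolding x kk_reps_iff by auto
  note M = mat_algebra[OF iloops_algebra[OF B, of ps], of k]
  have "f \<in> alg_hom ((J ^^ length ps) ((Om ^^ 0) A)) (mat_alg k (iloops ps B))" using f by simp
  from dnil_null[OF A M this] have "null ((J ^^ length ps) A) (mat_alg k (iloops ps B)) f" by simp
  from null_equiv_zero[OF alg B this M HOL.refl k alg_hom_id]
  have "equivclp (kk_step A B) x (zero_rep B [] 1)" by (simp add: x)
  then have "equivclp (kk_step A B) x y \<longleftrightarrow> equivclp (kk_step A B) (zero_rep B [] 1) y" for y
    by (meson equivclp_sym equivclp_trans)
  then show ?thesis by (simp add: kk_class_def kk_zero_def zero_rep_def)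
qed

lemma kk_zero_reps:
  assumes A: "is_algebra A" and B: "is_algebra B"
  shows "([], 1, \<lambda>_. \<zero>\<^bsub>mat_alg 1 B\<^esub>) \<in> kk_zero A B" and "x \<in> kk_zero A B \<Longrightarrow> x \<in> kk_reps A B"
proof -
  show "([], 1, \<lambda>_. \<zero>\<^bsub>mat_alg 1 B\<^esub>) \<in> kk_zero A B" by (simp add: kk_zero_def kk_class_def equivclp_refl)
  assume "x \<in> kk_zero A B"
  then have "equivclp (kk_step A B) (zero_rep B [] 1) x" by (simp add: kk_zero_def kk_class_def zero_rep_def)
  from equivclp_reps[OF A B this] show "x \<in> kk_reps A B" using zero_rep_mem[OF B] by simp
qed

lemma kk_trivial:
  assumes A: "dnil A" and B: "is_algebra B" shows "kk A B = {kk_zero A B}"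
  using kk_class_zero[OF A B] zero_rep_mem[OF B, of 1 "[]" A] unfolding kk_def by auto

text \<open>The group has one element only, which is therefore its own negative.\<close>

lemma kk_neg_zero:
  assumes A: "dnil A" and B: "is_algebra B" shows "kk_neg A B (kk_zero A B) = kk_zero A B"
proof -
  note alg = dnil_algebra[OF A]
  have blk: "kk_class A B (ps, k + l, \<lambda>x. block_sum (iloops ps B) k (f x) (g x)) = kk_zero A B"
    if "(ps, k, f) \<in> kk_zero A B" "(ps, l, g) \<in> kk_zero A B" for ps k l f g
  proof (rule kk_class_zero[OF A B])
    have "(ps, k, f) \<in> kk_reps A B" "(ps, l, g) \<in> kk_reps A B" using that kk_zero_reps(2)[OF alg B] by auto
    then show "(ps, k + l, \<lambda>x. block_sum (iloops ps B) k (f x) (g x)) \<in> kk_reps A B"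
      unfolding kk_reps_iff using block_sum_hom[OF iloops_algebra[OF B] _ _ J_pow_algebra[OF alg]] by simp
  qed
  have "kk_add A B (kk_zero A B) (kk_zero A B) = kk_zero A B"
    unfolding kk_add_def
  proof (rule cSup_eq_maximum)
    show "kk_zero A B \<in> {kk_class A B (ps, k + l, \<lambda>x. block_sum (iloops ps B) k (f x) (g x)) | ps k l f g.
        (ps, k, f) \<in> kk_zero A B \<and> (ps, l, g) \<in> kk_zero A B}"
      unfolding mem_Collect_eq
      by (intro exI[of _ "[]"] exI[of _ 1] exI[of _ "\<lambda>_. \<zero>\<^bsub>mat_alg 1 B\<^esub>"] conjI kk_zero_reps(1)[OF alg B])
        (rule blk[OF kk_zero_reps(1)[OF alg B] kk_zero_reps(1)[OF alg B], symmetric])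
  qed (use blk in auto)
  then show ?thesis unfolding kk_neg_def kk_trivial[OF A B] by (intro the_equality) simp_all
qed

lemma kk_prod_reps:
  assumes A: "is_algebra A" and B: "is_algebra B" and C: "is_algebra C"
    and a: "a \<in> kk_reps B C" and b: "b \<in> kk_reps A B" and c: "c \<in> kk_prod A B C a b"
  shows "c \<in> kk_reps A C"
proof -
  obtain qs l \<alpha> where a': "a = (qs, l, \<alpha>)" by (cases a)
  obtain ps k \<beta> where b': "b = (ps, k, \<beta>)" by (cases b)
  let ?m = "length qs" and ?E = "iloops qs C"
  have \<alpha>: "0 < l" "\<alpha> \<in> alg_hom ((J ^^ ?m) B) (mat_alg l ?E)" using a unfolding a' kk_reps_iff by auto
  have \<beta>: "0 < k" "\<beta> \<in> alg_hom ((J ^^ length ps) A) (mat_alg k (iloops ps B))" using b unfolding b' kk_reps_iff by auto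
  obtain \<beta>' g where c': "c = (ps @ qs, k * l, mat_tensor l \<circ> mat_map (loops_mat ps ?E) \<circ>
      mat_map (iloops_map ps (mat_alg l ?E) \<alpha>) \<circ> mat_map g \<circ> \<beta>')"
    "\<beta>' \<in> J_pow ?m k (iloops ps B) \<beta>" "g \<in> gamma_pow ?m ps B"
    using c unfolding a' b' kk_prod_def by auto
  note E = iloops_algebra[OF C, of qs] and JB = J_pow_algebra[OF B, of ?m]
  note M = mat_algebra[OF iloops_algebra[OF C, of qs], of l]
  have 1: "\<beta>' \<in> alg_hom ((J ^^ ?m) ((J ^^ length ps) A)) (mat_alg k ((J ^^ ?m) (iloops ps B)))"
    by (rule J_pow_hom[OF J_pow_algebra[OF A] iloops_algebra[OF B] \<beta>(2) c'(2)])
  have 2: "mat_map g \<in> alg_hom (mat_alg k ((J ^^ ?m) (iloops ps B))) (mat_alg k (iloops ps ((J ^^ ?m) B)))"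
    by (rule mat_map_alg_hom[OF J_pow_algebra[OF iloops_algebra[OF B]] iloops_algebra[OF JB] gamma_pow_hom[OF B c'(3)]])
  have 3: "mat_map (iloops_map ps (mat_alg l ?E) \<alpha>) \<in> alg_hom (mat_alg k (iloops ps ((J ^^ ?m) B))) (mat_alg k (iloops ps (mat_alg l ?E)))"
    by (rule mat_map_alg_hom[OF iloops_algebra[OF JB] iloops_algebra[OF M] iloops_map_hom[OF JB M \<alpha>(2)]])
  have 4: "mat_map (loops_mat ps ?E) \<in> alg_hom (mat_alg k (iloops ps (mat_alg l ?E))) (mat_alg k (mat_alg l (iloops ps ?E)))"
    by (rule mat_map_alg_hom[OF iloops_algebra[OF M] mat_algebra[OF iloops_algebra[OF E]] loops_mat_hom[OF E]])
  have 5: "mat_tensor l \<in> alg_hom (mat_alg k (mat_alg l (iloops ps ?E))) (mat_alg (k * l) (iloops ps ?E))"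
    by (rule mat_tensor_hom[OF iloops_algebra[OF E]])
  have "(J ^^ length (ps @ qs)) A = (J ^^ ?m) ((J ^^ length ps) A)" by (simp add: add.commute[of "length ps"] funpow_add)
  then show ?thesis
    using alg_hom_comp[OF alg_hom_comp[OF alg_hom_comp[OF alg_hom_comp[OF 1 2] 3] 4] 5] \<alpha>(1) \<beta>(1)
    unfolding c'(1) kk_reps_iff iloops_append by (simp add: comp_assoc)
qed

text \<open>All products of representatives lie in the only class from \<open>A\<close> to \<open>C\<close>.\<close>

lemma kk_comp_zero:
  assumes A: "dnil A" and B: "is_algebra B" and C: "is_algebra C"
  shows "kk_comp A B C (kk_zero B C) (kk_zero A B) = kk_zero A C"
proof -
  note alg = dnil_algebra[OF A]
  have cls: "(if odd (length (fst b) * length (fst a)) then kk_neg A C else id) (kk_class A C c) = kk_zero A C"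
    if "a \<in> kk_zero B C" "b \<in> kk_zero A B" "c \<in> kk_prod A B C a b" for a b c
  proof -
    have "c \<in> kk_reps A C"
      by (rule kk_prod_reps[OF alg B C kk_zero_reps(2)[OF B C that(1)] kk_zero_reps(2)[OF alg B that(2)] that(3)])
    then show ?thesis using kk_class_zero[OF A C] kk_neg_zero[OF A C] by simp
  qed
  let ?a = "([], 1, \<lambda>_. \<zero>\<^bsub>mat_alg 1 C\<^esub>) :: ('h, 'a) kk_rep_type" and ?b = "([], 1, \<lambda>_. \<zero>\<^bsub>mat_alg 1 B\<^esub>) :: ('h, 'a) kk_rep_type"
  have "\<exists>c. c \<in> kk_prod A B C ?a ?b" unfolding kk_prod_def by auto
  then obtain c where c: "c \<in> kk_prod A B C ?a ?b" by (rule exE)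
  show "kk_comp A B C (kk_zero B C) (kk_zero A B) = kk_zero A C"
    unfolding kk_comp_def
  proof (rule cSup_eq_maximum)
    show "kk_zero A C \<in> {(if odd (length (fst b) * length (fst a)) then kk_neg A C else id) (kk_class A C c) | a b c.
        a \<in> kk_zero B C \<and> b \<in> kk_zero A B \<and> c \<in> kk_prod A B C a b}"
      unfolding mem_Collect_eq
      by (intro exI[of _ ?a] exI[of _ ?b] exI[of _ c] conjI kk_zero_reps(1)[OF B C] kk_zero_reps(1)[OF alg B] c)
        (rule cls[OF kk_zero_reps(1)[OF B C] kk_zero_reps(1)[OF alg B] c, symmetric])
  qed (use cls in auto)
qed

lemma kk_id_zero: "dnil A \<Longrightarrow> kk_id A = kk_zero A A"
  unfolding kk_id_def
  by (rule kk_class_zero) (auto simp: kk_reps_iff dnil_algebra intro: corner_hom)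

lemma zero_alg_dnil: "dnil (zero_alg :: ('h, 'a) ualg)"
proof (rule dnil.zero)
  show "is_algebra (zero_alg :: ('h, 'a) ualg)"
    unfolding is_algebra_def by (intro conjI impI ballI abelian_groupI) (simp_all add: zero_alg_def Let_def)
qed (simp add: zero_alg_def Let_def)

lemma dnil_kk_equivalent:
  assumes A: "dnil A" and B: "dnil B" shows "kk_equivalent A B"
proof -
  note alg = dnil_algebra[OF A] dnil_algebra[OF B]
  show ?thesis unfolding kk_equivalent_def kk_trivial[OF A alg(2)] kk_trivial[OF B alg(1)]
    using kk_comp_zero[OF A alg(2,1)] kk_comp_zero[OF B alg] kk_id_zero[OF A] kk_id_zero[OF B] by simp
qed

end

theorem theorem7p2p4:
  fixes H :: "'h ring" and central :: bool and und :: underlying and A :: "('h, 'a) ualg"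
  assumes "kk_setting H central"
    and "kk_setting.is_algebra H central A"
    and "kk_setting.F_nilpotent H und A"
  shows "kk_setting.kk_equivalent H central und A zero_alg"
proof -
  interpret kk_setting H central und by (rule assms(1))
  have "nilpotent_alg A" using assms(3) by (simp add: F_nilpotent_def)
  then show ?thesis by (intro dnil_kk_equivalent nilpotent_dnil zero_alg_dnil assms(2))
qed

end
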